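(* Let $\mathfrak h=\langle H;\ddot o,b_j;d_j\rangle$ be an elementary indefinite Hamiltonian of kind (A). For every $z\in\mathbb C$ let $V(\cdot,z):(\sigma,s_+]\to\mathbb C^{2\times2}$ be a solution of $$\frac{\partial}{\partial t}V(t,z)J=zV(t,z)H(t)\quad\text{for a.a. }t\in(\sigma,s_+),$$ such that $V(t,z)$ is non-singular for all $t\in(\sigma,s_+]$ and $z\in\mathbb C$. Set $$U^-(z):=\bigl[\tilde\Gamma^-(z)W_{\mathfrak h}(\cdot,z)^T\bigr]^T,\qquad U^+(z):=\bigl[\tilde\Gamma^+(z)V(\cdot,z)^T\bigr]^T .$$ Then $$\det U^-(z)=1,\qquad\det U^+(z)=\det V(t,z)$$ and $$W_{\mathfrak h}(t,z)=U^-(z)\bigl(\mathscr R(z)\bigr)^T\bigl(U^+(z)\bigr)^{-1}V(t,z)$$ for all $z\in\mathbb C$ and $t\in(\sigma,s_+]$.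
   Context: **Hamiltonians.** $J=\begin{pmatrix}0&-1\\1&0\end{pmatrix}$. A Hamiltonian on an interval $(a,b)$ is a measurable, locally integrable function $H:(a,b)\to\mathbb R^{2\times2}$ with $H(t)\ge0$ a.e. and $\{t:H(t)=0\}$ of measure $0$; entries: $H=\begin{pmatrix}h_1&h_3\\ h_3&h_2\end{pmatrix}$. $H$ is in limit circle case at an endpoint if it is integrable near that endpoint, and in limit point case otherwise. An interval $(c,d)$ is $H$-indivisible of type $\phi$ if $\operatorname{ran}H(t)=\operatorname{span}\{\xi_\phi\}$ for a.a. $t\in(c,d)$, where $\xi_\phi=(\cos\phi,\sin\phi)^T$. Functions $f_1,f_2$ are identified ($f_1=_Hf_2$) if $Hf_1=Hf_2$ a.e. $L^2(H)$ is the space of classes modulo $=_H$ of measurable $f:(a,b)\to\mathbb C^2$ with $\int f^*Hf<\infty$ and such that $\xi_\phi^*f$ is a.e. constant on each $H$-indivisible interval of type $\phi$. $T_{\max}(H)$ is the set of $(f;g)\in L^2(H)\times L^2(H)$ for which $f$ has a locally absolutely continuous representative $\hat f$ with $\hat f'=JHg$ a.e. **The functions $\mathfrak w_n$.** Let $H_-$ be a Hamiltonian on $(s_-,\sigma)$, limit circle at $s_-$, limit point at $\sigma$, satisfying conditions (I) and (HS), i.e. $\int_{s_-}^{\sigma}h_1<\infty$ and $\int_{s_-}^{\sigma}\bigl(\int_{s_-}^th_2\bigr)h_1(t)\,dt<\infty$. Put $(\mathcal If)(t)=\int_{s_-}^tJH_-(s)f(s)\,ds$. $\Delta(H_-)$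 is the infimum of all $n\in\mathbb N_0$ such that $\mathcal I^n\binom01+\sum_{k=0}^{n-1}\mathcal I^kv_{n-k}\in L^2(H_-)$ for some $v_1,\dots,v_n\in\mathbb C^2$ ($\inf\emptyset=\infty$). If $\Delta(H_-)<\infty$, there is a unique sequence $(\omega_n^-)_{n\ge0}$ with $\omega_0^-=1$ and $\sum_{k=0}^n\mathcal I^k\binom0{\omega^-_{n-k}}\in L^2(H_-)$ for all $n\ge\Delta(H_-)$; set $\mathfrak w_n:=\sum_{k=0}^n\mathcal I^k\binom0{\omega^-_{n-k}}$ on $[s_-,\sigma)$ for all $n\ge0$. For a Hamiltonian $H_+$ on $(\sigma,s_+)$, limit point at $\sigma$, limit circle at $s_+$, everything is analogous with $\int_t^{s_+}h_2$ instead of $\int_{s_-}^th_2$ in (HS) and with $(\tilde{\mathcal I}f)(t)=-\int_t^{s_+}JH_+(s)f(s)\,ds$, giving $\Delta(H_+)$, $(\omega_n^+)$ and $\mathfrak w_n$ on $(\sigma,s_+]$. **Elementary indefinite Hamiltonian of kind (A)**, $\mathfrak h=\langle H;\ddot o,b_j;d_j\rangle$: (1) finite non-empty intervals $(s_-,\sigma)$, $(\sigma,s_+)$ and Hamiltonians $H_-$ on $(s_-,\sigma)$ (limit circle at $s_-$, limit point at $\sigma$) and $H_+$ on $(\sigma,s_+)$ (limit point at $\sigma$, limit circle at $s_+$), both satisfying (I) and (HS), with $\Delta(H_\pm)<\infty$, and such that either no interval $(s,\sigma)$, $s\in[s_-,\sigma)$, is $H_-$-indivisible, or no interval $(\sigma,s)$,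 $s\in(\sigma,s_+)$, is $H_+$-indivisible; $H:=(H_-,H_+)$ and $\Delta:=\Delta(H):=\max\{\Delta(H_-),\Delta(H_+)\}$; (2) numbers $d_0,\dots,d_{2\Delta-1}\in\mathbb R$; (3) $\ddot o\in\mathbb N_0$ and, if $\ddot o>0$, $b_1,\dots,b_{\ddot o}\in\mathbb R$ with $b_1\ne0$. "$(s_-,\sigma)$ (resp. $(\sigma,s_+)$) is indivisible" means $H_-$- (resp. $H_+$-) indivisible. $L^2(H):=L^2(H_+)\oplus L^2(H_-)$, $T_{\max}(H):=T_{\max}(H_+)\oplus T_{\max}(H_-)$; $\mathfrak w_n$ is regarded as a function on $[s_-,\sigma)\cup(\sigma,s_+]$. The functions $\mathfrak w_0,\dots,\mathfrak w_{\Delta-1}$ are linearly independent modulo $L^2(H)$ and $\mathfrak w_0,\dots,\mathfrak w_\Delta$ are linearly independent modulo $\operatorname{dom}T_{\max}(H)$. **Model space, relation and boundary mapping.** $L^2_\Delta(H):=L^2(H)\dot+\operatorname{span}\{\mathfrak w_0,\dots,\mathfrak w_{\Delta-1}\}$, $\mathring{\mathfrak P}(\mathfrak h):=L^2_\Delta(H)\times\mathbb C^\Delta\times\mathbb C^{\ddot o}$, with elements $(f,(\xi_i)_{i=0}^{\Delta-1},(\alpha_k)_{k=1}^{\ddot o})$. The linear relation $\mathring T(\mathfrak h)$ consists of all pairs $(F;G)$, $F=(f,\xi,\alpha)$, $G=(g,\eta,\beta)$ in $\mathring{\mathfrak P}(\mathfrak h)$, such that (1)–(5) hold, where, for $1\le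 k\le\Delta$, $B_k:=\omega_k^-f(s_-)_1$ if $(\sigma,s_+)$ is indivisible, $B_k:=-\omega_k^+f(s_+)_1$ if $(s_-,\sigma)$ is indivisible, and $B_k:=\omega_k^-f(s_-)_1-\omega_k^+f(s_+)_1$ otherwise: (1) $f=f_0+\sum_{i=0}^\Delta\lambda_i\mathfrak w_i$ with $\lambda_i\in\mathbb C$ and $(f_0;g-\sum_{i=0}^{\Delta-1}\lambda_{i+1}\mathfrak w_i)\in T_{\max}(H)$. Put $E:=\int_{s_-}^{s_+}\mathfrak w_\Delta^*H(g-\sum_{i=0}^{\Delta-1}\lambda_{i+1}\mathfrak w_i)+\frac12\sum_{i=0}^{\Delta-1}d_{\Delta-1+i}\lambda_i+d_{2\Delta-1}\lambda_\Delta-B_\Delta$. (2) If $\ddot o=0$: $\xi_{\Delta-1}=E$. If $\ddot o>0$: $\alpha_{\ddot o}=b_1\lambda_\Delta$. (3) If neither interval is indivisible: $\eta_0=f(s_-)_1-f(s_+)_1-\frac12\sum_{i=0}^{\Delta-1}d_i\lambda_{i+1}$. (4) $\eta_k=\xi_{k-1}-\frac12d_{k-1}\lambda_0-\frac12d_{k+\Delta-1}\lambda_\Delta+B_k$ for $1\le k\le\Delta-1$. (5) If $\ddot o>0$: $\beta_1=E-\xi_{\Delta-1}$ and $\beta_j=\alpha_{j-1}-b_{\ddot o+2-j}\lambda_\Delta$ for $2\le j\le\ddot o$. Here $f(s_-)$ (resp. $f(s_+)$) is used only when $(s_-,\sigma)$ (resp. $(\sigma,s_+)$) is not indivisible, and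 denotes the value of the unique locally absolutely continuous representative of $f$ satisfying $\hat f'=JHg$ a.e. Subscripts $1,2$ denote components. The boundary mapping $\mathring\Gamma(\mathfrak h)$ assigns to $(F;G)\in\mathring T(\mathfrak h)$ two vectors in $\mathbb C^2$: $\mathring\Gamma(\mathfrak h)(F;G)(s_-)=f(s_-)$ if $(s_-,\sigma)$ is not indivisible, and $=\bigl(f(s_+)_1+\eta_0+\frac12\sum_{i=0}^{\Delta-1}d_i\lambda_{i+1},\ \lambda_0\bigr)^T$ if it is; $\mathring\Gamma(\mathfrak h)(F;G)(s_+)=f(s_+)$ if $(\sigma,s_+)$ is not indivisible, and $=\bigl(f(s_-)_1-\eta_0-\frac12\sum_{i=0}^{\Delta-1}d_i\lambda_{i+1},\ \lambda_0\bigr)^T$ if it is. For every $z\in\mathbb C$ and $c\in\mathbb C^2$ there is a unique $F$ with $(F;zF)\in\mathring T(\mathfrak h)$ and $\mathring\Gamma(\mathfrak h)(F;zF)(s_-)=c$. **The matrix $W_{\mathfrak h}$** (maximal chain of matrices of $\mathfrak h$; $W_{\mathfrak h}(s_+,\cdot)$ is the monodromy matrix). For $z\in\mathbb C$, on $[s_-,\sigma)$, $W_{\mathfrak h}(\cdot,z)$ is the unique locally absolutely continuous solution of $\frac{\partial}{\partial t}W(t,z)J=zW(t,z)H(t)$ a.e. with $W(s_-,z)=I$. On $(\sigma,s_+]$ it is the unique locally absolutely continuous solution of the same equation whose value at $s_+$ satisfies $W_{\mathfrak h}(s_+,z)^T\mathfrak e_i=\mathring\Gamma(\mathfrak h)(F^{(i)};zF^{(i)})(s_+)$,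 $i=1,2$, where $\mathfrak e_1=\binom10$, $\mathfrak e_2=\binom01$, and $F^{(i)}$ is the unique element with $(F^{(i)};zF^{(i)})\in\mathring T(\mathfrak h)$ and $\mathring\Gamma(\mathfrak h)(F^{(i)};zF^{(i)})(s_-)=\mathfrak e_i$. **Generalised boundary values.** For a locally absolutely continuous solution $\hat f$ of $y'=zJHy$ on $(s_-,\sigma)$ (sign $-$) or on $(\sigma,s_+)$ (sign $+$) put $$\Gamma_{\mathsf r}^\pm\hat f:=\lim_{x\to\sigma\pm}\hat f(x)_2,\quad\Gamma_{\mathsf s}^\pm(z)\hat f:=\lim_{x\to\sigma\pm}\sum_{n=0}^\Delta z^n(\mathfrak w_n(x))^*J\Bigl(\hat f(x)-(\Gamma_{\mathsf r}^\pm\hat f)\sum_{j=\Delta+1}^{2\Delta-n}z^j\mathfrak w_j(x)\Bigr),\quad\Gamma^\pm(z)\hat f:=\begin{pmatrix}\Gamma_{\mathsf s}^\pm(z)\hat f\\ \Gamma_{\mathsf r}^\pm\hat f\end{pmatrix}$$ (these limits exist for all such solutions; empty sums are $0$). For a $2\times2$-matrix function $M(\cdot,z)$ whose columns are such solutions, $\tilde\Gamma^\pm(z)M(\cdot,z)$ is the $2\times2$ matrix with columns $\Gamma^\pm(z)(M(\cdot,z)\mathfrak e_1)$ and $\Gamma^\pm(z)(M(\cdot,z)\mathfrak e_2)$. In $U^-(z)$, $W_{\mathfrak h}(\cdot,z)$ is taken on $[s_-,\sigma)$. **The matrix $\mathscr R$.** $\mathscr p(z):=-\sum_{n=1}^{2\Delta}d_{n-1}z^n+\sum_{n=2\Delta+1}^{2\Delta+\ddot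 o}b_{\ddot o+2\Delta+1-n}z^n$ and $\mathscr R(z):=\begin{pmatrix}1&\mathscr p(z)\\0&1\end{pmatrix}$. *)

theory Defs
  imports "HOL-Analysis.Analysis"
begin

section \<open>Absolute continuity\<close>

definition abs_continuous_on :: "real \<Rightarrow> real \<Rightarrow> (real \<Rightarrow> 'a::real_normed_vector) \<Rightarrow> bool" where
  "abs_continuous_on c d f \<longleftrightarrow>
     (\<forall>e>0. \<exists>\<delta>>0. \<forall>D. D division_of \<Union>D \<and> \<Union>D \<subseteq> {c..d} \<and> (\<Sum>k\<in>D. Sup k - Inf k) < \<delta>
        \<longrightarrow> (\<Sum>k\<in>D. norm (f (Sup k) - f (Inf k))) < e)"

definition loc_abs_continuous_on :: "real set \<Rightarrow> (real \<Rightarrow> 'a::real_normed_vector) \<Rightarrow> bool" where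
  "loc_abs_continuous_on S f \<longleftrightarrow> (\<forall>c d. c \<le> d \<and> {c..d} \<subseteq> S \<longrightarrow> abs_continuous_on c d f)"

section \<open>Hamiltonians\<close>

definition J :: "complex^2^2" where
  "J = vector [vector [0, -1], vector [1, 0]]"

type_synonym hamiltonian = "real \<Rightarrow> real^2^2"

abbreviation cmat :: "real^2^2 \<Rightarrow> complex^2^2" where
  "cmat \<equiv> map_matrix complex_of_real"

text \<open>\<open>cdot x y\<close> is \<open>x\<^sup>* y\<close>; it is conjugate linear in the first argument.\<close>

definition cdot :: "complex^2 \<Rightarrow> complex^2 \<Rightarrow> complex" where
  "cdot x y = (\<Sum>i\<in>UNIV. cnj (x $ i) * y $ i)"

definition xi :: "real \<Rightarrow> real^2" where
  "xi \<phi> = vector [cos \<phi>, sin \<phi>]"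

definition is_hamiltonian :: "hamiltonian \<Rightarrow> real \<Rightarrow> real \<Rightarrow> bool" where
  "is_hamiltonian H a b \<longleftrightarrow>
     H \<in> borel_measurable (lebesgue_on {a<..<b}) \<and>
     (\<forall>c d. a < c \<and> c \<le> d \<and> d < b \<longrightarrow> set_integrable lebesgue {c..d} H) \<and>
     (AE t\<in>{a<..<b} in lebesgue. transpose (H t) = H t \<and> (\<forall>x. 0 \<le> x \<bullet> (H t *v x))) \<and>
     (AE t\<in>{a<..<b} in lebesgue. H t \<noteq> 0)"

definition limit_circle_left :: "hamiltonian \<Rightarrow> real \<Rightarrow> real \<Rightarrow> bool" where
  "limit_circle_left H a b \<longleftrightarrow> (\<exists>c\<in>{a<..<b}. set_integrable lebesgue {a<..<c} H)"

definition limit_circle_right :: "hamiltonian \<Rightarrow> real \<Rightarrow> real \<Rightarrow> bool" where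
  "limit_circle_right H a b \<longleftrightarrow> (\<exists>c\<in>{a<..<b}. set_integrable lebesgue {c<..<b} H)"

definition indivisible_type :: "hamiltonian \<Rightarrow> real \<Rightarrow> real \<Rightarrow> real \<Rightarrow> bool" where
  "indivisible_type H c d \<phi> \<longleftrightarrow>
     c < d \<and> (AE t\<in>{c<..<d} in lebesgue. range (\<lambda>x. H t *v x) = span {xi \<phi>})"

definition indivisible :: "hamiltonian \<Rightarrow> real \<Rightarrow> real \<Rightarrow> bool" where
  "indivisible H c d \<longleftrightarrow> (\<exists>\<phi>. indivisible_type H c d \<phi>)"

text \<open>Elements of \<open>L\<^sup>2(H)\<close> are handled through representatives; two functions represent the
  same element iff they are related by \<open>eq_H\<close>.\<close>

definition eq_H :: "hamiltonian \<Rightarrow> real \<Rightarrow> real \<Rightarrow> (real \<Rightarrow> complex^2) \<Rightarrow> (real \<Rightarrow> complex^2) \<Rightarrow> bool" where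
  "eq_H H a b f g \<longleftrightarrow> (AE t\<in>{a<..<b} in lebesgue. cmat (H t) *v f t = cmat (H t) *v g t)"

definition in_L2 :: "hamiltonian \<Rightarrow> real \<Rightarrow> real \<Rightarrow> (real \<Rightarrow> complex^2) \<Rightarrow> bool" where
  "in_L2 H a b f \<longleftrightarrow>
     f \<in> borel_measurable (lebesgue_on {a<..<b}) \<and>
     set_integrable lebesgue {a<..<b} (\<lambda>t. cdot (f t) (cmat (H t) *v f t)) \<and>
     (\<forall>c d \<phi>. a \<le> c \<and> d \<le> b \<and> indivisible_type H c d \<phi> \<longrightarrow>
        (\<exists>k. AE t\<in>{c<..<d} in lebesgue. cdot (\<chi> i. complex_of_real (xi \<phi> $ i)) (f t) = k))"

text \<open>\<open>y\<close> is a representative of \<open>f\<close> which is locally absolutely continuous on \<open>S\<close> and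
  satisfies \<open>y' = J H g\<close> a.e.; \<open>S\<close> is \<open>(a,b)\<close>, \<open>[a,b)\<close> or \<open>(a,b]\<close>.\<close>

definition ac_representative ::
  "hamiltonian \<Rightarrow> real \<Rightarrow> real \<Rightarrow> real set \<Rightarrow> (real \<Rightarrow> complex^2) \<Rightarrow> (real \<Rightarrow> complex^2) \<Rightarrow> (real \<Rightarrow> complex^2) \<Rightarrow> bool" where
  "ac_representative H a b S f g y \<longleftrightarrow>
     loc_abs_continuous_on S y \<and> eq_H H a b y f \<and>
     (AE t\<in>{a<..<b} in lebesgue. (y has_vector_derivative J *v (cmat (H t) *v g t)) (at t))"

definition in_Tmax :: "hamiltonian \<Rightarrow> real \<Rightarrow> real \<Rightarrow> (real \<Rightarrow> complex^2) \<Rightarrow> (real \<Rightarrow> complex^2) \<Rightarrow> bool" where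
  "in_Tmax H a b f g \<longleftrightarrow>
     in_L2 H a b f \<and> in_L2 H a b g \<and> (\<exists>y. ac_representative H a b {a<..<b} f g y)"

section \<open>The functions \<open>\<ww>\<^sub>n\<close>\<close>

definition cond_I :: "hamiltonian \<Rightarrow> real \<Rightarrow> real \<Rightarrow> bool" where
  "cond_I H a b \<longleftrightarrow> set_integrable lebesgue {a<..<b} (\<lambda>t. H t $ 1 $ 1)"

definition cond_HS_left :: "hamiltonian \<Rightarrow> real \<Rightarrow> real \<Rightarrow> bool" where
  "cond_HS_left H a b \<longleftrightarrow> set_integrable lebesgue {a<..<b}
     (\<lambda>t. (LINT s:{a<..<t}|lebesgue. H s $ 2 $ 2) * H t $ 1 $ 1)"

definition cond_HS_right :: "hamiltonian \<Rightarrow> real \<Rightarrow> real \<Rightarrow> bool" where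
  "cond_HS_right H a b \<longleftrightarrow> set_integrable lebesgue {a<..<b}
     (\<lambda>t. (LINT s:{t<..<b}|lebesgue. H s $ 2 $ 2) * H t $ 1 $ 1)"

type_synonym fun_op = "(real \<Rightarrow> complex^2) \<Rightarrow> real \<Rightarrow> complex^2"

definition int_left :: "hamiltonian \<Rightarrow> real \<Rightarrow> fun_op" where
  "int_left H a f t = (LINT s:{a<..<t}|lebesgue. J *v (cmat (H s) *v f s))"

definition int_right :: "hamiltonian \<Rightarrow> real \<Rightarrow> fun_op" where
  "int_right H b f t = - (LINT s:{t<..<b}|lebesgue. J *v (cmat (H s) *v f s))"

text \<open>In the following three definitions \<open>I\<close> is \<open>int_left H a\<close> or \<open>int_right H b\<close>. The infimum
  is taken in \<^typ>\<open>enat\<close>, where \<open>Inf {} = \<infinity>\<close>.\<close>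

definition Delta_of :: "hamiltonian \<Rightarrow> real \<Rightarrow> real \<Rightarrow> fun_op \<Rightarrow> enat" where
  "Delta_of H a b I = Inf (enat ` {n. \<exists>v :: nat \<Rightarrow> complex^2.
     in_L2 H a b (\<lambda>t. (I ^^ n) (\<lambda>_. vector [0, 1]) t + (\<Sum>k<n. (I ^^ k) (\<lambda>_. v (n - k)) t))})"

definition w_of :: "fun_op \<Rightarrow> (nat \<Rightarrow> complex) \<Rightarrow> nat \<Rightarrow> real \<Rightarrow> complex^2" where
  "w_of I \<omega> n t = (\<Sum>k\<le>n. (I ^^ k) (\<lambda>_. vector [0, \<omega> (n - k)]) t)"

definition omega_of :: "hamiltonian \<Rightarrow> real \<Rightarrow> real \<Rightarrow> fun_op \<Rightarrow> nat \<Rightarrow> complex" where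
  "omega_of H a b I = (THE \<omega>. \<omega> 0 = 1 \<and>
     (\<forall>n. Delta_of H a b I \<le> enat n \<longrightarrow> in_L2 H a b (w_of I \<omega> n)))"

section \<open>Elementary indefinite Hamiltonians of kind (A)\<close>

text \<open>The Hamiltonians \<open>H\<^sub>-\<close> and \<open>H\<^sub>+\<close> are the restrictions of the single function \<open>ham\<close> to
  \<open>(s\<^sub>-, \<sigma>)\<close> and \<open>(\<sigma>, s\<^sub>+)\<close>. Only the values \<open>bpar 1, \<dots>, bpar odd_o\<close> and
  \<open>dpar 0, \<dots>, dpar (2 * \<Delta> - 1)\<close> are data; the others are never used.\<close>

record indef_hamiltonian =
  s_minus :: real
  sigma :: real
  s_plus :: real
  ham :: hamiltonian
  odd_o :: nat
  bpar :: "nat \<Rightarrow> real"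
  dpar :: "nat \<Rightarrow> real"

definition Delta_minus :: "indef_hamiltonian \<Rightarrow> enat" where
  "Delta_minus h = Delta_of (ham h) (s_minus h) (sigma h) (int_left (ham h) (s_minus h))"

definition Delta_plus :: "indef_hamiltonian \<Rightarrow> enat" where
  "Delta_plus h = Delta_of (ham h) (sigma h) (s_plus h) (int_right (ham h) (s_plus h))"

text \<open>For \<open>h\<close> of kind (A) the maximum is finite, and it is at least 1 because
  \<open>ham h\<close> is limit point at \<open>\<sigma>\<close>.\<close>

definition Delta :: "indef_hamiltonian \<Rightarrow> nat" where
  "Delta h = the_enat (max (Delta_minus h) (Delta_plus h))"

definition kind_A :: "indef_hamiltonian \<Rightarrow> bool" where
  "kind_A h \<longleftrightarrow>
     s_minus h < sigma h \<and> sigma h < s_plus h \<and>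
     is_hamiltonian (ham h) (s_minus h) (sigma h) \<and>
     limit_circle_left (ham h) (s_minus h) (sigma h) \<and>
     \<not> limit_circle_right (ham h) (s_minus h) (sigma h) \<and>
     cond_I (ham h) (s_minus h) (sigma h) \<and> cond_HS_left (ham h) (s_minus h) (sigma h) \<and>
     Delta_minus h < \<infinity> \<and>
     is_hamiltonian (ham h) (sigma h) (s_plus h) \<and>
     \<not> limit_circle_left (ham h) (sigma h) (s_plus h) \<and>
     limit_circle_right (ham h) (sigma h) (s_plus h) \<and>
     cond_I (ham h) (sigma h) (s_plus h) \<and> cond_HS_right (ham h) (sigma h) (s_plus h) \<and>
     Delta_plus h < \<infinity> \<and>
     ((\<forall>s\<in>{s_minus h..<sigma h}. \<not> indivisible (ham h) s (sigma h)) \<or>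
      (\<forall>s\<in>{sigma h<..<s_plus h}. \<not> indivisible (ham h) (sigma h) s)) \<and>
     (odd_o h > 0 \<longrightarrow> bpar h 1 \<noteq> 0)"

definition omega_minus :: "indef_hamiltonian \<Rightarrow> nat \<Rightarrow> complex" where
  "omega_minus h = omega_of (ham h) (s_minus h) (sigma h) (int_left (ham h) (s_minus h))"

definition omega_plus :: "indef_hamiltonian \<Rightarrow> nat \<Rightarrow> complex" where
  "omega_plus h = omega_of (ham h) (sigma h) (s_plus h) (int_right (ham h) (s_plus h))"

definition w_fun :: "indef_hamiltonian \<Rightarrow> nat \<Rightarrow> real \<Rightarrow> complex^2" where
  "w_fun h n t = (if t < sigma h then w_of (int_left (ham h) (s_minus h)) (omega_minus h) n t
              else w_of (int_right (ham h) (s_plus h)) (omega_plus h) n t)"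

abbreviation indiv_minus :: "indef_hamiltonian \<Rightarrow> bool" where
  "indiv_minus h \<equiv> indivisible (ham h) (s_minus h) (sigma h)"

abbreviation indiv_plus :: "indef_hamiltonian \<Rightarrow> bool" where
  "indiv_plus h \<equiv> indivisible (ham h) (sigma h) (s_plus h)"

section \<open>Model space, relation and boundary mapping\<close>

text \<open>Functions on \<open>(s\<^sub>-, \<sigma>) \<union> (\<sigma>, s\<^sub>+)\<close> are given by functions on the real line whose values
  elsewhere are ignored. In this way \<open>L\<^sup>2(H)\<close> and \<open>T\<^sub>m\<^sub>a\<^sub>x(H)\<close> become direct sums.\<close>

definition L2_H :: "indef_hamiltonian \<Rightarrow> (real \<Rightarrow> complex^2) \<Rightarrow> bool" where
  "L2_H h f \<longleftrightarrow> in_L2 (ham h) (s_minus h) (sigma h) f \<and> in_L2 (ham h) (sigma h) (s_plus h) f"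

definition Tmax_H :: "indef_hamiltonian \<Rightarrow> (real \<Rightarrow> complex^2) \<Rightarrow> (real \<Rightarrow> complex^2) \<Rightarrow> bool" where
  "Tmax_H h f g \<longleftrightarrow>
     in_Tmax (ham h) (s_minus h) (sigma h) f g \<and> in_Tmax (ham h) (sigma h) (s_plus h) f g"

definition L2_Delta :: "indef_hamiltonian \<Rightarrow> (real \<Rightarrow> complex^2) \<Rightarrow> bool" where
  "L2_Delta h f \<longleftrightarrow> (\<exists>c :: nat \<Rightarrow> complex. L2_H h (\<lambda>t. f t - (\<Sum>i<Delta h. c i *s w_fun h i t)))"

text \<open>Triples \<open>(f, \<xi>, \<alpha>)\<close>; the vectors \<open>\<xi>\<close> (indices \<open>0, \<dots>, \<Delta> - 1\<close>) and \<open>\<alpha>\<close> (indices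
  \<open>1, \<dots>, odd_o\<close>) are extended by zero, and \<open>f\<close> is a representative modulo \<open>eq_H\<close>.\<close>

type_synonym model_elem = "(real \<Rightarrow> complex^2) \<times> (nat \<Rightarrow> complex) \<times> (nat \<Rightarrow> complex)"

definition model_space :: "indef_hamiltonian \<Rightarrow> model_elem set" where
  "model_space h = {(f, \<xi>, \<alpha>). L2_Delta h f \<and> (\<forall>i. i \<notin> {..<Delta h} \<longrightarrow> \<xi> i = 0) \<and>
     (\<forall>k. k \<notin> {1..odd_o h} \<longrightarrow> \<alpha> k = 0)}"

definition model_scale :: "complex \<Rightarrow> model_elem \<Rightarrow> model_elem" where
  "model_scale z F = (case F of (f, \<xi>, \<alpha>) \<Rightarrow> (\<lambda>t. z *s f t, \<lambda>i. z * \<xi> i, \<lambda>k. z * \<alpha> k))"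

text \<open>The values \<open>f(s\<^sub>-)\<close> and \<open>f(s\<^sub>+)\<close>. They depend on \<open>f\<close> and \<open>g\<close>, and are meaningful only
  if the respective interval is not indivisible.\<close>

definition val_minus :: "indef_hamiltonian \<Rightarrow> (real \<Rightarrow> complex^2) \<Rightarrow> (real \<Rightarrow> complex^2) \<Rightarrow> complex^2" where
  "val_minus h f g = (THE v. \<exists>y. v = y (s_minus h) \<and>
     ac_representative (ham h) (s_minus h) (sigma h) {s_minus h..<sigma h} f g y)"

definition val_plus :: "indef_hamiltonian \<Rightarrow> (real \<Rightarrow> complex^2) \<Rightarrow> (real \<Rightarrow> complex^2) \<Rightarrow> complex^2" where
  "val_plus h f g = (THE v. \<exists>y. v = y (s_plus h) \<and>
     ac_representative (ham h) (sigma h) (s_plus h) {sigma h<..s_plus h} f g y)"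

definition B_term :: "indef_hamiltonian \<Rightarrow> (real \<Rightarrow> complex^2) \<Rightarrow> (real \<Rightarrow> complex^2) \<Rightarrow> nat \<Rightarrow> complex" where
  "B_term h f g k =
     (if indiv_plus h then omega_minus h k * val_minus h f g $ 1
      else if indiv_minus h then - (omega_plus h k * val_plus h f g $ 1)
      else omega_minus h k * val_minus h f g $ 1 - omega_plus h k * val_plus h f g $ 1)"

definition E_term :: "indef_hamiltonian \<Rightarrow> (real \<Rightarrow> complex^2) \<Rightarrow> (real \<Rightarrow> complex^2) \<Rightarrow> (nat \<Rightarrow> complex) \<Rightarrow> complex" where
  "E_term h f g lam =
     (LINT t:{s_minus h<..<s_plus h}|lebesgue.
        cdot (w_fun h (Delta h) t) (cmat (ham h t) *v (g t - (\<Sum>i<Delta h. lam (i + 1) *s w_fun h i t))))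
     + 1/2 * (\<Sum>i<Delta h. of_real (dpar h (Delta h - 1 + i)) * lam i)
     + of_real (dpar h (2 * Delta h - 1)) * lam (Delta h)
     - B_term h f g (Delta h)"

text \<open>\<open>T_coeff h F G lam\<close>: the pair \<open>(F; G)\<close> belongs to the relation \<open>T(h)\<close>, and
  \<open>lam 0, \<dots>, lam (Delta h)\<close> are the coefficients in the decomposition of the first component of \<open>F\<close>. These coefficients are
  unique because \<open>\<ww>\<^sub>0, \<dots>, \<ww>\<^sub>\<Delta>\<close> are linearly independent modulo the domain of \<open>Tmax_H\<close>.\<close>

definition T_coeff :: "indef_hamiltonian \<Rightarrow> model_elem \<Rightarrow> model_elem \<Rightarrow> (nat \<Rightarrow> complex) \<Rightarrow> bool" where
  "T_coeff h F G lam \<longleftrightarrow> F \<in> model_space h \<and> G \<in> model_space h \<and>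
     (case (F, G) of ((f, \<xi>, \<alpha>), (g, \<eta>, \<beta>)) \<Rightarrow>
        Tmax_H h (\<lambda>t. f t - (\<Sum>i\<le>Delta h. lam i *s w_fun h i t))
                 (\<lambda>t. g t - (\<Sum>i<Delta h. lam (i + 1) *s w_fun h i t)) \<and>
        (if odd_o h = 0 then \<xi> (Delta h - 1) = E_term h f g lam
         else \<alpha> (odd_o h) = of_real (bpar h 1) * lam (Delta h)) \<and>
        (\<not> indiv_minus h \<and> \<not> indiv_plus h \<longrightarrow>
           \<eta> 0 = val_minus h f g $ 1 - val_plus h f g $ 1
                  - 1/2 * (\<Sum>i<Delta h. of_real (dpar h i) * lam (i + 1))) \<and>
        (\<forall>k. 1 \<le> k \<and> k \<le> Delta h - 1 \<longrightarrow>
           \<eta> k = \<xi> (k - 1) - 1/2 * of_real (dpar h (k - 1)) * lam 0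
                  - 1/2 * of_real (dpar h (k + Delta h - 1)) * lam (Delta h) + B_term h f g k) \<and>
        (odd_o h > 0 \<longrightarrow>
           \<beta> 1 = E_term h f g lam - \<xi> (Delta h - 1) \<and>
           (\<forall>j. 2 \<le> j \<and> j \<le> odd_o h \<longrightarrow>
              \<beta> j = \<alpha> (j - 1) - of_real (bpar h (odd_o h + 2 - j)) * lam (Delta h))))"

definition bdry_minus :: "indef_hamiltonian \<Rightarrow> model_elem \<Rightarrow> model_elem \<Rightarrow> (nat \<Rightarrow> complex) \<Rightarrow> complex^2" where
  "bdry_minus h F G lam = (case (F, G) of ((f, \<xi>, \<alpha>), (g, \<eta>, \<beta>)) \<Rightarrow>
     if \<not> indiv_minus h then val_minus h f g
     else vector [val_plus h f g $ 1 + \<eta> 0 + 1/2 * (\<Sum>i<Delta h. of_real (dpar h i) * lam (i + 1)), lam 0])"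

definition bdry_plus :: "indef_hamiltonian \<Rightarrow> model_elem \<Rightarrow> model_elem \<Rightarrow> (nat \<Rightarrow> complex) \<Rightarrow> complex^2" where
  "bdry_plus h F G lam = (case (F, G) of ((f, \<xi>, \<alpha>), (g, \<eta>, \<beta>)) \<Rightarrow>
     if \<not> indiv_plus h then val_plus h f g
     else vector [val_minus h f g $ 1 - \<eta> 0 - 1/2 * (\<Sum>i<Delta h. of_real (dpar h i) * lam (i + 1)), lam 0])"

text \<open>The boundary mapping, given by its graph; its domain is the relation \<open>T(h)\<close>. The elements are
  \<open>((F, G), (\<Gamma>(F;G)(s\<^sub>-), \<Gamma>(F;G)(s\<^sub>+)))\<close>.\<close>

definition Gamma_map :: "indef_hamiltonian \<Rightarrow> ((model_elem \<times> model_elem) \<times> ((complex^2) \<times> (complex^2))) set" where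
  "Gamma_map h = {((F, G), (u, v)). \<exists>lam. T_coeff h F G lam \<and> u = bdry_minus h F G lam \<and> v = bdry_plus h F G lam}"

section \<open>The maximal chain of matrices\<close>

text \<open>\<open>mat z ** A\<close> is the scalar multiple \<open>z A\<close>.\<close>

definition canonical_solution ::
  "hamiltonian \<Rightarrow> real \<Rightarrow> real \<Rightarrow> real set \<Rightarrow> complex \<Rightarrow> (real \<Rightarrow> complex^2^2) \<Rightarrow> bool" where
  "canonical_solution H a b S z M \<longleftrightarrow>
     loc_abs_continuous_on S M \<and>
     (AE t\<in>{a<..<b} in lebesgue.
        ((\<lambda>s. M s ** J) has_vector_derivative mat z ** (M t ** cmat (H t))) (at t))"

definition maximal_chain :: "indef_hamiltonian \<Rightarrow> (real \<Rightarrow> complex \<Rightarrow> complex^2^2) \<Rightarrow> bool" where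
  "maximal_chain h W \<longleftrightarrow> (\<forall>z.
     canonical_solution (ham h) (s_minus h) (sigma h) {s_minus h..<sigma h} z (\<lambda>t. W t z) \<and>
     W (s_minus h) z = mat 1 \<and>
     canonical_solution (ham h) (sigma h) (s_plus h) {sigma h<..s_plus h} z (\<lambda>t. W t z) \<and>
     (\<forall>i. \<exists>F. ((F, model_scale z F), (axis i 1, transpose (W (s_plus h) z) *v axis i 1)) \<in> Gamma_map h))"

section \<open>Generalised boundary values\<close>

text \<open>The filter \<open>L\<close> is \<open>at_left (sigma h)\<close> for the sign \<open>-\<close> and \<open>at_right (sigma h)\<close> for the
  sign \<open>+\<close>.\<close>

definition Gamma_r :: "real filter \<Rightarrow> (real \<Rightarrow> complex^2) \<Rightarrow> complex" where
  "Gamma_r L y = Lim L (\<lambda>x. y x $ 2)"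

definition Gamma_s :: "indef_hamiltonian \<Rightarrow> real filter \<Rightarrow> complex \<Rightarrow> (real \<Rightarrow> complex^2) \<Rightarrow> complex" where
  "Gamma_s h L z y = Lim L (\<lambda>x. \<Sum>n\<le>Delta h. z ^ n *
     cdot (w_fun h n x) (J *v (y x - Gamma_r L y *s (\<Sum>j = Delta h + 1..2 * Delta h - n. z ^ j *s w_fun h j x))))"

definition Gamma_vec :: "indef_hamiltonian \<Rightarrow> real filter \<Rightarrow> complex \<Rightarrow> (real \<Rightarrow> complex^2) \<Rightarrow> complex^2" where
  "Gamma_vec h L z y = vector [Gamma_s h L z y, Gamma_r L y]"

definition Gamma_mat :: "indef_hamiltonian \<Rightarrow> real filter \<Rightarrow> complex \<Rightarrow> (real \<Rightarrow> complex^2^2) \<Rightarrow> complex^2^2" where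
  "Gamma_mat h L z M = (\<chi> i j. Gamma_vec h L z (\<lambda>x. M x *v axis j 1) $ i)"

definition U_minus :: "indef_hamiltonian \<Rightarrow> (real \<Rightarrow> complex \<Rightarrow> complex^2^2) \<Rightarrow> complex \<Rightarrow> complex^2^2" where
  "U_minus h W z = transpose (Gamma_mat h (at_left (sigma h)) z (\<lambda>t. transpose (W t z)))"

definition U_plus :: "indef_hamiltonian \<Rightarrow> (real \<Rightarrow> complex \<Rightarrow> complex^2^2) \<Rightarrow> complex \<Rightarrow> complex^2^2" where
  "U_plus h V z = transpose (Gamma_mat h (at_right (sigma h)) z (\<lambda>t. transpose (V t z)))"

definition p_poly :: "indef_hamiltonian \<Rightarrow> complex \<Rightarrow> complex" where
  "p_poly h z = - (\<Sum>n = 1..2 * Delta h. of_real (dpar h (n - 1)) * z ^ n)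
     + (\<Sum>n = 2 * Delta h + 1..2 * Delta h + odd_o h. of_real (bpar h (odd_o h + 2 * Delta h + 1 - n)) * z ^ n)"

definition R_mat :: "indef_hamiltonian \<Rightarrow> complex \<Rightarrow> complex^2^2" where
  "R_mat h z = vector [vector [1, p_poly h z], vector [0, 1]]"

end

theory Submission
  imports Defs "HOL-Computational_Algebra.Fundamental_Theorem_Algebra"
begin

text \<open>Let \<open>y\<close> solve \<open>y' = zJHy\<close> near \<open>\<sigma>\<close> on one side. With \<open>l = \<Gamma>\<^sub>r y\<close> the difference
  \<open>y - l (\<Sum>i<m. z\<^sup>i w\<^sub>i)\<close> is square integrable for large \<open>m\<close>, because the second components of all \<open>w\<^sub>n\<close>,
  \<open>n > 0\<close>, vanish at \<open>\<sigma>\<close>. Differentiating the pairing of \<open>y\<close> with \<open>\<Sum> z\<^sup>n w\<^sub>n\<close> gives, with \<open>c\<close> the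
  regular endpoint, the formula
  \<open>\<Gamma>\<^sub>s y = (\<Sum>n\<le>m. z\<^sup>n \<omega>\<^sub>n) y(c)\<^sub>1 \<mp> z\<^sup>m\<^sup>+\<^sup>1 \<integral> w\<^sub>m\<^sup>* H (y - l (\<Sum>i<m. z\<^sup>i w\<^sub>i))\<close>.
  If \<open>(F; zF)\<close> belongs to the model relation, its coefficients are \<open>\<lambda>\<^sub>i = z\<^sup>i \<lambda>\<^sub>0\<close>, and the columns of
  \<open>W\<^sup>T\<close> on the two sides represent \<open>F\<close>, so that \<open>\<Gamma>\<^sub>r\<^sup>+ = \<Gamma>\<^sub>r\<^sup>- = \<lambda>\<^sub>0\<close>. Eliminating \<open>\<xi>\<close> and \<open>\<alpha>\<close> from the
  relation turns the difference of the two formulas into \<open>\<Gamma>\<^sub>s\<^sup>+ - \<Gamma>\<^sub>s\<^sup>- = p(z) \<Gamma>\<^sub>r\<^sup>-\<close>.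
  Finally the boundary values preserve the Wronskian, which gives the determinants, and which on the
  right-hand side determines \<open>W(t, z)\<close> from \<open>V(t, z)\<close> and the boundary values of both.\<close>

section \<open>Absolutely continuous functions\<close>

text \<open>The analytic obstacle is the vanishing of the second component of \<open>w n\<close> at
  \<sigma>. For n above the one-sided index it follows from square integrability; for smaller n > 0
  it has to be extracted from the minimality of the index. All estimates rest on one asymmetry:
  first components oscillate against \<open>h2\<close>, whose mass at \<sigma> is infinite, second
  components against the integrable \<open>h1\<close>, and (HS) balances the two. The tail of the
  (HS) integral is the small parameter \<open>kappa\<close>. The pairing of two functions that are
  not square integrable has no limit in general. The terms with j > \<Delta> in \<Gamma>_s repair
  this: their derivatives telescope and leave the remainder y - l (...) in place of y. \<Delta> is
  the larger of the two one-sided indices, so the independence of the \<open>w i\<close> that forces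
  \<lambda>_(i+1) = z \<lambda>_i is taken from a side that attains \<Delta>. An indivisible side
  has no value f(s\<plusminus>), but there \<open>H\<close> sees only the second component, which is
  constant and equal to \<lambda>_0.\<close>

lemma abs_continuous_onD:
  assumes "abs_continuous_on c d f" "e > 0"
  obtains \<delta> where "\<delta> > 0" "\<And>D. \<lbrakk>D division_of \<Union>D; \<Union>D \<subseteq> {c..d}; (\<Sum>k\<in>D. Sup k - Inf k) < \<delta>\<rbrakk>
      \<Longrightarrow> (\<Sum>k\<in>D. norm (f (Sup k) - f (Inf k))) < e"
proof -
  obtain \<delta> where "\<delta> > 0" "\<forall>D. D division_of \<Union>D \<and> \<Union>D \<subseteq> {c..d} \<and> (\<Sum>k\<in>D. Sup k - Inf k) < \<delta>
        \<longrightarrow> (\<Sum>k\<in>D. norm (f (Sup k) - f (Inf k))) < e"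
    using assms(1)[unfolded abs_continuous_on_def, rule_format, OF assms(2)] by (elim exE conjE)
  then show thesis by (intro that[of \<delta>]) simp_all
qed

lemma abs_continuous_on_imp_continuous_on:
  assumes "abs_continuous_on c d f"
  shows "continuous_on {c..d} f"
  unfolding continuous_on_iff
proof (intro ballI allI impI)
  fix x and e :: real assume x: "x \<in> {c..d}" and "e > 0"
  then obtain \<delta> where \<delta>: "\<delta> > 0" "\<And>D. \<lbrakk>D division_of \<Union>D; \<Union>D \<subseteq> {c..d}; (\<Sum>k\<in>D. Sup k - Inf k) < \<delta>\<rbrakk>
      \<Longrightarrow> (\<Sum>k\<in>D. norm (f (Sup k) - f (Inf k))) < e"
    using abs_continuous_onD[OF assms \<open>e > 0\<close>] by blast
  have "dist (f y) (f x) < e" if "y \<in> {c..d}" "dist y x < \<delta>" for y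
  proof -
    let ?k = "{min x y..max x y}"
    have "{?k} division_of \<Union>{?k}"
      using division_of_self[of "min x y" "max x y"] by (simp add: cbox_interval)
    moreover have "\<Union>{?k} \<subseteq> {c..d}" using x that by auto
    moreover have "(\<Sum>k\<in>{?k}. Sup k - Inf k) < \<delta>" using that by (auto simp: dist_real_def)
    ultimately have "(\<Sum>k\<in>{?k}. norm (f (Sup k) - f (Inf k))) < e" by (rule \<delta>(2))
    then show ?thesis by (auto simp: dist_norm min_def max_def norm_minus_commute split: if_splits)
  qed
  with \<delta>(1) show "\<exists>d'>0. \<forall>y\<in>{c..d}. dist y x < d' \<longrightarrow> dist (f y) (f x) < e" by blast
qed

text \<open>Linear images and products of absolutely continuous functions both fall under this
  criterion: their increments are bounded by increments of the given functions.\<close>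

lemma abs_continuous_on_comparison:
  assumes f: "abs_continuous_on c d f" and g: "abs_continuous_on c d g" and "K \<ge> 0" "L \<ge> 0"
    and le: "\<And>u v. \<lbrakk>c \<le> u; u \<le> v; v \<le> d\<rbrakk> \<Longrightarrow> norm (h v - h u) \<le> K * norm (f v - f u) + L * norm (g v - g u)"
  shows "abs_continuous_on c d h"
  unfolding abs_continuous_on_def
proof (intro allI impI)
  fix e :: real assume e: "e > 0"
  \<comment> \<open>The summand 1 keeps the divisor positive when \<open>K = L = 0\<close>.\<close>
  define M where "M = K + L + 1"
  have M: "M > 0" "K \<le> M" "L \<le> M" using assms(3,4) by (auto simp: M_def)
  have e2: "e / (2 * M) > 0" using e M by simp
  obtain \<delta>1 where 1: "\<delta>1 > 0" "\<And>D. \<lbrakk>D division_of \<Union>D; \<Union>D \<subseteq> {c..d}; (\<Sum>k\<in>D. Sup k - Inf k) < \<delta>1\<rbrakk>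
      \<Longrightarrow> (\<Sum>k\<in>D. norm (f (Sup k) - f (Inf k))) < e / (2 * M)"
    by (rule abs_continuous_onD[OF f e2]) blast
  obtain \<delta>2 where 2: "\<delta>2 > 0" "\<And>D. \<lbrakk>D division_of \<Union>D; \<Union>D \<subseteq> {c..d}; (\<Sum>k\<in>D. Sup k - Inf k) < \<delta>2\<rbrakk>
      \<Longrightarrow> (\<Sum>k\<in>D. norm (g (Sup k) - g (Inf k))) < e / (2 * M)"
    by (rule abs_continuous_onD[OF g e2]) blast
  have "(\<Sum>k\<in>D. norm (h (Sup k) - h (Inf k))) < e"
    if D: "D division_of \<Union>D" "\<Union>D \<subseteq> {c..d}" "(\<Sum>k\<in>D. Sup k - Inf k) < min \<delta>1 \<delta>2" for D
  proof -
    have "(\<Sum>k\<in>D. norm (h (Sup k) - h (Inf k)))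
        \<le> (\<Sum>k\<in>D. M * norm (f (Sup k) - f (Inf k)) + M * norm (g (Sup k) - g (Inf k)))"
    proof (rule sum_mono)
      fix k assume k: "k \<in> D"
      then obtain u v where uv: "k = {u..v}" "k \<noteq> {}"
        using division_ofD(3,4)[OF D(1)] by (metis cbox_interval)
      then have "u \<le> v" by auto
      moreover have "k \<subseteq> {c..d}" using D(2) k by auto
      ultimately have "c \<le> u" "v \<le> d" using uv by auto
      have "norm (h v - h u) \<le> K * norm (f v - f u) + L * norm (g v - g u)"
        by (rule le) fact+
      also have "\<dots> \<le> M * norm (f v - f u) + M * norm (g v - g u)"
        using M by (intro add_mono mult_right_mono) auto
      finally show "norm (h (Sup k) - h (Inf k)) \<le>
          M * norm (f (Sup k) - f (Inf k)) + M * norm (g (Sup k) - g (Inf k))"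
        using uv \<open>u \<le> v\<close> by simp
    qed
    also have "\<dots> = M * ((\<Sum>k\<in>D. norm (f (Sup k) - f (Inf k))) + (\<Sum>k\<in>D. norm (g (Sup k) - g (Inf k))))"
      by (simp add: sum.distrib sum_distrib_left distrib_left)
    also have "\<dots> < M * (e / (2 * M) + e / (2 * M))"
      using 1(2)[OF D(1,2)] 2(2)[OF D(1,2)] D(3) M by (intro mult_strict_left_mono add_strict_mono) auto
    also have "\<dots> = e" using M by (simp add: field_simps)
    finally show ?thesis .
  qed
  then show "\<exists>\<delta>>0. \<forall>D. D division_of \<Union>D \<and> \<Union>D \<subseteq> {c..d} \<and> (\<Sum>k\<in>D. Sup k - Inf k) < \<delta> \<longrightarrow>
      (\<Sum>k\<in>D. norm (h (Sup k) - h (Inf k))) < e"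
    using 1(1) 2(1) by (intro exI[of _ "min \<delta>1 \<delta>2"]) auto
qed

lemma abs_continuous_on_linear:
  assumes "bounded_linear T" "abs_continuous_on c d f"
  shows "abs_continuous_on c d (\<lambda>t. T (f t))"
proof -
  obtain K where K: "K \<ge> 0" "\<And>x. norm (T x) \<le> norm x * K"
    using bounded_linear.nonneg_bounded[OF assms(1)] by blast
  show ?thesis
  proof (rule abs_continuous_on_comparison[OF assms(2,2) K(1) order_refl])
    fix u v show "norm (T (f v) - T (f u)) \<le> K * norm (f v - f u) + 0 * norm (f v - f u)"
      using K(2)[of "f v - f u"] assms(1)
      by (simp add: mult.commute linear_diff bounded_linear.linear)
  qed
qed

lemma abs_continuous_on_mult:
  fixes f g :: "real \<Rightarrow> 'a::real_normed_algebra"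
  assumes f: "abs_continuous_on c d f" and g: "abs_continuous_on c d g"
  shows "abs_continuous_on c d (\<lambda>t. f t * g t)"
proof -
  have "bounded (f ` {c..d})" "bounded (g ` {c..d})"
    using f g by (auto intro!: compact_imp_bounded compact_continuous_image abs_continuous_on_imp_continuous_on)
  then obtain K L where K: "K > 0" "\<And>t. t \<in> {c..d} \<Longrightarrow> norm (f t) \<le> K"
    and L: "L > 0" "\<And>t. t \<in> {c..d} \<Longrightarrow> norm (g t) \<le> L"
    unfolding bounded_pos by (metis imageI)
  show ?thesis
  proof (rule abs_continuous_on_comparison[OF f g])
    fix u v assume uv: "c \<le> u" "u \<le> v" "v \<le> d"
    have "f v * g v - f u * g u = (f v - f u) * g v + f u * (g v - g u)" by (simp add: algebra_simps)
    also have "norm \<dots> \<le> norm (f v - f u) * norm (g v) + norm (f u) * norm (g v - g u)"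
      by (intro norm_triangle_le add_mono norm_mult_ineq)
    also have "\<dots> \<le> norm (f v - f u) * L + K * norm (g v - g u)"
      using K L uv by (intro add_mono mult_mono) auto
    finally show "norm (f v * g v - f u * g u) \<le> L * norm (f v - f u) + K * norm (g v - g u)"
      by (simp add: mult.commute)
  qed (use K L in auto)
qed

text \<open>Near the exceptional null set the gauge keeps the intervals inside a small open
  superset, where absolute continuity controls the increments of \<open>f\<close>.\<close>

lemma abs_continuous_on_has_integral:
  fixes f g :: "real \<Rightarrow> 'a::banach"
  assumes f: "abs_continuous_on c d f" and "c \<le> d" and N: "negligible N"
    and der: "\<And>t. t \<in> {c..d} - N \<Longrightarrow> (f has_vector_derivative g t) (at t within {c..d})"
  shows "(g has_integral (f d - f c)) {c..d}"
proof -
  define g' where "g' t = (if t \<in> N then 0 else g t)" for t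
  have "(g' has_integral (f d - f c)) (cbox c d)"
    unfolding has_integral
  proof (intro allI impI)
    fix e :: real assume e: "e > 0"
    \<comment> \<open>The summand 1 covers the degenerate interval \<open>c = d\<close>.\<close>
    define e' where "e' = e / (2 * (d - c + 1))"
    have e': "e' > 0" using e \<open>c \<le> d\<close> by (simp add: e'_def)
    obtain \<delta> where \<delta>: "\<delta> > 0" "\<And>D. \<lbrakk>D division_of \<Union>D; \<Union>D \<subseteq> {c..d}; (\<Sum>k\<in>D. Sup k - Inf k) < \<delta>\<rbrakk>
      \<Longrightarrow> (\<Sum>k\<in>D. norm (f (Sup k) - f (Inf k))) < e / 2"
      by (rule abs_continuous_onD[OF f half_gt_zero[OF e]]) blast
    have Nl: "N \<in> sets lebesgue" "emeasure lebesgue N = 0"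
      using N by (auto simp: negligible_iff_null_sets)
    obtain U where U: "open U" "N \<subseteq> U" "U - N \<in> lmeasurable" "emeasure lebesgue (U - N) < ennreal \<delta>"
      using sets_lebesgue_outer_open[OF Nl(1) \<delta>(1)] by metis
    have UN: "U = (U - N) \<union> N" using U(2) by blast
    have Nn: "N \<in> null_sets lebesgue" using N by (simp add: negligible_iff_null_sets)
    have Ul: "U \<in> lmeasurable"
      by (subst UN) (intro fmeasurable.Un U(3) fmeasurableI_null_sets Nn)
    have Um: "measure lebesgue U < \<delta>"
    proof -
      have "emeasure lebesgue U = emeasure lebesgue (U - N)"
        using emeasure_Un_null_set[OF _ Nn, of "U - N"] U(3) UN by (auto simp: fmeasurableD)
      then have "emeasure lebesgue U < ennreal \<delta>" using U(4) by simp
      then show ?thesis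
        using Ul \<delta>(1) by (simp add: emeasure_eq_measure2 ennreal_less_iff)
    qed
    have "\<exists>r>0. (t \<in> N \<longrightarrow> ball t r \<subseteq> U) \<and>
        (t \<notin> N \<longrightarrow> t \<in> {c..d} \<longrightarrow> (\<forall>s\<in>{c..d} \<inter> ball t r. norm (f s - f t - (s - t) *\<^sub>R g t) \<le> e' * \<bar>s - t\<bar>))" for t
    proof (cases "t \<in> N \<or> t \<notin> {c..d}")
      case True
      then show ?thesis
        using U(1,2) unfolding open_contains_ball by (metis gt_ex subset_eq)
    next
      case False
      then have "(f has_derivative (\<lambda>h. h *\<^sub>R g t)) (at t within {c..d})"
        using der[of t] by (auto simp: has_vector_derivative_def)
      then obtain r where "r > 0"
        "\<And>s. \<lbrakk>s \<in> {c..d}; norm (s - t) < r\<rbrakk> \<Longrightarrow> norm (f s - f t - (s - t) *\<^sub>R g t) \<le> e' * norm (s - t)"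
        using e' unfolding has_derivative_within_alt by blast
      then show ?thesis using False by (intro exI[of _ r]) (auto simp: dist_norm norm_minus_commute)
    qed
    then obtain r where r: "\<And>t. r t > 0" "\<And>t. t \<in> N \<Longrightarrow> ball t (r t) \<subseteq> U"
      "\<And>t s. \<lbrakk>t \<notin> N; t \<in> {c..d}; s \<in> {c..d} \<inter> ball t (r t)\<rbrakk> \<Longrightarrow> norm (f s - f t - (s - t) *\<^sub>R g t) \<le> e' * \<bar>s - t\<bar>"
      by metis
    define \<gamma> where "\<gamma> t = ball t (r t)" for t
    have "gauge \<gamma>" using r(1) by (auto simp: gauge_def \<gamma>_def)
    moreover have "norm ((\<Sum>(x, k)\<in>p. measure lborel k *\<^sub>R g' x) - (f d - f c)) < e"
      if p: "p tagged_division_of cbox c d" "\<gamma> fine p" for p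
    proof -
      have fin: "finite p" using p(1) by blast
      have tp: "p tagged_division_of {c..d}" using p(1) by (simp add: cbox_interval)
      have tel: "(\<Sum>(x, k)\<in>p. f (Sup k) - f (Inf k)) = f d - f c"
        by (rule additive_tagged_division_1[OF \<open>c \<le> d\<close> tp])
      define q where "q = {(x, k) \<in> p. x \<in> N}"
      have q: "q \<subseteq> p" by (auto simp: q_def)
      have "(\<Sum>(x, k)\<in>p. measure lborel k *\<^sub>R g' x) - (f d - f c)
          = (\<Sum>(x, k)\<in>p. measure lborel k *\<^sub>R g' x - (f (Sup k) - f (Inf k)))"
        unfolding tel[symmetric] by (simp add: sum_subtractf case_prod_beta)
      also have "norm \<dots> \<le> (\<Sum>(x, k)\<in>p. norm (measure lborel k *\<^sub>R g' x - (f (Sup k) - f (Inf k))))"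
        by (rule order_trans[OF norm_sum]) (simp add: case_prod_beta)
      also have "\<dots> = (\<Sum>(x, k)\<in>p - q. norm (measure lborel k *\<^sub>R g' x - (f (Sup k) - f (Inf k))))
          + (\<Sum>(x, k)\<in>q. norm (measure lborel k *\<^sub>R g' x - (f (Sup k) - f (Inf k))))"
        by (rule sum.subset_diff[OF q fin])
      also have "(\<Sum>(x, k)\<in>q. norm (measure lborel k *\<^sub>R g' x - (f (Sup k) - f (Inf k))))
          = (\<Sum>(x, k)\<in>q. norm (f (Sup k) - f (Inf k)))"
        by (rule sum.cong) (auto simp: q_def g'_def norm_minus_commute)
      also have "\<dots> < e / 2"
      proof -
        have qp: "q tagged_partial_division_of cbox c d"
          using tagged_partial_division_subset[OF _ q] p(1) tagged_division_of_def by blast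
        then have qt: "q tagged_division_of \<Union>(snd ` q)"
          by (simp add: tagged_partial_division_of_Union_self)
        have qd: "snd ` q division_of \<Union>(snd ` q)" by (rule division_of_tagged_division[OF qt])
        have sub: "\<Union>(snd ` q) \<subseteq> U"
        proof
          fix s assume "s \<in> \<Union>(snd ` q)"
          then obtain x k where "(x, k) \<in> q" "s \<in> k" by auto
          then show "s \<in> U" using r(2)[of x] p(2) q unfolding q_def fine_def \<gamma>_def by blast
        qed
        have sub2: "\<Union>(snd ` q) \<subseteq> {c..d}"
          using tagged_division_ofD(3)[OF p(1)] q by force
        have "(\<Sum>k\<in>snd ` q. Sup k - Inf k) = (\<Sum>k\<in>snd ` q. measure lebesgue k)"
        proof (rule sum.cong[OF refl])
          fix k assume "k \<in> snd ` q"
          then obtain u v where "k = {u..v}" "k \<noteq> {}"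
            using division_ofD(3,4)[OF qd] by (metis cbox_interval)
          then show "Sup k - Inf k = measure lebesgue k" by auto
        qed
        also have "\<dots> = measure lebesgue (\<Union>(snd ` q))"
          using content_division[OF qd] by simp
        also have "\<dots> \<le> measure lebesgue U"
          using qd by (intro measure_mono_fmeasurable sub Ul) (auto simp: fmeasurableD lmeasurable_division)
        finally have "(\<Sum>k\<in>snd ` q. Sup k - Inf k) < \<delta>" using Um by simp
        from \<delta>(2)[OF qd sub2 this] have "(\<Sum>k\<in>snd ` q. norm (f (Sup k) - f (Inf k))) < e / 2" .
        moreover have "(\<Sum>(x, k)\<in>q. norm (f (Sup k) - f (Inf k))) = (\<Sum>k\<in>snd ` q. norm (f (Sup k) - f (Inf k)))"
        proof -
          \<comment> \<open>\<open>Sup\<close> and \<open>Inf\<close> of the empty set are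
            unspecified, hence the value 0 there: passing from tagged intervals to intervals
            requires a function that vanishes on every degenerate interval.\<close>
          define \<theta> where "\<theta> k = (if k = {} then 0 else norm (f (Sup k) - f (Inf k)))" for k
          have ne: "k \<noteq> {}" if "k \<in> snd ` q" for k using that division_ofD(3)[OF qd] by blast
          have "(\<Sum>(x, k)\<in>q. norm (f (Sup k) - f (Inf k))) = (\<Sum>(x, k)\<in>q. \<theta> k)"
            using ne by (intro sum.cong) (force simp: \<theta>_def)+
          also have "\<dots> = (\<Sum>k\<in>snd ` q. \<theta> k)"
          proof (rule sum.over_tagged_division_lemma[OF qt])
            fix u v :: real assume "box u v = {}"
            then have "v \<le> u" by (simp add: box_real)
            then show "\<theta> (cbox u v) = 0"
              by (cases "u = v") (auto simp: cbox_interval \<theta>_def)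
          qed
          also have "\<dots> = (\<Sum>k\<in>snd ` q. norm (f (Sup k) - f (Inf k)))"
            using ne by (intro sum.cong) (auto simp: \<theta>_def)
          finally show ?thesis .
        qed
        ultimately show ?thesis by simp
      qed
      also have "(\<Sum>(x, k)\<in>p - q. norm (measure lborel k *\<^sub>R g' x - (f (Sup k) - f (Inf k))))
          \<le> (\<Sum>(x, k)\<in>p - q. e' * measure lborel k)"
      proof (rule sum_mono, clarify)
        fix x k assume xk: "(x, k) \<in> p" "(x, k) \<notin> q"
        then have x: "x \<notin> N" "x \<in> k" "k \<subseteq> {c..d}" "k \<subseteq> ball x (r x)"
          using tagged_division_ofD(2,3)[OF p(1)] p(2) by (auto simp: q_def fine_def \<gamma>_def)
        obtain u v where k: "k = {u..v}" using tagged_division_ofD(4)[OF p(1) xk(1)] by (metis cbox_interval)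
        then have uv: "u \<le> x" "x \<le> v" using x by auto
        then have "u \<in> k" "v \<in> k" using k by auto
        then have uvb: "u \<in> {c..d} \<inter> ball x (r x)" "v \<in> {c..d} \<inter> ball x (r x)" using x by blast+
        have "norm (f v - f x - (v - x) *\<^sub>R g x) \<le> e' * \<bar>v - x\<bar>"
          using x uvb by (intro r(3)) blast+
        moreover have "norm (f u - f x - (u - x) *\<^sub>R g x) \<le> e' * \<bar>u - x\<bar>"
          using x uvb by (intro r(3)) blast+
        moreover have "measure lborel k *\<^sub>R g' x - (f (Sup k) - f (Inf k)) =
            (f u - f x - (u - x) *\<^sub>R g x) - (f v - f x - (v - x) *\<^sub>R g x)"
          using k uv x(1) by (simp add: g'_def algebra_simps)
        ultimately have "norm (measure lborel k *\<^sub>R g' x - (f (Sup k) - f (Inf k))) \<le> e' * \<bar>u - x\<bar> + e' * \<bar>v - x\<bar>"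
          by (simp only:) (rule norm_triangle_le_diff, rule add_mono)
        also have "\<dots> = e' * measure lborel k" using k uv by (simp add: algebra_simps)
        finally show "norm (measure lborel k *\<^sub>R g' x - (f (Sup k) - f (Inf k))) \<le> e' * measure lborel k" .
      qed
      also have "\<dots> \<le> (\<Sum>(x, k)\<in>p. e' * measure lborel k)"
        using fin e' by (intro sum_mono2) auto
      also have "\<dots> = e' * (d - c)"
        using additive_content_tagged_division[OF p(1)] \<open>c \<le> d\<close>
        by (simp add: case_prod_beta flip: sum_distrib_left)
      also have "\<dots> \<le> e / 2" using \<open>c \<le> d\<close> e by (simp add: e'_def field_simps)
      finally show ?thesis by simp
    qed
    ultimately show "\<exists>\<gamma>. gauge \<gamma> \<and> (\<forall>\<D>. \<D> tagged_division_of cbox c d \<and> \<gamma> fine \<D> \<longrightarrow>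
        norm ((\<Sum>(x, k)\<in>\<D>. measure lborel k *\<^sub>R g' x) - (f d - f c)) < e)"
      by (intro exI[of _ \<gamma>]) simp
  qed
  then show ?thesis
    by (intro has_integral_spike[OF N, of "{c..d}" g g']) (auto simp: g'_def cbox_interval)
qed

text \<open>Truncation: \<open>min (norm (f x)) n\<close> misses less than \<open>e / 2\<close> of
  the integral over \<open>S\<close>, and the bounded part contributes at most \<open>n\<close>
  times the measure of \<open>A\<close>.\<close>

lemma absolutely_integrable_uniformly_small:
  fixes f :: "real \<Rightarrow> 'a::euclidean_space"
  assumes f: "f absolutely_integrable_on S" and "S \<in> sets lebesgue" and "e > 0"
  obtains \<delta> where "\<delta> > 0" "\<And>A. \<lbrakk>A \<in> lmeasurable; A \<subseteq> S; measure lebesgue A < \<delta>\<rbrakk> \<Longrightarrow> integral A (\<lambda>x. norm (f x)) < e"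
proof -
  define g where "g = (\<lambda>n x. min (norm (f x)) (real n))"
  have nf: "(\<lambda>x. norm (f x)) absolutely_integrable_on S" by (rule absolutely_integrable_norm[OF f, unfolded o_def])
  have gint: "g n absolutely_integrable_on S" for n
  proof (rule measurable_bounded_by_integrable_imp_absolutely_integrable[of _ _ "\<lambda>x. norm (f x)"])
    have "(\<lambda>x. norm (f x)) \<in> borel_measurable (lebesgue_on S)"
      using nf assms(2) by (simp add: absolutely_integrable_measurable)
    then show "g n \<in> borel_measurable (lebesgue_on S)" unfolding g_def by measurable
  qed (use assms(2) nf in \<open>auto simp: g_def set_lebesgue_integral_eq_integral(1)\<close>)
  have "(\<lambda>n. integral S (g n)) \<longlonglongrightarrow> integral S (\<lambda>x. norm (f x))"
  proof (rule dominated_convergence(2)[where h = "\<lambda>x. norm (f x)"])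
    show "(\<lambda>n. g n x) \<longlonglongrightarrow> norm (f x)" if "x \<in> S" for x
    proof (rule tendsto_eventually)
      show "\<forall>\<^sub>F n in sequentially. g n x = norm (f x)"
        using eventually_ge_at_top[of "nat \<lceil>norm (f x)\<rceil>"]
      proof eventually_elim
        case (elim n)
        then have "norm (f x) \<le> real n" by linarith
        then show "g n x = norm (f x)" by (simp add: g_def)
      qed
    qed
  qed (use gint nf in \<open>auto simp: g_def set_lebesgue_integral_eq_integral(1)\<close>)
  then obtain n where n: "dist (integral S (g n)) (integral S (\<lambda>x. norm (f x))) < e / 2"
    using \<open>e > 0\<close> unfolding lim_sequentially by (meson half_gt_zero order_refl)
  define \<delta> where "\<delta> = e / (2 * (real n + 1))"
  have "\<delta> > 0" using \<open>e > 0\<close> by (simp add: \<delta>_def)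
  moreover have "integral A (\<lambda>x. norm (f x)) < e"
    if A: "A \<in> lmeasurable" "A \<subseteq> S" "measure lebesgue A < \<delta>" for A
  proof -
    have Am: "A \<in> sets lebesgue" using A(1) by (simp add: fmeasurableD)
    have i1: "(\<lambda>x. norm (f x)) integrable_on A" "(\<lambda>x. norm (f x)) integrable_on S"
      using set_integrable_subset[OF nf Am A(2)] nf by (auto simp: set_lebesgue_integral_eq_integral(1))
    have i2: "g n integrable_on A" "g n integrable_on S"
      using set_integrable_subset[OF gint Am A(2)] gint by (auto simp: set_lebesgue_integral_eq_integral(1))
    have i3: "(\<lambda>x. norm (f x) - g n x) integrable_on A" "(\<lambda>x. norm (f x) - g n x) integrable_on S"
      using i1 i2 by (auto intro: integrable_diff)
    have "integral A (\<lambda>x. norm (f x)) = integral A (\<lambda>x. norm (f x) - g n x) + integral A (g n)"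
      using i1 i2 by (simp add: integral_diff)
    also have "integral A (\<lambda>x. norm (f x) - g n x) \<le> integral S (\<lambda>x. norm (f x) - g n x)"
      using A i3 by (intro integral_subset_le) (auto simp: g_def)
    also have "\<dots> < e / 2" using n unfolding dist_real_def integral_diff[OF i1(2) i2(2)] by linarith
    also have "integral A (g n) \<le> integral A (\<lambda>x. real n)"
      using i2 integrable_on_const[OF A(1)] by (intro integral_le) (auto simp: g_def)
    also have "\<dots> = real n * measure lebesgue A"
      using lmeasure_integral[OF A(1)] integral_mult_right[of A "real n" "\<lambda>_. 1::real"] by simp
    also have "\<dots> \<le> (real n + 1) * \<delta>" using A(3) \<open>\<delta> > 0\<close> by (intro mult_mono) auto
    also have "\<dots> = e / 2" by (simp add: \<delta>_def field_simps)
    finally show ?thesis by simp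
  qed
  ultimately show thesis using that by blast
qed

section \<open>Primitives of locally integrable functions\<close>

text \<open>This is \<open>F' = f\<close> a.e. with \<open>F\<close> locally absolutely continuous,
  in integrated form, so that exceptional null sets disappear from the calculus. Only compact
  subintervals count; \<open>f\<close> may fail to be integrable up to a missing end of
  \<open>S\<close>.\<close>

definition is_prim :: "real set \<Rightarrow> (real \<Rightarrow> 'a::euclidean_space) \<Rightarrow> (real \<Rightarrow> 'a) \<Rightarrow> bool" where
  "is_prim S F f \<longleftrightarrow> (\<forall>u v. u \<le> v \<and> {u..v} \<subseteq> S \<longrightarrow> f absolutely_integrable_on {u..v} \<and> F v - F u = integral {u..v} f)"

lemma is_primD:
  assumes "is_prim S F f" "u \<le> v" "{u..v} \<subseteq> S"
  shows "f absolutely_integrable_on {u..v}" "f integrable_on {u..v}" "F v - F u = integral {u..v} f"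
  using assms unfolding is_prim_def by (auto intro: set_lebesgue_integral_eq_integral(1))

text \<open>The increments over a division add up to at most the integral of \<open>norm f\<close>
  over its union, which is small when the union has small measure.\<close>

lemma is_prim_imp_abs_continuous_on:
  assumes "is_prim S F f" "{c..d} \<subseteq> S"
  shows "abs_continuous_on c d F"
proof (cases "c \<le> d")
  case True
  show ?thesis
    unfolding abs_continuous_on_def
  proof (intro allI impI)
    fix e :: real assume "e > 0"
    have fi: "f absolutely_integrable_on {c..d}" using is_primD[OF assms(1) True assms(2)] by simp
    from absolutely_integrable_uniformly_small[OF fi _ \<open>e > 0\<close>]
    obtain \<delta> where \<delta>: "\<delta> > 0"
      "\<And>A. \<lbrakk>A \<in> lmeasurable; A \<subseteq> {c..d}; measure lebesgue A < \<delta>\<rbrakk> \<Longrightarrow> integral A (\<lambda>x. norm (f x)) < e"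
      by (metis lmeasurable_interval(1) cbox_interval fmeasurableD)
    have "(\<Sum>k\<in>D. norm (F (Sup k) - F (Inf k))) < e"
      if D: "D division_of \<Union>D" "\<Union>D \<subseteq> {c..d}" "(\<Sum>k\<in>D. Sup k - Inf k) < \<delta>" for D
    proof -
      have k: "k \<subseteq> {c..d} \<and> Sup k - Inf k = measure lebesgue k \<and> F (Sup k) - F (Inf k) = integral k f
          \<and> f absolutely_integrable_on k" if kD: "k \<in> D" for k
      proof -
        obtain u v where uv: "k = {u..v}" "u \<le> v"
          using division_ofD(3,4)[OF D(1) kD] by (metis atLeastatMost_empty_iff cbox_interval)
        moreover have "k \<subseteq> {c..d}" using kD D(2) by auto
        ultimately show ?thesis using is_primD[OF assms(1), of u v] subset_trans[of "{u..v}" "{c..d}" S] assms(2) by auto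
      qed
      have ml: "\<Union>D \<in> lmeasurable" using lmeasurable_division[OF D(1)] .
      have "measure lebesgue (\<Union>D) = (\<Sum>k\<in>D. measure lebesgue k)" using content_division[OF D(1)] by simp
      also have "\<dots> = (\<Sum>k\<in>D. Sup k - Inf k)" using k by (intro sum.cong) auto
      finally have "measure lebesgue (\<Union>D) < \<delta>" using D(3) by simp
      note small = \<delta>(2)[OF ml D(2) this]
      have "(\<Sum>k\<in>D. norm (F (Sup k) - F (Inf k))) \<le> (\<Sum>k\<in>D. integral k (\<lambda>x. norm (f x)))"
        using k by (intro sum_mono) (auto intro!: integral_norm_bound_integral absolutely_integrable_norm[unfolded o_def]
            set_lebesgue_integral_eq_integral(1))
      also have "\<dots> = integral (\<Union>D) (\<lambda>x. norm (f x))"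
      proof (rule integral_combine_division_bottomup[symmetric, OF D(1)])
        show "(\<lambda>x. norm (f x)) integrable_on k" if "k \<in> D" for k
          using k[OF that] absolutely_integrable_norm[unfolded o_def] by (blast intro: set_lebesgue_integral_eq_integral(1))
      qed
      finally show ?thesis using small by simp
    qed
    with \<delta>(1) show "\<exists>\<delta>>0. \<forall>D. D division_of \<Union>D \<and> \<Union>D \<subseteq> {c..d} \<and> (\<Sum>k\<in>D. Sup k - Inf k) < \<delta> \<longrightarrow>
        (\<Sum>k\<in>D. norm (F (Sup k) - F (Inf k))) < e"
      by (intro exI[of _ \<delta>] conjI allI impI) auto
  qed
next
  case False
  then have "{c..d} = {}" by simp
  have "D = {}" if "D division_of \<Union>D" "\<Union>D \<subseteq> {c..d}" for D
    using division_ofD(2,3)[OF that(1)] that(2) \<open>{c..d} = {}\<close> by fastforce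
  then show ?thesis unfolding abs_continuous_on_def by (metis sum.empty zero_less_one)
qed

lemma is_prim_imp_loc_abs_continuous_on: "is_prim S F f \<Longrightarrow> loc_abs_continuous_on S F"
  unfolding loc_abs_continuous_on_def using is_prim_imp_abs_continuous_on by blast

text \<open>Near each of its points an interval agrees with a compact one: \<open>l\<close> and
  \<open>r\<close> lie strictly beside \<open>x\<close> unless \<open>x\<close> is itself an end of
  \<open>S\<close>.\<close>

lemma continuous_on_local_real:
  fixes F :: "real \<Rightarrow> 'a::topological_space"
  assumes "is_interval S" "\<And>u v. u \<le> v \<Longrightarrow> {u..v} \<subseteq> S \<Longrightarrow> continuous_on {u..v} F"
  shows "continuous_on S F"
  unfolding continuous_on_eq_continuous_within
proof
  fix x assume x: "x \<in> S"
  have "\<exists>l\<in>S. l \<le> x \<and> (l = x \<longrightarrow> (\<forall>u\<in>S. x \<le> u))"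
  proof (cases "\<forall>u\<in>S. x \<le> u")
    case False
    then obtain u where "u \<in> S" "u < x" by (auto simp: not_le)
    then show ?thesis by (intro bexI[of _ u]) auto
  qed (use x in auto)
  moreover have "\<exists>r\<in>S. x \<le> r \<and> (r = x \<longrightarrow> (\<forall>u\<in>S. u \<le> x))"
  proof (cases "\<forall>u\<in>S. u \<le> x")
    case False
    then obtain u where "u \<in> S" "x < u" by (auto simp: not_le)
    then show ?thesis by (intro bexI[of _ u]) auto
  qed (use x in auto)
  ultimately obtain l r where l: "l \<in> S" "l \<le> x" "l = x \<Longrightarrow> \<forall>u\<in>S. x \<le> u"
    and r: "r \<in> S" "x \<le> r" "r = x \<Longrightarrow> \<forall>u\<in>S. u \<le> x" by auto
  have sub: "{l..r} \<subseteq> S" using mem_is_interval_1_I[OF assms(1) l(1) r(1)] by auto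
  then have "continuous (at x within {l..r}) F"
    using assms(2)[of l r] l r by (auto simp: continuous_on_eq_continuous_within)
  moreover have "at x within S = at x within {l..r}"
  proof -
    define a where "a = (if l = x then x - 1 else l)"
    define b where "b = (if r = x then x + 1 else r)"
    have ab: "a < x" "x < b" using l(2) r(2) by (auto simp: a_def b_def)
    have 1: "l \<le> s" if "s \<in> S" "a < s" for s using that l(3) by (cases "l = x") (auto simp: a_def)
    have 2: "s \<le> r" if "s \<in> S" "s < b" for s using that r(3) by (cases "r = x") (auto simp: b_def)
    have "S \<inter> {a<..<b} - {x} = {l..r} \<inter> {a<..<b} - {x}" using 1 2 sub by auto
    then show ?thesis using ab by (intro at_within_nhd[of _ "{a<..<b}"]) auto
  qed
  ultimately show "continuous (at x within S) F" by simp
qed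

lemma is_prim_imp_continuous_on:
  assumes "is_prim S F f" "is_interval S"
  shows "continuous_on S F"
  by (rule continuous_on_local_real[OF assms(2)])
    (blast intro: abs_continuous_on_imp_continuous_on is_prim_imp_abs_continuous_on[OF assms(1)])

text \<open>Averages over \<open>{x..x + h}\<close> with \<open>h > 0\<close> yield the right-hand
  derivative; the same averages of the reflected function \<open>f1\<close> supply the left-hand
  one. The extension \<open>f0\<close> by zero makes both functions integrable on every box.\<close>

lemma lebesgue_differentiation_real:
  fixes f :: "real \<Rightarrow> 'a::euclidean_space"
  assumes f: "f absolutely_integrable_on {c..d}"
    and F: "\<And>t. t \<in> {c..d} \<Longrightarrow> F t - F c = integral {c..t} f"
  obtains N where "negligible N" "\<And>t. t \<in> {c<..<d} - N \<Longrightarrow> (F has_vector_derivative f t) (at t)"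
proof -
  define f0 where "f0 x = (if x \<in> {c..d} then f x else 0)" for x
  define f1 where "f1 x = f0 (- x)" for x
  have "f integrable_on {c..d}" using f by (rule set_lebesgue_integral_eq_integral(1))
  then have "f0 integrable_on UNIV" unfolding f0_def by (simp only: integrable_restrict_UNIV)
  then have i0: "f0 integrable_on cbox a b" for a b by (rule integrable_on_subcbox) simp
  have i1: "f1 integrable_on cbox a b" for a b
    using i0[of "-b" "-a"] Henstock_Kurzweil_Integration.integrable_reflect_real[of f0 "-a" "-b"] unfolding f1_def by (simp add: cbox_interval)
  obtain N0 where N0: "negligible N0" "\<And>x e. \<lbrakk>x \<notin> N0; 0 < e\<rbrakk> \<Longrightarrow> \<exists>d>0. \<forall>h. 0 < h \<and> h < d \<longrightarrow>
      norm (integral (cbox x (x + h *\<^sub>R One)) f0 /\<^sub>R h ^ DIM(real) - f0 x) < e"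
    using integrable_ccontinuous_explicit[OF i0] by metis
  obtain N1 where N1: "negligible N1" "\<And>x e. \<lbrakk>x \<notin> N1; 0 < e\<rbrakk> \<Longrightarrow> \<exists>d>0. \<forall>h. 0 < h \<and> h < d \<longrightarrow>
      norm (integral (cbox x (x + h *\<^sub>R One)) f1 /\<^sub>R h ^ DIM(real) - f1 x) < e"
    using integrable_ccontinuous_explicit[OF i1] by metis
  show thesis
  proof (rule that[of "N0 \<union> uminus ` N1"])
    show "negligible (N0 \<union> uminus ` N1)"
      using N0(1) N1(1) by (intro negligible_Un negligible_differentiable_image_negligible) (auto intro!: derivative_intros)
    fix t assume t: "t \<in> {c<..<d} - (N0 \<union> uminus ` N1)"
    have FF: "F v - F u = integral {u..v} f0" if "u \<le> v" "{u..v} \<subseteq> {c..d}" for u v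
    proof -
      have uv: "u \<in> {c..d}" "v \<in> {c..d}" using that by auto
      have "f integrable_on {c..v}"
        using \<open>f integrable_on {c..d}\<close> uv by (auto intro: integrable_subinterval_real)
      then have "integral {c..u} f + integral {u..v} f = integral {c..v} f"
        using uv that(1) by (intro Henstock_Kurzweil_Integration.integral_combine) auto
      then have "integral {u..v} f = F v - F u" using F[OF uv(1)] F[OF uv(2)] by (simp add: algebra_simps)
      moreover have "integral {u..v} f = integral {u..v} f0"
        using that(2) by (intro integral_cong) (auto simp: f0_def)
      ultimately show ?thesis by simp
    qed
    have FR: "norm ((F (t + h) - F t) /\<^sub>R h - f t) = norm (integral {t..t + h} f0 /\<^sub>R h - f0 t)"
      if "0 < h" "t + h \<le> d" for h using FF[of t "t + h"] that t by (auto simp: f0_def)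
    have FL: "norm ((F (t - h) - F t) /\<^sub>R (- h) - f t) = norm (integral {- t..- t + h} f1 /\<^sub>R h - f1 (- t))"
      if "0 < h" "c \<le> t - h" for h
    proof -
      have "integral {- t..- t + h} f1 = integral {t - h..t} f0"
        unfolding f1_def using Henstock_Kurzweil_Integration.integral_reflect_real[of t "t - h" f0] by (simp add: add.commute)
      also have "\<dots> = F t - F (t - h)" using FF[of "t - h" t] that t by auto
      finally have "integral {- t..- t + h} f1 = F t - F (t - h)" .
      moreover have "f1 (- t) = f t" using t by (simp add: f1_def f0_def)
      moreover have "(F t - F (t - h)) /\<^sub>R h = (F (t - h) - F t) /\<^sub>R (- h)"
        by (simp add: scaleR_diff_right)
      ultimately show ?thesis by simp
    qed
    have nt: "t \<notin> N0" "- t \<notin> N1" using t by (auto simp: image_iff)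
    have lim: "((\<lambda>h. (F (t + h) - F t) /\<^sub>R h) \<longlongrightarrow> f t) (at 0)"
    proof (rule LIM_I)
      fix e :: real assume "e > 0"
      obtain d0 where d0: "d0 > 0" "\<And>h. 0 < h \<Longrightarrow> h < d0 \<Longrightarrow> norm (integral {t..t + h} f0 /\<^sub>R h - f0 t) < e"
        using N0(2)[OF nt(1) \<open>e > 0\<close>] by (auto simp: cbox_interval)
      obtain d1 where d1: "d1 > 0" "\<And>h. 0 < h \<Longrightarrow> h < d1 \<Longrightarrow> norm (integral {- t..- t + h} f1 /\<^sub>R h - f1 (- t)) < e"
        using N1(2)[OF nt(2) \<open>e > 0\<close>] by (auto simp: cbox_interval)
      have "norm ((F (t + h) - F t) /\<^sub>R h - f t) < e"
        if h: "h \<noteq> 0" "\<bar>h\<bar> < min (min d0 d1) (min (t - c) (d - t))" for h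
      proof (cases "h > 0")
        case True
        then show ?thesis using FR[of h] d0(2)[of h] h by auto
      next
        case False
        then show ?thesis using FL[of "- h"] d1(2)[of "- h"] h by auto
      qed
      then show "\<exists>s>0. \<forall>h. h \<noteq> 0 \<and> norm (h - 0) < s \<longrightarrow> norm ((F (t + h) - F t) /\<^sub>R h - f t) < e"
        using d0(1) d1(1) t by (intro exI[of _ "min (min d0 d1) (min (t - c) (d - t))"]) auto
    qed
    show "(F has_vector_derivative f t) (at t)"
    proof -
      have "norm (F (t + h) - F t - h *\<^sub>R f t) / norm h = norm ((F (t + h) - F t) /\<^sub>R h - f t)" if "h \<noteq> 0" for h
      proof -
        have "(F (t + h) - F t) /\<^sub>R h - f t = (F (t + h) - F t - h *\<^sub>R f t) /\<^sub>R h"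
          using that by (simp add: algebra_simps)
        then show ?thesis by (simp add: divide_inverse mult.commute)
      qed
      moreover have "((\<lambda>h. norm ((F (t + h) - F t) /\<^sub>R h - f t)) \<longlongrightarrow> 0) (at 0)"
        using lim by (intro tendsto_norm_zero) (simp add: LIM_zero)
      ultimately have "((\<lambda>h. norm (F (t + h) - F t - h *\<^sub>R f t) / norm h) \<longlongrightarrow> 0) (at 0)"
        by (subst tendsto_cong) (auto simp: eventually_at intro!: exI[of _ 1])
      then show ?thesis
        by (simp add: has_vector_derivative_def has_derivative_at bounded_linear_scaleR_left)
    qed
  qed
qed

lemma is_prim_has_vector_derivative:
  assumes "is_prim S F f" "{a<..<b} \<subseteq> S"
  shows "AE t\<in>{a<..<b} in lebesgue. (F has_vector_derivative f t) (at t)"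
proof -
  \<comment> \<open>Compact intervals that exhaust \<open>{a<..<b}\<close>; their exceptional sets
    form a countable union of null sets.\<close>
  define l where "l n = a + 1 / Suc n" for n :: nat
  define r where "r n = b - 1 / Suc n" for n :: nat
  have "\<exists>N. negligible N \<and> (\<forall>t\<in>{l n<..<r n} - N. (F has_vector_derivative f t) (at t))" for n
  proof (cases "l n \<le> r n")
    case True
    have "{l n..r n} \<subseteq> {a<..<b}"
    proof -
      have "a < l n" "r n < b" by (simp_all add: l_def r_def)
      then show ?thesis by auto
    qed
    then have sub: "{u..v} \<subseteq> S" if "{u..v} \<subseteq> {l n..r n}" for u v using assms(2) that by blast
    obtain N where "negligible N" "\<And>t. t \<in> {l n<..<r n} - N \<Longrightarrow> (F has_vector_derivative f t) (at t)"
    proof (rule lebesgue_differentiation_real)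
      show "f absolutely_integrable_on {l n..r n}" using is_primD[OF assms(1) True sub] by simp
      show "F t - F (l n) = integral {l n..t} f" if "t \<in> {l n..r n}" for t
        using is_primD[OF assms(1) _ sub, of "l n" t] that by auto
    qed blast
    then show ?thesis by blast
  next
    case False
    then have "{l n<..<r n} = {}" by simp
    then show ?thesis by (intro exI[of _ "{}"]) simp
  qed
  then obtain N where N: "\<And>n. negligible (N n)" "\<And>n t. t \<in> {l n<..<r n} - N n \<Longrightarrow> (F has_vector_derivative f t) (at t)"
    by metis
  have "(\<Union>n. N n) \<in> null_sets lebesgue"
    using N(1) by (intro null_sets_UN) (simp add: negligible_iff_null_sets)
  then show ?thesis
  proof (rule AE_I')
    have "(F has_vector_derivative f t) (at t)" if t: "t \<in> {a<..<b}" "t \<notin> (\<Union>n. N n)" for t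
    proof -
      obtain n :: nat where n: "1 / Suc n < min (t - a) (b - t)"
        using nat_approx_posE[of "min (t - a) (b - t)"] t by auto
      then have "t \<in> {l n<..<r n} - N n" using t by (auto simp: l_def r_def)
      then show ?thesis by (rule N(2))
    qed
    then show "{t \<in> space lebesgue. \<not> (t \<in> {a<..<b} \<longrightarrow> (F has_vector_derivative f t) (at t))} \<subseteq> (\<Union>n. N n)"
      by blast
  qed
qed

lemma AE_negligible:
  "(AE t\<in>S in lebesgue. P t) \<longleftrightarrow> (\<exists>N. negligible N \<and> (\<forall>t\<in>S - N. P t))"
proof
  assume "AE t\<in>S in lebesgue. P t"
  then obtain N where "N \<in> null_sets lebesgue" "{t \<in> space lebesgue. \<not> (t \<in> S \<longrightarrow> P t)} \<subseteq> N"
    by (rule AE_E3) auto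
  then show "\<exists>N. negligible N \<and> (\<forall>t\<in>S - N. P t)" by (intro exI[of _ N]) (auto simp: negligible_iff_null_sets)
next
  assume "\<exists>N. negligible N \<and> (\<forall>t\<in>S - N. P t)"
  then obtain N where "N \<in> null_sets lebesgue" "\<forall>t\<in>S - N. P t" by (auto simp: negligible_iff_null_sets)
  then show "AE t\<in>S in lebesgue. P t" by (intro AE_I'[of N]) auto
qed

text \<open>The entrance from conditions of the kind "absolutely continuous with prescribed
  derivative a.e.", as in \<open>ac_representative\<close> and
  \<open>canonical_solution\<close>.\<close>

lemma is_primI_abs_continuous:
  assumes F: "loc_abs_continuous_on S F"
    and der: "\<And>u v. {u..v} \<subseteq> S \<Longrightarrow> AE t\<in>{u<..<v} in lebesgue. (F has_vector_derivative f t) (at t)"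
    and int: "\<And>u v. u \<le> v \<Longrightarrow> {u..v} \<subseteq> S \<Longrightarrow> f absolutely_integrable_on {u..v}"
  shows "is_prim S F f"
  unfolding is_prim_def
proof (intro allI impI conjI)
  fix u v assume uv: "u \<le> v \<and> {u..v} \<subseteq> S"
  then show "f absolutely_integrable_on {u..v}" using int by blast
  obtain N where N: "negligible N" "\<forall>t\<in>{u<..<v} - N. (F has_vector_derivative f t) (at t)"
    using der[of u v] uv unfolding AE_negligible by blast
  have "(f has_integral (F v - F u)) {u..v}"
  proof (rule abs_continuous_on_has_integral)
    show "abs_continuous_on u v F" using F uv unfolding loc_abs_continuous_on_def by blast
    show "negligible (N \<union> {u, v})" by (rule negligible_Un[OF N(1)]) (simp add: negligible_finite)
    fix t assume t: "t \<in> {u..v} - (N \<union> {u, v})"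
    then have "t \<in> {u<..<v} - N" by auto
    then show "(F has_vector_derivative f t) (at t within {u..v})"
      using N(2) by (blast intro: has_vector_derivative_at_within)
  qed (use uv in auto)
  then show "F v - F u = integral {u..v} f" by (simp add: integral_unique)
qed

lemma continuous_on_imp_measurable_bounded:
  fixes f :: "real \<Rightarrow> 'a::euclidean_space"
  assumes "continuous_on {u..v} f"
  shows "f \<in> borel_measurable (lebesgue_on {u..v})" "bounded (f ` {u..v})"
  using assms by (auto intro: continuous_imp_measurable_on_sets_lebesgue compact_imp_bounded compact_continuous_image)

lemma absolutely_integrable_continuous_mult:
  fixes f g :: "real \<Rightarrow> 'a::{real_normed_algebra, euclidean_space}"
  assumes "continuous_on {u..v} f" "g absolutely_integrable_on {u..v}"
  shows "(\<lambda>t. f t * g t) absolutely_integrable_on {u..v}"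
  using continuous_on_imp_measurable_bounded[OF assms(1)] assms(2)
  by (intro absolutely_integrable_bounded_measurable_product[where h = "(*)"] bilinear_times) auto

lemma absolutely_integrable_continuous_mult':
  fixes f g :: "real \<Rightarrow> 'a::{real_normed_algebra, euclidean_space}"
  assumes "continuous_on {u..v} g" "f absolutely_integrable_on {u..v}"
  shows "(\<lambda>t. f t * g t) absolutely_integrable_on {u..v}"
  using continuous_on_imp_measurable_bounded[OF assms(1)] assms(2)
    bilinear_times[where 'a = 'a, unfolded bilinear_def]
  by (intro absolutely_integrable_bounded_measurable_product[where h = "\<lambda>x y. y * x" and f = g and g = f])
    (auto simp: bilinear_def)

text \<open>Integration by parts. The product rule holds a.e., and absolute continuity of the
  product turns it back into an identity of integrals.\<close>

lemma is_prim_mult: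
  fixes F G :: "real \<Rightarrow> 'a::{real_normed_algebra, euclidean_space}"
  assumes F: "is_prim S F f" and G: "is_prim S G g" and S: "is_interval S"
  shows "is_prim S (\<lambda>t. F t * G t) (\<lambda>t. F t * g t + f t * G t)"
proof (rule is_primI_abs_continuous)
  show "loc_abs_continuous_on S (\<lambda>t. F t * G t)"
    using is_prim_imp_abs_continuous_on[OF F] is_prim_imp_abs_continuous_on[OF G]
    by (auto simp: loc_abs_continuous_on_def intro: abs_continuous_on_mult)
  fix u v :: real assume "{u..v} \<subseteq> S"
  then have "{u<..<v} \<subseteq> S" by auto
  then show "AE t\<in>{u<..<v} in lebesgue. ((\<lambda>t. F t * G t) has_vector_derivative F t * g t + f t * G t) (at t)"
    using is_prim_has_vector_derivative[OF F, of u v] is_prim_has_vector_derivative[OF G, of u v]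
    by (auto elim!: eventually_elim2 intro: has_vector_derivative_mult)
next
  fix u v assume uv: "u \<le> v" "{u..v} \<subseteq> S"
  have "continuous_on {u..v} F" "continuous_on {u..v} G"
    using uv S F G by (auto intro: continuous_on_subset is_prim_imp_continuous_on)
  then have "(\<lambda>t. F t * g t) absolutely_integrable_on {u..v}" "(\<lambda>t. f t * G t) absolutely_integrable_on {u..v}"
    using is_primD(1)[OF F uv] is_primD(1)[OF G uv]
    by (auto intro: absolutely_integrable_continuous_mult absolutely_integrable_continuous_mult')
  then show "(\<lambda>t. F t * g t + f t * G t) absolutely_integrable_on {u..v}"
    by (simp add: set_integral_add(1))
qed

lemma is_prim_const: "is_prim S (\<lambda>_. c) (\<lambda>_. 0)"
  unfolding is_prim_def by simp

lemma is_prim_add: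
  assumes "is_prim S F f" "is_prim S G g"
  shows "is_prim S (\<lambda>t. F t + G t) (\<lambda>t. f t + g t)"
  unfolding is_prim_def
proof (intro allI impI conjI)
  fix u v assume uv: "u \<le> v \<and> {u..v} \<subseteq> S"
  note * = is_primD[OF assms(1), of u v] is_primD[OF assms(2), of u v]
  show "(\<lambda>t. f t + g t) absolutely_integrable_on {u..v}"
    using * uv by (intro set_integral_add(1)) auto
  have "F v + G v - (F u + G u) = (F v - F u) + (G v - G u)" by simp
  also have "\<dots> = integral {u..v} f + integral {u..v} g" using * uv by simp
  also have "\<dots> = integral {u..v} (\<lambda>t. f t + g t)"
    using * uv by (subst integral_add) auto
  finally show "F v + G v - (F u + G u) = integral {u..v} (\<lambda>t. f t + g t)" .
qed

lemma is_prim_linear: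
  assumes "is_prim S F f" "bounded_linear T"
  shows "is_prim S (\<lambda>t. T (F t)) (\<lambda>t. T (f t))"
  unfolding is_prim_def
proof (intro allI impI conjI)
  fix u v assume uv: "u \<le> v \<and> {u..v} \<subseteq> S"
  note * = is_primD[OF assms(1), of u v]
  show "(\<lambda>t. T (f t)) absolutely_integrable_on {u..v}"
    using * uv absolutely_integrable_linear[OF _ assms(2)] by (auto simp: o_def)
  have "T (F v) - T (F u) = T (F v - F u)" using assms(2) by (simp add: linear_diff bounded_linear.linear)
  also have "\<dots> = T (integral {u..v} f)" using * uv by simp
  also have "\<dots> = integral {u..v} (\<lambda>t. T (f t))"
    using integral_linear[OF *(2) assms(2)] uv by (simp add: o_def)
  finally show "T (F v) - T (F u) = integral {u..v} (\<lambda>t. T (f t))" .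
qed

lemma is_prim_cmult:
  fixes F :: "real \<Rightarrow> complex"
  shows "is_prim S F f \<Longrightarrow> is_prim S (\<lambda>t. k * F t) (\<lambda>t. k * f t)"
  using is_prim_linear[OF _ bounded_linear_mult_right] .

lemma is_prim_diff:
  assumes "is_prim S F f" "is_prim S G g"
  shows "is_prim S (\<lambda>t. F t - G t) (\<lambda>t. f t - g t)"
  using is_prim_add[OF assms(1) is_prim_linear[OF assms(2) bounded_linear_minus[OF bounded_linear_ident]]] by simp

lemma is_prim_sum:
  assumes "\<And>i. i \<in> A \<Longrightarrow> is_prim S (F i) (f i)"
  shows "is_prim S (\<lambda>t. \<Sum>i\<in>A. F i t) (\<lambda>t. \<Sum>i\<in>A. f i t)"
  using assms by (induction A rule: infinite_finite_induct) (simp_all add: is_prim_const is_prim_add)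

lemma is_prim_cong_AE:
  assumes F: "is_prim S F f" and FG: "\<And>t. t \<in> S \<Longrightarrow> F t = G t"
    and fg: "\<And>u v. {u..v} \<subseteq> S \<Longrightarrow> AE t\<in>{u<..<v} in lebesgue. f t = g t"
  shows "is_prim S G g"
  unfolding is_prim_def
proof (intro allI impI conjI)
  fix u v assume uv: "u \<le> v \<and> {u..v} \<subseteq> S"
  obtain N where N: "negligible N" "\<forall>t\<in>{u<..<v} - N. f t = g t"
    using fg[of u v] uv unfolding AE_negligible by blast
  have N2: "negligible (N \<union> {u, v})" by (rule negligible_Un[OF N(1)]) (simp add: negligible_finite)
  have eq: "g t = f t" if "t \<in> {u..v} - (N \<union> {u, v})" for t using N(2) that by auto
  note * = is_primD[OF F, of u v]
  show "g absolutely_integrable_on {u..v}"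
    by (rule absolutely_integrable_spike[where f = f, OF _ N2]) (use * uv eq in auto)
  have "integral {u..v} g = integral {u..v} f" using integral_spike[OF N2] eq by metis
  moreover have "u \<in> S" "v \<in> S" using uv by auto
  ultimately show "G v - G u = integral {u..v} g" using * uv FG by metis
qed

lemma is_prim_cong:
  assumes "is_prim S F f" "\<And>t. t \<in> S \<Longrightarrow> F t = G t" "\<And>t. t \<in> S \<Longrightarrow> f t = g t"
  shows "is_prim S G g"
  using assms(2,3) by (intro is_prim_cong_AE[OF assms(1)]) (auto simp: subset_iff)

lemma is_prim_zero_imp_eq:
  assumes "is_prim S F (\<lambda>_. 0)" "is_interval S" "s \<in> S" "t \<in> S"
  shows "F s = F t"
proof -
  have "F b = F a" if "a \<le> b" "a \<in> S" "b \<in> S" for a b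
  proof -
    have "{a..b} \<subseteq> S" using that mem_is_interval_1_I[OF assms(2), of a b] by auto
    then show ?thesis using is_primD(3)[OF assms(1) that(1)] by simp
  qed
  then show ?thesis using assms(3,4) by (metis linear)
qed

lemma is_prim_indefinite_integral:
  fixes p :: "real \<Rightarrow> 'a::euclidean_space"
  assumes p: "p absolutely_integrable_on {l..r}"
  shows "is_prim {l..r} (\<lambda>x. integral {l..x} p) p" "is_prim {l..r} (\<lambda>x. integral {x..r} p) (\<lambda>x. - p x)"
proof -
  have pi: "p integrable_on {a..b}" "p absolutely_integrable_on {a..b}" if "{a..b} \<subseteq> {l..r}" for a b
    using set_integrable_subset[OF p _ that] by (auto intro: set_lebesgue_integral_eq_integral(1))
  have comb: "integral {a..x} p + integral {x..b} p = integral {a..b} p"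
    if "a \<le> x" "x \<le> b" "{a..b} \<subseteq> {l..r}" for a x b
    using Henstock_Kurzweil_Integration.integral_combine[OF that(1,2)] pi(1)[OF that(3)] by blast
  have "integral {l..v} p - integral {l..u} p = integral {u..v} p \<and> integral {v..r} p - integral {u..r} p = - integral {u..v} p"
    if "u \<le> v" "{u..v} \<subseteq> {l..r}" for u v
  proof -
    have "l \<le> u" "v \<le> r" using that by auto
    then show ?thesis using comb[of l u v] comb[of u v r] that(1) by (auto simp: algebra_simps)
  qed
  then show "is_prim {l..r} (\<lambda>x. integral {l..x} p) p" "is_prim {l..r} (\<lambda>x. integral {x..r} p) (\<lambda>x. - p x)"
    unfolding is_prim_def
    using pi absolutely_integrable_linear[OF pi(2) bounded_linear_minus[OF bounded_linear_ident]] by (auto simp: o_def)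
qed

text \<open>Fubini on a triangle, by parts: the product of the two indefinite integrals vanishes at
  both ends of \<open>{l..r}\<close>.\<close>

lemma integral_triangle_swap:
  fixes p q :: "real \<Rightarrow> real"
  assumes "p absolutely_integrable_on {l..r}" "q absolutely_integrable_on {l..r}" "l \<le> r"
  shows "integral {l..r} (\<lambda>x. p x * integral {x..r} q) = integral {l..r} (\<lambda>x. integral {l..x} p * q x)"
    "(\<lambda>x. p x * integral {x..r} q) integrable_on {l..r}" "(\<lambda>x. integral {l..x} p * q x) integrable_on {l..r}"
proof -
  note P = is_prim_indefinite_integral(1)[OF assms(1)] and R = is_prim_indefinite_integral(2)[OF assms(2)]
  have cP: "continuous_on {l..r} (\<lambda>x. integral {l..x} p)" and cR: "continuous_on {l..r} (\<lambda>x. integral {x..r} q)"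
    using P R by (auto intro: is_prim_imp_continuous_on)
  show i1: "(\<lambda>x. p x * integral {x..r} q) integrable_on {l..r}"
    using absolutely_integrable_continuous_mult'[OF cR assms(1)] by (rule set_lebesgue_integral_eq_integral(1))
  show i2: "(\<lambda>x. integral {l..x} p * q x) integrable_on {l..r}"
    using absolutely_integrable_continuous_mult[OF cP assms(2)] by (rule set_lebesgue_integral_eq_integral(1))
  have "is_prim {l..r} (\<lambda>x. integral {l..x} p * integral {x..r} q) (\<lambda>x. integral {l..x} p * - q x + p x * integral {x..r} q)"
    by (rule is_prim_mult[OF P R]) simp
  from is_primD(3)[OF this assms(3)]
  have "0 = integral {l..r} (\<lambda>x. p x * integral {x..r} q - integral {l..x} p * q x)" by simp
  then show "integral {l..r} (\<lambda>x. p x * integral {x..r} q) = integral {l..r} (\<lambda>x. integral {l..x} p * q x)"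
    using i1 i2 by (simp add: integral_diff)
qed

section \<open>Quadratic forms\<close>

lemma real_form_nonneg:
  fixes a b r x y :: real
  assumes "0 \<le> a" "0 \<le> b" "r\<^sup>2 \<le> a * b"
  shows "0 \<le> a * x\<^sup>2 + 2 * r * x * y + b * y\<^sup>2"
proof (cases "a = 0")
  case True
  then have "r = 0" using assms by simp
  then show ?thesis using True assms by simp
next
  case False
  have "a * (a * x\<^sup>2 + 2 * r * x * y + b * y\<^sup>2) = (a * x + r * y)\<^sup>2 + (a * b - r\<^sup>2) * y\<^sup>2"
    by (simp add: power2_eq_square algebra_simps)
  also have "\<dots> \<ge> 0" using assms by simp
  finally show ?thesis using False assms(1) by (simp add: zero_le_mult_iff)
qed

lemma cnj_sgn_mult: "cnj (sgn z) * z = of_real (norm z)"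
proof (cases "z = 0")
  case False
  have "cnj (sgn z) * z = (z * cnj z) / of_real (norm z)"
    by (simp add: sgn_eq)
  also have "z * cnj z = of_real ((norm z)\<^sup>2)" by (rule complex_norm_square[symmetric])
  finally show ?thesis using False by (simp add: power2_eq_square)
qed simp

text \<open>The minimising weight is \<open>k = sqrt B / sqrt A\<close>. If \<open>A\<close>
  vanishes, a large \<open>k\<close> forces \<open>x = 0\<close>; if \<open>B\<close> vanishes, a
  small \<open>k\<close> does.\<close>

lemma square_le_of_weighted_le:
  fixes x A B :: real
  assumes "0 \<le> x" "0 \<le> A" "0 \<le> B" and le: "\<And>k. k > 0 \<Longrightarrow> 2 * x \<le> k * A + B / k"
  shows "x\<^sup>2 \<le> A * B"
proof (cases "A = 0 \<or> B = 0")
  case True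
  have "x = 0"
  proof (rule ccontr)
    assume "x \<noteq> 0"
    then have x: "x > 0" using assms by simp
    consider "A = 0" | "B = 0" using True by blast
    then show False
    proof cases
      case 1
      then have "B * x + x * 2 \<le> 0" using le[of "(B + 1) / x"] x assms(3) by (simp add: field_simps)
      then show False using x assms(3) mult_nonneg_nonneg[of B x] by linarith
    next
      case 2
      then have "A * x + x * 2 \<le> 0" using le[of "x / (A + 1)"] x assms(2) by (simp add: field_simps)
      then show False using x assms(2) mult_nonneg_nonneg[of A x] by linarith
    qed
  qed
  then show ?thesis using assms by simp
next
  case False
  then have pos: "A > 0" "B > 0" using assms by auto
  define k where "k = sqrt B / sqrt A"
  have "k > 0" using pos by (simp add: k_def)
  have "2 * x \<le> k * A + B / k" using \<open>k > 0\<close> by (rule le)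
  also have "k * A = k * (sqrt A * sqrt A)" using pos by simp
  also have "\<dots> = sqrt A * sqrt B" unfolding k_def using pos by (simp add: field_simps)
  also have "B / k = (sqrt B * sqrt B) / k" using pos by simp
  also have "\<dots> = sqrt A * sqrt B" unfolding k_def using pos by (simp add: field_simps)
  finally have "x \<le> sqrt A * sqrt B" by simp
  then have "x\<^sup>2 \<le> (sqrt A * sqrt B)\<^sup>2" using assms(1) by (intro power_mono)
  then show ?thesis using pos by (simp add: power_mult_distrib)
qed

text \<open>The pointwise bound is linearised with a weight \<open>k\<close> and integrated;
  \<open>k\<close> is optimised only afterwards.\<close>

lemma integral_Cauchy_Schwarz:
  fixes f :: "real \<Rightarrow> 'a::euclidean_space" and p q :: "real \<Rightarrow> real"
  assumes f: "f absolutely_integrable_on X" and p: "p integrable_on X" and q: "q integrable_on X"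
    and nonneg: "\<And>t. t \<in> X \<Longrightarrow> 0 \<le> p t" "\<And>t. t \<in> X \<Longrightarrow> 0 \<le> q t"
    and le: "\<And>t. t \<in> X \<Longrightarrow> (norm (f t))\<^sup>2 \<le> p t * q t"
  shows "(norm (integral X f))\<^sup>2 \<le> integral X p * integral X q"
proof (rule square_le_of_weighted_le)
  show "0 \<le> integral X p" "0 \<le> integral X q" using nonneg p q by (auto intro: integral_nonneg)
  fix k :: real assume k: "k > 0"
  have "2 * norm (f t) \<le> k * p t + q t / k" if "t \<in> X" for t
  proof -
    have "(2 * norm (f t))\<^sup>2 \<le> 4 * ((k * p t) * (q t / k))"
      using le[OF that] k by (simp add: power_mult_distrib)
    also have "\<dots> \<le> (k * p t + q t / k)\<^sup>2"
      using zero_le_power2[of "k * p t - q t / k"] by (simp add: power2_eq_square algebra_simps)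
    finally have "(2 * norm (f t))\<^sup>2 \<le> (k * p t + q t / k)\<^sup>2" .
    moreover have "0 \<le> k * p t + q t / k" using k nonneg[OF that] by simp
    ultimately show ?thesis by (rule power2_le_imp_le)
  qed
  then have "norm (f t) \<le> (k * p t + q t / k) / 2" if "t \<in> X" for t using that by force
  moreover have int: "((\<lambda>t. (k * p t + q t / k) / 2) has_integral (k * integral X p + integral X q / k) / 2) X"
    using p q by (intro has_integral_divide has_integral_add has_integral_mult_right) (simp_all add: integrable_integral)
  ultimately have "norm (integral X f) \<le> integral X (\<lambda>t. (k * p t + q t / k) / 2)"
    using f by (intro integral_norm_bound_integral) (auto intro: set_lebesgue_integral_eq_integral(1))
  then show "2 * norm (integral X f) \<le> k * integral X p + integral X q / k"
    using integral_unique[OF int] by simp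
qed simp

section \<open>Canonical systems on one side of the singularity\<close>

text \<open>Unordered endpoints allow one treatment of both sides of \<sigma>, where the regular
  endpoint lies once to the left and once to the right.\<close>

definition seg :: "real \<Rightarrow> real \<Rightarrow> real set" where
  "seg u v = {min u v..max u v}"

lemma seg_refl [simp]: "seg u u = {u}" by (auto simp: seg_def)

lemma is_prim_norm_diff_le:
  assumes F: "is_prim S F f" and "seg u v \<subseteq> S"
  shows "norm (F v - F u) = norm (integral (seg u v) f)" "f absolutely_integrable_on seg u v"
proof -
  have "norm (F v - F u) = norm (integral (seg u v) f) \<and> f absolutely_integrable_on seg u v"
  proof (cases "u \<le> v")
    case True
    then have "seg u v = {u..v}" by (simp add: seg_def)
    then show ?thesis using is_primD(1,3)[OF F True] assms(2) by simp
  next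
    case False
    then have "v \<le> u" "seg u v = {v..u}" by (simp_all add: seg_def)
    then show ?thesis using is_primD(1,3)[OF F, of v u] assms(2) by (simp add: norm_minus_commute)
  qed
  then show "norm (F v - F u) = norm (integral (seg u v) f)" "f absolutely_integrable_on seg u v" by simp_all
qed

text \<open>The point \<open>c\<close> is the regular endpoint and \<open>s\<close> is \<open>\<sigma>\<close>; both orders are allowed, so that
  \<open>H\<^sub>-\<close> and \<open>H\<^sub>+\<close> are instances. Here \<open>(P1 f, P2 f)\<close> is \<open>Hf\<close>, \<open>Q f\<close> is \<open>f\<^sup>* H f\<close>, \<open>Bf f g\<close> is \<open>f\<^sup>T H g\<close>
  without conjugation, \<open>chn y f\<close> is \<open>y' = JHf\<close> on the interval \<open>S\<close> that includes \<open>c\<close>, and \<open>sq f\<close> is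
  square integrability, without the constancy condition on indivisible intervals.\<close>

locale canonical_side =
  fixes h1 h2 h3 :: "real \<Rightarrow> real" and c s :: real
  assumes cs: "c \<noteq> s"
    and psd: "\<And>t. 0 \<le> h1 t" "\<And>t. 0 \<le> h2 t" "\<And>t. (h3 t)\<^sup>2 \<le> h1 t * h2 t"
    and loc_int: "\<And>u v. {u..v} \<subseteq> insert c {min c s<..<max c s} \<Longrightarrow> h1 absolutely_integrable_on {u..v}"
      "\<And>u v. {u..v} \<subseteq> insert c {min c s<..<max c s} \<Longrightarrow> h2 absolutely_integrable_on {u..v}"
      "\<And>u v. {u..v} \<subseteq> insert c {min c s<..<max c s} \<Longrightarrow> h3 absolutely_integrable_on {u..v}"
    and int_h1: "h1 absolutely_integrable_on {min c s<..<max c s}"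
    and HS: "(\<lambda>t. integral (seg c t) h2 * h1 t) absolutely_integrable_on {min c s<..<max c s}"
    and h_measurable: "h1 \<in> borel_measurable (lebesgue_on {min c s<..<max c s})"
      "h2 \<in> borel_measurable (lebesgue_on {min c s<..<max c s})"
      "h3 \<in> borel_measurable (lebesgue_on {min c s<..<max c s})"
    and lp: "\<not> h2 absolutely_integrable_on {min c s<..<max c s}"
begin

definition "D = {min c s<..<max c s}"
definition "S = insert c D"
definition "F = at s within D"
text \<open>The inner integral of (HS). It does not decrease towards \<open>s\<close>, and
  \<open>HS\<close> makes it integrable against \<open>h1\<close>.\<close>

definition "A t = integral (seg c t) h2"
definition tail :: "real \<Rightarrow> real set" where "tail u = {min u s<..<max u s}"

definition P1 :: "(real \<Rightarrow> complex^2) \<Rightarrow> real \<Rightarrow> complex" where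
  "P1 f t = of_real (h1 t) * f t $ 1 + of_real (h3 t) * f t $ 2"
definition P2 :: "(real \<Rightarrow> complex^2) \<Rightarrow> real \<Rightarrow> complex" where
  "P2 f t = of_real (h3 t) * f t $ 1 + of_real (h2 t) * f t $ 2"
definition Q :: "(real \<Rightarrow> complex^2) \<Rightarrow> real \<Rightarrow> real" where
  "Q f t = h1 t * (norm (f t $ 1))\<^sup>2 + 2 * h3 t * Re (cnj (f t $ 1) * f t $ 2) + h2 t * (norm (f t $ 2))\<^sup>2"
definition Bf :: "(real \<Rightarrow> complex^2) \<Rightarrow> (real \<Rightarrow> complex^2) \<Rightarrow> real \<Rightarrow> complex" where
  "Bf f g t = f t $ 1 * P1 g t + f t $ 2 * P2 g t"
definition chn :: "(real \<Rightarrow> complex^2) \<Rightarrow> (real \<Rightarrow> complex^2) \<Rightarrow> bool" where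
  "chn y f \<longleftrightarrow> is_prim S (\<lambda>t. y t $ 1) (\<lambda>t. - P2 f t) \<and> is_prim S (\<lambda>t. y t $ 2) (P1 f)"
definition cont :: "(real \<Rightarrow> complex^2) \<Rightarrow> bool" where
  "cont f \<longleftrightarrow> continuous_on S (\<lambda>t. f t $ 1) \<and> continuous_on S (\<lambda>t. f t $ 2)"
definition meas :: "(real \<Rightarrow> complex^2) \<Rightarrow> bool" where
  "meas f \<longleftrightarrow> (\<lambda>t. f t $ 1) \<in> borel_measurable (lebesgue_on D) \<and> (\<lambda>t. f t $ 2) \<in> borel_measurable (lebesgue_on D)"
definition sq :: "(real \<Rightarrow> complex^2) \<Rightarrow> bool" where
  "sq f \<longleftrightarrow> meas f \<and> Q f absolutely_integrable_on D"

lemma D_sub_S: "D \<subseteq> S" and c_in_S [simp]: "c \<in> S" and c_notin_D [simp]: "c \<notin> D" and s_notin_S [simp]: "s \<notin> S"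
  using cs by (auto simp: S_def D_def)

lemma D_lebesgue [simp]: "D \<in> sets lebesgue" by (simp add: D_def)

lemma interval_S: "is_interval S"
  unfolding is_interval_1 S_def D_def by (auto simp: min_def max_def split: if_splits)

lemma interval_D: "is_interval D"
  unfolding D_def by (rule is_interval_oo)

lemma seg_sub_S: "u \<in> S \<Longrightarrow> v \<in> S \<Longrightarrow> seg u v \<subseteq> S"
  unfolding S_def D_def seg_def by auto

lemma int_seg:
  assumes "u \<in> S" "v \<in> S"
  shows "h1 absolutely_integrable_on seg u v" "h2 absolutely_integrable_on seg u v" "h3 absolutely_integrable_on seg u v"
  using loc_int[of "min u v" "max u v"] seg_sub_S[OF assms] unfolding seg_def S_def D_def by blast+

text \<open>\<open>H\<close> is real and symmetric, so the real and imaginary parts of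
  \<open>f\<close> decouple and positivity reduces to real forms.\<close>

lemma Q_real_form:
  "Q f t = (h1 t * (Re (f t $ 1))\<^sup>2 + 2 * h3 t * Re (f t $ 1) * Re (f t $ 2) + h2 t * (Re (f t $ 2))\<^sup>2)
     + (h1 t * (Im (f t $ 1))\<^sup>2 + 2 * h3 t * Im (f t $ 1) * Im (f t $ 2) + h2 t * (Im (f t $ 2))\<^sup>2)"
  unfolding Q_def cmod_power2 by (simp add: algebra_simps)

lemma Q_nonneg [simp]: "0 \<le> Q f t"
  unfolding Q_real_form using psd by (intro add_nonneg_nonneg real_form_nonneg)

text \<open>Changing the sign of the second component gives another nonnegative value of the form,
  and in the sum of the two values the cross terms cancel.\<close>

lemma Q_le: "Q f t \<le> 2 * (h1 t * (norm (f t $ 1))\<^sup>2 + h2 t * (norm (f t $ 2))\<^sup>2)"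
proof -
  have "0 \<le> Q (\<lambda>t. vector [f t $ 1, - (f t $ 2)]) t" by (rule Q_nonneg)
  then show ?thesis by (simp add: Q_def algebra_simps)
qed

lemma Q_scale: "Q (\<lambda>t. k *s f t) t = (norm k)\<^sup>2 * Q f t"
  unfolding Q_real_form cmod_power2 by (simp add: power2_eq_square algebra_simps)

lemma Q_parallelogram: "Q (\<lambda>t. f t + g t) t + Q (\<lambda>t. f t - g t) t = 2 * Q f t + 2 * Q g t"
  unfolding Q_real_form by (simp add: power2_eq_square algebra_simps)

lemma Q_add_le: "Q (\<lambda>t. f t + g t) t \<le> 2 * Q f t + 2 * Q g t"
  using Q_parallelogram[of f g t] Q_nonneg[of "\<lambda>t. f t - g t" t] by linarith

lemma Q_diff_le: "Q (\<lambda>t. f t - g t) t \<le> 2 * Q f t + 2 * Q g t"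
  using Q_parallelogram[of f g t] Q_nonneg[of "\<lambda>t. f t + g t" t] by linarith

lemma Q_cnj: "Q (\<lambda>t. \<chi> i. cnj (f t $ i)) t = Q f t"
  unfolding Q_real_form by simp

text \<open>Cauchy-Schwarz for the semi-inner product of \<open>H\<close> with the first unit
  vector. The defect is the determinant of \<open>H\<close> times the squared modulus of the second
  component.\<close>

lemma P1_le: "(norm (P1 f t))\<^sup>2 \<le> h1 t * Q f t"
proof -
  have "h1 t * Q f t - (norm (P1 f t))\<^sup>2 = (h1 t * h2 t - (h3 t)\<^sup>2) * ((Re (f t $ 2))\<^sup>2 + (Im (f t $ 2))\<^sup>2)"
    unfolding Q_real_form cmod_power2 P1_def by (simp add: power2_eq_square algebra_simps)
  also have "\<dots> \<ge> 0" using psd[of t] by simp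
  finally show ?thesis by simp
qed

lemma P2_le: "(norm (P2 f t))\<^sup>2 \<le> h2 t * Q f t"
proof -
  have "h2 t * Q f t - (norm (P2 f t))\<^sup>2 = (h1 t * h2 t - (h3 t)\<^sup>2) * ((Re (f t $ 1))\<^sup>2 + (Im (f t $ 1))\<^sup>2)"
    unfolding Q_real_form cmod_power2 P2_def by (simp add: power2_eq_square algebra_simps)
  also have "\<dots> \<ge> 0" using psd[of t] by simp
  finally show ?thesis by simp
qed

lemma Bf_eq_Q_diff: "2 * Re (Bf (\<lambda>t. \<chi> i. cnj (k t $ i)) g t) = Q k t + Q g t - Q (\<lambda>t. k t - g t) t"
proof -
  have "Re (Bf (\<lambda>t. \<chi> i. cnj (k t $ i)) g t)
    = h1 t * (Re (k t $ 1) * Re (g t $ 1) + Im (k t $ 1) * Im (g t $ 1))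
      + h3 t * (Re (k t $ 1) * Re (g t $ 2) + Im (k t $ 1) * Im (g t $ 2))
      + h3 t * (Re (k t $ 2) * Re (g t $ 1) + Im (k t $ 2) * Im (g t $ 1))
      + h2 t * (Re (k t $ 2) * Re (g t $ 2) + Im (k t $ 2) * Im (g t $ 2))"
    unfolding P1_def P2_def Bf_def by (simp add: algebra_simps)
  then show ?thesis
    unfolding Q_real_form by (simp add: power2_eq_square algebra_simps)
qed

text \<open>A factor \<open>w\<close> of modulus 1, or 0, turns \<open>Bf f g t\<close> into its
  modulus; polarisation then bounds it by the quadratic forms.\<close>

lemma Bf_le: "norm (Bf f g t) \<le> (Q f t + Q g t) / 2"
proof -
  define w where "w = cnj (sgn (Bf f g t))"
  have w: "norm w \<le> 1" by (simp add: w_def norm_sgn)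
  define k where "k = (\<lambda>t. \<chi> i. cnj (w * f t $ i))"
  have "Bf (\<lambda>t. \<chi> i. cnj (k t $ i)) g t = w * Bf f g t"
    by (simp add: k_def Bf_def algebra_simps)
  moreover have "w * Bf f g t = of_real (norm (Bf f g t))"
    unfolding w_def by (rule cnj_sgn_mult)
  ultimately have "2 * norm (Bf f g t) = Q k t + Q g t - Q (\<lambda>t. k t - g t) t"
    using Bf_eq_Q_diff[of k g t] by simp
  then have le: "2 * norm (Bf f g t) \<le> Q k t + Q g t"
    using Q_nonneg[of "\<lambda>t. k t - g t" t] by linarith
  have "Q k t = (norm w)\<^sup>2 * Q f t"
    using Q_cnj[of "\<lambda>t. w *s f t" t] unfolding k_def Q_scale by simp
  moreover have "\<dots> \<le> 1 * Q f t" using w by (intro mult_right_mono) (auto simp: power_le_one)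
  ultimately have "Q k t \<le> Q f t" by simp
  then have "2 * norm (Bf f g t) \<le> Q f t + Q g t" by (rule order_trans[OF le add_right_mono])
  then show ?thesis by simp
qed

lemma negligible_S_minus_D: "negligible (S - D)"
  by (rule negligible_subset[of "{c}"]) (auto simp: S_def)

lemma abs_int_S_iff:
  fixes f :: "real \<Rightarrow> 'b::euclidean_space"
  shows "f absolutely_integrable_on S \<longleftrightarrow> f absolutely_integrable_on D"
proof (rule absolutely_integrable_spike_set_eq)
  show "negligible {x \<in> S - D. f x \<noteq> 0}" by (rule negligible_subset[OF negligible_S_minus_D]) auto
  show "negligible {x \<in> D - S. f x \<noteq> 0}" using D_sub_S by (auto intro: negligible_subset[of "{}"])
qed

lemma integral_S_eq:
  fixes f :: "real \<Rightarrow> 'b::euclidean_space"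
  shows "integral S f = integral D f"
proof (rule integral_spike_set)
  show "negligible {x \<in> S - D. f x \<noteq> 0}" by (rule negligible_subset[OF negligible_S_minus_D]) auto
  show "negligible {x \<in> D - S. f x \<noteq> 0}" using D_sub_S by (auto intro: negligible_subset[of "{}"])
qed

lemma seg_lebesgue [simp]: "seg u v \<in> sets lebesgue" by (simp add: seg_def)

lemma tail_lebesgue [simp]: "tail u \<in> sets lebesgue" by (simp add: tail_def)

lemma tail_sub: "u \<in> S \<Longrightarrow> tail u \<subseteq> D"
  unfolding tail_def S_def D_def by auto

lemma abs_int_seg:
  fixes f :: "real \<Rightarrow> 'b::euclidean_space"
  assumes "f absolutely_integrable_on D" "u \<in> S" "v \<in> S"
  shows "f absolutely_integrable_on seg u v"
proof -
  have "f absolutely_integrable_on S" using assms(1) by (simp add: abs_int_S_iff)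
  from set_integrable_subset[OF this seg_lebesgue seg_sub_S[OF assms(2,3)]] show ?thesis .
qed

lemma abs_int_tail:
  fixes f :: "real \<Rightarrow> 'b::euclidean_space"
  assumes "f absolutely_integrable_on D" "u \<in> S"
  shows "f absolutely_integrable_on tail u"
  using set_integrable_subset[OF assms(1) tail_lebesgue tail_sub[OF assms(2)]] .

lemma integral_seg_le:
  fixes g :: "real \<Rightarrow> real"
  assumes "g absolutely_integrable_on D" "\<And>t. 0 \<le> g t" "u \<in> S" "v \<in> S"
  shows "integral (seg u v) g \<le> integral D g"
proof -
  have "integral (seg u v) g \<le> integral S g"
    using assms abs_int_seg[OF assms(1,3,4)] seg_sub_S[OF assms(3,4)]
    by (intro integral_subset_le) (auto simp: abs_int_S_iff intro: set_lebesgue_integral_eq_integral(1))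
  then show ?thesis by (simp add: integral_S_eq)
qed

lemma meas_add: "meas f \<Longrightarrow> meas g \<Longrightarrow> meas (\<lambda>t. f t + g t)"
  and meas_diff: "meas f \<Longrightarrow> meas g \<Longrightarrow> meas (\<lambda>t. f t - g t)"
  and meas_scale: "meas f \<Longrightarrow> meas (\<lambda>t. k *s f t)"
  unfolding meas_def by auto

lemma cont_imp_meas: "cont f \<Longrightarrow> meas f"
  unfolding cont_def meas_def
  using D_sub_S by (auto intro: continuous_imp_measurable_on_sets_lebesgue continuous_on_subset)

lemma cont_add: "cont f \<Longrightarrow> cont g \<Longrightarrow> cont (\<lambda>t. f t + g t)"
  and cont_diff: "cont f \<Longrightarrow> cont g \<Longrightarrow> cont (\<lambda>t. f t - g t)"
  and cont_scale: "cont f \<Longrightarrow> cont (\<lambda>t. k *s f t)"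
  and cont_const: "cont (\<lambda>t. v)"
  unfolding cont_def by (auto intro: continuous_intros)

lemma cont_sum: "(\<And>i. i \<in> I \<Longrightarrow> cont (f i)) \<Longrightarrow> cont (\<lambda>t. \<Sum>i\<in>I. f i t)"
  unfolding cont_def by (auto intro: continuous_intros)

lemma chn_cont: "chn y f \<Longrightarrow> cont y"
  unfolding chn_def cont_def using is_prim_imp_continuous_on interval_S by blast

lemma P_linear:
  "P1 (\<lambda>t. f t + g t) t = P1 f t + P1 g t" "P2 (\<lambda>t. f t + g t) t = P2 f t + P2 g t"
  "P1 (\<lambda>t. f t - g t) t = P1 f t - P1 g t" "P2 (\<lambda>t. f t - g t) t = P2 f t - P2 g t"
  "P1 (\<lambda>t. k *s f t) t = k * P1 f t" "P2 (\<lambda>t. k *s f t) t = k * P2 f t"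
  "P1 (\<lambda>t. 0) t = 0" "P2 (\<lambda>t. 0) t = 0"
  by (simp_all add: P1_def P2_def algebra_simps)

lemma P_sum:
  "P1 (\<lambda>t. \<Sum>i\<in>I. f i t) t = (\<Sum>i\<in>I. P1 (f i) t)" "P2 (\<lambda>t. \<Sum>i\<in>I. f i t) t = (\<Sum>i\<in>I. P2 (f i) t)"
  by (simp_all add: P1_def P2_def sum.distrib sum_distrib_left)

lemma chn_add: "chn y f \<Longrightarrow> chn x g \<Longrightarrow> chn (\<lambda>t. y t + x t) (\<lambda>t. f t + g t)"
  unfolding chn_def using is_prim_add[of S "\<lambda>t. y t $ 1" "\<lambda>t. - P2 f t" "\<lambda>t. x t $ 1" "\<lambda>t. - P2 g t"]
    is_prim_add[of S "\<lambda>t. y t $ 2" "P1 f" "\<lambda>t. x t $ 2" "P1 g"]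
  by (simp add: P_linear[abs_def])

lemma chn_diff: "chn y f \<Longrightarrow> chn x g \<Longrightarrow> chn (\<lambda>t. y t - x t) (\<lambda>t. f t - g t)"
  unfolding chn_def using is_prim_diff[of S "\<lambda>t. y t $ 1" "\<lambda>t. - P2 f t" "\<lambda>t. x t $ 1" "\<lambda>t. - P2 g t"]
    is_prim_diff[of S "\<lambda>t. y t $ 2" "P1 f" "\<lambda>t. x t $ 2" "P1 g"]
  by (simp add: P_linear[abs_def])

lemma chn_scale: "chn y f \<Longrightarrow> chn (\<lambda>t. k *s y t) (\<lambda>t. k *s f t)"
  unfolding chn_def using is_prim_cmult[of S "\<lambda>t. y t $ 1" "\<lambda>t. - P2 f t" k] is_prim_cmult[of S "\<lambda>t. y t $ 2" "P1 f" k]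
  by (simp add: P_linear[abs_def])

lemma chn_const: "chn (\<lambda>t. v) (\<lambda>t. 0)"
  unfolding chn_def by (simp add: P_linear[abs_def] is_prim_const)

lemma chn_sum: "(\<And>i. i \<in> I \<Longrightarrow> chn (y i) (f i)) \<Longrightarrow> chn (\<lambda>t. \<Sum>i\<in>I. y i t) (\<lambda>t. \<Sum>i\<in>I. f i t)"
  by (induction I rule: infinite_finite_induct) (simp_all add: chn_const chn_add)

lemma chn_cong:
  assumes "chn y f" "\<And>t. t \<in> S \<Longrightarrow> y t = x t" "\<And>t. t \<in> S \<Longrightarrow> f t = g t"
  shows "chn x g"
  unfolding chn_def
proof
  show "is_prim S (\<lambda>t. x t $ 1) (\<lambda>t. - P2 g t)"
    by (rule is_prim_cong[OF conjunct1[OF assms(1)[unfolded chn_def]]]) (simp_all add: assms(2,3) P2_def)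
  show "is_prim S (\<lambda>t. x t $ 2) (P1 g)"
    by (rule is_prim_cong[OF conjunct2[OF assms(1)[unfolded chn_def]]]) (simp_all add: assms(2,3) P1_def)
qed

lemma chn_zero_const:
  assumes "chn y f" "\<And>t. t \<in> S \<Longrightarrow> f t = 0" "t \<in> S" "u \<in> S"
  shows "y t = y u"
proof -
  have "chn y (\<lambda>_. 0)" by (rule chn_cong[OF assms(1)]) (simp_all add: assms(2))
  then have "y t $ 1 = y u $ 1" "y t $ 2 = y u $ 2"
    unfolding chn_def using is_prim_zero_imp_eq[OF _ interval_S assms(3,4)] by (auto simp: P_linear[abs_def])
  then show ?thesis by (simp add: vec_eq_iff forall_2)
qed

lemma chn_unique:
  assumes "chn y f" "chn x f" "y c = x c" "t \<in> S"
  shows "y t = x t"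
proof -
  have "chn (\<lambda>t. y t - x t) (\<lambda>t. f t - f t)" by (rule chn_diff[OF assms(1,2)])
  from chn_zero_const[OF this _ assms(4) c_in_S] show ?thesis using assms(3) by simp
qed

lemma meas_PQ:
  assumes "meas f"
  shows "P1 f \<in> borel_measurable (lebesgue_on D)" "P2 f \<in> borel_measurable (lebesgue_on D)"
    "Q f \<in> borel_measurable (lebesgue_on D)"
proof -
  define f1 where "f1 t = f t $ 1" for t
  define f2 where "f2 t = f t $ 2" for t
  have [measurable]: "f1 \<in> borel_measurable (lebesgue_on D)" "f2 \<in> borel_measurable (lebesgue_on D)"
    using assms unfolding meas_def f1_def[abs_def] f2_def[abs_def] by auto
  note [measurable] = h_measurable[folded D_def]
  show "P1 f \<in> borel_measurable (lebesgue_on D)" "P2 f \<in> borel_measurable (lebesgue_on D)"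
    unfolding P1_def[abs_def] P2_def[abs_def] f1_def[symmetric] f2_def[symmetric] by measurable
  show "Q f \<in> borel_measurable (lebesgue_on D)"
    unfolding Q_real_form[abs_def] f1_def[symmetric] f2_def[symmetric] by measurable
qed

lemma meas_Bf: "meas f \<Longrightarrow> meas g \<Longrightarrow> Bf f g \<in> borel_measurable (lebesgue_on D)"
proof -
  assume "meas f" "meas g"
  then show ?thesis
    using meas_PQ[of g] unfolding meas_def Bf_def[abs_def] by (intro borel_measurable_add borel_measurable_times) auto
qed

lemma absolutely_integrable_bound_D:
  fixes f :: "real \<Rightarrow> 'b::euclidean_space"
  assumes "f \<in> borel_measurable (lebesgue_on D)" "g absolutely_integrable_on D" "\<And>t. t \<in> D \<Longrightarrow> norm (f t) \<le> g t"
  shows "f absolutely_integrable_on D"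
  using assms by (intro measurable_bounded_by_integrable_imp_absolutely_integrable[of f D g])
    (auto intro: set_lebesgue_integral_eq_integral(1))

lemma sq_scale: "sq f \<Longrightarrow> sq (\<lambda>t. k *s f t)"
  unfolding sq_def by (auto simp: Q_scale[abs_def] meas_scale)

lemma sq_add:
  assumes "sq f" "sq g"
  shows "sq (\<lambda>t. f t + g t)"
  unfolding sq_def
proof
  show m: "meas (\<lambda>t. f t + g t)" using assms by (simp add: sq_def meas_add)
  have "(\<lambda>t. 2 * Q f t) absolutely_integrable_on D" "(\<lambda>t. 2 * Q g t) absolutely_integrable_on D"
    using assms by (simp_all add: sq_def)
  then have "(\<lambda>t. 2 * Q f t + 2 * Q g t) absolutely_integrable_on D" by (rule set_integral_add(1))
  then show "Q (\<lambda>t. f t + g t) absolutely_integrable_on D"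
    by (rule absolutely_integrable_bound_D[OF meas_PQ(3)[OF m]]) (simp add: Q_add_le)
qed

lemma sq_diff: "sq f \<Longrightarrow> sq g \<Longrightarrow> sq (\<lambda>t. f t - g t)"
  using sq_add[OF _ sq_scale[of g "-1"]] by simp

lemma sq_zero: "sq (\<lambda>t. 0)"
  unfolding sq_def meas_def Q_def by simp

lemma sq_sum: "(\<And>i. i \<in> I \<Longrightarrow> sq (f i)) \<Longrightarrow> sq (\<lambda>t. \<Sum>i\<in>I. f i t)"
  by (induction I rule: infinite_finite_induct) (simp_all add: sq_zero sq_add)

lemma sq_cong:
  assumes "sq f" "\<And>t. t \<in> D \<Longrightarrow> f t = g t"
  shows "sq g"
proof -
  have "meas g"
    using assms measurable_cong[of "lebesgue_on D" "\<lambda>t. f t $ 1" "\<lambda>t. g t $ 1"]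
      measurable_cong[of "lebesgue_on D" "\<lambda>t. f t $ 2" "\<lambda>t. g t $ 2"]
    unfolding sq_def meas_def by simp
  moreover have "Q g absolutely_integrable_on D"
    using assms unfolding sq_def by (auto simp: Q_def[abs_def] cong: set_integrable_cong)
  ultimately show ?thesis by (simp add: sq_def)
qed

lemma sq_e1: "sq (\<lambda>_. vector [1, 0])"
  using int_h1 unfolding sq_def meas_def Q_def[abs_def] D_def by simp

lemma not_sq_e2: "\<not> sq (\<lambda>_. vector [0, 1])"
  using lp unfolding sq_def meas_def Q_def[abs_def] D_def by simp

lemma sq_Bf:
  assumes "sq f" "sq g"
  shows "Bf f g absolutely_integrable_on D"
proof -
  have "(\<lambda>t. Q f t + Q g t) absolutely_integrable_on D"
    using assms by (intro set_integral_add(1)) (simp_all add: sq_def)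
  then have "(\<lambda>t. (Q f t + Q g t) / 2) absolutely_integrable_on D" by (rule set_integrable_divide)
  from absolutely_integrable_bound_D[OF meas_Bf this Bf_le] show ?thesis
    using assms by (simp add: sq_def)
qed

lemma sq_P1: "sq f \<Longrightarrow> P1 f absolutely_integrable_on D"
  using sq_Bf[OF sq_e1, of f] by (simp add: Bf_def[abs_def])

lemma cont_Q_int:
  assumes "cont f" "u \<in> S" "v \<in> S"
  shows "Q f absolutely_integrable_on seg u v"
proof -
  have c: "continuous_on (seg u v) (\<lambda>t. f t $ 1)" "continuous_on (seg u v) (\<lambda>t. f t $ 2)"
    using assms seg_sub_S[OF assms(2,3)] unfolding cont_def by (auto intro: continuous_on_subset)
  then have "continuous_on (seg u v) (\<lambda>t. (norm (f t $ 1))\<^sup>2)" "continuous_on (seg u v) (\<lambda>t. (norm (f t $ 2))\<^sup>2)"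
    "continuous_on (seg u v) (\<lambda>t. 2 * Re (cnj (f t $ 1) * f t $ 2))"
    by (auto intro!: continuous_intros)
  with int_seg[OF assms(2,3)] have "(\<lambda>t. (norm (f t $ 1))\<^sup>2 * h1 t) absolutely_integrable_on seg u v"
    "(\<lambda>t. (norm (f t $ 2))\<^sup>2 * h2 t) absolutely_integrable_on seg u v"
    "(\<lambda>t. 2 * Re (cnj (f t $ 1) * f t $ 2) * h3 t) absolutely_integrable_on seg u v"
    unfolding seg_def by (auto intro: absolutely_integrable_continuous_mult)
  then have "(\<lambda>t. ((norm (f t $ 1))\<^sup>2 * h1 t + 2 * Re (cnj (f t $ 1) * f t $ 2) * h3 t) + (norm (f t $ 2))\<^sup>2 * h2 t) absolutely_integrable_on seg u v"
    by (intro set_integral_add(1))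
  then show ?thesis by (simp add: Q_def[abs_def] mult_ac)
qed

end

section \<open>Estimates near the singular endpoint\<close>

lemma abs_int_imp:
  fixes f :: "'a::euclidean_space \<Rightarrow> 'b::euclidean_space"
  shows "f absolutely_integrable_on X \<Longrightarrow> f integrable_on X"
  by (rule set_lebesgue_integral_eq_integral(1))

context canonical_side
begin

text \<open>First components oscillate against \<open>h2\<close>, which is not integrable up to
  \<open>s\<close>, second components against \<open>h1\<close>, which is. Every later estimate
  balances these two bounds.\<close>

lemma chn_oscillation:
  assumes v: "chn v f" and u: "u \<in> S" and t: "t \<in> S" and Qf: "Q f integrable_on seg u t"
  shows "(norm (v t $ 1 - v u $ 1))\<^sup>2 \<le> integral (seg u t) h2 * integral (seg u t) (Q f)"
    "(norm (v t $ 2 - v u $ 2))\<^sup>2 \<le> integral (seg u t) h1 * integral (seg u t) (Q f)"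
proof -
  note p = v[unfolded chn_def]
  note sub = seg_sub_S[OF u t]
  note i = int_seg[OF u t]
  have "(norm (integral (seg u t) (\<lambda>t. - P2 f t)))\<^sup>2 \<le> integral (seg u t) h2 * integral (seg u t) (Q f)"
    using is_prim_norm_diff_le(2)[OF conjunct1[OF p] sub] i Qf psd P2_le
    by (intro integral_Cauchy_Schwarz) (auto intro: abs_int_imp)
  then show "(norm (v t $ 1 - v u $ 1))\<^sup>2 \<le> integral (seg u t) h2 * integral (seg u t) (Q f)"
    using is_prim_norm_diff_le(1)[OF conjunct1[OF p] sub] by simp
  have "(norm (integral (seg u t) (P1 f)))\<^sup>2 \<le> integral (seg u t) h1 * integral (seg u t) (Q f)"
    using is_prim_norm_diff_le(2)[OF conjunct2[OF p] sub] i Qf psd P1_le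
    by (intro integral_Cauchy_Schwarz) (auto intro: abs_int_imp)
  then show "(norm (v t $ 2 - v u $ 2))\<^sup>2 \<le> integral (seg u t) h1 * integral (seg u t) (Q f)"
    using is_prim_norm_diff_le(1)[OF conjunct2[OF p] sub] by simp
qed

text \<open>The \<open>h2\<close>-mass weighted with the \<open>h1\<close> still ahead equals the
  \<open>h1\<close>-mass weighted with the \<open>h2\<close> already passed, and the latter is
  controlled by (HS).\<close>

lemma seg_triangle:
  assumes "u \<in> S" "t \<in> S"
  shows "integral (seg u t) (\<lambda>x. h2 x * integral (seg x t) h1) = integral (seg u t) (\<lambda>x. h1 x * integral (seg u x) h2)"
    "(\<lambda>x. h2 x * integral (seg x t) h1) integrable_on seg u t"
    "(\<lambda>x. h1 x * integral (seg u x) h2) integrable_on seg u t"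
proof -
  have "integral (seg u t) (\<lambda>x. h2 x * integral (seg x t) h1) = integral (seg u t) (\<lambda>x. h1 x * integral (seg u x) h2)
    \<and> (\<lambda>x. h2 x * integral (seg x t) h1) integrable_on seg u t \<and> (\<lambda>x. h1 x * integral (seg u x) h2) integrable_on seg u t"
  proof (cases "u \<le> t")
    case True
    have 1: "integral {u..t} (\<lambda>x. h2 x * integral (seg x t) h1) = integral {u..t} (\<lambda>x. h2 x * integral {x..t} h1)"
      "integral {u..t} (\<lambda>x. h1 x * integral (seg u x) h2) = integral {u..t} (\<lambda>x. h1 x * integral {u..x} h2)"
      by (auto intro!: integral_cong simp: seg_def min_def max_def)
    have 2: "(\<lambda>x. h2 x * integral (seg x t) h1) integrable_on {u..t} \<longleftrightarrow> (\<lambda>x. h2 x * integral {x..t} h1) integrable_on {u..t}"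
      "(\<lambda>x. h1 x * integral (seg u x) h2) integrable_on {u..t} \<longleftrightarrow> (\<lambda>x. h1 x * integral {u..x} h2) integrable_on {u..t}"
      by (auto intro!: integrable_cong simp: seg_def min_def max_def)
    have "seg u t = {u..t}" using True by (simp add: seg_def)
    then show ?thesis
      using integral_triangle_swap[where p = h2 and q = h1 and l = u and r = t] True int_seg[OF assms] unfolding 1 2 by (simp add: 1 2 mult.commute)
  next
    case False
    have 1: "integral {t..u} (\<lambda>x. h2 x * integral (seg x t) h1) = integral {t..u} (\<lambda>x. h2 x * integral {t..x} h1)"
      "integral {t..u} (\<lambda>x. h1 x * integral (seg u x) h2) = integral {t..u} (\<lambda>x. h1 x * integral {x..u} h2)"
      by (auto intro!: integral_cong simp: seg_def min_def max_def)
    have 2: "(\<lambda>x. h2 x * integral (seg x t) h1) integrable_on {t..u} \<longleftrightarrow> (\<lambda>x. h2 x * integral {t..x} h1) integrable_on {t..u}"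
      "(\<lambda>x. h1 x * integral (seg u x) h2) integrable_on {t..u} \<longleftrightarrow> (\<lambda>x. h1 x * integral {x..u} h2) integrable_on {t..u}"
      by (auto intro!: integrable_cong simp: seg_def min_def max_def)
    have "seg u t = {t..u}" using False by (simp add: seg_def)
    then show ?thesis
      using integral_triangle_swap[where p = h1 and q = h2 and l = t and r = u] False int_seg[OF assms] by (simp add: 1 2 mult.commute)
  qed
  then show "integral (seg u t) (\<lambda>x. h2 x * integral (seg x t) h1) = integral (seg u t) (\<lambda>x. h1 x * integral (seg u x) h2)"
    "(\<lambda>x. h2 x * integral (seg x t) h1) integrable_on seg u t"
    "(\<lambda>x. h1 x * integral (seg u x) h2) integrable_on seg u t" by simp_all
qed

lemma in_tail_iff: "u \<in> S \<Longrightarrow> t \<in> tail u \<longleftrightarrow> t \<in> D \<and> t \<noteq> u \<and> u \<in> seg c t"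
  using cs unfolding tail_def S_def D_def seg_def by auto

lemma seg_mono: "x \<in> seg u t \<Longrightarrow> seg u x \<subseteq> seg u t" "x \<in> seg u t \<Longrightarrow> seg x t \<subseteq> seg u t"
  unfolding seg_def by auto

lemma integral_seg_mono:
  fixes g :: "real \<Rightarrow> real"
  assumes "g absolutely_integrable_on seg a b" "\<And>t. 0 \<le> g t" "seg u v \<subseteq> seg a b"
  shows "integral (seg u v) g \<le> integral (seg a b) g"
  using assms set_integrable_subset[OF assms(1) seg_lebesgue assms(3)]
  by (intro integral_subset_le) (auto intro: abs_int_imp)

lemma seg_sub_tail: "u \<in> S \<Longrightarrow> t \<in> tail u \<Longrightarrow> seg u t \<subseteq> insert u (tail u)"
  unfolding tail_def seg_def S_def D_def using cs by auto

text \<open>Tail of the (HS) integral. It becomes arbitrarily small near \<open>s\<close>, which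
  allows terms to be absorbed into a left-hand side.\<close>

definition "kappa u = integral (tail u) (\<lambda>x. A x * h1 x)"

lemma A_nonneg: "t \<in> S \<Longrightarrow> 0 \<le> A t"
  unfolding A_def using int_seg psd by (intro integral_nonneg) (auto intro: abs_int_imp)

lemma int_Ah1: "(\<lambda>x. A x * h1 x) absolutely_integrable_on D"
  using HS unfolding A_def D_def .

lemma integral_seg_le_tail:
  fixes g :: "real \<Rightarrow> real"
  assumes "g absolutely_integrable_on D" "\<And>t. t \<in> S \<Longrightarrow> 0 \<le> g t" "u \<in> S" "t \<in> tail u"
  shows "integral (seg u t) g \<le> integral (tail u) g"
proof -
  have tS: "t \<in> S" using tail_sub[OF assms(3)] assms(4) D_sub_S by blast
  have "integral (seg u t) g = integral (seg u t - {u}) g"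
    by (rule integral_spike_set) (auto intro: negligible_subset[of "{u}"])
  also have "\<dots> \<le> integral (tail u) g"
  proof (rule integral_subset_le)
    show "seg u t - {u} \<subseteq> tail u" using seg_sub_tail[OF assms(3,4)] by blast
    show "g integrable_on tail u" using abs_int_tail[OF assms(1,3)] by (rule abs_int_imp)
    have "seg u t - {u} \<in> sets lebesgue" by auto
    then show "g integrable_on seg u t - {u}"
      using set_integrable_subset[OF abs_int_tail[OF assms(1,3)] _ \<open>seg u t - {u} \<subseteq> tail u\<close>] by (blast intro: abs_int_imp)
    show "\<forall>x\<in>tail u. 0 \<le> g x" using tail_sub[OF assms(3)] D_sub_S assms(2) by blast
  qed
  finally show ?thesis .
qed

lemma integral_h1_G_le_kappa:
  assumes u: "u \<in> S" and t: "t \<in> tail u"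
  shows "integral (seg u t) (\<lambda>x. h1 x * integral (seg u x) h2) \<le> kappa u"
proof -
  have tS: "t \<in> S" and ut: "u \<in> seg c t" using t tail_sub[OF u] D_sub_S in_tail_iff[OF u] by blast+
  have "integral (seg u t) (\<lambda>x. h1 x * integral (seg u x) h2) \<le> integral (seg u t) (\<lambda>x. A x * h1 x)"
  proof (rule integral_le[OF seg_triangle(3)[OF u tS] abs_int_imp[OF abs_int_seg[OF int_Ah1 u tS]]])
    fix x assume x: "x \<in> seg u t"
    then have "seg u x \<subseteq> seg c x" using ut by (auto simp: seg_def)
    moreover have "x \<in> S" using x seg_sub_S[OF u tS] by blast
    ultimately have "integral (seg u x) h2 \<le> A x"
      unfolding A_def using psd int_seg[OF c_in_S, of x] by (intro integral_seg_mono) auto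
    then show "h1 x * integral (seg u x) h2 \<le> A x * h1 x" using psd(1)[of x] by (simp add: mult.commute mult_left_mono)
  qed
  also have "\<dots> \<le> kappa u"
    unfolding kappa_def using A_nonneg psd u t by (intro integral_seg_le_tail int_Ah1) auto
  finally show ?thesis .
qed

definition "m1 = integral D h1"

lemma m1_nonneg: "0 \<le> m1"
  unfolding m1_def using psd int_h1 by (intro integral_nonneg) (auto simp: D_def intro: abs_int_imp)

lemma kappa_nonneg: "u \<in> S \<Longrightarrow> 0 \<le> kappa u"
proof -
  assume u: "u \<in> S"
  have "0 \<le> A x * h1 x" if "x \<in> tail u" for x
    using that tail_sub[OF u] D_sub_S A_nonneg[of x] psd(1)[of x] by (intro mult_nonneg_nonneg) auto
  then show ?thesis
    unfolding kappa_def using abs_int_imp[OF abs_int_tail[OF int_Ah1 u]] by (intro integral_nonneg)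
qed

text \<open>Because of its zero at \<open>t\<close> the second component at \<open>x\<close> is
  bounded by the \<open>h1\<close>-mass between \<open>x\<close> and \<open>t\<close>, while the
  first is controlled from \<open>u\<close> on by the \<open>h2\<close>-mass. After the triangle
  swap both contributions are multiples of \<open>kappa u\<close>, with 4 + 2 = 6. The constants do
  not depend on \<open>t\<close>.\<close>

lemma tail_estimate:
  assumes v: "chn v f" and u: "u \<in> S" and t: "t \<in> tail u" and v2: "v t $ 2 = 0"
    and Qf: "Q f absolutely_integrable_on seg u t"
  shows "integral (seg u t) (Q v) \<le> 4 * m1 * (norm (v u $ 1))\<^sup>2 + 6 * kappa u * integral (seg u t) (Q f)"
proof -
  have tS: "t \<in> S" and ut: "u \<in> seg c t" using t tail_sub[OF u] D_sub_S in_tail_iff[OF u] by blast+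
  define N where "N = integral (seg u t) (Q f)"
  have N: "0 \<le> N" unfolding N_def using Qf by (intro integral_nonneg) (auto intro: abs_int_imp)
  \<comment> \<open>Majorant of \<open>Q v\<close>: initial value of the first component at
    \<open>u\<close>, its growth, and the size of the second component.\<close>
  define b where "b = (\<lambda>x. (4 * (norm (v u $ 1))\<^sup>2) * h1 x + ((4 * N) * (h1 x * integral (seg u x) h2)
      + (2 * N) * (h2 x * integral (seg x t) h1)))"
  have le: "Q v x \<le> b x" if x: "x \<in> seg u t" for x
  proof -
    have xS: "x \<in> S" using x seg_sub_S[OF u tS] by blast
    have q1: "Q f absolutely_integrable_on seg u x" "Q f absolutely_integrable_on seg x t"
      using set_integrable_subset[OF Qf seg_lebesgue] seg_mono[OF x] by blast+
    have n1: "integral (seg u x) (Q f) \<le> N" "integral (seg x t) (Q f) \<le> N"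
      unfolding N_def using seg_mono[OF x] by (auto intro!: integral_seg_mono Qf)
    have G: "0 \<le> integral (seg u x) h2" and B: "0 \<le> integral (seg x t) h1"
      using int_seg[OF u xS] int_seg[OF xS tS] psd by (auto intro!: integral_nonneg intro: abs_int_imp)
    have "(norm (v x $ 1 - v u $ 1))\<^sup>2 \<le> integral (seg u x) h2 * integral (seg u x) (Q f)"
      by (rule chn_oscillation(1)[OF v u xS abs_int_imp[OF q1(1)]])
    also have "\<dots> \<le> integral (seg u x) h2 * N" using G n1 by (intro mult_left_mono)
    finally have d1: "(norm (v x $ 1 - v u $ 1))\<^sup>2 \<le> integral (seg u x) h2 * N" .
    have "(norm (v x $ 1))\<^sup>2 \<le> (norm (v u $ 1) + norm (v x $ 1 - v u $ 1))\<^sup>2"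
      by (intro power_mono norm_ge_zero) (metis add.commute diff_add_cancel norm_triangle_ineq)
    also have "\<dots> \<le> 2 * (norm (v u $ 1))\<^sup>2 + 2 * (norm (v x $ 1 - v u $ 1))\<^sup>2"
      using zero_le_power2[of "norm (v u $ 1) - norm (v x $ 1 - v u $ 1)"] by (simp add: power2_eq_square algebra_simps)
    finally have a1: "(norm (v x $ 1))\<^sup>2 \<le> 2 * (norm (v u $ 1))\<^sup>2 + 2 * (integral (seg u x) h2 * N)"
      using d1 by linarith
    have "(norm (v t $ 2 - v x $ 2))\<^sup>2 \<le> integral (seg x t) h1 * integral (seg x t) (Q f)"
      by (rule chn_oscillation(2)[OF v xS tS abs_int_imp[OF q1(2)]])
    also have "\<dots> \<le> integral (seg x t) h1 * N" using B n1 by (intro mult_left_mono)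
    finally have a2: "(norm (v x $ 2))\<^sup>2 \<le> integral (seg x t) h1 * N" by (simp add: v2)
    have "Q v x \<le> 2 * (h1 x * (norm (v x $ 1))\<^sup>2 + h2 x * (norm (v x $ 2))\<^sup>2)" by (rule Q_le)
    also have "\<dots> \<le> 2 * (h1 x * (2 * (norm (v u $ 1))\<^sup>2 + 2 * (integral (seg u x) h2 * N)) + h2 x * (integral (seg x t) h1 * N))"
      using a1 a2 psd[of x] by (intro mult_left_mono add_mono) auto
    also have "\<dots> = b x" unfolding b_def by (simp add: algebra_simps)
    finally show ?thesis .
  qed
  note tri = seg_triangle[OF u tS]
  have i1: "h1 integrable_on seg u t" using int_seg[OF u tS] by (auto intro: abs_int_imp)
  have bi: "(b has_integral (4 * (norm (v u $ 1))\<^sup>2) * integral (seg u t) h1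
      + ((4 * N) * integral (seg u t) (\<lambda>x. h1 x * integral (seg u x) h2)
      + (2 * N) * integral (seg u t) (\<lambda>x. h2 x * integral (seg x t) h1))) (seg u t)"
    unfolding b_def
    by (intro has_integral_add has_integral_mult_right integrable_integral i1 tri(2,3))
  have "Q v integrable_on seg u t" by (intro abs_int_imp cont_Q_int chn_cont[OF v] u tS)
  then have "integral (seg u t) (Q v) \<le> integral (seg u t) b"
    using bi le by (intro integral_le) (auto simp: has_integral_integrable)
  also have "\<dots> = (4 * (norm (v u $ 1))\<^sup>2) * integral (seg u t) h1 + 6 * N * integral (seg u t) (\<lambda>x. h1 x * integral (seg u x) h2)"
    using integral_unique[OF bi] tri(1) by (simp add: algebra_simps)
  also have "\<dots> \<le> (4 * (norm (v u $ 1))\<^sup>2) * m1 + 6 * N * kappa u"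
    using integral_h1_G_le_kappa[OF u t] N integral_seg_le[OF int_h1[folded D_def] psd(1) u tS] unfolding m1_def
    by (intro add_mono mult_left_mono) auto
  finally show ?thesis by (simp add: N_def mult_ac)
qed

lemma tail_integral_small:
  fixes g :: "real \<Rightarrow> 'b::euclidean_space"
  assumes g: "g absolutely_integrable_on D" and "e > 0"
  obtains u where "u \<in> D" "integral (tail u) (\<lambda>x. norm (g x)) < e"
proof -
  obtain \<delta> where \<delta>: "\<delta> > 0" "\<And>X. \<lbrakk>X \<in> lmeasurable; X \<subseteq> D; measure lebesgue X < \<delta>\<rbrakk> \<Longrightarrow> integral X (\<lambda>x. norm (g x)) < e"
    using absolutely_integrable_uniformly_small[OF g D_lebesgue assms(2)] by blast
  define r where "r = min (\<delta> / 2) (\<bar>s - c\<bar> / 2)"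
  have "0 < \<bar>s - c\<bar>" using cs by simp
  moreover from this have "0 < r" using \<delta>(1) by (simp add: r_def)
  moreover have "r \<le> \<delta> / 2" "r \<le> \<bar>s - c\<bar> / 2" unfolding r_def by (rule min.cobounded1 min.cobounded2)+
  ultimately have r: "0 < r" "r < \<delta>" "r < \<bar>s - c\<bar>" using \<delta>(1) by simp_all
  define u where "u = s + (if c < s then - r else r)"
  have uD: "u \<in> D" using r cs by (auto simp: u_def D_def)
  then have uS: "u \<in> S" using D_sub_S by blast
  have "measure lebesgue (tail u) = r" using r by (auto simp: tail_def u_def)
  moreover have "tail u \<in> lmeasurable" by (simp add: tail_def)
  ultimately have "integral (tail u) (\<lambda>x. norm (g x)) < e" using \<delta>(2)[of "tail u"] tail_sub[OF uS] r by simp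
  then show thesis using that uD by blast
qed

lemma kappa_small:
  assumes "e > 0"
  obtains u where "u \<in> D" "kappa u < e"
proof -
  obtain u where u: "u \<in> D" "integral (tail u) (\<lambda>x. norm (A x * h1 x)) < e"
    using tail_integral_small[OF int_Ah1 assms] .
  have uS: "u \<in> S" using u(1) D_sub_S by blast
  have "kappa u = integral (tail u) (\<lambda>x. norm (A x * h1 x))"
    unfolding kappa_def using tail_sub[OF uS] D_sub_S A_nonneg psd by (intro integral_cong) (auto simp: subset_iff)
  with u that show thesis by simp
qed

text \<open>The points \<open>tn u n\<close> increase strictly from \<open>u\<close> towards the singular endpoint.\<close>

definition "tn u n = s + (u - s) / (real n + 2)"

lemma tn:
  assumes "u \<in> S"
  shows "tn u n \<in> tail u" "tn u n \<in> D" "tn u n \<in> S" "m \<le> n \<Longrightarrow> seg u (tn u m) \<subseteq> seg u (tn u n)" "tn u \<longlonglongrightarrow> s"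
proof -
  have *: "tn u n \<in> tail u" for n
  proof -
    define q where "q = 1 / (real n + 2)"
    have q: "0 < q" "q < 1" by (auto simp: q_def field_simps)
    have e: "tn u n = (1 - q) * s + q * u" by (simp add: tn_def q_def algebra_simps diff_divide_distrib)
    have "u \<noteq> s" using assms cs by (auto simp: S_def D_def)
    then consider "u < s" | "s < u" by linarith
    then show ?thesis
    proof cases
      case 1
      have "q * (s - u) > 0" "(1 - q) * (s - u) > 0" using 1 q by simp_all
      then show ?thesis using 1 unfolding e tail_def by (simp add: algebra_simps)
    next
      case 2
      have "q * (u - s) > 0" "(1 - q) * (u - s) > 0" using 2 q by simp_all
      then show ?thesis using 2 unfolding e tail_def by (simp add: algebra_simps)
    qed
  qed
  show "tn u n \<in> tail u" by (rule *)
  then show "tn u n \<in> D" "tn u n \<in> S" using tail_sub[OF assms] D_sub_S by blast+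
  show "seg u (tn u m) \<subseteq> seg u (tn u n)" if "m \<le> n"
  proof -
    have "tn u m \<in> seg u (tn u n)"
    proof (cases "u < s")
      case True
      then have "(s - u) / (real n + 2) \<le> (s - u) / (real m + 2)" using that by (intro divide_left_mono) auto
      then have "tn u m \<le> tn u n" by (simp add: tn_def minus_divide_left[symmetric] algebra_simps diff_divide_distrib)
      then show ?thesis using *[of m] True by (auto simp: tail_def seg_def)
    next
      case False
      then have "(u - s) / (real n + 2) \<le> (u - s) / (real m + 2)" using that by (intro divide_left_mono) auto
      then have "tn u n \<le> tn u m" by (simp add: tn_def)
      then show ?thesis using *[of m] False by (auto simp: tail_def seg_def)
    qed
    then show ?thesis by (rule seg_mono)
  qed
  have "LIM n sequentially. 2 + real n :> at_top"
    by (rule filterlim_tendsto_add_at_top[OF tendsto_const filterlim_real_sequentially])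
  then have "(\<lambda>n. (u - s) / (2 + real n)) \<longlonglongrightarrow> 0"
    by (intro tendsto_divide_0[OF tendsto_const] filterlim_at_top_imp_at_infinity)
  then have "(\<lambda>n. s + (u - s) / (real n + 2)) \<longlonglongrightarrow> s + 0"
    by (intro tendsto_add tendsto_const) (simp add: add.commute)
  then show "tn u \<longlonglongrightarrow> s" unfolding tn_def[abs_def] by simp
qed

text \<open>Monotone convergence along the points \<open>tn u n\<close> gives integrability between
  \<open>u\<close> and \<open>s\<close>; the stretch from \<open>c\<close> to \<open>u\<close> is
  added separately.\<close>

lemma abs_int_from_bound:
  fixes g :: "real \<Rightarrow> real"
  assumes u: "u \<in> S" and int: "\<And>t. t \<in> S \<Longrightarrow> g absolutely_integrable_on seg c t" and nonneg: "\<And>t. 0 \<le> g t"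
    and le: "\<And>t. t \<in> tail u \<Longrightarrow> integral (seg u t) g \<le> C"
  shows "g absolutely_integrable_on D"
proof -
  define f where "f n x = (if x \<in> seg u (tn u n) then g x else 0)" for n x
  have gi: "g absolutely_integrable_on seg u t" if "t \<in> tail u" for t
  proof -
    have "t \<in> S" "seg u t \<subseteq> seg c t"
      using that in_tail_iff[OF u, of t] D_sub_S seg_mono(2)[of u c t] by auto
    then show ?thesis using set_integrable_subset[OF int seg_lebesgue] by blast
  qed
  have int': "integral (tail u) (f n) = integral (seg u (tn u n)) g \<and> f n integrable_on tail u" for n
  proof -
    have sub: "seg u (tn u n) \<subseteq> insert u (tail u)" by (rule seg_sub_tail[OF u tn(1)[OF u]])
    define X where "X = seg u (tn u n) \<inter> tail u"
    have eq: "integral X g = integral (seg u (tn u n)) g"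
    proof (rule integral_spike_set)
      have "{x \<in> X - seg u (tn u n). g x \<noteq> 0} = {}" by (auto simp: X_def)
      then show "negligible {x \<in> X - seg u (tn u n). g x \<noteq> 0}" by (simp only: negligible_empty)
      have "{x \<in> seg u (tn u n) - X. g x \<noteq> 0} \<subseteq> {u}" using sub unfolding X_def by blast
      then show "negligible {x \<in> seg u (tn u n) - X. g x \<noteq> 0}" by (rule negligible_subset[OF negligible_sing])
    qed
    have "X \<in> sets lebesgue" by (auto simp: X_def)
    then have "g absolutely_integrable_on X"
      by (rule set_integrable_subset[OF gi[OF tn(1)[OF u, of n]]]) (simp add: X_def)
    moreover have "f n = (\<lambda>x. if x \<in> seg u (tn u n) then g x else 0)" by (auto simp: f_def)
    ultimately show ?thesis
      using eq abs_int_imp unfolding X_def by (simp add: integral_restrict_Int integrable_restrict_Int Int_commute)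
  qed
  have "g integrable_on tail u"
  proof (rule conjunct1, rule monotone_convergence_increasing[where f = f])
    show "f n integrable_on tail u" for n using int' by blast
    show "f n x \<le> f (Suc n) x" for n x using tn(4)[OF u, of n "Suc n"] nonneg by (auto simp: f_def)
    show "(\<lambda>n. f n x) \<longlonglongrightarrow> g x" if "x \<in> tail u" for x
    proof -
      have "\<forall>\<^sub>F n in sequentially. f n x = g x"
      proof -
        have "\<forall>\<^sub>F n in sequentially. tn u n \<in> (if u < s then {x<..} else {..<x})"
          using that by (intro topological_tendstoD[OF tn(5)[OF u]]) (auto simp: tail_def split: if_splits)
        then show ?thesis
        proof eventually_elim
          case (elim n)
          then show ?case using that by (auto simp: f_def seg_def tail_def split: if_splits)
        qed
      qed
      then show ?thesis by (rule tendsto_eventually)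
    qed
    have "integral (tail u) (f n) \<in> {0..C}" for n
      using int'[of n] le[OF tn(1)[OF u]] abs_int_imp[OF gi[OF tn(1)[OF u, of n]]] nonneg by (auto intro: integral_nonneg)
    then show "bounded (range (\<lambda>n. integral (tail u) (f n)))"
      by (intro bounded_subset[OF bounded_closed_interval[of 0 C]]) (auto simp: cbox_interval)
  qed
  then have t: "g absolutely_integrable_on tail u"
    using nonneg by (intro nonnegative_absolutely_integrable_1) auto
  have "g absolutely_integrable_on (seg c u \<union> tail u)"
    using int[OF u] t by (intro set_integrable_Un) auto
  moreover have "D \<subseteq> seg c u \<union> tail u" using u cs by (auto simp: D_def S_def seg_def tail_def)
  ultimately show ?thesis by (rule set_integrable_subset[OF _ D_lebesgue])
qed

end

lemma convergent_subsequence_finite: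
  fixes a :: "nat \<Rightarrow> nat \<Rightarrow> complex"
  assumes "\<And>n k. k < m \<Longrightarrow> norm (a n k) \<le> 1"
  obtains r b where "strict_mono r" "\<And>k. k < m \<Longrightarrow> (\<lambda>n. a (r n) k) \<longlonglongrightarrow> b k"
proof -
  have "\<exists>r b. strict_mono (r :: nat \<Rightarrow> nat) \<and> (\<forall>k<m. (\<lambda>n. a (r n) k) \<longlonglongrightarrow> b k)"
    using assms
  proof (induction m)
    case 0
    show ?case by (rule exI[of _ id]) (simp add: strict_mono_def)
  next
    case (Suc m)
    have "\<exists>r b. strict_mono (r :: nat \<Rightarrow> nat) \<and> (\<forall>k<m. (\<lambda>n. a (r n) k) \<longlonglongrightarrow> b k)"
      by (rule Suc.IH) (simp add: Suc.prems)
    then obtain r b where r: "strict_mono (r :: nat \<Rightarrow> nat)" "\<forall>k<m. (\<lambda>n. a (r n) k) \<longlonglongrightarrow> b k" by blast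
    have "bounded (range (\<lambda>n. a (r n) m))"
      by (rule boundedI[of _ 1]) (auto simp: Suc.prems)
    then obtain l q where q: "strict_mono (q :: nat \<Rightarrow> nat)" "((\<lambda>n. a (r n) m) \<circ> q) \<longlonglongrightarrow> l"
      using bounded_imp_convergent_subsequence by blast
    have "(\<lambda>n. a ((r \<circ> q) n) k) \<longlonglongrightarrow> (b(m := l)) k" if "k < Suc m" for k
    proof (cases "k = m")
      case True
      then show ?thesis using q(2) by (simp add: o_def)
    next
      case False
      then have "(\<lambda>n. a (r n) k) \<longlonglongrightarrow> b k" using r(2) that by simp
      from LIMSEQ_subseq_LIMSEQ[OF this q(1)] show ?thesis using False by (simp add: o_def)
    qed
    moreover have "strict_mono (r \<circ> q)" using r(1) q(1) by (rule strict_mono_o)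
    ultimately show ?case by blast
  qed
  then show thesis using that by blast
qed

section \<open>Limits at the singular endpoint and criteria for square integrability\<close>

context canonical_side
begin

lemma s_notin_D [simp]: "s \<notin> D"
  by (simp add: D_def)

lemma filterlim_F:
  assumes "\<And>n. t n \<in> D" "t \<longlonglongrightarrow> s"
  shows "filterlim t F sequentially"
  unfolding F_def filterlim_at using assms s_notin_D by (metis (mono_tags, lifting) always_eventually)

lemma F_neq_bot: "F \<noteq> bot"
proof -
  have "s islimpt D"
    using islimpt_greaterThanLessThan1[of s c] islimpt_greaterThanLessThan2[of c s] cs
    by (cases "c < s") (auto simp: D_def)
  then show ?thesis by (simp add: F_def trivial_limit_within)
qed

lemma eventually_tail: "u \<in> S \<Longrightarrow> eventually (\<lambda>t. t \<in> tail u) F"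
proof -
  assume u: "u \<in> S"
  then have "u \<noteq> s" by auto
  then have "\<bar>u - s\<bar> > 0" by simp
  then show ?thesis
    unfolding F_def eventually_at
    using u by (intro exI[of _ "\<bar>u - s\<bar>"]) (auto simp: dist_real_def tail_def D_def S_def)
qed

lemma eventually_D: "eventually (\<lambda>t. t \<in> D) F"
  using eventually_tail[OF c_in_S] by eventually_elim (use tail_sub[OF c_in_S] in blast)

lemma filterlim_tn: "u \<in> S \<Longrightarrow> filterlim (tn u) F sequentially"
  using tn(2,5)[of u] by (intro filterlim_F) auto

lemma eventually_seq_tail:
  assumes "u \<in> S" "t \<longlonglongrightarrow> s" "\<And>n. t n \<in> D"
  shows "eventually (\<lambda>n. t n \<in> tail u) sequentially"
proof -
  have "filterlim t F sequentially" by (rule filterlim_F[OF assms(3,2)])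
  then show ?thesis using eventually_tail[OF assms(1)] by (rule eventually_compose_filterlim[rotated])
qed

text \<open>Orientation: \<open>sg\<close> times an integral over \<open>D\<close> is the oriented
  integral from \<open>c\<close> to \<open>s\<close>.\<close>

definition sg :: real where "sg = (if c < s then 1 else -1)"

lemma prim_limit:
  fixes y :: "real \<Rightarrow> 'b::euclidean_space"
  assumes y: "is_prim S y g" and g: "g absolutely_integrable_on D"
  shows "(y \<longlongrightarrow> y c + sg *\<^sub>R integral D g) F"
proof -
  define a b where "a = min c s" and "b = max c s"
  have ab: "D = {a<..<b}" "a \<le> b" by (auto simp: D_def a_def b_def)
  have gi: "g integrable_on {a..b}" and gI: "integral {a..b} g = integral D g"
    using abs_int_imp[OF g] integrable_on_open_interval[of g a b] integral_open_interval[of a b g]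
    by (simp_all add: ab box_real cbox_interval)
  show ?thesis
  proof (cases "c < s")
    case True
    then have c: "a = c" "b = s" by (auto simp: a_def b_def)
    have eq: "y t = y c + integral {c..t} g" if "t \<in> D" for t
    proof -
      have "c \<le> t" "{c..t} \<subseteq> S" using that True by (auto simp: D_def S_def)
      from is_primD(3)[OF y this] show ?thesis by (simp add: algebra_simps)
    qed
    have "continuous_on {c..s} (\<lambda>x. integral {c..x} g)" using indefinite_integral_continuous_1[OF gi] by (simp add: c)
    then have "((\<lambda>x. integral {c..x} g) \<longlongrightarrow> integral {c..s} g) (at s within {c..s})"
      using True by (simp add: continuous_on_def)
    then have "((\<lambda>x. integral {c..x} g) \<longlongrightarrow> integral D g) (at s within {c..s})"
      using gI by (simp add: c)
    then have "((\<lambda>x. integral {c..x} g) \<longlongrightarrow> integral D g) F"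
      unfolding F_def by (rule tendsto_within_subset) (auto simp: ab c)
    then have "((\<lambda>x. y c + integral {c..x} g) \<longlongrightarrow> y c + integral D g) F" by (intro tendsto_intros)
    then have "(y \<longlongrightarrow> y c + integral D g) F"
      by (rule Lim_transform_eventually) (rule eventually_mono[OF eventually_D], simp add: eq)
    then show ?thesis using True by (simp add: sg_def)
  next
    case False
    then have c: "a = s" "b = c" "s < c" using cs by (auto simp: a_def b_def)
    have eq: "y t = y c - integral {t..c} g" if "t \<in> D" for t
    proof -
      have "t \<le> c" "{t..c} \<subseteq> S" using that c by (auto simp: D_def S_def)
      from is_primD(3)[OF y this] show ?thesis by (simp add: algebra_simps)
    qed
    have "continuous_on {s..c} (\<lambda>x. integral {x..c} g)" using indefinite_integral_continuous_1'[OF gi] by (simp add: c)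
    then have "((\<lambda>x. integral {x..c} g) \<longlongrightarrow> integral {s..c} g) (at s within {s..c})"
      using c(3) by (simp add: continuous_on_def)
    then have "((\<lambda>x. integral {x..c} g) \<longlongrightarrow> integral D g) (at s within {s..c})"
      using gI by (simp add: c)
    then have "((\<lambda>x. integral {x..c} g) \<longlongrightarrow> integral D g) F"
      unfolding F_def by (rule tendsto_within_subset) (auto simp: ab c)
    then have "((\<lambda>x. y c - integral {x..c} g) \<longlongrightarrow> y c - integral D g) F" by (intro tendsto_intros)
    then have "(y \<longlongrightarrow> y c - integral D g) F"
      by (rule Lim_transform_eventually) (rule eventually_mono[OF eventually_D], simp add: eq)
    then show ?thesis using False by (simp add: sg_def)
  qed
qed

lemma tail_c: "tail c = D" by (simp add: tail_def D_def)

lemma sq_from_bound: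
  assumes "cont f" "u \<in> S" "\<And>t. t \<in> tail u \<Longrightarrow> integral (seg u t) (Q f) \<le> C"
  shows "sq f"
  unfolding sq_def
  using cont_imp_meas[OF assms(1)] abs_int_from_bound[OF assms(2) cont_Q_int[OF assms(1) c_in_S] Q_nonneg assms(3)] by blast

lemma integral_Q_le: "sq f \<Longrightarrow> u \<in> S \<Longrightarrow> v \<in> S \<Longrightarrow> integral (seg u v) (Q f) \<le> integral D (Q f)"
  unfolding sq_def by (intro integral_seg_le) auto

lemma chn_limit:
  assumes "chn v f" "sq f"
  obtains l where "((\<lambda>t. v t $ 2) \<longlongrightarrow> l) F"
  using prim_limit[OF conjunct2[OF assms(1)[unfolded chn_def]] sq_P1[OF assms(2)]] that by blast

definition "Bt t = integral (tail t) h1"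

lemma Bt_nonneg: "t \<in> S \<Longrightarrow> 0 \<le> Bt t"
  unfolding Bt_def using psd abs_int_tail[OF int_h1[folded D_def]] by (intro integral_nonneg) (auto intro: abs_int_imp)

text \<open>\<open>A\<close> does not decrease towards \<open>s\<close>, so the factor
  \<open>A t\<close> may be moved under the integral over the tail.\<close>

lemma A_Bt_le: "t \<in> D \<Longrightarrow> A t * Bt t \<le> kappa t"
proof -
  assume t: "t \<in> D"
  then have tS: "t \<in> S" using D_sub_S by blast
  have h1i: "h1 integrable_on tail t" using abs_int_tail[OF int_h1[folded D_def] tS] by (rule abs_int_imp)
  have "A t * Bt t = integral (tail t) (\<lambda>x. A t * h1 x)" by (simp add: Bt_def)
  also have "\<dots> \<le> integral (tail t) (\<lambda>x. A x * h1 x)"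
  proof (rule integral_le)
    show "(\<lambda>x. A t * h1 x) integrable_on tail t" using h1i by (rule integrable_on_mult_right)
    show "(\<lambda>x. A x * h1 x) integrable_on tail t" by (rule abs_int_imp[OF abs_int_tail[OF int_Ah1 tS]])
    fix x assume "x \<in> tail t"
    then have x: "x \<in> S" "t \<in> seg c x" using in_tail_iff[OF tS] D_sub_S by blast+
    then have "A t \<le> A x" unfolding A_def
      using int_seg[OF c_in_S x(1)] psd seg_mono(1)[OF x(2)] by (intro integral_seg_mono) auto
    then show "A t * h1 x \<le> A x * h1 x" using psd by (intro mult_right_mono) auto
  qed
  finally show ?thesis by (simp add: kappa_def)
qed

lemma kappa_mono: "t \<in> tail u \<Longrightarrow> u \<in> S \<Longrightarrow> kappa t \<le> kappa u"
proof -
  assume a: "t \<in> tail u" "u \<in> S"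
  then have tS: "t \<in> S" using tail_sub D_sub_S by blast
  have "tail t \<subseteq> tail u" using a(1) by (auto simp: tail_def)
  then show ?thesis unfolding kappa_def
    using abs_int_imp[OF abs_int_tail[OF int_Ah1 tS]] abs_int_imp[OF abs_int_tail[OF int_Ah1 a(2)]] tail_sub[OF a(2)] A_nonneg psd D_sub_S
    by (intro integral_subset_le) (auto intro!: mult_nonneg_nonneg)
qed

text \<open>The oscillation of the second component is measured from \<open>t\<close> to points
  tending to \<open>s\<close>, where the component vanishes. So it decays at least like the root of
  \<open>Bt\<close>, while the first component may grow like the root of \<open>A\<close>;
  \<open>A_Bt_le\<close> controls the product.\<close>

lemma chn_bounds:
  assumes v: "chn v f" and f: "sq f" and lim: "((\<lambda>t. v t $ 2) \<longlongrightarrow> 0) F" and t: "t \<in> D"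
  shows "(norm (v t $ 2))\<^sup>2 \<le> Bt t * integral D (Q f)"
    "(norm (v t $ 1))\<^sup>2 \<le> 2 * (norm (v c $ 1))\<^sup>2 + 2 * A t * integral D (Q f)"
proof -
  have tS: "t \<in> S" using t D_sub_S by blast
  have N: "0 \<le> integral D (Q f)" using f by (intro integral_nonneg) (auto simp: sq_def intro: abs_int_imp)
  have Qi: "Q f integrable_on seg x y" if "x \<in> S" "y \<in> S" for x y
    using f that by (auto simp: sq_def intro!: abs_int_imp abs_int_seg)
  have h1a: "h1 absolutely_integrable_on D" using int_h1 by (simp add: D_def)
  have "(norm (v (tn t n) $ 2 - v t $ 2))\<^sup>2 \<le> Bt t * integral D (Q f)" for n
  proof -
    have "(norm (v (tn t n) $ 2 - v t $ 2))\<^sup>2 \<le> integral (seg t (tn t n)) h1 * integral (seg t (tn t n)) (Q f)"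
      by (rule chn_oscillation(2)[OF v tS tn(3)[OF tS] Qi[OF tS tn(3)[OF tS]]])
    also have "\<dots> \<le> Bt t * integral D (Q f)"
      unfolding Bt_def using integral_Q_le[OF f tS tn(3)[OF tS]] integral_seg_le_tail[OF h1a psd(1) tS tn(1)[OF tS]] Bt_nonneg[OF tS]
        Qi[OF tS tn(3)[OF tS]]
      by (intro mult_mono) (auto simp: Bt_def intro: integral_nonneg)
    finally show ?thesis .
  qed
  moreover have "(\<lambda>n. (norm (v (tn t n) $ 2 - v t $ 2))\<^sup>2) \<longlonglongrightarrow> (norm (0 - v t $ 2))\<^sup>2"
    by (intro tendsto_intros filterlim_compose[OF lim filterlim_tn[OF tS]])
  ultimately have "(norm (0 - v t $ 2))\<^sup>2 \<le> Bt t * integral D (Q f)" by (intro LIMSEQ_le_const2) auto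
  then show "(norm (v t $ 2))\<^sup>2 \<le> Bt t * integral D (Q f)" by simp
  have "(norm (v t $ 1 - v c $ 1))\<^sup>2 \<le> A t * integral (seg c t) (Q f)"
    unfolding A_def by (rule chn_oscillation(1)[OF v c_in_S tS Qi[OF c_in_S tS]])
  also have "\<dots> \<le> A t * integral D (Q f)"
    by (intro mult_left_mono integral_Q_le f c_in_S tS A_nonneg)
  finally have d: "(norm (v t $ 1 - v c $ 1))\<^sup>2 \<le> A t * integral D (Q f)" .
  have "(norm (v t $ 1))\<^sup>2 \<le> (norm (v c $ 1) + norm (v t $ 1 - v c $ 1))\<^sup>2"
    by (intro power_mono norm_ge_zero) (metis add.commute diff_add_cancel norm_triangle_ineq)
  also have "\<dots> \<le> 2 * (norm (v c $ 1))\<^sup>2 + 2 * (norm (v t $ 1 - v c $ 1))\<^sup>2"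
    using zero_le_power2[of "norm (v c $ 1) - norm (v t $ 1 - v c $ 1)"] by (simp add: power2_eq_square algebra_simps)
  finally show "(norm (v t $ 1))\<^sup>2 \<le> 2 * (norm (v c $ 1))\<^sup>2 + 2 * A t * integral D (Q f)"
    using d by linarith
qed

lemma Q_e2: "Q (\<lambda>_. vector [0, k]) t = (norm k)\<^sup>2 * h2 t"
  by (simp add: Q_def)

text \<open>\<open>tail_estimate\<close> asks for a zero at \<open>t\<close>. Subtracting the
  constant vector with entries 0 and \<open>v t $ 2\<close> creates one and leaves the derivative
  unchanged. Adding it back costs \<open>A t\<close> times the squared modulus of
  \<open>v t $ 2\<close>, which stays bounded by \<open>A_Bt_le\<close>.\<close>

lemma chn_vanishing_imp_sq:
  assumes v: "chn v f" and f: "sq f" and lim: "((\<lambda>t. v t $ 2) \<longlongrightarrow> 0) F"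
  shows "sq v"
proof (rule sq_from_bound[OF chn_cont[OF v] c_in_S])
  fix t assume "t \<in> tail c"
  then have t: "t \<in> D" and tS: "t \<in> S" using D_sub_S by (auto simp: tail_c)
  define N where "N = integral D (Q f)"
  have N: "0 \<le> N" unfolding N_def using f by (intro integral_nonneg) (auto simp: sq_def intro: abs_int_imp)
  define x where "x = (\<lambda>r. v r - vector [0, v t $ 2])"
  have x: "chn x f" unfolding x_def using chn_diff[OF v chn_const[of "vector [0, v t $ 2]"]] by simp
  have Qf: "Q f absolutely_integrable_on seg c t" using f tS by (auto simp: sq_def intro: abs_int_seg)
  have "integral (seg c t) (Q x) \<le> 4 * m1 * (norm (x c $ 1))\<^sup>2 + 6 * kappa c * integral (seg c t) (Q f)"
    by (rule tail_estimate[OF x c_in_S]) (use t Qf in \<open>auto simp: tail_c x_def\<close>)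
  also have "\<dots> \<le> 4 * m1 * (norm (v c $ 1))\<^sup>2 + 6 * kappa c * N"
    unfolding N_def using integral_Q_le[OF f c_in_S tS] kappa_nonneg[OF c_in_S] by (auto simp: x_def intro!: mult_left_mono)
  finally have 1: "integral (seg c t) (Q x) \<le> 4 * m1 * (norm (v c $ 1))\<^sup>2 + 6 * kappa c * N" .
  have xi: "Q x integrable_on seg c t" and vi: "Q v integrable_on seg c t"
    by (intro abs_int_imp cont_Q_int chn_cont[OF x] chn_cont[OF v] c_in_S tS)+
  have h2i: "h2 integrable_on seg c t" using int_seg[OF c_in_S tS] by (auto intro: abs_int_imp)
  have "Q v r \<le> 2 * Q x r + (2 * (norm (v t $ 2))\<^sup>2) * h2 r" for r
    using Q_add_le[of x "\<lambda>_. vector [0, v t $ 2]" r] by (simp add: x_def Q_e2)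
  then have "integral (seg c t) (Q v) \<le> integral (seg c t) (\<lambda>r. 2 * Q x r + (2 * (norm (v t $ 2))\<^sup>2) * h2 r)"
    by (intro integral_le vi integrable_add integrable_on_mult_right xi h2i)
  also have "\<dots> = 2 * integral (seg c t) (Q x) + 2 * ((norm (v t $ 2))\<^sup>2 * A t)"
    using xi h2i by (subst integral_add) (auto simp: A_def integrable_on_mult_right)
  finally have 2: "integral (seg c t) (Q v) \<le> 2 * integral (seg c t) (Q x) + 2 * ((norm (v t $ 2))\<^sup>2 * A t)" .
  have "(norm (v t $ 2))\<^sup>2 * A t \<le> (Bt t * N) * A t"
    unfolding N_def by (intro mult_right_mono chn_bounds(1)[OF v f lim t] A_nonneg tS)
  also have "\<dots> = (A t * Bt t) * N" by simp
  also have "\<dots> \<le> kappa c * N"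
    using A_Bt_le[OF t] kappa_mono[of t c] t N by (intro mult_right_mono) (auto simp: tail_c)
  finally have "(norm (v t $ 2))\<^sup>2 * A t \<le> kappa c * N" .
  then have 3: "2 * ((norm (v t $ 2))\<^sup>2 * A t) \<le> 2 * (kappa c * N)" by (rule mult_left_mono) simp
  have "2 * integral (seg c t) (Q x) \<le> 2 * (4 * m1 * (norm (v c $ 1))\<^sup>2 + 6 * kappa c * N)"
    using 1 by (rule mult_left_mono) simp
  from order_trans[OF 2 add_mono[OF this 3]]
  show "integral (seg c t) (Q v) \<le> 2 * (4 * m1 * (norm (v c $ 1))\<^sup>2 + 6 * kappa c * N) + 2 * (kappa c * N)" .
qed

text \<open>The second component has some limit \<open>l\<close>, and after removal of the constant
  vector with entries 0 and \<open>l\<close> the function is square integrable. Hence so is this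
  vector, which forces \<open>l = 0\<close> because \<open>h2\<close> is not integrable.\<close>

lemma sq_imp_vanishing:
  assumes v: "chn v f" and f: "sq f" and "sq v"
  shows "((\<lambda>t. v t $ 2) \<longlongrightarrow> 0) F"
proof -
  obtain l where l: "((\<lambda>t. v t $ 2) \<longlongrightarrow> l) F" using chn_limit[OF v f] .
  define x where "x = (\<lambda>r. v r - vector [0, l])"
  have x: "chn x f" unfolding x_def using chn_diff[OF v chn_const[of "vector [0, l]"]] by simp
  have "((\<lambda>t. v t $ 2 - l) \<longlongrightarrow> l - l) F" by (intro tendsto_intros l)
  then have "sq x" by (intro chn_vanishing_imp_sq[OF x f]) (simp add: x_def)
  from sq_diff[OF assms(3) this] have k: "sq (\<lambda>_. vector [0, l])" by (simp add: x_def)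
  have "l = 0"
  proof (rule ccontr)
    assume "l \<noteq> 0"
    then have "(\<lambda>_::real. (1 / l) *s vector [0, l]) = (\<lambda>_. vector [0, 1] :: complex^2)"
      by (auto simp: fun_eq_iff vec_eq_iff forall_2)
    then show False using sq_scale[OF k, of "1 / l"] not_sq_e2 by simp
  qed
  then show ?thesis using l by simp
qed

lemma Q_sum_le:
  fixes m :: nat
  shows "Q (\<lambda>t. \<Sum>k<m. f k t) t \<le> 2 ^ m * (\<Sum>k<m. Q (f k) t)"
proof (induction m)
  case 0
  show ?case by (simp add: Q_def)
next
  case (Suc m)
  have "Q (\<lambda>t. \<Sum>k<Suc m. f k t) t \<le> 2 * Q (\<lambda>t. \<Sum>k<m. f k t) t + 2 * Q (f m) t"
    using Q_add_le[of "\<lambda>t. \<Sum>k<m. f k t" "f m" t] by simp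
  also have "\<dots> \<le> 2 * (2 ^ m * (\<Sum>k<m. Q (f k) t)) + 2 * (2 ^ m * Q (f m) t)"
    using Suc.IH mult_right_mono[of 1 "2 ^ m" "Q (f m) t"] by (intro add_mono mult_left_mono) auto
  also have "\<dots> = 2 ^ Suc m * (\<Sum>k<Suc m. Q (f k) t)" by (simp add: algebra_simps)
  finally show ?case .
qed

text \<open>Normalised coefficient vectors accumulate at some \<open>b\<close>, which is nonzero
  because one coefficient always has modulus 1. On a fixed segment the combination with
  \<open>b\<close> is close to one far along the sequence, whose bound reaches beyond this
  segment.\<close>

lemma sq_compactness:
  fixes m :: nat
  assumes e: "\<And>k. k < m \<Longrightarrow> cont (e k)" and u: "u \<in> S"
    and a: "\<And>n k. k < m \<Longrightarrow> norm (a n k) \<le> 1" "\<And>n. \<exists>k<m. norm (a n k) = 1"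
    and t: "\<And>n. t n \<in> D" "t \<longlonglongrightarrow> s"
    and C: "\<And>n. integral (seg u (t n)) (Q (\<lambda>x. \<Sum>k<m. a n k *s e k x)) \<le> C"
  obtains b where "\<exists>k<m. b k \<noteq> 0" "sq (\<lambda>x. \<Sum>k<m. b k *s e k x)"
proof -
  obtain r b where r: "strict_mono r" and b: "\<And>k. k < m \<Longrightarrow> (\<lambda>n. a (r n) k) \<longlonglongrightarrow> b k"
    using convergent_subsequence_finite[of m a] a(1) by blast
  have "\<exists>k<m. b k \<noteq> 0"
  proof -
    have "(\<lambda>n. \<Sum>k<m. norm (a (r n) k)) \<longlonglongrightarrow> (\<Sum>k<m. norm (b k))" by (intro tendsto_intros b) simp
    moreover have "1 \<le> (\<Sum>k<m. norm (a (r n) k))" for n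
    proof -
      obtain k where "k < m" "norm (a (r n) k) = 1" using a(2) by blast
      then show ?thesis using member_le_sum[of k "{..<m}" "\<lambda>k. norm (a (r n) k)"] by simp
    qed
    ultimately have "1 \<le> (\<Sum>k<m. norm (b k))" by (intro LIMSEQ_le_const) auto
    then show ?thesis by (metis (mono_tags, lifting) lessThan_iff norm_zero not_one_le_zero sum.neutral)
  qed
  moreover have "sq (\<lambda>x. \<Sum>k<m. b k *s e k x)"
  proof (rule sq_from_bound[OF _ u])
    show "cont (\<lambda>x. \<Sum>k<m. b k *s e k x)" by (intro cont_sum cont_scale e) simp
    fix \<tau> assume \<tau>: "\<tau> \<in> tail u"
    then have \<tau>S: "\<tau> \<in> S" using tail_sub[OF u] D_sub_S by blast
    \<comment> \<open>Bounds the effect of replacing \<open>a (r n)\<close> by its limit on the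
      fixed segment up to \<tau>.\<close>
    define w where "w n = 2 ^ m * (\<Sum>k<m. (norm (b k - a (r n) k))\<^sup>2 * integral (seg u \<tau>) (Q (e k)))" for n
    have "w \<longlonglongrightarrow> 2 ^ m * (\<Sum>k<m. (norm (b k - b k))\<^sup>2 * integral (seg u \<tau>) (Q (e k)))"
      unfolding w_def[abs_def] by (intro tendsto_intros b) simp
    then have "w \<longlonglongrightarrow> 0" by simp
    then have "eventually (\<lambda>n. w n < 1) sequentially" by (rule order_tendstoD) simp
    moreover have "(\<lambda>n. t (r n)) \<longlonglongrightarrow> s" using LIMSEQ_subseq_LIMSEQ[OF t(2) r] by (simp add: o_def)
    then have "eventually (\<lambda>n. t (r n) \<in> tail \<tau>) sequentially" using t(1) by (intro eventually_seq_tail[OF \<tau>S]) auto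
    ultimately have "eventually (\<lambda>n. w n < 1 \<and> t (r n) \<in> tail \<tau>) sequentially" by (rule eventually_conj)
    then obtain n where n: "w n < 1" "t (r n) \<in> tail \<tau>" by (auto dest: eventually_happens)
    define f where "f = (\<lambda>x. \<Sum>k<m. a (r n) k *s e k x)"
    define d where "d = (\<lambda>x. \<Sum>k<m. (b k - a (r n) k) *s e k x)"
    have tS: "t (r n) \<in> S" using t(1) D_sub_S by blast
    have cf: "cont f" and cd: "cont d" unfolding f_def d_def by (intro cont_sum cont_scale e; simp)+
    have "seg u \<tau> \<subseteq> seg u (t (r n))" using \<tau> n(2) by (auto simp: tail_def seg_def)
    then have 1: "integral (seg u \<tau>) (Q f) \<le> C"
      using C[of "r n"] integral_seg_mono[OF cont_Q_int[OF cf u tS] Q_nonneg] unfolding f_def by (meson order_trans)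
    have ei: "Q (e k) integrable_on seg u \<tau>" if "k < m" for k
      using that by (intro abs_int_imp cont_Q_int e u \<tau>S)
    have fi: "Q f integrable_on seg u \<tau>" "Q d integrable_on seg u \<tau>"
      by (intro abs_int_imp cont_Q_int cf cd u \<tau>S)+
    have "integral (seg u \<tau>) (Q d) \<le> integral (seg u \<tau>) (\<lambda>x. 2 ^ m * (\<Sum>k<m. (norm (b k - a (r n) k))\<^sup>2 * Q (e k) x))"
    proof (rule integral_le[OF fi(2)])
      show "(\<lambda>x. 2 ^ m * (\<Sum>k<m. (norm (b k - a (r n) k))\<^sup>2 * Q (e k) x)) integrable_on seg u \<tau>"
        by (intro integrable_on_mult_right integrable_sum ei) auto
      show "Q d x \<le> 2 ^ m * (\<Sum>k<m. (norm (b k - a (r n) k))\<^sup>2 * Q (e k) x)" for x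
        unfolding d_def using Q_sum_le[where m = m and f = "\<lambda>k x. (b k - a (r n) k) *s e k x" and t = x] by (simp only: Q_scale)
    qed
    also have "\<dots> = w n"
      unfolding w_def using ei by (subst integral_mult_right, subst integral_sum) (auto intro: integrable_on_mult_right)
    finally have 2: "integral (seg u \<tau>) (Q d) \<le> 1" using n(1) by simp
    have "(\<lambda>x. \<Sum>k<m. b k *s e k x) = (\<lambda>x. f x + d x)"
      by (simp add: f_def d_def sum.distrib[symmetric] vec_eq_iff fun_eq_iff algebra_simps)
    then have "integral (seg u \<tau>) (Q (\<lambda>x. \<Sum>k<m. b k *s e k x)) \<le> integral (seg u \<tau>) (\<lambda>x. 2 * Q f x + 2 * Q d x)"
      using Q_add_le cont_Q_int[OF cont_add[OF cf cd] u \<tau>S] fi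
      by (intro integral_le integrable_add integrable_on_mult_right) (auto intro: abs_int_imp)
    also have "\<dots> = 2 * integral (seg u \<tau>) (Q f) + 2 * integral (seg u \<tau>) (Q d)"
      using fi by (subst integral_add) (auto intro: integrable_on_mult_right)
    finally show "integral (seg u \<tau>) (Q (\<lambda>x. \<Sum>k<m. b k *s e k x)) \<le> 2 * C + 2" using 1 2 by simp
  qed
  ultimately show thesis using that by blast
qed

end

section \<open>Vanishing of the second components\<close>

text \<open>Splitting off a root \<open>x\<close>, each coefficient is one of the quotient, of lower
  degree, minus \<open>x\<close> times another. The condition \<open>d \<le> 1\<close> makes
  \<open>2 ^ n\<close> a common bound for all coefficients of the quotient, its leading one
  included.\<close>

lemma monic_poly_coeff_le:
  fixes p :: "complex poly"
  assumes "degree p = n" "lead_coeff p = 1" "0 < d" "d \<le> 1" "\<And>x. poly p x = 0 \<Longrightarrow> norm x < d" "i < n"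
  shows "norm (coeff p i) \<le> 2 ^ n * d"
  using assms
proof (induction n arbitrary: p i)
  case 0
  then show ?case by simp
next
  case (Suc n)
  have "\<not> constant (poly p)" using Suc.prems(1) by (simp add: constant_degree)
  then obtain x where x: "poly p x = 0" using fundamental_theorem_of_algebra by blast
  then obtain q where q: "p = [:- x, 1:] * q" by (metis dvdE poly_eq_0_iff_dvd)
  then have "q \<noteq> 0" using Suc.prems(2) by auto
  then have dq: "degree q = n" using Suc.prems(1) degree_mult_eq[of "[:- x, 1:]" q] unfolding q by simp
  have lq: "lead_coeff q = 1" using Suc.prems(2) lead_coeff_mult[of "[:- x, 1:]" q] unfolding q by simp
  have qr: "norm y < d" if "poly q y = 0" for y using Suc.prems(5)[of y] that unfolding q by simp
  have IH: "norm (coeff q j) \<le> 2 ^ n * d" if "j < n" for j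
    using Suc.IH[OF dq lq Suc.prems(3,4) qr that] by simp
  have le1: "norm (coeff q i) \<le> 2 ^ n"
  proof (cases "i = n")
    case True
    then show ?thesis using lq dq by simp
  next
    case False
    then have "norm (coeff q i) \<le> 2 ^ n * d" using Suc.prems(6) by (intro IH) simp
    also have "\<dots> \<le> 2 ^ n * 1" using Suc.prems(4) by (intro mult_left_mono) auto
    finally show ?thesis by simp
  qed
  have le2: "norm (case i of 0 \<Rightarrow> 0 | Suc j \<Rightarrow> coeff q j) \<le> 2 ^ n * d"
    using IH Suc.prems(3,6) by (auto split: nat.split)
  have "coeff p i = (case i of 0 \<Rightarrow> 0 | Suc j \<Rightarrow> coeff q j) - x * coeff q i"
    unfolding q by (auto simp: coeff_pCons split: nat.split)
  then have "norm (coeff p i) \<le> norm (case i of 0 \<Rightarrow> 0 | Suc j \<Rightarrow> coeff q j) + norm x * norm (coeff q i)"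
    by (metis norm_mult norm_triangle_ineq4)
  also have "\<dots> \<le> 2 ^ n * d + d * 2 ^ n"
    using le2 le1 Suc.prems(3) Suc.prems(5)[OF x] by (intro add_mono mult_mono) auto
  also have "\<dots> = 2 ^ Suc n * d" by simp
  finally show ?case .
qed

context canonical_side
begin

lemma eventually_F_E:
  assumes "eventually P F"
  obtains u where "u \<in> D" "\<And>t. t \<in> tail u \<Longrightarrow> P t"
proof -
  from assms obtain d where d: "d > 0" "\<And>t. t \<in> D \<Longrightarrow> t \<noteq> s \<Longrightarrow> dist t s < d \<Longrightarrow> P t"
    unfolding F_def eventually_at by blast
  have "eventually (\<lambda>n. dist (tn c n) s < d) sequentially" using tn(5)[OF c_in_S] d(1) by (rule tendstoD)
  then obtain n where n: "dist (tn c n) s < d" by (auto dest: eventually_happens)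
  show thesis
  proof (rule that[of "tn c n"])
    show "tn c n \<in> D" by (rule tn(2)[OF c_in_S])
    fix t assume t: "t \<in> tail (tn c n)"
    then have "t \<in> D" using tail_sub[OF tn(3)[OF c_in_S]] by blast
    moreover have "dist t s < d" using t n by (auto simp: tail_def dist_real_def)
    moreover have "t \<noteq> s" using calculation(1) s_notin_D by blast
    ultimately show "P t" by (intro d(2))
  qed
qed

lemma tail_mono: "t \<in> tail u \<Longrightarrow> tail t \<subseteq> tail u"
  by (auto simp: tail_def)

lemma kappa_small_eventually:
  assumes "e > 0" "eventually P F"
  obtains u where "u \<in> D" "kappa u < e" "\<And>t. t \<in> tail u \<Longrightarrow> P t"
proof -
  obtain u1 where u1: "u1 \<in> D" "kappa u1 < e" using kappa_small[OF assms(1)] .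
  obtain u2 where u2: "u2 \<in> D" "\<And>t. t \<in> tail u2 \<Longrightarrow> P t" using eventually_F_E[OF assms(2)] by blast
  have S: "u1 \<in> S" "u2 \<in> S" using u1 u2 D_sub_S by auto
  have "eventually (\<lambda>t. t \<in> tail u1 \<and> t \<in> tail u2) F" using eventually_tail S by (intro eventually_conj)
  then obtain u where u: "u \<in> tail u1" "u \<in> tail u2" using eventually_happens'[OF F_neq_bot] by blast
  show thesis
  proof (rule that[of u])
    show "u \<in> D" using u(1) tail_sub[OF S(1)] by blast
    show "kappa u < e" using kappa_mono[OF u(1) S(1)] u1 by simp
    show "P t" if "t \<in> tail u" for t using that tail_mono[OF u(2)] u2 by blast
  qed
qed

lemma not_eventually_seq:
  assumes "\<not> eventually P F" "u \<in> S"
  obtains t where "\<And>n. t n \<in> tail u" "t \<longlonglongrightarrow> s" "\<And>n. \<not> P (t n)"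
proof -
  have "\<exists>t. t \<in> tail (tn u n) \<and> \<not> P t" for n
  proof (rule ccontr)
    assume "\<nexists>t. t \<in> tail (tn u n) \<and> \<not> P t"
    then have "eventually P F" using eventually_tail[OF tn(3)[OF assms(2), of n]] by (auto elim: eventually_mono)
    then show False using assms(1) by blast
  qed
  then obtain t where t: "\<And>n. t n \<in> tail (tn u n)" "\<And>n. \<not> P (t n)" by metis
  show thesis
  proof (rule that[of t])
    show "t n \<in> tail u" for n using t(1)[of n] tail_mono[OF tn(1)[OF assms(2), of n]] by blast
    have "\<bar>t n - s\<bar> \<le> \<bar>tn u n - s\<bar>" for n using t(1)[of n] by (auto simp: tail_def)
    moreover have "(\<lambda>n. tn u n - s) \<longlonglongrightarrow> 0" using tn(5)[OF assms(2)] by (simp add: LIM_zero)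
    ultimately have "(\<lambda>n. t n - s) \<longlonglongrightarrow> 0"
      by (intro Lim_null_comparison[of "\<lambda>n. t n - s" "\<lambda>n. \<bar>tn u n - s\<bar>"] tendsto_rabs_zero) auto
    then show "t \<longlonglongrightarrow> s" by (rule LIM_zero_cancel)
    show "\<not> P (t n)" for n by (rule t(2))
  qed
qed

end

text \<open>\<open>N0\<close> is \<open>\<Delta>(H\<^sub>\<plusminus>)\<close>.\<close>

locale w_chain = canonical_side +
  fixes w :: "nat \<Rightarrow> real \<Rightarrow> complex^2" and N0 :: nat
  assumes w_0: "\<And>t. t \<in> S \<Longrightarrow> w 0 t = vector [0, 1]"
    and w_chn: "\<And>n. chn (w (Suc n)) (w n)"
    and w_c1: "\<And>n. w n c $ 1 = 0"
    and w_sq: "\<And>n. N0 \<le> n \<Longrightarrow> sq (w n)"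
    and w_minimal: "\<And>x m. (\<And>t. t \<in> S \<Longrightarrow> x 0 t = vector [0, 1]) \<Longrightarrow> (\<And>k. k < m \<Longrightarrow> chn (x (Suc k)) (x k))
        \<Longrightarrow> sq (x m) \<Longrightarrow> N0 \<le> m"
begin

text \<open>Gives \<open>w 0\<close> a right-hand side as well, so that sums over the whole chain
  need no case distinction.\<close>

definition wd :: "nat \<Rightarrow> real \<Rightarrow> complex^2" where "wd n = (if n = 0 then \<lambda>_. 0 else w (n - 1))"

lemma w_wd: "chn (w n) (wd n)"
proof (cases n)
  case 0
  have "chn (w 0) (\<lambda>_. 0)" by (rule chn_cong[OF chn_const[of "vector [0, 1]"]]) (simp_all add: w_0)
  then show ?thesis using 0 by (simp add: wd_def)
next
  case (Suc m)
  then show ?thesis using w_chn[of m] by (simp add: wd_def)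
qed

lemma w_cont: "cont (w n)"
  using chn_cont[OF w_wd] .

lemma N0_pos: "N0 > 0"
proof (rule ccontr)
  assume "\<not> N0 > 0"
  then have "sq (w 0)" using w_sq[of 0] by simp
  then have "sq (\<lambda>_. vector [0, 1])" by (rule sq_cong) (use w_0 D_sub_S in auto)
  then show False using not_sq_e2 by blast
qed

lemma w_combination_chn: "chn (\<lambda>t. \<Sum>k\<le>Suc i. b k *s w k t) (\<lambda>t. \<Sum>k\<le>i. b (Suc k) *s w k t)"
proof -
  have "chn (\<lambda>t. \<Sum>k\<le>Suc i. b k *s w k t) (\<lambda>t. \<Sum>k\<le>Suc i. b k *s wd k t)"
    by (intro chn_sum chn_scale w_wd)
  moreover have "(\<Sum>k\<le>Suc i. b k *s wd k t) = (\<Sum>k\<le>i. b (Suc k) *s w k t)" for t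
    by (subst sum.atMost_Suc_shift) (simp add: wd_def)
  ultimately show ?thesis by simp
qed

text \<open>Let \<open>p\<close> be the last index with nonzero coefficient. Dividing by
  \<open>a p\<close> and shifting the coefficients down yields a chain that leads in
  \<open>p\<close> steps from the vector with entries 0 and 1 to the given combination; minimality
  then gives \<open>N0 \<le> p\<close>.\<close>

lemma w_independent:
  assumes "m < N0" "j \<le> m" "a j \<noteq> 0"
  shows "\<not> sq (\<lambda>t. \<Sum>k\<le>m. a k *s w k t)"
proof
  assume sq: "sq (\<lambda>t. \<Sum>k\<le>m. a k *s w k t)"
  define p where "p = Max {k. k \<le> m \<and> a k \<noteq> 0}"
  have fin: "finite {k. k \<le> m \<and> a k \<noteq> 0}" by simp
  have "j \<in> {k. k \<le> m \<and> a k \<noteq> 0}" using assms by simp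
  then have "p \<in> {k. k \<le> m \<and> a k \<noteq> 0}" unfolding p_def by (intro Max_in[OF fin]) blast
  then have p: "p \<le> m" "a p \<noteq> 0" by auto
  have pm: "a k = 0" if "p < k" "k \<le> m" for k
  proof (rule ccontr)
    assume "a k \<noteq> 0"
    then have "k \<le> p" unfolding p_def using that(2) by (intro Max_ge[OF fin]) simp
    then show False using that(1) by simp
  qed
  have "(\<Sum>k\<le>m. a k *s w k t) = (\<Sum>k\<le>p. a k *s w k t)" for t
    using p pm by (intro sum.mono_neutral_right) auto
  then have sqp: "sq (\<lambda>t. \<Sum>k\<le>p. (a k / a p) *s w k t)"
    using sq_scale[OF sq, of "1 / a p"] by (simp add: vec.scale_sum_right)
  define x where "x i = (\<lambda>t. \<Sum>k\<le>i. (a (p - i + k) / a p) *s w k t)" for i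
  have "N0 \<le> p"
  proof (rule w_minimal[of x p])
    show "x 0 t = vector [0, 1]" if "t \<in> S" for t using that p by (simp add: x_def w_0)
    show "chn (x (Suc i)) (x i)" if "i < p" for i
      using w_combination_chn[of "\<lambda>k. a (p - Suc i + k) / a p" i] that unfolding x_def
      by (simp add: Suc_diff_Suc flip: add_Suc_right add_Suc)
    show "sq (x p)" using sqp by (simp add: x_def)
  qed
  then show False using p assms(1) by simp
qed

text \<open>If roots \<open>\<zeta>\<close> stayed away from \<open>0\<close> along some \<open>t n \<longlonglongrightarrow> s\<close>, then \<open>U = \<Sum> \<zeta>\<^sup>N\<^sup>0\<^sup>-\<^sup>k w\<^sub>k\<close>, whose second
  component vanishes at \<open>t n\<close>, would bound \<open>V = \<Sum> \<zeta>\<^sup>N\<^sup>0\<^sup>-\<^sup>1\<^sup>-\<^sup>k w\<^sub>k\<close> up to \<open>t n\<close>, since \<open>\<zeta> V = U - w\<^sub>N\<^sub>0\<close> and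
  \<open>U' = JHV\<close>. Compactness then yields a nontrivial square integrable combination of \<open>w\<^sub>0, \<dots>\<close> of
  length \<open>N0\<close>.\<close>

lemma w_roots_small:
  assumes "\<delta> > 0"
  shows "eventually (\<lambda>t. \<forall>\<zeta>. (\<Sum>k\<le>N0. \<zeta> ^ (N0 - k) * w k t $ 2) = 0 \<longrightarrow> norm \<zeta> < \<delta>) F"
proof (rule ccontr)
  define P where "P t = (\<forall>\<zeta>. (\<Sum>k\<le>N0. \<zeta> ^ (N0 - k) * w k t $ 2) = 0 \<longrightarrow> norm \<zeta> < \<delta>)" for t
  assume "\<not> eventually (\<lambda>t. \<forall>\<zeta>. (\<Sum>k\<le>N0. \<zeta> ^ (N0 - k) * w k t $ 2) = 0 \<longrightarrow> norm \<zeta> < \<delta>) F"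
  then have nP: "\<not> eventually P F" by (simp add: P_def[abs_def])
  \<comment> \<open>With this bound \<open>12 * kappa u\<close> is at most half of the squared
    modulus of \<zeta>, so that the term with \<open>IV\<close> can be absorbed.\<close>
  obtain u where u: "u \<in> D" "kappa u < \<delta>\<^sup>2 / 24" using kappa_small[of "\<delta>\<^sup>2 / 24"] assms by auto
  have uS: "u \<in> S" using u D_sub_S by blast
  obtain t where t: "\<And>n. t n \<in> tail u" "t \<longlonglongrightarrow> s" "\<And>n. \<not> P (t n)" using not_eventually_seq[OF nP uS] by blast
  have tD: "t n \<in> D" "t n \<in> S" for n using t(1)[of n] tail_sub[OF uS] D_sub_S by auto
  obtain \<zeta> where \<zeta>: "\<And>n. (\<Sum>k\<le>N0. \<zeta> n ^ (N0 - k) * w k (t n) $ 2) = 0" "\<And>n. \<delta> \<le> norm (\<zeta> n)"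
    using t(3) unfolding P_def by (metis linorder_not_less)
  \<comment> \<open>The largest modulus among the coefficients of \<open>V\<close>, whether \<zeta>
    is small or unbounded. After division by it one coefficient has modulus exactly 1.\<close>
  define M where "M n = max 1 (norm (\<zeta> n) ^ (N0 - 1))" for n
  have M: "1 \<le> M n" for n by (simp add: M_def)
  define a where "a n k = \<zeta> n ^ (N0 - 1 - k) / of_real (M n)" for n k
  define W where "W = integral D (Q (w N0))"
  define C0 where "C0 = (norm (w N0 u $ 1))\<^sup>2"
  define Cw where "Cw = (\<Sum>k<N0. norm (w k u $ 1))"
  have W: "0 \<le> W" unfolding W_def using w_sq[of N0] by (intro integral_nonneg) (auto simp: sq_def intro: abs_int_imp)
  have Cw: "0 \<le> Cw" unfolding Cw_def by (intro sum_nonneg) simp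
  have pow_le: "norm (\<zeta> n) ^ j \<le> M n" if "j \<le> N0 - 1" for n j
  proof (cases "norm (\<zeta> n) \<le> 1")
    case True
    then show ?thesis using M[of n] power_le_one[of "norm (\<zeta> n)" j] by simp
  next
    case False
    then have "norm (\<zeta> n) ^ j \<le> norm (\<zeta> n) ^ (N0 - 1)" using that by (intro power_increasing) auto
    then show ?thesis by (simp add: M_def)
  qed
  have bound: "integral (seg u (t n)) (Q (\<lambda>x. \<Sum>k<N0. a n k *s w k x))
      \<le> 32 * m1 * Cw\<^sup>2 + (32 * m1 * C0 + 4 * W) / \<delta>\<^sup>2" for n
  proof -
    define z where "z = \<zeta> n"
    have z: "\<delta> \<le> norm z" "0 < norm z" using \<zeta>(2)[of n] assms by (auto simp: z_def)
    define V where "V = (\<lambda>x. \<Sum>k<N0. z ^ (N0 - 1 - k) *s w k x)"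
    define U where "U = (\<lambda>x. \<Sum>k\<le>N0. z ^ (N0 - k) *s w k x)"
    obtain N1 where N1: "N0 = Suc N1" using N0_pos by (cases N0) auto
    have UV: "chn U V"
      using w_combination_chn[of "\<lambda>k. z ^ (N0 - k)" N1] unfolding U_def V_def N1 by (simp add: lessThan_Suc_atMost)
    have zV: "z *s V x = U x - w N0 x" for x
    proof -
      have "U x = (\<Sum>k<N0. z ^ (N0 - k) *s w k x) + w N0 x"
        unfolding U_def by (simp add: lessThan_Suc_atMost[symmetric])
      also have "(\<Sum>k<N0. z ^ (N0 - k) *s w k x) = (\<Sum>k<N0. z *s (z ^ (N0 - 1 - k) *s w k x))"
        by (intro sum.cong refl) (auto simp: N1 Suc_diff_le)
      finally show ?thesis by (simp add: V_def vec.scale_sum_right)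
    qed
    have contV: "cont V" unfolding V_def by (intro cont_sum cont_scale w_cont)
    have contU: "cont U" by (rule chn_cont[OF UV])
    define IV where "IV = integral (seg u (t n)) (Q V)"
    have U2: "U (t n) $ 2 = 0" using \<zeta>(1)[of n] by (simp add: U_def z_def)
    have QV: "Q V absolutely_integrable_on seg u (t n)" by (rule cont_Q_int[OF contV uS tD(2)])
    have QU: "Q U absolutely_integrable_on seg u (t n)" by (rule cont_Q_int[OF contU uS tD(2)])
    have Qw: "Q (w N0) absolutely_integrable_on seg u (t n)" by (rule cont_Q_int[OF w_cont uS tD(2)])
    have IV: "0 \<le> IV" unfolding IV_def using QV by (intro integral_nonneg) (auto intro: abs_int_imp)
    have 1: "integral (seg u (t n)) (Q U) \<le> 4 * m1 * (norm (U u $ 1))\<^sup>2 + 6 * kappa u * IV"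
      unfolding IV_def by (rule tail_estimate[OF UV uS t(1) U2 QV])
    have "(norm z)\<^sup>2 * Q V x \<le> 2 * Q U x + 2 * Q (w N0) x" for x
      using Q_diff_le[of U "w N0" x] Q_scale[of z V x] zV by simp
    then have "integral (seg u (t n)) (\<lambda>x. (norm z)\<^sup>2 * Q V x) \<le> integral (seg u (t n)) (\<lambda>x. 2 * Q U x + 2 * Q (w N0) x)"
      using QV QU Qw by (intro integral_le integrable_add integrable_on_mult_right) (auto intro: abs_int_imp)
    also have "\<dots> = 2 * integral (seg u (t n)) (Q U) + 2 * integral (seg u (t n)) (Q (w N0))"
      using QU Qw by (subst integral_add) (auto intro!: integrable_on_mult_right intro: abs_int_imp)
    finally have 2: "(norm z)\<^sup>2 * IV \<le> 2 * integral (seg u (t n)) (Q U) + 2 * integral (seg u (t n)) (Q (w N0))"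
      unfolding IV_def by simp
    have 3: "integral (seg u (t n)) (Q (w N0)) \<le> W"
      unfolding W_def by (rule integral_Q_le[OF w_sq uS tD(2)]) simp
    have 4: "12 * kappa u * IV \<le> (norm z)\<^sup>2 / 2 * IV"
    proof (rule mult_right_mono[OF _ IV])
      have "12 * kappa u \<le> \<delta>\<^sup>2 / 2" using u(2) by simp
      also have "\<dots> \<le> (norm z)\<^sup>2 / 2" using z assms by (auto intro!: power_mono)
      finally show "12 * kappa u \<le> (norm z)\<^sup>2 / 2" .
    qed
    have 5: "(norm (U u $ 1))\<^sup>2 \<le> 2 * (norm z)\<^sup>2 * (norm (V u $ 1))\<^sup>2 + 2 * C0"
    proof -
      have "U u $ 1 = z * V u $ 1 + w N0 u $ 1" using zV[of u] by (simp add: vec_eq_iff forall_2)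
      then have "(norm (U u $ 1))\<^sup>2 \<le> (norm z * norm (V u $ 1) + norm (w N0 u $ 1))\<^sup>2"
        by (intro power_mono norm_ge_zero) (metis norm_mult norm_triangle_ineq)
      also have "\<dots> \<le> 2 * (norm z * norm (V u $ 1))\<^sup>2 + 2 * C0"
        unfolding C0_def using zero_le_power2[of "norm z * norm (V u $ 1) - norm (w N0 u $ 1)"]
        by (simp add: power2_eq_square algebra_simps)
      finally show ?thesis by (simp add: power_mult_distrib)
    qed
    have 6: "norm (V u $ 1) \<le> M n * Cw"
    proof -
      have "norm (V u $ 1) \<le> (\<Sum>k<N0. norm (z ^ (N0 - 1 - k) * w k u $ 1))"
        unfolding V_def by (simp add: norm_sum)
      also have "\<dots> \<le> (\<Sum>k<N0. M n * norm (w k u $ 1))"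
        unfolding norm_mult norm_power z_def by (intro sum_mono mult_right_mono pow_le) auto
      finally show ?thesis by (simp add: Cw_def sum_distrib_left)
    qed
    have "(norm z)\<^sup>2 * IV \<le> 2 * (4 * m1 * (norm (U u $ 1))\<^sup>2 + 6 * kappa u * IV) + 2 * W"
      using 1 2 3 by argo
    also have "\<dots> \<le> 8 * m1 * (2 * (norm z)\<^sup>2 * (norm (V u $ 1))\<^sup>2 + 2 * C0) + (norm z)\<^sup>2 / 2 * IV + 2 * W"
    proof -
      have "8 * m1 * (norm (U u $ 1))\<^sup>2 \<le> 8 * m1 * (2 * (norm z)\<^sup>2 * (norm (V u $ 1))\<^sup>2 + 2 * C0)"
        using 5 m1_nonneg by (intro mult_left_mono) auto
      then show ?thesis using 4 by (simp add: algebra_simps)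
    qed
    finally have "(norm z)\<^sup>2 * IV \<le> (norm z)\<^sup>2 * (32 * m1 * (norm (V u $ 1))\<^sup>2) + (32 * m1 * C0 + 4 * W)"
      by (simp add: algebra_simps)
    then have "IV \<le> 32 * m1 * (norm (V u $ 1))\<^sup>2 + (32 * m1 * C0 + 4 * W) / (norm z)\<^sup>2"
      using z(2) by (simp add: field_simps)
    also have "\<dots> \<le> 32 * m1 * (M n * Cw)\<^sup>2 + (32 * m1 * C0 + 4 * W) / \<delta>\<^sup>2"
      using 6 m1_nonneg W z assms by (intro add_mono mult_left_mono power_mono divide_left_mono) (auto simp: C0_def)
    also have "\<dots> \<le> (M n)\<^sup>2 * (32 * m1 * Cw\<^sup>2 + (32 * m1 * C0 + 4 * W) / \<delta>\<^sup>2)"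
    proof -
      have "1 * ((32 * m1 * C0 + 4 * W) / \<delta>\<^sup>2) \<le> (M n)\<^sup>2 * ((32 * m1 * C0 + 4 * W) / \<delta>\<^sup>2)"
        using M[of n] m1_nonneg W by (intro mult_right_mono) (auto simp: C0_def one_le_power)
      then show ?thesis by (simp add: power_mult_distrib distrib_left mult_ac)
    qed
    finally have 7: "IV \<le> (M n)\<^sup>2 * (32 * m1 * Cw\<^sup>2 + (32 * m1 * C0 + 4 * W) / \<delta>\<^sup>2)" .
    have "(\<lambda>x. \<Sum>k<N0. a n k *s w k x) = (\<lambda>x. (1 / of_real (M n)) *s V x)"
      unfolding V_def a_def z_def by (simp add: vec.scale_sum_right)
    then have "integral (seg u (t n)) (Q (\<lambda>x. \<Sum>k<N0. a n k *s w k x)) = IV / (M n)\<^sup>2"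
      unfolding IV_def using M[of n] by (simp add: Q_scale[abs_def] norm_divide power_divide)
    also have "\<dots> \<le> 32 * m1 * Cw\<^sup>2 + (32 * m1 * C0 + 4 * W) / \<delta>\<^sup>2"
      using 7 M[of n] by (simp add: pos_divide_le_eq mult.commute)
    finally show ?thesis .
  qed
  have a1: "norm (a n k) \<le> 1" if "k < N0" for n k
    using pow_le[of "N0 - 1 - k" n] M[of n] by (simp add: a_def norm_divide norm_power)
  have a2: "\<exists>k<N0. norm (a n k) = 1" for n
  proof (cases "norm (\<zeta> n) ^ (N0 - 1) \<le> 1")
    case True
    then have "M n = 1" by (simp add: M_def)
    then show ?thesis using N0_pos by (intro exI[of _ "N0 - 1"]) (simp add: a_def)
  next
    case False
    then have "M n = norm (\<zeta> n) ^ (N0 - 1)" by (simp add: M_def)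
    moreover have "\<zeta> n \<noteq> 0" using \<zeta>(2)[of n] assms by auto
    ultimately show ?thesis using N0_pos by (intro exI[of _ 0]) (simp add: a_def norm_divide norm_power)
  qed
  obtain b where b: "\<exists>k<N0. b k \<noteq> 0" "sq (\<lambda>x. \<Sum>k<N0. b k *s w k x)"
    using sq_compactness[of N0 w u a t, OF w_cont uS a1 a2 tD(1) t(2) bound] by blast
  obtain N1 where N1: "N0 = Suc N1" using N0_pos by (cases N0) auto
  show False using b w_independent[of N1 _ b] by (auto simp: N1 lessThan_Suc_atMost less_Suc_eq_le)
qed

text \<open>For \<open>n \<le> N0\<close> the numbers \<open>w n t $ 2\<close> are coefficients of the monic polynomial whose roots
  are small by \<open>w_roots_small\<close>.\<close>

lemma w_vanishing:
  assumes "n > 0"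
  shows "((\<lambda>t. w n t $ 2) \<longlongrightarrow> 0) F"
proof (cases "n > N0")
  case True
  \<comment> \<open>Here \<open>w n\<close> and its right-hand side \<open>w m\<close> are both
    square integrable.\<close>
  then obtain m where m: "n = Suc m" "N0 \<le> m" by (cases n) auto
  show ?thesis unfolding m(1) using m by (intro sq_imp_vanishing[OF w_chn] w_sq) auto
next
  case False
  show ?thesis
  proof (rule tendstoI)
    fix e :: real assume e: "e > 0"
    define \<delta> where "\<delta> = min 1 (e / (2 * 2 ^ N0))"
    have \<delta>: "0 < \<delta>" "\<delta> \<le> 1" "2 ^ N0 * \<delta> < e"
    proof -
      show "0 < \<delta>" "\<delta> \<le> 1" using e by (auto simp: \<delta>_def)
      have "2 ^ N0 * \<delta> \<le> 2 ^ N0 * (e / (2 * 2 ^ N0))" by (intro mult_left_mono) (auto simp: \<delta>_def)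
      also have "\<dots> < e" using e by simp
      finally show "2 ^ N0 * \<delta> < e" .
    qed
    show "eventually (\<lambda>t. dist (w n t $ 2) 0 < e) F"
      using w_roots_small[OF \<delta>(1)] eventually_D
    proof eventually_elim
      case (elim t)
      define p where "p = (\<Sum>k\<le>N0. monom (w k t $ 2) (N0 - k))"
      have poly_p: "poly p x = (\<Sum>k\<le>N0. x ^ (N0 - k) * w k t $ 2)" for x
        by (simp add: p_def poly_sum poly_monom mult.commute)
      have coeff_p: "coeff p i = w (N0 - i) t $ 2" if "i \<le> N0" for i
      proof -
        have "coeff p i = (\<Sum>k\<le>N0. if k = N0 - i then w k t $ 2 else 0)"
          unfolding p_def coeff_sum using that by (intro sum.cong) auto
        then show ?thesis by simp
      qed
      have "w 0 t = vector [0, 1]" using elim(2) D_sub_S by (intro w_0) auto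
      then have c1: "coeff p N0 = 1" using coeff_p[of N0] by simp
      moreover have "degree p \<le> N0" unfolding p_def by (intro degree_sum_le) (auto intro: order_trans[OF degree_monom_le])
      ultimately have deg: "degree p = N0" using le_degree[of p N0] by simp
      have "norm (coeff p (N0 - n)) \<le> 2 ^ N0 * \<delta>"
        using elim(1) assms False by (intro monic_poly_coeff_le[OF deg] \<delta>) (auto simp: deg c1 poly_p)
      then show ?case using coeff_p[of "N0 - n"] False \<delta>(3) by simp
    qed
  qed
qed

end

section \<open>Regularised boundary values\<close>

text \<open>The shift from (n, j) to (n - 1, j + 1) keeps n + j, so it respects the bound
  \<open>j \<le> 2 * m - n\<close>. Only the edge \<open>j = m + 1\<close> survives. This is the
  reason for the upper summation limit in \<open>Gamma_s\<close>.\<close>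

lemma double_sum_telescope:
  fixes g :: "nat \<Rightarrow> nat \<Rightarrow> 'a::ab_group_add"
  shows "(\<Sum>n\<le>m. \<Sum>j=m+1..2*m-n. (if n = 0 then 0 else g (n - 1) (j + 1)) - g n j) = - (\<Sum>n<m. g n (m + 1))"
proof -
  define R where "R n = (\<Sum>j=m+1..2*m-n. g n j)" for n
  have step: "(\<Sum>j=m+1..2*m-Suc n. g n (j + 1)) = R n - g n (m + 1)" if "n < m" for n
  proof -
    have "(\<Sum>j=m+1..2*m-Suc n. g n (j + 1)) = (\<Sum>j=Suc (m+1)..Suc (2*m-Suc n). g n j)"
      by (subst sum.shift_bounds_cl_Suc_ivl) simp
    also have "Suc (2*m-Suc n) = 2*m-n" using that by simp
    finally show ?thesis
      unfolding R_def using that by (subst (2) sum.atLeast_Suc_atMost) auto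
  qed
  have "(\<Sum>n\<le>m. \<Sum>j=m+1..2*m-n. (if n = 0 then 0 else g (n - 1) (j + 1)) - g n j)
      = (\<Sum>n\<le>m. (\<Sum>j=m+1..2*m-n. (if n = 0 then 0 else g (n - 1) (j + 1)))) - (\<Sum>n\<le>m. R n)"
    by (simp add: sum_subtractf R_def)
  also have "(\<Sum>n\<le>m. (\<Sum>j=m+1..2*m-n. (if n = 0 then 0 else g (n - 1) (j + 1))))
      = (\<Sum>n<m. \<Sum>j=m+1..2*m-Suc n. g n (j + 1))"
    by (subst sum.atMost_shift) simp
  also have "\<dots> = (\<Sum>n<m. R n - g n (m + 1))" by (intro sum.cong refl step) simp
  also have "(\<Sum>n\<le>m. R n) = (\<Sum>n<m. R n) + R m" by (simp add: lessThan_Suc_atMost[symmetric])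
  finally show ?thesis by (simp add: sum_subtractf R_def)
qed

section \<open>Wronskians and their limits\<close>

context canonical_side
begin

text \<open>The bilinear form with matrix \<open>J\<close>, without conjugation. For functions
  \<open>w n\<close> with real values it agrees with the pairing
  \<open>cdot (w n x) (J *v y x)\<close> in \<open>Gamma_s\<close>.\<close>

definition wron :: "(real \<Rightarrow> complex^2) \<Rightarrow> (real \<Rightarrow> complex^2) \<Rightarrow> real \<Rightarrow> complex" where
  "wron f g t = f t $ 2 * g t $ 1 - f t $ 1 * g t $ 2"

lemma Bf_commute: "Bf f g t = Bf g f t"
  by (simp add: Bf_def P1_def P2_def algebra_simps)

lemma Bf_linear:
  "Bf (\<lambda>t. f t + g t) x t = Bf f x t + Bf g x t" "Bf x (\<lambda>t. f t + g t) t = Bf x f t + Bf x g t"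
  "Bf (\<lambda>t. f t - g t) x t = Bf f x t - Bf g x t" "Bf x (\<lambda>t. f t - g t) t = Bf x f t - Bf x g t"
  "Bf (\<lambda>t. k *s f t) x t = k * Bf f x t" "Bf x (\<lambda>t. k *s f t) t = k * Bf x f t"
  "Bf (\<lambda>t. 0) x t = 0" "Bf x (\<lambda>t. 0) t = 0"
  by (simp_all add: Bf_def P1_def P2_def algebra_simps)

lemma Bf_sum:
  "Bf (\<lambda>t. \<Sum>i\<in>I. f i t) x t = (\<Sum>i\<in>I. Bf (f i) x t)" "Bf x (\<lambda>t. \<Sum>i\<in>I. f i t) t = (\<Sum>i\<in>I. Bf x (f i) t)"
  by (simp_all add: Bf_def P_sum sum.distrib sum_distrib_left sum_distrib_right)

lemma wron_linear:
  "wron (\<lambda>t. f t + g t) x t = wron f x t + wron g x t" "wron x (\<lambda>t. f t + g t) t = wron x f t + wron x g t"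
  "wron (\<lambda>t. f t - g t) x t = wron f x t - wron g x t" "wron x (\<lambda>t. f t - g t) t = wron x f t - wron x g t"
  "wron (\<lambda>t. k *s f t) x t = k * wron f x t" "wron x (\<lambda>t. k *s f t) t = k * wron x f t"
  by (simp_all add: wron_def algebra_simps)

lemma wron_sum:
  "wron (\<lambda>t. \<Sum>i\<in>I. f i t) x t = (\<Sum>i\<in>I. wron (f i) x t)" "wron x (\<lambda>t. \<Sum>i\<in>I. f i t) t = (\<Sum>i\<in>I. wron x (f i) t)"
  by (simp_all add: wron_def sum_distrib_left sum_distrib_right sum_subtractf)

text \<open>Lagrange identity: the factors \<open>J\<close> from the form and from the two equations
  cancel up to sign.\<close>

lemma wron_prim:
  assumes "chn f f'" "chn g g'"
  shows "is_prim S (wron f g) (\<lambda>t. Bf f' g t - Bf f g' t)"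
proof -
  note f = assms(1)[unfolded chn_def] and g = assms(2)[unfolded chn_def]
  have "is_prim S (\<lambda>t. f t $ 2 * g t $ 1 - f t $ 1 * g t $ 2)
     (\<lambda>t. (f t $ 2 * - P2 g' t + P1 f' t * g t $ 1) - (f t $ 1 * P1 g' t + - P2 f' t * g t $ 2))"
    using f g interval_S by (intro is_prim_diff is_prim_mult) auto
  then show ?thesis
    by (rule is_prim_cong) (simp_all add: wron_def Bf_def P1_def P2_def algebra_simps)
qed

lemma wron_solutions_const:
  assumes "chn y (\<lambda>t. z *s y t)" "chn x (\<lambda>t. z *s x t)" "t \<in> S" "u \<in> S"
  shows "wron y x t = wron y x u"
proof (rule is_prim_zero_imp_eq[OF _ interval_S assms(3,4)])
  show "is_prim S (wron y x) (\<lambda>_. 0)"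
    by (rule is_prim_cong[OF wron_prim[OF assms(1,2)]]) (simp_all add: Bf_linear)
qed

text \<open>Each product of a second with a first component tends to 0: its squared modulus is at
  most a constant times \<open>Bt t + A t * Bt t\<close>, and both summands vanish at
  \<open>s\<close>.\<close>

lemma wron_vanishing:
  assumes "chn v f" "sq f" "sq v" "chn x g" "sq g" "sq x"
  shows "((\<lambda>t. wron v x t) \<longlongrightarrow> 0) F"
proof -
  have half: "((\<lambda>t. v t $ 2 * x t $ 1) \<longlongrightarrow> 0) F"
    if "chn v f" "sq f" "sq v" "chn x g" "sq g" "sq x" for v f x g
  proof (rule tendstoI)
    define N1 where "N1 = integral D (Q f)"
    define N2 where "N2 = integral D (Q g)"
    have N: "0 \<le> N1" "0 \<le> N2" unfolding N1_def N2_def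
      using that(2,5) by (auto intro!: integral_nonneg simp: sq_def intro: abs_int_imp)
    define K where "K = 2 * (norm (x c $ 1))\<^sup>2 * N1 + 2 * N1 * N2 + 1"
    have "2 * (norm (x c $ 1))\<^sup>2 * N1 \<ge> 0" "2 * N1 * N2 \<ge> 0" using N by simp_all
    then have K: "K > 0" "2 * (norm (x c $ 1))\<^sup>2 * N1 \<le> K" "2 * N1 * N2 \<le> K"
      unfolding K_def by linarith+
    fix e :: real assume e: "e > 0"
    define e' where "e' = e\<^sup>2 / (2 * K)"
    have e': "e' > 0" using e K by (simp add: e'_def)
    obtain u1 where u1: "u1 \<in> D" "kappa u1 < e'" using kappa_small[OF e'] .
    obtain u2 where u2: "u2 \<in> D" "integral (tail u2) (\<lambda>x. norm (h1 x)) < e'"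
      using tail_integral_small[OF int_h1[folded D_def] e'] .
    have S: "u1 \<in> S" "u2 \<in> S" using u1 u2 D_sub_S by auto
    show "eventually (\<lambda>t. dist (v t $ 2 * x t $ 1) 0 < e) F"
      using eventually_tail[OF S(1)] eventually_tail[OF S(2)] eventually_D
    proof eventually_elim
      case (elim t)
      then have tS: "t \<in> S" using D_sub_S by blast
      have 1: "A t * Bt t < e'" using A_Bt_le[OF elim(3)] kappa_mono[OF elim(1) S(1)] u1(2) by linarith
      have "Bt t \<le> integral (tail u2) h1" unfolding Bt_def
        using tail_mono[OF elim(2)] psd abs_int_tail[OF int_h1[folded D_def]] S(2) tS
        by (intro integral_subset_le) (auto intro: abs_int_imp)
      then have 2: "Bt t < e'" using u2(2) psd by simp
      have "(norm (v t $ 2 * x t $ 1))\<^sup>2 = (norm (v t $ 2))\<^sup>2 * (norm (x t $ 1))\<^sup>2"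
        by (simp add: norm_mult power_mult_distrib)
      also have "\<dots> \<le> (Bt t * N1) * (2 * (norm (x c $ 1))\<^sup>2 + 2 * A t * N2)"
        unfolding N1_def N2_def
        using chn_bounds(1)[OF that(1,2) sq_imp_vanishing[OF that(1-3)] elim(3)]
          chn_bounds(2)[OF that(4,5) sq_imp_vanishing[OF that(4-6)] elim(3)] Bt_nonneg[OF tS] N
        by (intro mult_mono) (auto simp: N1_def)
      also have "\<dots> = (2 * (norm (x c $ 1))\<^sup>2 * N1) * Bt t + (2 * N1 * N2) * (A t * Bt t)"
        by (simp add: algebra_simps)
      also have "\<dots> \<le> K * Bt t + K * (A t * Bt t)"
        using K Bt_nonneg[OF tS] A_nonneg[OF tS] by (intro add_mono mult_right_mono) auto
      also have "\<dots> < K * e' + K * e'"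
        using 1 2 K by (intro add_strict_mono mult_strict_left_mono)
      also have "\<dots> = e\<^sup>2" using K by (simp add: e'_def field_simps)
      finally have "norm (v t $ 2 * x t $ 1) < e" using e by (simp add: power2_less_imp_less)
      then show ?case by simp
    qed
  qed
  have "((\<lambda>t. v t $ 2 * x t $ 1 - x t $ 2 * v t $ 1) \<longlongrightarrow> 0 - 0) F"
    by (intro tendsto_diff half[of v f x g] half[of x g v f]) fact+
  then show ?thesis by (simp add: wron_def mult.commute)
qed

end

section \<open>Truncated series solutions and the existence of \<Gamma>_s\<close>

context w_chain
begin

text \<open>Truncation of the formal series solution of \<open>y' = z J H y\<close>. It violates the
  equation only by a multiple of the last \<open>w\<close>.\<close>

definition "Tl z n = (\<lambda>t. \<Sum>i<n. z ^ i *s w i t)"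

lemma Tl_Suc: "Tl z (Suc n) t = Tl z n t + z ^ n *s w n t"
  by (simp add: Tl_def)

lemma Tl_chn: "chn (Tl z (Suc n)) (\<lambda>t. z *s Tl z n t)"
proof -
  have "chn (Tl z (Suc n)) (\<lambda>t. \<Sum>k<Suc n. z ^ k *s wd k t)"
    unfolding Tl_def by (intro chn_sum chn_scale w_wd)
  moreover have "(\<Sum>k<Suc n. z ^ k *s wd k t) = z *s Tl z n t" for t
    by (subst sum.lessThan_Suc_shift) (simp add: wd_def Tl_def vec.scale_sum_right)
  ultimately show ?thesis by simp
qed

lemma Tl_cont: "cont (Tl z n)"
  unfolding Tl_def by (intro cont_sum cont_scale w_cont)

text \<open>The summands from \<open>N0\<close> on are square integrable. In the remaining
  combination \<open>w 0\<close> has the coefficient \<open>z ^ 0 = 1\<close>, also for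
  \<open>z = 0\<close>, and \<open>w_independent\<close> applies.\<close>

lemma not_sq_Tl:
  assumes "N0 \<le> n"
  shows "\<not> sq (Tl z n)"
proof
  assume sq: "sq (Tl z n)"
  have "sq (\<lambda>t. \<Sum>i\<in>{N0..<n}. z ^ i *s w i t)" by (intro sq_sum sq_scale w_sq) simp
  from sq_diff[OF sq this] have "sq (\<lambda>t. \<Sum>i<N0. z ^ i *s w i t)"
  proof (rule sq_cong)
    fix t
    have eq: "(\<Sum>i<N0. z ^ i *s w i t) + (\<Sum>i\<in>{N0..<n}. z ^ i *s w i t) = Tl z n t"
      using sum.atLeastLessThan_concat[of 0 N0 n "\<lambda>i. z ^ i *s w i t"] assms by (simp add: Tl_def atLeast0LessThan)
    show "Tl z n t - (\<Sum>i\<in>{N0..<n}. z ^ i *s w i t) = (\<Sum>i<N0. z ^ i *s w i t)"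
      unfolding eq[symmetric] by (rule add_diff_cancel_right')
  qed
  moreover obtain N1 where N1: "N0 = Suc N1" using N0_pos by (cases N0) auto
  ultimately show False using w_independent[of N1 0 "\<lambda>i. z ^ i"] by (simp add: N1 lessThan_Suc_atMost)
qed

lemma Tl_limit: "n > 0 \<Longrightarrow> ((\<lambda>t. Tl z n t $ 2) \<longlongrightarrow> 1) F"
proof -
  assume "n > 0"
  have "((\<lambda>t. w i t $ 2) \<longlongrightarrow> (if i = 0 then 1 else 0)) F" for i
  proof (cases "i = 0")
    case True
    have "eventually (\<lambda>t. 1 = w 0 t $ 2) F"
      using eventually_D by eventually_elim (use w_0 D_sub_S in auto)
    then show ?thesis using True by (auto intro: Lim_transform_eventually[OF tendsto_const])
  next
    case False
    then show ?thesis using w_vanishing[of i] by simp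
  qed
  then have "((\<lambda>t. \<Sum>i<n. z ^ i * w i t $ 2) \<longlongrightarrow> (\<Sum>i<n. z ^ i * (if i = 0 then 1 else 0))) F"
    by (intro tendsto_intros)
  moreover have "(\<Sum>i<n. z ^ i * (if i = 0 then 1 else 0)) = (1 :: complex)"
    using \<open>n > 0\<close> by (subst sum.remove[of _ 0]) auto
  ultimately show ?thesis by (simp add: Tl_def)
qed

text \<open>The coefficient \<open>r\<close> is a limit point of the \<open>r m\<close> for which the second component of
  \<open>y - r m *s T\<close> vanishes at \<open>t m\<close>; this includes the limit point \<open>\<infinity>\<close>, which is excluded at the
  end because \<open>T\<close> is not square integrable.\<close>

lemma solution_decomposition:
  assumes y: "chn y (\<lambda>t. z *s y t)" and n: "N0 \<le> n"
  obtains r where "sq (\<lambda>t. y t - r *s Tl z (Suc n) t)"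
proof -
  define T where "T = Tl z (Suc n)"
  define k where "k = z ^ Suc n"
  have T: "chn T (\<lambda>t. z *s T t - k *s w n t)"
    by (rule chn_cong[OF Tl_chn[of z n, folded T_def] refl]) (simp add: T_def Tl_Suc k_def vec_eq_iff algebra_simps)
  have contT: "cont T" and conty: "cont y" using chn_cont T y by auto
  have "eventually (\<lambda>t. dist (T t $ 2) 1 < 1/2) F" using Tl_limit[of "Suc n" z] unfolding T_def by (intro tendstoD) auto
  note ev = this
  \<comment> \<open>With 24 = 2 * 2 * 6 the term with \<open>I\<close> on the right-hand side
    becomes at most \<open>I / 2\<close>. The summand 1 allows \<open>z = 0\<close>.\<close>
  have "1 / (24 * (norm z)\<^sup>2 + 1) > 0" by (simp add: add_nonneg_pos)
  then obtain u where u: "u \<in> D" "kappa u < 1 / (24 * (norm z)\<^sup>2 + 1)" and T2: "\<And>t. t \<in> tail u \<Longrightarrow> dist (T t $ 2) 1 < 1/2"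
    using kappa_small_eventually[OF _ ev] by blast
  have uS: "u \<in> S" using u D_sub_S by blast
  have T0: "T t $ 2 \<noteq> 0" if "t \<in> tail u" for t using T2[OF that] by (auto simp: dist_norm)
  have kz: "24 * kappa u * (norm z)\<^sup>2 \<le> 1"
  proof -
    have "kappa u * (24 * (norm z)\<^sup>2 + 1) < 1" using u(2) by (subst (asm) pos_less_divide_eq) (simp_all add: add_nonneg_pos)
    then show ?thesis using kappa_nonneg[OF uS] by (simp add: algebra_simps)
  qed
  define t where "t = tn u"
  have t: "t m \<in> tail u" "t m \<in> D" "t m \<in> S" "t \<longlonglongrightarrow> s" for m using tn[OF uS] unfolding t_def by auto
  define r where "r m = y (t m) $ 2 / T (t m) $ 2" for m
  define M where "M m = max 1 (norm (r m))" for m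
  have M: "1 \<le> M m" "norm (r m) \<le> M m" for m by (simp_all add: M_def)
  define a where "a m i = (if i = 0 then 1 / of_real (M m) else - r m / of_real (M m))" for m i :: nat
  define e where "e i = (if i = 0 then y else T)" for i :: nat
  define W where "W = integral D (Q (w n))"
  have W: "0 \<le> W" unfolding W_def using w_sq[OF n] by (intro integral_nonneg) (auto simp: sq_def intro: abs_int_imp)
  define Y where "Y = norm (y u $ 1) + norm (T u $ 1)"
  have Y: "0 \<le> Y" by (simp add: Y_def)
  have bound: "integral (seg u (t m)) (Q (\<lambda>x. \<Sum>i<2. a m i *s e i x)) \<le> 8 * m1 * Y\<^sup>2 + 24 * kappa u * (norm k)\<^sup>2 * W" for m
  proof -
    define v where "v = (\<lambda>x. y x - r m *s T x)"
    have v: "chn v (\<lambda>x. z *s v x + (r m * k) *s w n x)"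
      by (rule chn_cong[OF chn_diff[OF y chn_scale[OF T, of "r m"]]]) (simp_all add: v_def vec_eq_iff algebra_simps)
    have contv: "cont v" by (rule chn_cont[OF v])
    have v2: "v (t m) $ 2 = 0" using T0[OF t(1)[of m]] by (simp add: v_def r_def)
    define I where "I = integral (seg u (t m)) (Q v)"
    have Qv: "Q v absolutely_integrable_on seg u (t m)" and Qw: "Q (w n) absolutely_integrable_on seg u (t m)"
      and Qf: "Q (\<lambda>x. z *s v x + (r m * k) *s w n x) absolutely_integrable_on seg u (t m)"
      by (intro cont_Q_int cont_add cont_scale contv w_cont uS t(3))+
    have I: "0 \<le> I" unfolding I_def using Qv by (intro integral_nonneg) (auto intro: abs_int_imp)
    define R where "R = (norm (r m))\<^sup>2 * (norm k)\<^sup>2"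
    have R: "0 \<le> R" by (simp add: R_def)
    have "Q (\<lambda>x. z *s v x + (r m * k) *s w n x) x \<le> (2 * (norm z)\<^sup>2) * Q v x + (2 * R) * Q (w n) x" for x
      using Q_add_le[of "\<lambda>x. z *s v x" "\<lambda>x. (r m * k) *s w n x" x] by (simp add: Q_scale R_def norm_mult power_mult_distrib)
    then have "integral (seg u (t m)) (Q (\<lambda>x. z *s v x + (r m * k) *s w n x))
        \<le> integral (seg u (t m)) (\<lambda>x. (2 * (norm z)\<^sup>2) * Q v x + (2 * R) * Q (w n) x)"
      using Qv Qw Qf by (intro integral_le integrable_add integrable_on_mult_right) (auto intro: abs_int_imp)
    also have "\<dots> = (2 * (norm z)\<^sup>2) * I + (2 * R) * integral (seg u (t m)) (Q (w n))"
      using Qv Qw unfolding I_def by (subst integral_add) (auto intro!: integrable_on_mult_right intro: abs_int_imp)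
    also have "\<dots> \<le> (2 * (norm z)\<^sup>2) * I + (2 * R) * W"
      unfolding W_def using R integral_Q_le[OF w_sq[OF n] uS t(3)[of m]] by (intro add_left_mono mult_left_mono) auto
    finally have f: "integral (seg u (t m)) (Q (\<lambda>x. z *s v x + (r m * k) *s w n x)) \<le> (2 * (norm z)\<^sup>2) * I + (2 * R) * W" .
    have "I \<le> 4 * m1 * (norm (v u $ 1))\<^sup>2 + 6 * kappa u * integral (seg u (t m)) (Q (\<lambda>x. z *s v x + (r m * k) *s w n x))"
      unfolding I_def by (rule tail_estimate[OF v uS t(1) v2 Qf])
    also have "\<dots> \<le> 4 * m1 * (norm (v u $ 1))\<^sup>2 + 6 * kappa u * ((2 * (norm z)\<^sup>2) * I + (2 * R) * W)"
      using f kappa_nonneg[OF uS] by (intro add_left_mono mult_left_mono) auto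
    also have "\<dots> = 4 * m1 * (norm (v u $ 1))\<^sup>2 + (24 * kappa u * (norm z)\<^sup>2) * I / 2 + 12 * kappa u * R * W"
      by (simp add: algebra_simps)
    also have "\<dots> \<le> 4 * m1 * (norm (v u $ 1))\<^sup>2 + 1 * I / 2 + 12 * kappa u * R * W"
      using mult_right_mono[OF kz I] by (simp add: algebra_simps)
    finally have "I \<le> 8 * m1 * (norm (v u $ 1))\<^sup>2 + 24 * kappa u * R * W" by simp
    also have "\<dots> \<le> 8 * m1 * (M m * Y)\<^sup>2 + 24 * kappa u * ((M m)\<^sup>2 * (norm k)\<^sup>2) * W"
    proof -
      have "norm (v u $ 1) \<le> norm (y u $ 1) + norm (r m) * norm (T u $ 1)"
        unfolding v_def by (simp add: norm_mult[symmetric] norm_triangle_ineq4)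
      also have "\<dots> \<le> M m * norm (y u $ 1) + M m * norm (T u $ 1)"
        using M[of m] mult_right_mono[OF M(1)[of m], of "norm (y u $ 1)"] by (intro add_mono mult_right_mono) auto
      finally have "norm (v u $ 1) \<le> M m * Y" by (simp add: Y_def distrib_left)
      moreover have "R \<le> (M m)\<^sup>2 * (norm k)\<^sup>2"
        unfolding R_def using M[of m] by (intro mult_right_mono power_mono) auto
      ultimately show ?thesis
        using m1_nonneg kappa_nonneg[OF uS] W by (intro add_mono mult_left_mono mult_right_mono power_mono) auto
    qed
    also have "\<dots> = (M m)\<^sup>2 * (8 * m1 * Y\<^sup>2 + 24 * kappa u * (norm k)\<^sup>2 * W)"
      by (simp add: power_mult_distrib algebra_simps)
    finally have le: "I \<le> (M m)\<^sup>2 * (8 * m1 * Y\<^sup>2 + 24 * kappa u * (norm k)\<^sup>2 * W)" .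
    have "(\<lambda>x. \<Sum>i<2. a m i *s e i x) = (\<lambda>x. (1 / of_real (M m)) *s v x)"
      unfolding v_def a_def e_def by (auto simp: numeral_2_eq_2 vec_eq_iff field_simps fun_eq_iff)
    then have "integral (seg u (t m)) (Q (\<lambda>x. \<Sum>i<2. a m i *s e i x)) = I / (M m)\<^sup>2"
      unfolding I_def using M[of m] by (simp add: Q_scale[abs_def] norm_divide power_divide)
    also have "\<dots> \<le> 8 * m1 * Y\<^sup>2 + 24 * kappa u * (norm k)\<^sup>2 * W"
      using le M[of m] by (simp add: pos_divide_le_eq mult.commute)
    finally show ?thesis .
  qed
  have a1: "norm (a m i) \<le> 1" if "i < 2" for m i
    using M[of m] by (simp add: a_def norm_divide)
  have a2: "\<exists>i<2. norm (a m i) = 1" for m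
  proof (cases "norm (r m) \<le> 1")
    case True
    then show ?thesis by (intro exI[of _ 0]) (simp add: a_def M_def)
  next
    case False
    then have "norm (r m) \<noteq> 0" "M m = norm (r m)" by (auto simp: M_def)
    then show ?thesis by (intro exI[of _ 1]) (simp add: a_def norm_divide)
  qed
  have ce: "cont (e i)" for i using contT conty by (simp add: e_def)
  obtain b where b: "\<exists>i<2. b i \<noteq> 0" "sq (\<lambda>x. \<Sum>i<2. b i *s e i x)"
    using sq_compactness[of 2 e u a t, OF ce uS a1 a2 t(2) t(4) bound] by blast
  have sb: "sq (\<lambda>x. b 0 *s y x + b 1 *s T x)" using b(2) by (simp add: numeral_2_eq_2 e_def)
  have b0: "b 0 \<noteq> 0"
  proof
    assume "b 0 = 0"
    then have "b 1 \<noteq> 0" using b(1) by (auto simp: less_2_cases_iff)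
    have "sq T" using sq_scale[OF sb, of "1 / b 1"] \<open>b 0 = 0\<close> \<open>b 1 \<noteq> 0\<close> by simp
    then show False using not_sq_Tl[of "Suc n" z] n by (simp add: T_def)
  qed
  have "(\<lambda>x. (1 / b 0) *s (b 0 *s y x + b 1 *s T x)) = (\<lambda>x. y x - (- b 1 / b 0) *s T x)"
    using b0 by (auto simp: vec_eq_iff field_simps fun_eq_iff)
  then have "sq (\<lambda>x. y x - (- b 1 / b 0) *s T x)" using sq_scale[OF sb, of "1 / b 0"] by simp
  then show thesis using that unfolding T_def by blast
qed

text \<open>Truncating one step earlier changes the remainder by a multiple of \<open>w n\<close>,
  which is square integrable. So the remainder and its right-hand side are square integrable
  together.\<close>

lemma remainder_chn:
  assumes y: "chn y (\<lambda>t. z *s y t)" and n: "N0 \<le> n" and r: "sq (\<lambda>t. y t - r *s Tl z (Suc n) t)"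
  shows "chn (\<lambda>t. y t - r *s Tl z (Suc n) t) (\<lambda>t. z *s (y t - r *s Tl z n t))"
    "sq (\<lambda>t. y t - r *s Tl z n t)"
proof -
  show "chn (\<lambda>t. y t - r *s Tl z (Suc n) t) (\<lambda>t. z *s (y t - r *s Tl z n t))"
    by (rule chn_cong[OF chn_diff[OF y chn_scale[OF Tl_chn[of z n], of r]]]) (simp_all add: vec_eq_iff algebra_simps)
  have "sq (\<lambda>t. (y t - r *s Tl z (Suc n) t) + (r * z ^ n) *s w n t)"
    by (intro sq_add sq_scale r w_sq n)
  then show "sq (\<lambda>t. y t - r *s Tl z n t)"
    by (rule sq_cong) (simp add: Tl_Suc vec_eq_iff algebra_simps)
qed

lemma solution_limit:
  assumes y: "chn y (\<lambda>t. z *s y t)" and n: "N0 \<le> n" and r: "sq (\<lambda>t. y t - r *s Tl z (Suc n) t)"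
  shows "((\<lambda>t. y t $ 2) \<longlongrightarrow> r) F"
proof -
  note c = remainder_chn[OF assms]
  have "((\<lambda>t. (y t - r *s Tl z (Suc n) t) $ 2) \<longlongrightarrow> 0) F"
    by (rule sq_imp_vanishing[OF c(1) sq_scale[OF c(2)] r])
  from tendsto_add[OF this tendsto_mult[OF tendsto_const[of r] Tl_limit[of "Suc n" z]]]
  show ?thesis by simp
qed

text \<open>The expression under the limit in \<open>Gamma_s\<close>, with \<open>r\<close> in place
  of \<Gamma>_r. Its counterterm, split off below as \<open>DS\<close>, does not depend on
  \<open>y\<close>.\<close>

definition GX :: "complex \<Rightarrow> nat \<Rightarrow> complex \<Rightarrow> (real \<Rightarrow> complex^2) \<Rightarrow> real \<Rightarrow> complex" where
  "GX z m r y x = (\<Sum>n\<le>m. z ^ n * wron (w n) (\<lambda>x. y x - r *s (\<Sum>j=m+1..2*m-n. z ^ j *s w j x)) x)"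

definition DS :: "complex \<Rightarrow> nat \<Rightarrow> real \<Rightarrow> complex" where
  "DS z m x = (\<Sum>n\<le>m. \<Sum>j=m+1..2*m-n. z ^ (n + j) * wron (w n) (w j) x)"

lemma GX_eq: "GX z m r y x = wron (Tl z (Suc m)) y x - r * DS z m x"
proof -
  have "wron (Tl z (Suc m)) y x = (\<Sum>n\<le>m. z ^ n * wron (w n) y x)"
    unfolding Tl_def by (simp add: wron_sum wron_linear lessThan_Suc_atMost del: sum.lessThan_Suc)
  then show ?thesis
    unfolding GX_def DS_def
    by (simp add: wron_linear wron_sum sum_subtractf sum_distrib_left algebra_simps power_add)
qed

text \<open>The pairing of \<open>y\<close> with the truncated series has
  \<open>- z ^ Suc m * Bf (w m) y\<close> as derivative, which need not be integrable. By
  telescoping, \<open>DS\<close> has the same derivative with \<open>Tl z m\<close> in place of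
  \<open>y\<close>. So only the difference enters, and for the right \<open>r\<close> it is square
  integrable.\<close>

lemma GX_prim:
  assumes y: "chn y (\<lambda>t. z *s y t)"
  shows "is_prim S (GX z m r y) (\<lambda>t. - (z ^ Suc m * Bf (w m) (\<lambda>t. y t - r *s Tl z m t) t))"
proof -
  have 1: "is_prim S (wron (Tl z (Suc m)) y) (\<lambda>t. - (z ^ Suc m * Bf (w m) y t))"
    by (rule is_prim_cong[OF wron_prim[OF Tl_chn y]])
      (simp_all add: Bf_linear Tl_Suc[abs_def] algebra_simps)
  define g where "g n j t = z ^ (n + j) * Bf (w n) (w (j - 1)) t" for n j t
  have "is_prim S (\<lambda>t. z ^ (n + j) * wron (w n) (w j) t) (\<lambda>t. (if n = 0 then 0 else g (n - 1) (j + 1) t) - g n j t)"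
    if "j > 0" for n j
    by (rule is_prim_cong[OF is_prim_cmult[OF wron_prim[OF w_wd w_wd]]])
      (use that in \<open>auto simp: g_def wd_def Bf_linear algebra_simps\<close>)
  then have "is_prim S (DS z m) (\<lambda>t. \<Sum>n\<le>m. \<Sum>j=m+1..2*m-n. (if n = 0 then 0 else g (n - 1) (j + 1) t) - g n j t)"
    unfolding DS_def by (intro is_prim_sum) auto
  then have "is_prim S (DS z m) (\<lambda>t. - (\<Sum>n<m. g n (m + 1) t))"
    by (subst (asm) double_sum_telescope)
  then have 2: "is_prim S (DS z m) (\<lambda>t. - (z ^ Suc m * Bf (w m) (Tl z m) t))"
    by (rule is_prim_cong)
      (simp_all add: g_def Tl_def Bf_sum Bf_linear sum_distrib_left power_add Bf_commute[of "w m"] algebra_simps)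
  show ?thesis
    by (rule is_prim_cong[OF is_prim_diff[OF 1 is_prim_cmult[OF 2, of r]]])
      (simp_all add: GX_eq Bf_linear algebra_simps)
qed

text \<open>The first components of all \<open>w n\<close> vanish at \<open>c\<close>, and with them
  the counterterm.\<close>

lemma GX_at_c: "GX z m r y c = (\<Sum>n\<le>m. z ^ n * w n c $ 2) * y c $ 1"
  unfolding GX_def wron_def by (simp add: w_c1 sum_distrib_right mult.assoc)

lemma GX_limit:
  fixes z :: complex
  assumes y: "chn y (\<lambda>t. z *s y t)" and m: "N0 \<le> m" and r: "sq (\<lambda>t. y t - r *s Tl z (Suc m) t)"
  shows "(GX z m r y \<longlongrightarrow> (\<Sum>n\<le>m. z ^ n * w n c $ 2) * y c $ 1
      - of_real sg * z ^ Suc m * integral D (Bf (w m) (\<lambda>t. y t - r *s Tl z m t))) F"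
proof -
  have i: "Bf (w m) (\<lambda>t. y t - r *s Tl z m t) absolutely_integrable_on D"
    by (intro sq_Bf w_sq m remainder_chn(2)[OF assms])
  then have j: "(\<lambda>t. - (z ^ Suc m * Bf (w m) (\<lambda>t. y t - r *s Tl z m t) t)) absolutely_integrable_on D"
    by (rule absolutely_integrable_linear[OF _ bounded_linear_minus[OF bounded_linear_mult_right], unfolded o_def])
  have "integral D (\<lambda>t. - (z ^ Suc m * Bf (w m) (\<lambda>t. y t - r *s Tl z m t) t)) = - (z ^ Suc m * integral D (Bf (w m) (\<lambda>t. y t - r *s Tl z m t)))"
    using integral_linear[OF abs_int_imp[OF i] bounded_linear_minus[OF bounded_linear_mult_right, of "z ^ Suc m"]] by (simp add: o_def)
  with prim_limit[OF GX_prim[OF y] j] show ?thesis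
    by (simp add: GX_at_c scaleR_conv_of_real algebra_simps)
qed

text \<open>In this combination the counterterms cancel. What remains is the Wronskian of
  \<open>y\<close> and \<open>x\<close>, which is constant, minus that of the remainders, which
  tends to 0.\<close>

lemma wron_regularised:
  assumes y: "chn y (\<lambda>t. z *s y t)" and x: "chn x (\<lambda>t. z *s x t)" and m: "N0 \<le> m"
    and r: "sq (\<lambda>t. y t - r *s Tl z (Suc m) t)" and q: "sq (\<lambda>t. x t - q *s Tl z (Suc m) t)"
    and ly: "(GX z m r y \<longlongrightarrow> ly) F" and lx: "(GX z m q x \<longlongrightarrow> lx) F" and t: "t \<in> S"
  shows "r * lx - q * ly = wron y x t"
proof -
  define T where "T = Tl z (Suc m)"
  note cy = remainder_chn[OF y m r] and cx = remainder_chn[OF x m q]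
  have "((\<lambda>t. wron (\<lambda>t. y t - r *s T t) (\<lambda>t. x t - q *s T t) t) \<longlongrightarrow> 0) F"
    unfolding T_def by (rule wron_vanishing[OF cy(1) sq_scale[OF cy(2)] r cx(1) sq_scale[OF cx(2)] q])
  moreover have "r * GX z m q x t - q * GX z m r y t = wron y x t - wron (\<lambda>t. y t - r *s T t) (\<lambda>t. x t - q *s T t) t" for t
    unfolding GX_eq wron_def T_def by (simp add: algebra_simps)
  moreover have "((\<lambda>t. r * GX z m q x t - q * GX z m r y t) \<longlongrightarrow> r * lx - q * ly) F"
    by (intro tendsto_intros lx ly)
  ultimately have "((\<lambda>u. wron y x u) \<longlongrightarrow> r * lx - q * ly) F"
    using tendsto_add[of "\<lambda>t. r * GX z m q x t - q * GX z m r y t" "r * lx - q * ly" F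
        "\<lambda>t. wron (\<lambda>t. y t - r *s T t) (\<lambda>t. x t - q *s T t) t" 0] by simp
  moreover have "((\<lambda>u. wron y x u) \<longlongrightarrow> wron y x t) F"
  proof (rule Lim_transform_eventually[OF tendsto_const])
    show "eventually (\<lambda>u. wron y x t = wron y x u) F"
      using eventually_D by eventually_elim (rule wron_solutions_const[OF y x t], use D_sub_S in blast)
  qed
  ultimately show ?thesis using tendsto_unique[OF F_neq_bot] by blast
qed

end

section \<open>Matrix Hamiltonians and the index\<close>

context canonical_side
begin

lemma base_prim:
  fixes f :: "real \<Rightarrow> 'b::euclidean_space"
  assumes f: "\<And>u v. {u..v} \<subseteq> S \<Longrightarrow> f absolutely_integrable_on {u..v}"
  shows "is_prim S (\<lambda>t. sg *\<^sub>R integral (seg c t) f) f"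
  unfolding is_prim_def
proof (intro allI impI conjI)
  fix u v assume uv: "u \<le> v \<and> {u..v} \<subseteq> S"
  show "f absolutely_integrable_on {u..v}" using uv f by blast
  have S: "u \<in> S" "v \<in> S" using uv by auto
  show "sg *\<^sub>R integral (seg c v) f - sg *\<^sub>R integral (seg c u) f = integral {u..v} f"
  proof (cases "c < s")
    case True
    then have c: "c \<le> u" "c \<le> v" using S by (auto simp: S_def D_def)
    then have "{c..v} \<subseteq> S" using seg_sub_S[OF c_in_S S(2)] by (simp add: seg_def)
    then have "integral {c..u} f + integral {u..v} f = integral {c..v} f"
      using c uv f by (intro Henstock_Kurzweil_Integration.integral_combine) (auto intro: abs_int_imp)
    then show ?thesis using c True by (simp add: seg_def sg_def algebra_simps)
  next
    case False
    then have c: "u \<le> c" "v \<le> c" using S by (auto simp: S_def D_def)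
    then have "{u..c} \<subseteq> S" using seg_sub_S[OF S(1) c_in_S] by (simp add: seg_def)
    then have "integral {u..v} f + integral {v..c} f = integral {u..c} f"
      using c uv f by (intro Henstock_Kurzweil_Integration.integral_combine) (auto intro: abs_int_imp)
    then show ?thesis using c False by (simp add: seg_def sg_def algebra_simps)
  qed
qed

text \<open>Elements of the maximal relation come with representatives on the open interval; since
  the derivative is integrable up to \<open>c\<close>, they extend to the regular endpoint.\<close>

lemma prim_extend:
  fixes f :: "real \<Rightarrow> 'b::euclidean_space"
  assumes F: "is_prim D G f" and f: "\<And>u v. {u..v} \<subseteq> S \<Longrightarrow> f absolutely_integrable_on {u..v}"
  obtains G' where "is_prim S G' f" "\<And>t. t \<in> D \<Longrightarrow> G' t = G t"
proof -
  define B where "B t = sg *\<^sub>R integral (seg c t) f" for t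
  have B: "is_prim S B f" unfolding B_def[abs_def] by (rule base_prim[OF f])
  have "is_prim D B f" using B D_sub_S unfolding is_prim_def by blast
  then have "is_prim D (\<lambda>t. G t - B t) (\<lambda>t. 0)" using is_prim_diff[OF F] by fastforce
  then have k: "G t - B t = G (tn c 0) - B (tn c 0)" if "t \<in> D" for t
    using is_prim_zero_imp_eq[OF _ interval_D that tn(2)[OF c_in_S]] by blast
  show thesis
  proof (rule that[of "\<lambda>t. B t + (G (tn c 0) - B (tn c 0))"])
    show "is_prim S (\<lambda>t. B t + (G (tn c 0) - B (tn c 0))) f"
      using is_prim_add[OF B is_prim_const] by simp
    show "B t + (G (tn c 0) - B (tn c 0)) = G t" if "t \<in> D" for t
      unfolding k[OF that, symmetric] by simp
  qed
qed

lemma bounded_linear_vec_of_scalar: "bounded_linear (\<lambda>z::complex. z *s (v :: complex^2))"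
proof (rule linear_conv_bounded_linear[THEN iffD1])
  show "linear (\<lambda>z::complex. z *s (v :: complex^2))"
    by (rule linearI) (auto simp: vec_eq_iff algebra_simps)
qed

definition JHf :: "(real \<Rightarrow> complex^2) \<Rightarrow> real \<Rightarrow> complex^2" where
  "JHf f t = vector [- P2 f t, P1 f t]"

lemma JHf_eq: "JHf f t = (- P2 f t) *s axis 1 1 + P1 f t *s axis 2 1"
  by (simp add: JHf_def vec_eq_iff forall_2 axis_def)

lemma JHf_abs_int:
  assumes "P1 f absolutely_integrable_on X" "P2 f absolutely_integrable_on X"
  shows "JHf f absolutely_integrable_on X"
  unfolding JHf_eq[abs_def]
  using absolutely_integrable_linear[OF assms(1) bounded_linear_vec_of_scalar[of "axis 2 1"]]
    absolutely_integrable_linear[OF assms(2) bounded_linear_minus[OF bounded_linear_vec_of_scalar[of "axis 1 1"]]]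
  by (intro set_integral_add(1)) (auto simp: o_def)

lemma prim_JHf_iff: "is_prim S' y (JHf f) \<longleftrightarrow> is_prim S' (\<lambda>t. y t $ 1) (\<lambda>t. - P2 f t) \<and> is_prim S' (\<lambda>t. y t $ 2) (P1 f)"
proof (intro iffI conjI)
  assume y: "is_prim S' y (JHf f)"
  show "is_prim S' (\<lambda>t. y t $ 1) (\<lambda>t. - P2 f t)" "is_prim S' (\<lambda>t. y t $ 2) (P1 f)"
    using is_prim_linear[OF y bounded_linear_vec_nth[of 1]] is_prim_linear[OF y bounded_linear_vec_nth[of 2]]
    by (simp_all add: JHf_def)
next
  assume y: "is_prim S' (\<lambda>t. y t $ 1) (\<lambda>t. - P2 f t) \<and> is_prim S' (\<lambda>t. y t $ 2) (P1 f)"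
  have "is_prim S' (\<lambda>t. y t $ 1 *s axis 1 1 + y t $ 2 *s axis 2 1) (JHf f)"
    unfolding JHf_eq[abs_def]
    by (intro is_prim_add is_prim_linear[OF conjunct1[OF y] bounded_linear_vec_of_scalar]
        is_prim_linear[OF conjunct2[OF y] bounded_linear_vec_of_scalar])
  moreover have "y t $ 1 *s axis 1 1 + y t $ 2 *s axis 2 1 = y t" for t
    by (simp add: vec_eq_iff forall_2 axis_def)
  ultimately show "is_prim S' y (JHf f)" by simp
qed

lemma chn_JHf: "chn y f \<longleftrightarrow> is_prim S y (JHf f)"
  by (simp add: chn_def prim_JHf_iff)

text \<open>The squared modulus of \<open>P1 f\<close> is at most \<open>h1 * Q f\<close>, which is
  below the square of \<open>h1 + Q f\<close>; this sum dominates locally, and likewise for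
  \<open>P2 f\<close>. Measurability is known on \<open>D\<close>, hence the passage to
  \<open>seg u v \<inter> D\<close>.\<close>

lemma P_abs_int_of_sq:
  assumes "sq f" "{u..v} \<subseteq> S"
  shows "P1 f absolutely_integrable_on {u..v}" "P2 f absolutely_integrable_on {u..v}"
proof -
  have "P1 f absolutely_integrable_on {u..v} \<and> P2 f absolutely_integrable_on {u..v}"
  proof (cases "u \<le> v")
    case True
    then have S: "u \<in> S" "v \<in> S" "{u..v} = seg u v" using assms(2) by (auto simp: seg_def)
    have Q: "Q f absolutely_integrable_on seg u v" using assms(1) S by (auto simp: sq_def intro: abs_int_seg)
    have "P1 f absolutely_integrable_on seg u v \<and> P2 f absolutely_integrable_on seg u v"
    proof -
      have D: "seg u v \<inter> D \<in> sets lebesgue" by auto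
      have sp: "negligible (seg u v - seg u v \<inter> D)"
        using seg_sub_S[OF S(1,2)] by (intro negligible_subset[OF negligible_S_minus_D]) auto
      have iff: "g absolutely_integrable_on seg u v \<longleftrightarrow> g absolutely_integrable_on seg u v \<inter> D" for g :: "real \<Rightarrow> complex"
      proof (rule absolutely_integrable_spike_set_eq)
        show "negligible {x \<in> seg u v - seg u v \<inter> D. g x \<noteq> 0}" by (rule negligible_subset[OF sp]) auto
        have "{x \<in> seg u v \<inter> D - seg u v. g x \<noteq> 0} = {}" by auto
        then show "negligible {x \<in> seg u v \<inter> D - seg u v. g x \<noteq> 0}" by (simp only: negligible_empty)
      qed
      have dom: "g absolutely_integrable_on seg u v \<inter> D"
        if g: "g \<in> borel_measurable (lebesgue_on D)" and h: "h absolutely_integrable_on seg u v" "\<And>t. 0 \<le> h t"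
          and le: "\<And>t. (norm (g t))\<^sup>2 \<le> h t * Q f t" for g :: "real \<Rightarrow> complex" and h
      proof (rule measurable_bounded_by_integrable_imp_absolutely_integrable[of _ _ "\<lambda>t. h t + Q f t"])
        show "g \<in> borel_measurable (lebesgue_on (seg u v \<inter> D))" using g by (rule measurable_restrict_mono) auto
        have "(\<lambda>t. h t + Q f t) absolutely_integrable_on seg u v" by (intro set_integral_add(1) h Q)
        then have "(\<lambda>t. h t + Q f t) absolutely_integrable_on seg u v \<inter> D"
          by (rule set_integrable_subset) (use D in auto)
        then show "(\<lambda>t. h t + Q f t) integrable_on seg u v \<inter> D" by (rule abs_int_imp)
        fix t
        have "(norm (g t))\<^sup>2 \<le> (h t + Q f t)\<^sup>2"
        proof -
          have "(h t + Q f t)\<^sup>2 = h t * Q f t + (h t * h t + Q f t * Q f t + h t * Q f t)"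
            by (simp add: power2_eq_square algebra_simps)
          moreover have "0 \<le> h t * h t + Q f t * Q f t + h t * Q f t" using h(2)[of t] by simp
          ultimately show ?thesis using le[of t] by linarith
        qed
        then show "norm (g t) \<le> h t + Q f t" by (rule power2_le_imp_le) (use h(2)[of t] in auto)
      qed (use D in auto)
      show ?thesis
        unfolding iff using assms(1) meas_PQ[of f] int_seg[OF S(1,2)] psd P1_le P2_le
        by (auto simp: sq_def intro!: dom[of "P1 f" h1] dom[of "P2 f" h2])
    qed
    then show ?thesis using S(3) by simp
  qed simp
  then show "P1 f absolutely_integrable_on {u..v}" "P2 f absolutely_integrable_on {u..v}" by auto
qed

lemma P_abs_int_of_cont:
  assumes "cont f" "{u..v} \<subseteq> S"
  shows "P1 f absolutely_integrable_on {u..v}" "P2 f absolutely_integrable_on {u..v}"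
proof -
  have "continuous_on {u..v} (\<lambda>t. f t $ 1)" "continuous_on {u..v} (\<lambda>t. f t $ 2)"
    using assms unfolding cont_def by (auto intro: continuous_on_subset)
  moreover have "(\<lambda>t. complex_of_real (h1 t)) absolutely_integrable_on {u..v}"
    "(\<lambda>t. complex_of_real (h2 t)) absolutely_integrable_on {u..v}"
    "(\<lambda>t. complex_of_real (h3 t)) absolutely_integrable_on {u..v}"
    using loc_int[of u v] assms(2) absolutely_integrable_linear[OF _ bounded_linear_of_real]
    unfolding S_def D_def by (auto simp: o_def)
  ultimately show "P1 f absolutely_integrable_on {u..v}" "P2 f absolutely_integrable_on {u..v}"
    unfolding P1_def[abs_def] P2_def[abs_def]
    by (auto intro!: set_integral_add(1) absolutely_integrable_continuous_mult')
qed

end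

lemma cmat_mult: "(cmat M *v x) $ i = of_real (M $ i $ 1) * x $ 1 + of_real (M $ i $ 2) * x $ 2"
  by (simp add: matrix_vector_mult_def sum_2 map_matrix_def)

lemma J_mult: "J *v x = vector [- (x $ 2), x $ 1]"
  by (simp add: J_def matrix_vector_mult_def vec_eq_iff forall_2 sum_2)

text \<open>The coefficient functions satisfy the positivity inequalities at every point,
  \<open>H\<close> itself only almost everywhere; \<open>H_eq\<close> is the bridge between the
  two.\<close>

locale ham_side = canonical_side +
  fixes H :: hamiltonian
  assumes H_eq: "AE t\<in>{min c s<..<max c s} in lebesgue. H t $ 1 $ 1 = h1 t \<and> H t $ 2 $ 2 = h2 t \<and> H t $ 1 $ 2 = h3 t \<and> H t $ 2 $ 1 = h3 t"
    and H_nonzero: "AE t\<in>{min c s<..<max c s} in lebesgue. H t \<noteq> 0"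
begin

abbreviation "lo \<equiv> min c s"
abbreviation "hi \<equiv> max c s"

definition Iop :: fun_op where "Iop = (if c < s then int_left H c else int_right H c)"

lemma H_eq_D: "AE t\<in>D in lebesgue. H t $ 1 $ 1 = h1 t \<and> H t $ 2 $ 2 = h2 t \<and> H t $ 1 $ 2 = h3 t \<and> H t $ 2 $ 1 = h3 t"
  using H_eq unfolding D_def .

lemma JHf_AE: "AE t\<in>D in lebesgue. J *v (cmat (H t) *v f t) = JHf f t"
  using H_eq_D by eventually_elim (auto simp: J_mult JHf_def cmat_mult P1_def P2_def)

lemma Iop_prim:
  assumes f: "cont f"
  shows "chn (Iop f) f" "Iop f c = 0"
proof -
  have JI: "JHf f absolutely_integrable_on {u..v}" if "{u..v} \<subseteq> S" for u v
    using P_abs_int_of_cont[OF f that] by (rule JHf_abs_int)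
  obtain N where N: "negligible N" "\<forall>t\<in>D - N. J *v (cmat (H t) *v f t) = JHf f t"
    using JHf_AE[of f] unfolding AE_negligible by blast
  have key: "(LINT x:{u<..<v}|lebesgue. J *v (cmat (H x) *v f x)) = integral {u..v} (JHf f)"
    if uv: "{u..v} \<subseteq> S" "{u<..<v} \<subseteq> D" for u v
  proof -
    have "JHf f absolutely_integrable_on {u<..<v}"
      using JI[OF uv(1)] by (rule set_integrable_subset) auto
    then have 1: "(\<lambda>x. J *v (cmat (H x) *v f x)) absolutely_integrable_on {u<..<v}"
      by (rule absolutely_integrable_spike[where f = "JHf f", OF _ N(1)]) (use N(2) uv(2) in blast)
    have "(LINT x:{u<..<v}|lebesgue. J *v (cmat (H x) *v f x)) = integral {u<..<v} (\<lambda>x. J *v (cmat (H x) *v f x))"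
      by (rule set_lebesgue_integral_eq_integral(2)[OF 1])
    also have "\<dots> = integral {u<..<v} (JHf f)"
      by (rule integral_spike[OF N(1)]) (use N(2) uv(2) in auto)
    also have "\<dots> = integral {u..v} (JHf f)" using integral_open_interval[of u v "JHf f"] by (simp add: box_real cbox_interval)
    finally show ?thesis .
  qed
  have eq: "Iop f t = sg *\<^sub>R integral (seg c t) (JHf f)" if t: "t \<in> S" for t
  proof (cases "c < s")
    case True
    then have "seg c t = {c..t}" "{c<..<t} \<subseteq> D" using t by (auto simp: seg_def S_def D_def)
    then show ?thesis using key[of c t] seg_sub_S[OF c_in_S t] True by (simp add: Iop_def int_left_def sg_def)
  next
    case False
    then have "seg c t = {t..c}" "{t<..<c} \<subseteq> D" using t by (auto simp: seg_def S_def D_def)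
    then show ?thesis using key[of t c] seg_sub_S[OF c_in_S t] False by (simp add: Iop_def int_right_def sg_def)
  qed
  show "chn (Iop f) f"
    unfolding chn_JHf by (rule is_prim_cong[OF base_prim[OF JI]]) (simp_all add: eq)
  show "Iop f c = 0" unfolding eq[OF c_in_S] by simp
qed

lemma cdot_Q:
  assumes "H t $ 1 $ 1 = h1 t" "H t $ 2 $ 2 = h2 t" "H t $ 1 $ 2 = h3 t" "H t $ 2 $ 1 = h3 t"
  shows "cdot (f t) (cmat (H t) *v f t) = of_real (Q f t)"
  unfolding cdot_def sum_2 cmat_mult assms Q_real_form by (simp add: complex_eq_iff power2_eq_square algebra_simps)

lemma cdot_Q_AE: "AE t\<in>D in lebesgue. cdot (f t) (cmat (H t) *v f t) = of_real (Q f t)"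
  using H_eq_D by eventually_elim (auto intro: cdot_Q)

lemma in_L2_imp_sq:
  assumes "in_L2 H lo hi f"
  shows "sq f"
proof -
  have m: "f \<in> borel_measurable (lebesgue_on D)" and i: "(\<lambda>t. cdot (f t) (cmat (H t) *v f t)) absolutely_integrable_on D"
    using assms unfolding in_L2_def D_def by auto
  have "meas f" unfolding meas_def using m
    by (auto intro!: measurable_compose[OF m] borel_measurable_continuous_onI continuous_intros)
  obtain N where N: "negligible N" "\<forall>t\<in>D - N. cdot (f t) (cmat (H t) *v f t) = of_real (Q f t)"
    using cdot_Q_AE[of f] unfolding AE_negligible by blast
  have "(\<lambda>t. complex_of_real (Q f t)) absolutely_integrable_on D"
    by (rule absolutely_integrable_spike[OF i N(1)]) (use N(2) in auto)
  from absolutely_integrable_linear[OF this bounded_linear_Re] have "Q f absolutely_integrable_on D" by (simp add: o_def)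
  with \<open>meas f\<close> show ?thesis by (simp add: sq_def)
qed

lemma cont_imp_continuous_on: "cont f \<Longrightarrow> continuous_on S f"
proof -
  assume "cont f"
  then have "continuous_on S (\<lambda>t. \<chi> i. f t $ i)" unfolding cont_def
    by (intro continuous_on_vec_lambda) (metis exhaust_2)
  then show ?thesis by simp
qed

text \<open>On an indivisible interval \<open>H f\<close> is a.e. a multiple of
  \<open>xi \<phi>\<close>, and \<open>J\<close> turns it into a vector orthogonal to
  \<open>xi \<phi>\<close>. So the derivative of the pairing vanishes.\<close>

lemma indivisible_constant:
  assumes y: "chn y f" and sub: "{u<..<v} \<subseteq> D" and ind: "indivisible_type H u v \<phi>"
  shows "\<exists>k. \<forall>t\<in>{u<..<v}. of_real (cos \<phi>) * y t $ 1 + of_real (sin \<phi>) * y t $ 2 = k"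
proof -
  have uv: "u < v" using ind by (simp add: indivisible_type_def)
  have "AE t\<in>{u<..<v} in lebesgue. - (of_real (cos \<phi>) * P2 f t) + of_real (sin \<phi>) * P1 f t = 0"
  proof -
    have "AE t\<in>{u<..<v} in lebesgue. H t $ 1 $ 1 = h1 t \<and> H t $ 2 $ 2 = h2 t \<and> H t $ 1 $ 2 = h3 t \<and> H t $ 2 $ 1 = h3 t"
      using H_eq_D by eventually_elim (use sub in blast)
    moreover have "AE t\<in>{u<..<v} in lebesgue. range (\<lambda>x. H t *v x) = span {xi \<phi>}"
      using ind by (simp add: indivisible_type_def)
    ultimately show ?thesis
    proof eventually_elim
      case (elim t)
      show ?case
      proof
        assume t: "t \<in> {u<..<v}"
        have "H t *v axis 1 1 \<in> span {xi \<phi>}" "H t *v axis 2 1 \<in> span {xi \<phi>}" using elim t by auto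
        then obtain k1 k2 where "H t *v axis 1 1 = k1 *\<^sub>R xi \<phi>" "H t *v axis 2 1 = k2 *\<^sub>R xi \<phi>"
          unfolding span_singleton by auto
        then have k: "h1 t = k1 * cos \<phi>" "h3 t = k1 * sin \<phi>" "h3 t = k2 * cos \<phi>" "h2 t = k2 * sin \<phi>"
          using elim t unfolding vec_eq_iff forall_2
          by (auto simp: matrix_vector_mult_def sum_2 axis_def xi_def)
        have "P1 f t = of_real (cos \<phi>) * (of_real k1 * f t $ 1 + of_real k2 * f t $ 2)"
          unfolding P1_def k(1) k(3) by (simp add: algebra_simps)
        moreover have "P2 f t = of_real (sin \<phi>) * (of_real k1 * f t $ 1 + of_real k2 * f t $ 2)"
          unfolding P2_def k(2) k(4) by (simp add: algebra_simps)
        ultimately show "- (of_real (cos \<phi>) * P2 f t) + of_real (sin \<phi>) * P1 f t = 0" by simp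
      qed
    qed
  qed
  note ae = this
  have sub': "{u<..<v} \<subseteq> S" using sub D_sub_S by blast
  have y': "is_prim {u<..<v} (\<lambda>t. y t $ 1) (\<lambda>t. - P2 f t)" "is_prim {u<..<v} (\<lambda>t. y t $ 2) (P1 f)"
    using y sub' unfolding chn_def is_prim_def by blast+
  have "is_prim {u<..<v} (\<lambda>t. of_real (cos \<phi>) * y t $ 1 + of_real (sin \<phi>) * y t $ 2)
      (\<lambda>t. of_real (cos \<phi>) * - P2 f t + of_real (sin \<phi>) * P1 f t)"
    by (intro is_prim_add is_prim_cmult y')
  then have "is_prim {u<..<v} (\<lambda>t. of_real (cos \<phi>) * y t $ 1 + of_real (sin \<phi>) * y t $ 2) (\<lambda>t. 0)"
  proof (rule is_prim_cong_AE)
    fix a b assume "{a..b} \<subseteq> {u<..<v}"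
    then have "{a<..<b} \<subseteq> {u<..<v}" by auto
    then show "AE t\<in>{a<..<b} in lebesgue. of_real (cos \<phi>) * - P2 f t + of_real (sin \<phi>) * P1 f t = 0"
      using ae by (auto elim!: eventually_mono)
  qed simp
  note const = is_prim_zero_imp_eq[OF this is_interval_oo]
  have m: "(u + v) / 2 \<in> {u<..<v}" using uv by simp
  show ?thesis by (rule exI, rule ballI) (rule const[OF _ m])
qed

text \<open>For a function with \<open>chn y f\<close> the constancy condition in
  \<open>in_L2\<close> holds automatically, so along chains membership in the space is the same as
  \<open>sq\<close>.\<close>

lemma sq_imp_in_L2:
  assumes y: "chn y f" and sq: "sq y"
  shows "in_L2 H lo hi y"
  unfolding in_L2_def
proof (intro conjI allI impI)
  have "continuous_on D y" using cont_imp_continuous_on[OF chn_cont[OF y]] D_sub_S by (rule continuous_on_subset)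
  then show "y \<in> borel_measurable (lebesgue_on {lo<..<hi})"
    by (intro continuous_imp_measurable_on_sets_lebesgue) (simp_all add: D_def)
  obtain N where N: "negligible N" "\<forall>t\<in>D - N. cdot (y t) (cmat (H t) *v y t) = of_real (Q y t)"
    using cdot_Q_AE[of y] unfolding AE_negligible by blast
  have "(\<lambda>t. complex_of_real (Q y t)) absolutely_integrable_on D"
    using sq absolutely_integrable_linear[OF _ bounded_linear_of_real] by (auto simp: sq_def o_def)
  then have "(\<lambda>t. cdot (y t) (cmat (H t) *v y t)) absolutely_integrable_on D"
    by (rule absolutely_integrable_spike[OF _ N(1)]) (use N(2) in auto)
  then show "(\<lambda>t. cdot (y t) (cmat (H t) *v y t)) absolutely_integrable_on {lo<..<hi}" by (simp add: D_def)
  fix u v \<phi> assume a: "lo \<le> u \<and> v \<le> hi \<and> indivisible_type H u v \<phi>"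
  then have "{u<..<v} \<subseteq> D" by (auto simp: D_def)
  then obtain k where k: "\<forall>t\<in>{u<..<v}. of_real (cos \<phi>) * y t $ 1 + of_real (sin \<phi>) * y t $ 2 = k"
    using indivisible_constant[OF y] a by blast
  then show "\<exists>k. AE t\<in>{u<..<v} in lebesgue. cdot (\<chi> i. complex_of_real (xi \<phi> $ i)) (y t) = k"
    by (intro exI[of _ k]) (auto simp: cdot_def sum_2 xi_def)
qed

end

context canonical_side
begin

definition cj :: "(real \<Rightarrow> complex^2) \<Rightarrow> real \<Rightarrow> complex^2" where "cj f = (\<lambda>t. \<chi> i. cnj (f t $ i))"

lemma chn_cnj: "chn y f \<Longrightarrow> chn (cj y) (cj f)"
  unfolding chn_def cj_def
  using is_prim_linear[OF _ bounded_linear_cnj, of S "\<lambda>t. y t $ 1" "\<lambda>t. - P2 f t"]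
    is_prim_linear[OF _ bounded_linear_cnj, of S "\<lambda>t. y t $ 2" "P1 f"]
  by (auto simp: P1_def[abs_def] P2_def[abs_def])

lemma sq_cnj: "sq f \<Longrightarrow> sq (cj f)"
proof -
  assume f: "sq f"
  have "(\<lambda>t. cnj (f t $ i)) \<in> borel_measurable (lebesgue_on D)" for i
    using f exhaust_2[of i] unfolding sq_def meas_def
    by (auto intro!: borel_measurable_continuous_on[of cnj] continuous_intros)
  moreover have "Q (cj f) = Q f" unfolding cj_def by (rule ext) (rule Q_cnj)
  ultimately show ?thesis using f by (simp add: sq_def meas_def cj_def)
qed

end

section \<open>Chains of primitives and the index of a Hamiltonian\<close>

context ham_side
begin

lemma Iop_power_cont: "cont ((Iop ^^ k) (\<lambda>_. v))"
  by (induction k) (auto simp: cont_const intro: chn_cont Iop_prim)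

lemma Iop_power_chn: "chn ((Iop ^^ Suc k) (\<lambda>_. v)) ((Iop ^^ k) (\<lambda>_. v))"
  using Iop_prim(1)[OF Iop_power_cont] by simp

lemma Iop_power_c: "(Iop ^^ Suc k) (\<lambda>_. v) c = 0"
  using Iop_prim(2)[OF Iop_power_cont] by simp

text \<open>The primitive whose second component vanishes at \<sigma>, which keeps it square
  integrable. Its first component is still 0 at \<open>c\<close>, as the functions
  \<open>w_of\<close> require.\<close>

definition nxt :: "(real \<Rightarrow> complex^2) \<Rightarrow> real \<Rightarrow> complex^2" where
  "nxt f = (\<lambda>t. Iop f t - vector [0, Lim F (\<lambda>t. Iop f t $ 2)])"

lemma nxt:
  assumes "cont f" "sq f"
  shows "chn (nxt f) f" "sq (nxt f)" "nxt f c $ 1 = 0" "cont (nxt f)"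
proof -
  note I = Iop_prim(1)[OF assms(1)]
  obtain l where l: "((\<lambda>t. Iop f t $ 2) \<longlongrightarrow> l) F" using chn_limit[OF I assms(2)] .
  then have L: "Lim F (\<lambda>t. Iop f t $ 2) = l" by (rule tendsto_Lim[OF F_neq_bot])
  show n: "chn (nxt f) f" unfolding nxt_def using chn_diff[OF I chn_const] by simp
  have "((\<lambda>t. Iop f t $ 2 - l) \<longlongrightarrow> l - l) F" by (intro tendsto_intros l)
  then show "sq (nxt f)" by (intro chn_vanishing_imp_sq[OF n assms(2)]) (simp add: nxt_def L)
  show "nxt f c $ 1 = 0" by (simp add: nxt_def Iop_prim(2)[OF assms(1)])
  show "cont (nxt f)" by (rule chn_cont[OF n])
qed

lemma nxt_power:
  assumes "cont f" "sq f"
  shows "cont ((nxt ^^ k) f) \<and> sq ((nxt ^^ k) f)"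
  using assms by (induction k) (auto intro: nxt)

lemma w_of_chn: "chn (w_of Iop \<omega> (Suc n)) (w_of Iop \<omega> n)"
proof -
  define d where "d k = (\<lambda>t. if k = 0 then (0 :: complex^2) else (Iop ^^ (k - 1)) (\<lambda>_. vector [0, \<omega> (Suc n - k)]) t)" for k :: nat
  have "chn (\<lambda>t. \<Sum>k\<le>Suc n. (Iop ^^ k) (\<lambda>_. vector [0, \<omega> (Suc n - k)]) t) (\<lambda>t. \<Sum>k\<le>Suc n. d k t)"
  proof (rule chn_sum)
    fix k
    show "chn ((Iop ^^ k) (\<lambda>_. vector [0, \<omega> (Suc n - k)])) (d k)"
    proof (cases k)
      case 0
      then show ?thesis using chn_const[of "vector [0, \<omega> (Suc n)]"] by (simp add: d_def)
    next
      case (Suc j)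
      then show ?thesis using Iop_power_chn[of j] by (simp add: d_def)
    qed
  qed
  moreover have "(\<Sum>k\<le>Suc n. d k t) = w_of Iop \<omega> n t" for t
    by (subst sum.atMost_Suc_shift) (simp add: d_def w_of_def)
  ultimately show ?thesis by (simp add: w_of_def[abs_def])
qed

lemma w_of_c: "w_of Iop \<omega> n c = vector [0, \<omega> n]"
proof -
  have "w_of Iop \<omega> n c = (\<Sum>k\<le>n. if k = 0 then vector [0, \<omega> n] else 0)"
    unfolding w_of_def
  proof (rule sum.cong[OF refl])
    fix k assume "k \<in> {..n}"
    show "(Iop ^^ k) (\<lambda>_. vector [0, \<omega> (n - k)]) c = (if k = 0 then vector [0, \<omega> n] else 0)"
      using Iop_power_c by (cases k) auto
  qed
  then show ?thesis by simp
qed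

lemma w_of_0: "w_of Iop \<omega> 0 t = vector [0, \<omega> 0]"
  by (simp add: w_of_def)

lemma w_of_chn_0: "\<exists>g. chn (w_of Iop \<omega> n) g"
proof (cases n)
  case 0
  have "w_of Iop \<omega> 0 = (\<lambda>_. vector [0, \<omega> 0])" by (simp add: fun_eq_iff w_of_0)
  then show ?thesis using 0 chn_const by metis
qed (use w_of_chn in blast)

definition admissible :: "nat \<Rightarrow> bool" where
  "admissible n \<longleftrightarrow> (\<exists>v :: nat \<Rightarrow> complex^2. in_L2 H lo hi (\<lambda>t. (Iop ^^ n) (\<lambda>_. vector [0, 1]) t + (\<Sum>k<n. (Iop ^^ k) (\<lambda>_. v (n - k)) t)))"

text \<open>The functions tested in \<open>Delta_of\<close>; the constants \<open>v\<close> turn out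
  to be their values at \<open>c\<close>.\<close>

definition gv :: "(nat \<Rightarrow> complex^2) \<Rightarrow> nat \<Rightarrow> real \<Rightarrow> complex^2" where
  "gv v n = (\<lambda>t. (Iop ^^ n) (\<lambda>_. vector [0, 1]) t + (\<Sum>k<n. (Iop ^^ k) (\<lambda>_. v (n - k)) t))"

lemma gv_chn: "chn (gv v (Suc n)) (gv v n)"
proof -
  define d where "d k = (\<lambda>t. if k = 0 then (0 :: complex^2) else (Iop ^^ (k - 1)) (\<lambda>_. v (Suc n - k)) t)" for k :: nat
  have "chn (\<lambda>t. \<Sum>k<Suc n. (Iop ^^ k) (\<lambda>_. v (Suc n - k)) t) (\<lambda>t. \<Sum>k<Suc n. d k t)"
  proof (rule chn_sum)
    fix k
    show "chn ((Iop ^^ k) (\<lambda>_. v (Suc n - k))) (d k)"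
    proof (cases k)
      case 0
      then show ?thesis using chn_const[of "v (Suc n)"] by (simp add: d_def)
    next
      case (Suc j)
      then show ?thesis using Iop_power_chn[of j] by (simp add: d_def)
    qed
  qed
  from chn_add[OF Iop_power_chn[of n "vector [0, 1]"] this]
  have "chn (gv v (Suc n)) (\<lambda>t. (Iop ^^ n) (\<lambda>_. vector [0, 1]) t + (\<Sum>k<Suc n. d k t))" by (simp add: gv_def)
  moreover have "(\<Sum>k<Suc n. d k t) = (\<Sum>k<n. (Iop ^^ k) (\<lambda>_. v (n - k)) t)" for t
    by (subst sum.lessThan_Suc_shift) (simp add: d_def)
  ultimately show ?thesis by (simp add: gv_def)
qed

lemma gv_0: "gv v 0 t = vector [0, 1]"
  by (simp add: gv_def)

lemma gv_c: "n > 0 \<Longrightarrow> gv v n c = v n"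
proof -
  assume n: "n > 0"
  then obtain m where m: "n = Suc m" by (cases n) auto
  have "(\<Sum>k<n. (Iop ^^ k) (\<lambda>_. v (n - k)) c) = (\<Sum>k<n. if k = 0 then v n else 0)"
  proof (rule sum.cong[OF refl])
    fix k assume "k \<in> {..<n}"
    show "(Iop ^^ k) (\<lambda>_. v (n - k)) c = (if k = 0 then v n else 0)"
      using Iop_power_c by (cases k) auto
  qed
  also have "\<dots> = v n" using n by simp
  finally show ?thesis using Iop_power_c[of m "vector [0, 1]"] by (simp add: gv_def m)
qed

text \<open>A primitive is determined by its value at \<open>c\<close>. So all chains from the
  vector with entries 0 and 1 are of the form tested in \<open>Delta_of\<close>, and minimality
  holds among all of them.\<close>

lemma chain_eq_gv:
  assumes "\<And>t. t \<in> S \<Longrightarrow> x 0 t = vector [0, 1]" "\<And>k. k < m \<Longrightarrow> chn (x (Suc k)) (x k)" "n \<le> m" "t \<in> S"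
  shows "x n t = gv (\<lambda>j. x j c) n t"
  using assms(3,4)
proof (induction n arbitrary: t)
  case 0
  then show ?case using assms(1) by (simp add: gv_0)
next
  case (Suc n)
  have 1: "chn (gv (\<lambda>j. x j c) (Suc n)) (x n)"
    by (rule chn_cong[OF gv_chn refl]) (use Suc in simp)
  have 2: "chn (x (Suc n)) (x n)" using assms(2) Suc.prems by simp
  show ?case by (rule chn_unique[OF 2 1 _ Suc.prems(2)]) (simp add: gv_c)
qed

lemma chain_admissible:
  assumes "\<And>t. t \<in> S \<Longrightarrow> x 0 t = vector [0, 1]" "\<And>k. k < m \<Longrightarrow> chn (x (Suc k)) (x k)" "sq (x m)"
  shows "admissible m"
proof -
  have s: "sq (gv (\<lambda>j. x j c) m)"
    by (rule sq_cong[OF assms(3)]) (use chain_eq_gv[of x m m, OF assms(1,2)] D_sub_S in auto)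
  have "\<exists>g. chn (gv (\<lambda>j. x j c) m) g"
  proof (cases m)
    case 0
    have "gv (\<lambda>j. x j c) 0 = (\<lambda>_. vector [0, 1])" by (simp add: fun_eq_iff gv_0)
    then show ?thesis using 0 chn_const by metis
  qed (use gv_chn in blast)
  then have "in_L2 H lo hi (gv (\<lambda>j. x j c) m)" using sq_imp_in_L2[OF _ s] by blast
  then show ?thesis unfolding admissible_def gv_def by (intro exI[of _ "\<lambda>j. x j c"])
qed

lemma Delta_of_eq: "Delta_of H lo hi Iop = Inf (enat ` {n. admissible n})"
  by (simp add: Delta_of_def admissible_def)

end

section \<open>Existence, uniqueness and reality of the sequence \<omega>\<close>

locale finite_Delta = ham_side +
  fixes N0 :: nat
  assumes Delta_eq: "Delta_of H lo hi Iop = enat N0"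
begin

lemma N0_admissible: "admissible N0" and admissible_ge: "admissible n \<Longrightarrow> N0 \<le> n"
proof -
  \<comment> \<open>A finite infimum excludes the empty set and is therefore attained.\<close>
  have ne: "enat ` {n. admissible n} \<noteq> {}"
    using Delta_eq unfolding Delta_of_eq by (auto simp: Inf_enat_def split: if_splits)
  then have "\<exists>x. x \<in> enat ` {n. admissible n}" by blast
  from LeastI_ex[OF this] ne have "Inf (enat ` {n. admissible n}) \<in> enat ` {n. admissible n}"
    by (simp only: Inf_enat_def if_False)
  then show "admissible N0" using Delta_eq unfolding Delta_of_eq by auto
  assume "admissible n"
  then have "Inf (enat ` {n. admissible n}) \<le> enat n" by (intro Inf_lower) simp
  then show "N0 \<le> n" using Delta_eq unfolding Delta_of_eq by simp
qed

lemma N0_le_of_sq_chain: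
  assumes "\<And>t. t \<in> S \<Longrightarrow> x 0 t = vector [0, 1]" "\<And>k. k < m \<Longrightarrow> chn (x (Suc k)) (x k)" "sq (x m)"
  shows "N0 \<le> m"
  using chain_admissible[OF assms] by (rule admissible_ge)

lemma N0_gt_0: "0 < N0"
proof (rule ccontr)
  assume "\<not> 0 < N0"
  then obtain v where "in_L2 H lo hi (gv v 0)" using N0_admissible unfolding admissible_def gv_def by auto
  then have "sq (gv v 0)" by (rule in_L2_imp_sq)
  moreover have "gv v 0 = (\<lambda>_. vector [0, 1])" by (simp add: fun_eq_iff gv_0)
  ultimately show False using not_sq_e2 by simp
qed

definition good_omega :: "(nat \<Rightarrow> complex) \<Rightarrow> bool" where
  "good_omega \<omega> \<longleftrightarrow> \<omega> 0 = 1 \<and> (\<forall>n. Delta_of H lo hi Iop \<le> enat n \<longrightarrow> in_L2 H lo hi (w_of Iop \<omega> n))"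

lemma good_omega_iff: "good_omega \<omega> \<longleftrightarrow> \<omega> 0 = 1 \<and> (\<forall>n\<ge>N0. sq (w_of Iop \<omega> n))"
  unfolding good_omega_def Delta_eq using in_L2_imp_sq sq_imp_in_L2 w_of_chn_0 by (metis enat_ord_simps(1))

text \<open>An admissible chain may have nonzero first components at \<open>c\<close>. They are
  removed by subtracting multiples of the square integrable chain \<phi>, which starts at the vector
  with entries 1 and 0; square integrability at \<open>N0\<close> survives. From \<open>N0\<close>
  on the chain is continued by \<open>nxt\<close>, and \<omega> is read off from the second
  components at \<open>c\<close>.\<close>

lemma good_omega_exists: "\<exists>\<omega>. good_omega \<omega>"
proof -
  obtain v where v: "in_L2 H lo hi (gv v N0)" using N0_admissible unfolding admissible_def gv_def by blast
  define \<phi> where "\<phi> k = (nxt ^^ k) (\<lambda>_. vector [1, 0])" for k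
  have \<phi>: "cont (\<phi> k)" "sq (\<phi> k)" for k
    using nxt_power[OF cont_const sq_e1, of k] unfolding \<phi>_def by auto
  have \<phi>c: "chn (\<phi> (Suc k)) (\<phi> k)" "\<phi> (Suc k) c $ 1 = 0" for k
    using nxt[OF \<phi>, of k] by (simp_all add: \<phi>_def)
  define X where "X m = (\<lambda>t. gv v m t - (\<Sum>k<m. (v (m - k) $ 1) *s \<phi> k t))" for m
  have X_chn: "chn (X (Suc m)) (X m)" for m
  proof -
    define d where "d k = (\<lambda>t. if k = 0 then (0 :: complex^2) else (v (Suc m - k) $ 1) *s \<phi> (k - 1) t)" for k :: nat
    have "chn (\<lambda>t. \<Sum>k<Suc m. (v (Suc m - k) $ 1) *s \<phi> k t) (\<lambda>t. \<Sum>k<Suc m. d k t)"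
    proof (rule chn_sum)
      fix k
      show "chn (\<lambda>t. (v (Suc m - k) $ 1) *s \<phi> k t) (d k)"
      proof (cases k)
        case 0
        then show ?thesis using chn_const[of "v (Suc m) $ 1 *s vector [1, 0]"] by (simp add: d_def \<phi>_def)
      next
        case (Suc j)
        then show ?thesis using chn_scale[OF \<phi>c(1)[of j]] by (simp add: d_def)
      qed
    qed
    from chn_diff[OF gv_chn[of v m] this]
    have "chn (X (Suc m)) (\<lambda>t. gv v m t - (\<Sum>k<Suc m. d k t))" by (simp add: X_def)
    moreover have "(\<Sum>k<Suc m. d k t) = (\<Sum>k<m. (v (m - k) $ 1) *s \<phi> k t)" for t
      by (subst sum.lessThan_Suc_shift) (simp add: d_def)
    ultimately show ?thesis by (simp add: X_def)
  qed
  have X0: "X 0 t = vector [0, 1]" for t by (simp add: X_def gv_0)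
  have Xc: "X m c $ 1 = 0" for m
  proof (cases m)
    case 0
    then show ?thesis by (simp add: X0)
  next
    case (Suc j)
    have "(\<Sum>k<m. (v (m - k) $ 1) * \<phi> k c $ 1) = (\<Sum>k<m. if k = 0 then v m $ 1 else 0)"
    proof (rule sum.cong[OF refl])
      fix k assume "k \<in> {..<m}"
      show "(v (m - k) $ 1) * \<phi> k c $ 1 = (if k = 0 then v m $ 1 else 0)"
        using \<phi>c(2) by (cases k) (auto simp: \<phi>_def)
    qed
    also have "\<dots> = v m $ 1" using Suc by simp
    finally show ?thesis using gv_c[of m v] Suc by (simp add: X_def)
  qed
  have XN: "sq (X N0)" unfolding X_def by (intro sq_diff in_L2_imp_sq v sq_sum sq_scale \<phi>(2))
  define x where "x m = (if m \<le> N0 then X m else (nxt ^^ (m - N0)) (X N0))" for m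
  have x_ge: "x (N0 + k) = (nxt ^^ k) (X N0)" for k by (simp add: x_def)
  have XNc: "cont (X N0)" using chn_cont[OF X_chn] N0_gt_0 by (cases N0) auto
  have x_sq: "sq (x m)" "cont (x m)" if "N0 \<le> m" for m
    using nxt_power[OF XNc XN, of "m - N0"] x_ge[of "m - N0"] that by simp_all
  have x_chn: "chn (x (Suc m)) (x m)" for m
  proof (cases "m < N0")
    case True
    then show ?thesis using X_chn[of m] by (simp add: x_def)
  next
    case False
    then have "x (Suc m) = nxt (x m)" using x_ge[of "m - N0"] x_ge[of "Suc m - N0"] by (simp add: Suc_diff_le)
    then show ?thesis using nxt(1)[OF x_sq(2,1)] False by simp
  qed
  have x_c: "x m c $ 1 = 0" for m
  proof (cases "m \<le> N0")
    case True
    then show ?thesis using Xc by (simp add: x_def)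
  next
    case False
    then obtain j where "m = Suc (N0 + j)" using less_imp_Suc_add by (metis not_le)
    then have "x m = nxt (x (N0 + j))" using x_ge[of j] x_ge[of "Suc j"] by simp
    then show ?thesis using nxt(3)[OF x_sq(2,1)] by simp
  qed
  define \<omega> where "\<omega> m = x m c $ 2" for m
  have eq: "w_of Iop \<omega> m t = x m t" if "t \<in> S" for m t
    using that
  proof (induction m arbitrary: t)
    case 0
    then show ?case by (simp add: w_of_0 \<omega>_def x_def X0)
  next
    case (Suc m)
    have "chn (w_of Iop \<omega> (Suc m)) (x m)" by (rule chn_cong[OF w_of_chn refl]) (simp add: Suc.IH)
    then show ?case
      by (rule chn_unique[OF _ x_chn]) (use Suc.prems x_c[of "Suc m"] in \<open>auto simp: w_of_c vec_eq_iff forall_2 \<omega>_def\<close>)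
  qed
  have "good_omega \<omega>"
    unfolding good_omega_iff
  proof (intro conjI allI impI)
    show "\<omega> 0 = 1" by (simp add: \<omega>_def x_def X0)
    show "sq (w_of Iop \<omega> n)" if "N0 \<le> n" for n
      by (rule sq_cong[OF x_sq(1)[OF that]]) (use eq D_sub_S in auto)
  qed
  then show ?thesis by blast
qed

text \<open>From the first index \<open>j\<close> of disagreement on, the scaled differences form a
  chain that starts at the vector with entries 0 and 1. Minimality forbids this chain to become
  square integrable before step \<open>N0\<close>, but it does so \<open>j\<close> steps earlier, or
  at once if \<open>j\<close> exceeds \<open>N0\<close>.\<close>

lemma good_omega_unique:
  assumes "good_omega \<omega>" "good_omega \<omega>'"
  shows "\<omega> = \<omega>'"
proof (rule ccontr)
  assume "\<omega> \<noteq> \<omega>'"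
  then have ex: "\<exists>j. \<omega> j \<noteq> \<omega>' j" by auto
  define j where "j = (LEAST j. \<omega> j \<noteq> \<omega>' j)"
  have j: "\<omega> j \<noteq> \<omega>' j" using LeastI_ex[OF ex] by (simp add: j_def)
  have less: "\<omega> i = \<omega>' i" if "i < j" for i using not_less_Least[of i "\<lambda>j. \<omega> j \<noteq> \<omega>' j"] that by (auto simp: j_def)
  have "j \<noteq> 0" using j assms by (auto simp: good_omega_iff intro: ccontr)
  then obtain i where i: "j = Suc i" by (cases j) auto
  define x where "x k = (\<lambda>t. (1 / (\<omega> j - \<omega>' j)) *s (w_of Iop \<omega> (k + j) t - w_of Iop \<omega>' (k + j) t))" for k
  have same: "w_of Iop \<omega> i t = w_of Iop \<omega>' i t" for t
    unfolding w_of_def using less i by (intro sum.cong) auto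
  have 0: "chn (\<lambda>t. w_of Iop \<omega> j t - w_of Iop \<omega>' j t) (\<lambda>t. w_of Iop \<omega> i t - w_of Iop \<omega>' i t)"
    unfolding i by (rule chn_diff[OF w_of_chn w_of_chn])
  have x0: "x 0 t = vector [0, 1]" if "t \<in> S" for t
  proof -
    have "w_of Iop \<omega> j t - w_of Iop \<omega>' j t = w_of Iop \<omega> j c - w_of Iop \<omega>' j c"
      by (rule chn_zero_const[OF 0 _ that c_in_S]) (simp add: same)
    then show ?thesis using j by (simp add: x_def w_of_c vec_eq_iff forall_2 diff_divide_distrib[symmetric])
  qed
  have xc: "chn (x (Suc k)) (x k)" for k
    unfolding x_def using chn_scale[OF chn_diff[OF w_of_chn w_of_chn]] by simp
  \<comment> \<open>\<open>N0 - j + j \<ge> N0\<close> holds for truncated subtraction as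
    well.\<close>
  have "sq (x (N0 - j))"
    unfolding x_def using assms by (intro sq_scale sq_diff) (auto simp: good_omega_iff)
  from N0_le_of_sq_chain[OF x0 xc this] have "N0 \<le> N0 - j" .
  then show False using N0_gt_0 i by simp
qed

definition om :: "nat \<Rightarrow> complex" where "om = omega_of H lo hi Iop"

lemma om_good: "good_omega om"
proof -
  have "\<exists>!\<omega>. good_omega \<omega>" using good_omega_exists good_omega_unique by blast
  then show ?thesis unfolding om_def omega_of_def good_omega_def[symmetric] by (rule theI')
qed

definition ww :: "nat \<Rightarrow> real \<Rightarrow> complex^2" where "ww = w_of Iop om"

lemma ww_c: "ww n c = vector [0, om n]"
  by (simp add: ww_def w_of_c)

lemma om_0: "om 0 = 1" using om_good by (simp add: good_omega_iff)

sublocale w_chain h1 h2 h3 c s ww N0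
proof
  show "ww 0 t = vector [0, 1]" if "t \<in> S" for t by (simp add: ww_def w_of_0 om_0)
  show "chn (ww (Suc n)) (ww n)" for n unfolding ww_def by (rule w_of_chn)
  show "ww n c $ 1 = 0" for n by (simp add: ww_c)
  show "sq (ww n)" if "N0 \<le> n" for n using om_good that by (simp add: good_omega_iff ww_def)
  show "N0 \<le> m" if "\<And>t. t \<in> S \<Longrightarrow> x 0 t = vector [0, 1]" "\<And>k. k < m \<Longrightarrow> chn (x (Suc k)) (x k)" "sq (x m)" for x m
    using that by (rule N0_le_of_sq_chain)
qed

text \<open>\<open>H\<close> is real, so the conjugate sequence has the characterising property too,
  and uniqueness applies. Hence pairing with \<open>ww n\<close> by \<open>cdot\<close> is the
  bilinear pairing.\<close>

lemma ww_cnj: "t \<in> S \<Longrightarrow> cnj (ww n t $ i) = ww n t $ i"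
proof -
  assume t: "t \<in> S"
  define \<omega>' where "\<omega>' n = cnj (om n)" for n
  have eq: "w_of Iop \<omega>' m t = cj (ww m) t" if "t \<in> S" for m t
    using that
  proof (induction m arbitrary: t)
    case 0
    show ?case by (simp add: cj_def ww_def w_of_0 \<omega>'_def vec_eq_iff forall_2)
  next
    case (Suc m)
    have "chn (w_of Iop \<omega>' (Suc m)) (cj (ww m))" by (rule chn_cong[OF w_of_chn refl]) (simp add: Suc.IH)
    then show ?case
      by (rule chn_unique[OF _ chn_cnj[OF w_chn]]) (use Suc.prems in \<open>auto simp: w_of_c ww_c cj_def vec_eq_iff forall_2 \<omega>'_def\<close>)
  qed
  have "good_omega \<omega>'"
    unfolding good_omega_iff
  proof (intro conjI allI impI)
    show "\<omega>' 0 = 1" by (simp add: \<omega>'_def om_0)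
    show "sq (w_of Iop \<omega>' n)" if "N0 \<le> n" for n
      by (rule sq_cong[OF sq_cnj[OF w_sq[OF that]]]) (use eq D_sub_S in auto)
  qed
  then have "\<omega>' = om" using good_omega_unique om_good by blast
  then show ?thesis using eq[OF t, of n] by (simp add: ww_def cj_def vec_eq_iff)
qed

subsection \<open>The maximal relation\<close>

definition eqP :: "(real \<Rightarrow> complex^2) \<Rightarrow> (real \<Rightarrow> complex^2) \<Rightarrow> bool" where
  "eqP f g \<longleftrightarrow> (AE t\<in>D in lebesgue. P1 f t = P1 g t \<and> P2 f t = P2 g t)"

lemma cmat_P:
  assumes "H t $ 1 $ 1 = h1 t \<and> H t $ 2 $ 2 = h2 t \<and> H t $ 1 $ 2 = h3 t \<and> H t $ 2 $ 1 = h3 t"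
  shows "(cmat (H t) *v f t) $ 1 = P1 f t" "(cmat (H t) *v f t) $ 2 = P2 f t"
  using assms by (simp_all add: cmat_mult P1_def P2_def)

lemma eq_H_iff: "eq_H H lo hi f g \<longleftrightarrow> eqP f g"
proof -
  have key: "AE t\<in>D in lebesgue. (cmat (H t) *v f t = cmat (H t) *v g t) = (P1 f t = P1 g t \<and> P2 f t = P2 g t)"
    using H_eq_D
  proof eventually_elim
    case (elim t)
    then show ?case using cmat_P[of t f] cmat_P[of t g] by (simp add: vec_eq_iff forall_2)
  qed
  have "(AE t\<in>D in lebesgue. cmat (H t) *v f t = cmat (H t) *v g t) = (AE t\<in>D in lebesgue. P1 f t = P1 g t \<and> P2 f t = P2 g t)"
  proof
    assume "AE t\<in>D in lebesgue. cmat (H t) *v f t = cmat (H t) *v g t"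
    then show "AE t\<in>D in lebesgue. P1 f t = P1 g t \<and> P2 f t = P2 g t"
      using key by eventually_elim blast
  next
    assume "AE t\<in>D in lebesgue. P1 f t = P1 g t \<and> P2 f t = P2 g t"
    then show "AE t\<in>D in lebesgue. cmat (H t) *v f t = cmat (H t) *v g t"
      using key by eventually_elim blast
  qed
  then show ?thesis unfolding eq_H_def eqP_def D_def .
qed

lemma eqP_refl: "eqP f f"
  by (simp add: eqP_def)

lemma eqP_sym: assumes "eqP f g" shows "eqP g f"
  using assms unfolding eqP_def by eventually_elim auto

lemma eqP_trans: assumes "eqP f g" "eqP g k" shows "eqP f k"
  using assms unfolding eqP_def by eventually_elim auto

lemma eqP_cong: "(\<And>t. t \<in> D \<Longrightarrow> f t = g t) \<Longrightarrow> eqP f g"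
  unfolding eqP_def by (simp add: P1_def P2_def)

lemma eqP_add: assumes "eqP f g" "eqP x y" shows "eqP (\<lambda>t. f t + x t) (\<lambda>t. g t + y t)"
  using assms unfolding eqP_def by eventually_elim (auto simp: P_linear)

lemma eqP_scale: assumes "eqP f g" shows "eqP (\<lambda>t. k *s f t) (\<lambda>t. k *s g t)"
  using assms unfolding eqP_def by eventually_elim (auto simp: P_linear)

lemma interior_sub_D: "{u..v} \<subseteq> S \<Longrightarrow> {u<..<v} \<subseteq> D"
proof
  fix t assume S: "{u..v} \<subseteq> S" and t: "t \<in> {u<..<v}"
  then have "u \<in> S" "v \<in> S" "t \<in> S" by auto
  then show "t \<in> D" using t unfolding S_def D_def by auto
qed

lemma chn_eqP:
  assumes "chn y f" "eqP f g"
  shows "chn y g"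
proof -
  have ae: "AE t\<in>{u<..<v} in lebesgue. P1 f t = P1 g t \<and> P2 f t = P2 g t" if "{u..v} \<subseteq> S" for u v
    using assms(2) interior_sub_D[OF that] unfolding eqP_def by (auto elim!: eventually_mono)
  show ?thesis
    unfolding chn_def
  proof
    show "is_prim S (\<lambda>t. y t $ 1) (\<lambda>t. - P2 g t)"
    proof (rule is_prim_cong_AE[OF conjunct1[OF assms(1)[unfolded chn_def]] refl])
      fix u v assume "{u..v} \<subseteq> S"
      from ae[OF this] show "AE t\<in>{u<..<v} in lebesgue. - P2 f t = - P2 g t" by eventually_elim auto
    qed
    show "is_prim S (\<lambda>t. y t $ 2) (P1 g)"
    proof (rule is_prim_cong_AE[OF conjunct2[OF assms(1)[unfolded chn_def]] refl])
      fix u v assume "{u..v} \<subseteq> S"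
      from ae[OF this] show "AE t\<in>{u<..<v} in lebesgue. P1 f t = P1 g t" by eventually_elim auto
    qed
  qed
qed

lemma Q_P: "Q f t = Re (cnj (f t $ 1) * P1 f t + cnj (f t $ 2) * P2 f t)"
  unfolding Q_real_form P1_def P2_def by (simp add: power2_eq_square algebra_simps)

lemma P_symmetric: "Re (cnj (f t $ 1) * P1 g t + cnj (f t $ 2) * P2 g t) = Re (cnj (g t $ 1) * P1 f t + cnj (g t $ 2) * P2 f t)"
  unfolding P1_def P2_def by (simp add: algebra_simps)

text \<open>If \<open>H f = H g\<close>, symmetry of \<open>H\<close> gives, in real parts, that the
  value at \<open>f\<close> equals the mixed value of \<open>f\<close> and \<open>g\<close>, and
  this equals the value at \<open>g\<close>.\<close>

lemma Q_eqP: "P1 f t = P1 g t \<Longrightarrow> P2 f t = P2 g t \<Longrightarrow> Q f t = Q g t"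
  using Q_P[of f t] Q_P[of g t] P_symmetric[of f t g] by simp

lemma sq_eqP:
  assumes "sq f" "eqP f g" "meas g"
  shows "sq g"
proof -
  obtain N where N: "negligible N" "\<forall>t\<in>D - N. P1 f t = P1 g t \<and> P2 f t = P2 g t"
    using assms(2) unfolding eqP_def AE_negligible by blast
  have "Q f absolutely_integrable_on D" using assms(1) by (simp add: sq_def)
  then have "Q g absolutely_integrable_on D"
    by (rule absolutely_integrable_spike[OF _ N(1)]) (use N(2) Q_eqP in metis)
  with assms(3) show ?thesis by (simp add: sq_def)
qed

lemma chn_of_ac:
  assumes S': "S' = S \<or> S' = D" and y: "loc_abs_continuous_on S' y"
    and der: "AE t\<in>D in lebesgue. (y has_vector_derivative J *v (cmat (H t) *v g t)) (at t)"
    and int: "\<And>u v. {u..v} \<subseteq> S \<Longrightarrow> P1 g absolutely_integrable_on {u..v}" "\<And>u v. {u..v} \<subseteq> S \<Longrightarrow> P2 g absolutely_integrable_on {u..v}"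
  shows "is_prim S' y (JHf g)"
proof (rule is_primI_abs_continuous[OF y])
  have S'S: "S' \<subseteq> S" using S' D_sub_S by blast
  have "AE t\<in>D in lebesgue. (y has_vector_derivative JHf g t) (at t)"
    using der JHf_AE[of g] by eventually_elim auto
  then show "AE t\<in>{u<..<v} in lebesgue. (y has_vector_derivative JHf g t) (at t)" if "{u..v} \<subseteq> S'" for u v
    using interior_sub_D[OF order_trans[OF that S'S]] by (auto elim!: eventually_mono)
  show "JHf g absolutely_integrable_on {u..v}" if "{u..v} \<subseteq> S'" for u v
    using that S'S by (intro JHf_abs_int int) blast+
qed

lemma Tmax_representative:
  assumes "in_Tmax H lo hi f g"
  obtains y where "chn y g" "eqP y f" "sq f" "sq g"
proof -
  have sq: "sq f" "sq g" using assms unfolding in_Tmax_def by (auto intro: in_L2_imp_sq)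
  obtain y where y: "ac_representative H lo hi D f g y" using assms unfolding in_Tmax_def D_def by blast
  note int = P_abs_int_of_sq[OF sq(2)]
  have "is_prim D y (JHf g)"
    using y int unfolding ac_representative_def D_def[symmetric] by (intro chn_of_ac) auto
  then obtain y' where y': "is_prim S y' (JHf g)" "\<And>t. t \<in> D \<Longrightarrow> y' t = y t"
    using prim_extend[OF _ JHf_abs_int[OF int]] by blast
  have "eqP y f" using y unfolding ac_representative_def eq_H_iff by blast
  then have "eqP y' f" using eqP_trans[OF eqP_cong] y'(2) by blast
  with y'(1) sq show thesis using that by (simp add: chn_JHf)
qed

text \<open>Since \<open>H\<close> is real, the real or the imaginary part of \<open>k\<close> is a
  nonzero real kernel vector. As \<open>H t\<close> is symmetric and nonzero, its range is the line
  orthogonal to this vector, which is the same for almost all \<open>t\<close>.\<close>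

lemma kernel_imp_indivisible:
  assumes "k \<noteq> 0" "eqP (\<lambda>_. k) (\<lambda>_. 0)"
  shows "indivisible H lo hi"
proof -
  obtain r1 r2 :: real where r: "(r1, r2) \<noteq> (0, 0)"
    and rk: "\<And>a b :: real. of_real a * k $ 1 + of_real b * k $ 2 = 0 \<Longrightarrow> a * r1 + b * r2 = 0"
  proof (cases "(Re (k $ 1), Re (k $ 2)) = (0, 0)")
    case True
    then have "(Im (k $ 1), Im (k $ 2)) \<noteq> (0, 0)" using assms(1) by (auto simp: vec_eq_iff forall_2 complex_eq_iff)
    then show ?thesis by (intro that[of "Im (k $ 1)" "Im (k $ 2)"]) (auto simp: complex_eq_iff)
  next
    case False
    then show ?thesis by (intro that[of "Re (k $ 1)" "Re (k $ 2)"]) (auto simp: complex_eq_iff)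
  qed
  \<comment> \<open>The kernel vector turned by a right angle, in polar form: its argument is the
    type.\<close>
  define \<rho> where "\<rho> = norm (Complex r2 (- r1))"
  have \<rho>: "\<rho> \<noteq> 0" using r by (auto simp: \<rho>_def complex_eq_iff)
  define \<phi> where "\<phi> = Arg (Complex r2 (- r1))"
  have pol: "Complex r2 (- r1) = of_real \<rho> * cis \<phi>"
    unfolding \<rho>_def \<phi>_def using rcis_cmod_Arg[of "Complex r2 (- r1)"] by (simp add: rcis_def)
  have r1: "r1 = - \<rho> * sin \<phi>" and r2: "r2 = \<rho> * cos \<phi>"
    using arg_cong[OF pol, of Re] arg_cong[OF pol, of Im] by auto
  have perp: "a * sin \<phi> = b * cos \<phi>" if "of_real a * k $ 1 + of_real b * k $ 2 = 0" for a b :: real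
  proof -
    have "\<rho> * (b * cos \<phi>) - \<rho> * (a * sin \<phi>) = a * r1 + b * r2" by (simp add: r1 r2)
    then have "\<rho> * (b * cos \<phi>) - \<rho> * (a * sin \<phi>) = 0" using rk[OF that] by (simp only:)
    then have "\<rho> * (a * sin \<phi>) = \<rho> * (b * cos \<phi>)" by (simp only: right_minus_eq)
    then show ?thesis using \<rho> by (simp only: mult_left_cancel[OF \<rho>])
  qed
  have "AE t\<in>D in lebesgue. range (\<lambda>x. H t *v x) = span {xi \<phi>}"
    using H_eq_D assms(2)[unfolded eqP_def] H_nonzero[folded D_def]
  proof eventually_elim
    case (elim t)
    show ?case
    proof
      assume t: "t \<in> D"
      have e: "H t $ 1 $ 1 = h1 t" "H t $ 2 $ 2 = h2 t" "H t $ 1 $ 2 = h3 t" "H t $ 2 $ 1 = h3 t" using elim t by auto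
      have p: "h1 t * sin \<phi> = h3 t * cos \<phi>" "h3 t * sin \<phi> = h2 t * cos \<phi>"
        using elim t by (auto simp: P1_def P2_def intro!: perp)
      \<comment> \<open>The trace, which is the nonzero eigenvalue of the rank one matrix
        \<open>H t\<close>.\<close>
      define \<tau> where "\<tau> = h1 t + h2 t"
      have sc: "sin \<phi> * sin \<phi> = 1 - cos \<phi> * cos \<phi>" using sin_squared_eq[of \<phi>] by (simp add: power2_eq_square)
      have h1: "h1 t = \<tau> * cos \<phi> * cos \<phi>" and h3: "h3 t = \<tau> * cos \<phi> * sin \<phi>" and h2: "h2 t = \<tau> * sin \<phi> * sin \<phi>"
      proof -
        have a: "h1 t * sin \<phi> * sin \<phi> = h2 t * cos \<phi> * cos \<phi>"
          using p by (metis mult.assoc mult.commute)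
        have u: "cos \<phi> * cos \<phi> + sin \<phi> * sin \<phi> = 1" using sc by simp
        have one: "x = x * cos \<phi> * cos \<phi> + x * sin \<phi> * sin \<phi>" for x :: real
        proof -
          have "x * cos \<phi> * cos \<phi> + x * sin \<phi> * sin \<phi> = x * (cos \<phi> * cos \<phi> + sin \<phi> * sin \<phi>)" by (simp only: distrib_left mult.assoc)
          then show ?thesis by (simp only: u mult_1_right)
        qed
        show "h1 t = \<tau> * cos \<phi> * cos \<phi>" using one[of "h1 t"] a by (simp add: \<tau>_def distrib_right)
        show "h2 t = \<tau> * sin \<phi> * sin \<phi>" using one[of "h2 t"] a by (simp add: \<tau>_def distrib_right)
        have "\<tau> * cos \<phi> * sin \<phi> = (h1 t * sin \<phi>) * cos \<phi> + (h2 t * cos \<phi>) * sin \<phi>" by (simp add: \<tau>_def algebra_simps)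
        also have "\<dots> = h3 t * (cos \<phi> * cos \<phi> + sin \<phi> * sin \<phi>)" unfolding p(1) p(2)[symmetric] by (simp only: distrib_left mult.assoc)
        also have "\<dots> = h3 t" by (simp only: u mult_1_right)
        finally show "h3 t = \<tau> * cos \<phi> * sin \<phi>" by (rule sym)
      qed
      have Hx: "H t *v x = (\<tau> * (cos \<phi> * x $ 1 + sin \<phi> * x $ 2)) *\<^sub>R xi \<phi>" for x
        by (simp add: vec_eq_iff forall_2 matrix_vector_mult_def sum_2 e h1 h2 h3 xi_def algebra_simps)
      have "\<tau> \<noteq> 0"
      proof
        assume "\<tau> = 0"
        then have "H t = 0" by (simp add: vec_eq_iff forall_2 e h1 h2 h3)
        then show False using elim t by blast
      qed
      show "range (\<lambda>x. H t *v x) = span {xi \<phi>}"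
      proof (intro equalityI subsetI)
        fix v assume "v \<in> range (\<lambda>x. H t *v x)"
        then show "v \<in> span {xi \<phi>}" unfolding Hx by (auto simp: span_singleton)
      next
        fix v assume "v \<in> span {xi \<phi>}"
        then obtain q where q: "v = q *\<^sub>R xi \<phi>" by (auto simp: span_singleton)
        have "H t *v ((q / \<tau>) *\<^sub>R xi \<phi>) = v"
          unfolding Hx q using \<open>\<tau> \<noteq> 0\<close> sc by (simp add: xi_def algebra_simps flip: distrib_left)
        then show "v \<in> range (\<lambda>x. H t *v x)" by (metis rangeI)
      qed
    qed
  qed
  then show ?thesis using cs unfolding indivisible_def indivisible_type_def D_def by auto
qed

text \<open>Two representatives differ by a constant annihilated by \<open>H\<close>, and unless the
  interval is indivisible this constant is 0. So the descriptions in \<open>val_minus\<close> and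
  \<open>val_plus\<close> are unique.\<close>

lemma val_eq:
  assumes ni: "\<not> indivisible H lo hi" and y: "chn y g" "eqP y f"
  shows "(THE v. \<exists>y. v = y c \<and> ac_representative H lo hi S f g y) = y c"
proof (rule the_equality)
  have "AE t\<in>D in lebesgue. (y has_vector_derivative JHf g t) (at t)"
    using is_prim_has_vector_derivative[of S y "JHf g" lo hi] y(1) D_sub_S unfolding chn_JHf D_def by blast
  then have "AE t\<in>D in lebesgue. (y has_vector_derivative J *v (cmat (H t) *v g t)) (at t)"
    using JHf_AE[of g] by eventually_elim auto
  then have "ac_representative H lo hi S f g y"
    using y is_prim_imp_loc_abs_continuous_on unfolding ac_representative_def eq_H_iff chn_JHf D_def by blast
  then show "\<exists>ya. y c = ya c \<and> ac_representative H lo hi S f g ya" by blast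
  fix v assume "\<exists>y. v = y c \<and> ac_representative H lo hi S f g y"
  then obtain x where x: "v = x c" "ac_representative H lo hi S f g x" by blast
  have "is_prim S x (JHf g)"
    using x(2) y(1) unfolding ac_representative_def D_def[symmetric]
  proof (intro chn_of_ac)
    fix u v assume uv: "{u..v} \<subseteq> S"
    have "P1 g absolutely_integrable_on {u..v} \<and> P2 g absolutely_integrable_on {u..v}"
    proof (cases "u \<le> v")
      case True
      have "P1 g absolutely_integrable_on {u..v}" using is_primD(1)[OF conjunct2[OF y(1)[unfolded chn_def]] True uv] .
      moreover have "(\<lambda>t. - (- P2 g t)) absolutely_integrable_on {u..v}"
        using absolutely_integrable_linear[OF is_primD(1)[OF conjunct1[OF y(1)[unfolded chn_def]] True uv]
            bounded_linear_minus[OF bounded_linear_ident]] by (simp add: o_def)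
      ultimately show ?thesis by simp
    qed simp
    then show "P1 g absolutely_integrable_on {u..v}" "P2 g absolutely_integrable_on {u..v}" by simp_all
  qed auto
  then have xc: "chn x g" by (simp add: chn_JHf)
  have d: "chn (\<lambda>t. x t - y t) (\<lambda>t. g t - g t)" by (rule chn_diff[OF xc y(1)])
  have const: "x t - y t = x c - y c" if "t \<in> S" for t
    by (rule chn_zero_const[OF d _ that c_in_S]) simp
  have "eqP x f" using x(2) unfolding ac_representative_def eq_H_iff by blast
  from eqP_add[OF eqP_trans[OF this eqP_sym[OF y(2)]] eqP_scale[OF eqP_refl[of y], of "-1"]]
  have "eqP (\<lambda>t. x t - y t) (\<lambda>t. y t - y t)" by simp
  then have "eqP (\<lambda>t. x t - y t) (\<lambda>t. 0)" by simp
  moreover have "eqP (\<lambda>t. x c - y c) (\<lambda>t. x t - y t)"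
  proof (rule eqP_cong)
    fix t assume "t \<in> D"
    then have "t \<in> S" using D_sub_S by blast
    then show "x c - y c = x t - y t" by (rule const[symmetric])
  qed
  ultimately have "eqP (\<lambda>t. x c - y c) (\<lambda>t. 0)" by (rule eqP_trans[rotated])
  then have "x c - y c = 0" using kernel_imp_indivisible ni by blast
  then show "v = y c" using x(1) by simp
qed

text \<open>For a type with \<open>cos \<phi> \<noteq> 0\<close> the entry \<open>h2\<close> would
  be a multiple of \<open>h1\<close> and hence integrable by (I), in contradiction to the limit
  point case at \<sigma>.\<close>

lemma indivisible_h:
  assumes "indivisible H lo hi"
  shows "AE t\<in>D in lebesgue. h1 t = 0 \<and> h3 t = 0" "\<And>\<phi>. indivisible_type H lo hi \<phi> \<Longrightarrow> cos \<phi> = 0"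
proof -
  have *: "cos \<phi> = 0 \<and> (AE t\<in>D in lebesgue. h1 t = 0 \<and> h3 t = 0)" if \<phi>: "indivisible_type H lo hi \<phi>" for \<phi>
  proof -
    have "AE t\<in>D in lebesgue. \<exists>k1 k2. h1 t = k1 * cos \<phi> \<and> h3 t = k1 * sin \<phi> \<and> h3 t = k2 * cos \<phi> \<and> h2 t = k2 * sin \<phi>"
      using H_eq_D \<phi>[unfolded indivisible_type_def, THEN conjunct2, folded D_def]
    proof eventually_elim
      case (elim t)
      show ?case
      proof
        assume t: "t \<in> D"
        have "H t *v axis 1 1 \<in> span {xi \<phi>}" "H t *v axis 2 1 \<in> span {xi \<phi>}" using elim t by auto
        then obtain k1 k2 where "H t *v axis 1 1 = k1 *\<^sub>R xi \<phi>" "H t *v axis 2 1 = k2 *\<^sub>R xi \<phi>"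
          unfolding span_singleton by auto
        then show "\<exists>k1 k2. h1 t = k1 * cos \<phi> \<and> h3 t = k1 * sin \<phi> \<and> h3 t = k2 * cos \<phi> \<and> h2 t = k2 * sin \<phi>"
          using elim t unfolding vec_eq_iff forall_2
          by (intro exI[of _ k1] exI[of _ k2]) (auto simp: matrix_vector_mult_def sum_2 axis_def xi_def)
      qed
    qed
    then obtain N where N: "negligible N"
      "\<forall>t\<in>D - N. \<exists>k1 k2. h1 t = k1 * cos \<phi> \<and> h3 t = k1 * sin \<phi> \<and> h3 t = k2 * cos \<phi> \<and> h2 t = k2 * sin \<phi>"
      unfolding AE_negligible by blast
    have c0: "cos \<phi> = 0"
    proof (rule ccontr)
      assume c: "cos \<phi> \<noteq> 0"
      have eq: "h2 t = (sin \<phi> / cos \<phi>)\<^sup>2 * h1 t" if tN: "t \<in> D - N" for t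
      proof -
        obtain k1 k2 where k: "h1 t = k1 * cos \<phi>" "h3 t = k1 * sin \<phi>" "h3 t = k2 * cos \<phi>" "h2 t = k2 * sin \<phi>"
          using bspec[OF N(2) tN] by (elim exE conjE)
        have "k2 = k1 * sin \<phi> / cos \<phi>" using k(2,3) c by (simp add: field_simps)
        then show ?thesis using k c by (simp add: power2_eq_square field_simps)
      qed
      have "(\<lambda>t. (sin \<phi> / cos \<phi>)\<^sup>2 * h1 t) absolutely_integrable_on D"
        using int_h1 by (simp add: D_def)
      from absolutely_integrable_spike[where f = "\<lambda>t. (sin \<phi> / cos \<phi>)\<^sup>2 * h1 t", OF this N(1)] eq
      have "h2 absolutely_integrable_on D" by simp
      then show False using lp by (simp add: D_def)
    qed
    have "\<forall>t\<in>D - N. h1 t = 0 \<and> h3 t = 0" using N(2) c0 by fastforce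
    then show ?thesis using c0 N(1) unfolding AE_negligible by blast
  qed
  show "AE t\<in>D in lebesgue. h1 t = 0 \<and> h3 t = 0" using assms * unfolding indivisible_def by blast
  show "cos \<phi> = 0" if "indivisible_type H lo hi \<phi>" for \<phi> using * that by blast
qed

lemma indivisible_second_const:
  assumes ind: "indivisible H lo hi" and y: "chn y g" and t: "t \<in> S"
  shows "y t $ 2 = y c $ 2"
proof -
  have "is_prim S (\<lambda>t. y t $ 2) (\<lambda>t. 0)"
  proof (rule is_prim_cong_AE[OF conjunct2[OF y[unfolded chn_def]] refl])
    fix u v assume "{u..v} \<subseteq> S"
    from interior_sub_D[OF this] indivisible_h(1)[OF ind]
    show "AE t\<in>{u<..<v} in lebesgue. P1 g t = 0" by (auto elim!: eventually_mono simp: P1_def)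
  qed
  from is_prim_zero_imp_eq[OF this interval_S t c_in_S] show ?thesis .
qed

text \<open>The second component of \<open>ww n\<close> is constant with value \<open>om n\<close>,
  and it tends to 0. This explains why \<open>B_term\<close> may leave out an indivisible side for
  \<open>k \<ge> 1\<close>.\<close>

lemma indivisible_om:
  assumes "indivisible H lo hi" "n > 0"
  shows "om n = 0"
proof -
  have "((\<lambda>t. ww n t $ 2) \<longlongrightarrow> om n) F"
  proof (rule Lim_transform_eventually[OF tendsto_const])
    show "eventually (\<lambda>t. om n = ww n t $ 2) F"
      using eventually_D
    proof eventually_elim
      case (elim t)
      then show ?case using indivisible_second_const[OF assms(1) w_wd[of n], of t] D_sub_S by (auto simp: ww_c)
    qed
  qed
  then show ?thesis using tendsto_unique[OF F_neq_bot _ w_vanishing[OF assms(2)]] by blast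
qed

lemma indivisible_eqP:
  assumes "indivisible H lo hi" "\<And>t. t \<in> D \<Longrightarrow> f t $ 2 = g t $ 2"
  shows "eqP f g"
  unfolding eqP_def using indivisible_h(1)[OF assms(1)]
  by eventually_elim (auto simp: P1_def P2_def assms(2))

text \<open>Wronskians replace a Gronwall argument: those of the difference with \<open>p\<close>
  and \<open>q\<close> vanish, while \<open>p\<close> and \<open>q\<close> are linearly independent
  at every point.\<close>

lemma solution_unique:
  assumes m: "chn p (\<lambda>t. z *s p t)" "chn q (\<lambda>t. z *s q t)" "wron p q c \<noteq> 0"
    and y: "chn y (\<lambda>t. z *s y t)" and x: "chn x (\<lambda>t. z *s x t)" and c: "y c = x c" and t: "t \<in> S"
  shows "y t = x t"
proof -
  define d where "d = (\<lambda>t. y t - x t)"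
  have d: "chn d (\<lambda>t. z *s d t)"
    by (rule chn_cong[OF chn_diff[OF y x]]) (simp_all add: d_def vec_eq_iff algebra_simps)
  have w0: "wron d p t = 0" "wron d q t = 0"
    using wron_solutions_const[OF d m(1) t c_in_S] wron_solutions_const[OF d m(2) t c_in_S] c
    by (simp_all add: wron_def d_def)
  have w1: "wron p q t \<noteq> 0" using wron_solutions_const[OF m(1,2) t c_in_S] m(3) by simp
  have "d t $ 1 * wron p q t = 0" "d t $ 2 * wron p q t = 0"
  proof -
    have "d t $ 1 * wron p q t = q t $ 1 * - wron d p t + p t $ 1 * wron d q t"
      "d t $ 2 * wron p q t = q t $ 2 * - wron d p t + p t $ 2 * wron d q t"
      by (simp_all add: wron_def algebra_simps)
    then show "d t $ 1 * wron p q t = 0" "d t $ 2 * wron p q t = 0" using w0 by simp_all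
  qed
  then show ?thesis using w1 by (simp add: d_def vec_eq_iff forall_2)
qed

text \<open>The transpose of \<open>J\<close> is its inverse, so transposing
  \<open>(W J)' = z W H\<close> gives \<open>y' = z J H y\<close> for the columns of the
  transpose.\<close>

lemma canonical_solution_chn:
  assumes "canonical_solution H lo hi S z M"
  shows "chn (\<lambda>t. transpose (M t) *v v) (\<lambda>t. z *s (transpose (M t) *v v))"
proof -
  define y where "y t = transpose (M t) *v v" for t
  have M: "loc_abs_continuous_on S M"
    and der: "AE t\<in>D in lebesgue. ((\<lambda>s. M s ** J) has_vector_derivative mat z ** (M t ** cmat (H t))) (at t)"
    using assms unfolding canonical_solution_def D_def by auto
  \<comment> \<open>Chosen such that \<open>T (M ** J) = transpose M *v v\<close>, because the
    derivative is prescribed for \<open>M ** J\<close>.\<close>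
  define T where "T N = (vector [- (\<Sum>i\<in>UNIV. N $ i $ 2 * v $ i), (\<Sum>i\<in>UNIV. N $ i $ 1 * v $ i)] :: complex^2)" for N :: "complex^2^2"
  have "linear T"
    by (rule linearI) (auto simp: T_def vec_eq_iff forall_2 sum_2 algebra_simps)
  then have T: "bounded_linear T" by (simp add: linear_conv_bounded_linear)
  have "linear (\<lambda>N::complex^2^2. transpose N *v v)"
    by (rule linearI) (auto simp: transpose_def matrix_vector_mult_def vec_eq_iff forall_2 sum_2 algebra_simps)
  then have L: "bounded_linear (\<lambda>N::complex^2^2. transpose N *v v)" by (simp add: linear_conv_bounded_linear)
  have yac: "loc_abs_continuous_on S y"
    using M abs_continuous_on_linear[OF L] unfolding loc_abs_continuous_on_def y_def[abs_def] by blast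
  then have "continuous_on S y"
    unfolding loc_abs_continuous_on_def
    by (intro continuous_on_local_real[OF interval_S]) (blast intro: abs_continuous_on_imp_continuous_on)
  then have "cont y" unfolding cont_def by (auto intro: continuous_intros)
  then have cy: "cont (\<lambda>t. z *s y t)" by (rule cont_scale)
  have TM: "T (M t ** J) = y t" for t
    by (simp add: T_def y_def transpose_def matrix_vector_mult_def matrix_matrix_mult_def J_def vec_eq_iff forall_2 sum_2)
  have "AE t\<in>D in lebesgue. (y has_vector_derivative J *v (cmat (H t) *v (z *s y t))) (at t)"
    using der H_eq_D
  proof eventually_elim
    case (elim t)
    show ?case
    proof
      assume t: "t \<in> D"
      then have "((\<lambda>s. T (M s ** J)) has_vector_derivative T (mat z ** (M t ** cmat (H t)))) (at t)"
        using elim by (intro bounded_linear.has_vector_derivative[OF T]) auto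
      moreover have "T (mat z ** (M t ** cmat (H t))) = J *v (cmat (H t) *v (z *s y t))"
      proof -
        have e: "H t $ 1 $ 1 = h1 t" "H t $ 2 $ 2 = h2 t" "H t $ 1 $ 2 = h3 t" "H t $ 2 $ 1 = h3 t" using elim t by auto
        have 1: "(mat z ** N) $ i $ j = z * N $ i $ j" for N :: "complex^2^2" and i j
          using exhaust_2[of i] by (auto simp: matrix_matrix_mult_def mat_def sum_2)
        have 2: "(M t ** cmat (H t)) $ i $ j = M t $ i $ 1 * of_real (H t $ 1 $ j) + M t $ i $ 2 * of_real (H t $ 2 $ j)" for i j
          by (simp add: matrix_matrix_mult_def map_matrix_def sum_2)
        have 3: "y t $ j = M t $ 1 $ j * v $ 1 + M t $ 2 $ j * v $ 2" for j
          by (simp add: y_def transpose_def matrix_vector_mult_def sum_2)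
        have "T (mat z ** (M t ** cmat (H t))) $ i = (J *v (cmat (H t) *v (z *s y t))) $ i" for i
          using exhaust_2[of i] by (auto simp: T_def 1 2 3 J_mult cmat_mult e sum_2 algebra_simps)
        then show ?thesis by (simp add: vec_eq_iff)
      qed
      ultimately show "(y has_vector_derivative J *v (cmat (H t) *v (z *s y t))) (at t)" by (simp add: TM)
    qed
  qed
  then have "is_prim S y (JHf (\<lambda>t. z *s y t))"
    using yac P_abs_int_of_cont[OF cy] by (intro chn_of_ac) auto
  then show ?thesis by (simp add: chn_JHf y_def[abs_def])
qed

text \<open>Adding the \<open>ww i\<close> back to a representative of the regular part gives
  \<open>y\<close> with right-hand side \<open>z *s f\<close>; since \<open>y\<close> and
  \<open>f\<close> agree modulo \<open>H\<close>, \<open>y\<close> solves the equation. The last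
  conclusion compares \<open>z\<close> times the regular part of \<open>f\<close> with the regular
  part of \<open>z *s f\<close>: the surplus term in \<open>ww m\<close> is square integrable on its
  own.\<close>

lemma Tmax_solution:
  assumes T: "in_Tmax H lo hi (\<lambda>t. f t - (\<Sum>i\<le>m. lam i *s u i t)) (\<lambda>t. z *s f t - (\<Sum>i<m. lam (i + 1) *s u i t))"
    and u: "\<And>i t. t \<in> D \<Longrightarrow> u i t = ww i t" and m: "N0 \<le> m"
  obtains y where "chn y (\<lambda>t. z *s y t)" "eqP y f" "chn y (\<lambda>t. z *s f t)" "sq (\<lambda>t. y t - (\<Sum>i\<le>m. lam i *s ww i t))"
    "sq (\<lambda>t. \<Sum>i<m. (lam (i + 1) - z * lam i) *s ww i t)"
proof -
  define f0 where "f0 = (\<lambda>t. f t - (\<Sum>i\<le>m. lam i *s u i t))"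
  define g0 where "g0 = (\<lambda>t. z *s f t - (\<Sum>i<m. lam (i + 1) *s u i t))"
  obtain y0 where y0: "chn y0 g0" "eqP y0 f0" "sq f0" "sq g0"
    using Tmax_representative[OF T[folded f0_def g0_def]] .
  define y where "y = (\<lambda>t. y0 t + (\<Sum>i\<le>m. lam i *s ww i t))"
  have W: "chn (\<lambda>t. \<Sum>i\<le>m. lam i *s ww i t) (\<lambda>t. \<Sum>i<m. lam (i + 1) *s ww i t)"
  proof (cases m)
    case 0
    then show ?thesis using chn_scale[OF w_wd[of 0], of "lam 0"] by (simp add: wd_def)
  next
    case (Suc k)
    then show ?thesis using w_combination_chn[of lam k] by (simp add: lessThan_Suc_atMost)
  qed
  have g: "chn y (\<lambda>t. g0 t + (\<Sum>i<m. lam (i + 1) *s ww i t))" unfolding y_def by (rule chn_add[OF y0(1) W])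
  have yf: "chn y (\<lambda>t. z *s f t)" by (rule chn_eqP[OF g eqP_cong]) (simp add: g0_def u)
  have e: "eqP y f"
  proof -
    have "eqP y (\<lambda>t. f0 t + (\<Sum>i\<le>m. lam i *s ww i t))" unfolding y_def by (rule eqP_add[OF y0(2) eqP_refl])
    moreover have "eqP (\<lambda>t. f0 t + (\<Sum>i\<le>m. lam i *s ww i t)) f" by (rule eqP_cong) (simp add: f0_def u)
    ultimately show ?thesis by (rule eqP_trans)
  qed
  have "chn y (\<lambda>t. z *s y t)" by (rule chn_eqP[OF yf eqP_scale[OF eqP_sym[OF e]]])
  moreover have "sq (\<lambda>t. y t - (\<Sum>i\<le>m. lam i *s ww i t))"
    using sq_eqP[OF y0(3) eqP_sym[OF y0(2)] cont_imp_meas[OF chn_cont[OF y0(1)]]] by (simp add: y_def)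
  moreover have "sq (\<lambda>t. \<Sum>i<m. (lam (i + 1) - z * lam i) *s ww i t)"
  proof -
    have "sq (\<lambda>t. (z *s f0 t - g0 t) + (z * lam m) *s ww m t)"
      by (intro sq_add sq_diff sq_scale y0(3,4) w_sq m)
    then show ?thesis
      by (rule sq_cong) (simp add: f0_def g0_def u lessThan_Suc_atMost[symmetric] vec_eq_iff sum_subtractf sum_distrib_left algebra_simps)
  qed
  ultimately show thesis using that yf e by blast
qed

text \<open>The sum ends exactly at the last index covered by \<open>w_independent\<close>, so each
  coefficient vanishes. This is the place where a side whose own index equals \<open>Delta h\<close>
  is required.\<close>

lemma lam_recursion:
  assumes "m = N0" "sq (\<lambda>t. \<Sum>i<m. (lam (i + 1) - z * lam i) *s ww i t)" "i < m"
  shows "lam (i + 1) = z * lam i"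
proof (rule ccontr)
  assume ne: "lam (i + 1) \<noteq> z * lam i"
  obtain k where k: "m = Suc k" using assms(3) by (cases m) auto
  show False
  proof (rule notE[OF w_independent[of k i "\<lambda>i. lam (i + 1) - z * lam i"]])
    show "k < N0" "i \<le> k" "lam (i + 1) - z * lam i \<noteq> 0" using assms(1,3) k ne by auto
    show "sq (\<lambda>t. \<Sum>k\<le>k. (lam (k + 1) - z * lam k) *s ww k t)"
      using assms(2) unfolding k lessThan_Suc_atMost .
  qed
qed

text \<open>With \<lambda>_i = z^i l the vector paired with \<open>u m\<close> is \<open>z\<close>
  times the remainder \<open>f - l *s Tl z m\<close>. So the integral in \<open>E_term\<close> is
  the one that occurs in the formula for \<Gamma>_s.\<close>

lemma integral_cdot:
  assumes e: "eqP y f" and u: "\<And>i t. t \<in> D \<Longrightarrow> u i t = ww i t" and m: "N0 \<le> m"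
    and lam: "\<And>i. i \<le> m \<Longrightarrow> lam i = z ^ i * l" and sq: "sq (\<lambda>t. y t - l *s Tl z m t)"
  defines "G \<equiv> \<lambda>t. cdot (u m t) (cmat (H t) *v (z *s f t - (\<Sum>i<m. lam (i + 1) *s u i t)))"
  shows "G absolutely_integrable_on D" "integral D G = z * integral D (Bf (ww m) (\<lambda>t. y t - l *s Tl z m t))"
proof -
  have "AE t\<in>D in lebesgue. G t = z * Bf (ww m) (\<lambda>t. y t - l *s Tl z m t) t"
    using H_eq_D e[unfolded eqP_def]
  proof eventually_elim
    case (elim t)
    show ?case
    proof
      assume t: "t \<in> D"
      define x where "x = z *s f t - (\<Sum>i<m. lam (i + 1) *s u i t)"
      have "G t = ww m t $ 1 * P1 (\<lambda>_. x) t + ww m t $ 2 * P2 (\<lambda>_. x) t"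
        unfolding G_def cdot_def sum_2 x_def[symmetric]
        using ww_cnj[of t m] t D_sub_S u[OF t, of m] cmat_P[of t "\<lambda>_. x"] elim by auto
      moreover have x: "x = z *s (f t - l *s Tl z m t)"
        unfolding x_def Tl_def using u[OF t] lam
        by (simp add: vec_eq_iff sum_distrib_left algebra_simps)
      have "P1 (\<lambda>_. x) t = z * P1 (\<lambda>t. y t - l *s Tl z m t) t" "P2 (\<lambda>_. x) t = z * P2 (\<lambda>t. y t - l *s Tl z m t) t"
        using elim t unfolding x by (simp_all add: P1_def P2_def algebra_simps)
      ultimately show "G t = z * Bf (ww m) (\<lambda>t. y t - l *s Tl z m t) t" by (simp add: Bf_def algebra_simps)
    qed
  qed
  then obtain N where N: "negligible N" "\<forall>t\<in>D - N. G t = z * Bf (ww m) (\<lambda>t. y t - l *s Tl z m t) t"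
    unfolding AE_negligible by blast
  have i: "Bf (ww m) (\<lambda>t. y t - l *s Tl z m t) absolutely_integrable_on D"
    by (intro sq_Bf w_sq m sq)
  have j: "(\<lambda>t. z * Bf (ww m) (\<lambda>t. y t - l *s Tl z m t) t) absolutely_integrable_on D"
    using i by simp
  show "G absolutely_integrable_on D"
    by (rule absolutely_integrable_spike[OF j N(1)]) (use N(2) in blast)
  have "integral D G = integral D (\<lambda>t. z * Bf (ww m) (\<lambda>t. y t - l *s Tl z m t) t)"
    by (rule integral_spike[OF N(1)]) (use N(2) in auto)
  then show "integral D G = z * integral D (Bf (ww m) (\<lambda>t. y t - l *s Tl z m t))" by simp
qed

end

text \<open>Weighted with powers of \<open>z\<close>, the equations \<open>eta\<close> telescope in
  \<xi> up to \<open>\<xi> (m - 1)\<close>, which is then compared with \<open>E\<close>. This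
  produces the terms with \<open>d\<close>; the recursion for \<alpha> expresses
  \<open>E - \<xi> (m - 1)\<close> by the terms with \<open>bb\<close>.\<close>

lemma boundary_algebra:
  fixes z l IT :: complex and d bb lam B \<xi> \<alpha> :: "nat \<Rightarrow> complex"
  assumes m: "m \<ge> 1" and lam: "\<And>i. i \<le> m \<Longrightarrow> lam i = z ^ i * l"
    and eta0: "z * \<xi> 0 = B 0 - 1/2 * (\<Sum>i<m. d i * lam (i + 1))"
    and eta: "\<And>k. 1 \<le> k \<Longrightarrow> k \<le> m - 1 \<Longrightarrow> z * \<xi> k = \<xi> (k - 1) - 1/2 * d (k - 1) * lam 0 - 1/2 * d (k + m - 1) * lam m + B k"
    and E: "E = z * IT + 1/2 * (\<Sum>i<m. d (m - 1 + i) * lam i) + d (2 * m - 1) * lam m - B m"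
    and o0: "od = 0 \<Longrightarrow> \<xi> (m - 1) = E"
    and o1: "od > 0 \<Longrightarrow> \<alpha> od = bb 1 * lam m" "od > 0 \<Longrightarrow> z * \<alpha> 1 = E - \<xi> (m - 1)"
      "\<And>j. od > 0 \<Longrightarrow> 2 \<le> j \<Longrightarrow> j \<le> od \<Longrightarrow> z * \<alpha> j = \<alpha> (j - 1) - bb (od + 2 - j) * lam m"
  shows "z ^ Suc m * IT - (\<Sum>n\<le>m. z ^ n * B n)
    = (- (\<Sum>n = 1..2 * m. d (n - 1) * z ^ n) + (\<Sum>n = 2 * m + 1..2 * m + od. bb (od + 2 * m + 1 - n) * z ^ n)) * l"
proof -
  obtain k where k: "m = Suc k" using m by (cases m) auto
  \<comment> \<open>The terms of \<open>p_poly\<close> that come from the parameters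
    \<open>d\<close>, up to sign.\<close>
  define D where "D n = d n * z ^ Suc n" for n
  have sumB: "(\<Sum>n\<le>j. z ^ n * B n) = z ^ Suc j * \<xi> j + 1/2 * l * ((\<Sum>i<m. D i) + (\<Sum>i<j. D i) + (\<Sum>i<j. D (m + i)))"
    if "j \<le> k" for j
    using that
  proof (induction j)
    case 0
    have "(\<Sum>i<m. d i * lam (i + 1)) = (\<Sum>i<m. l * D i)"
      by (intro sum.cong) (auto simp: lam D_def)
    then show ?case using eta0 by (simp add: sum_distrib_left[symmetric] algebra_simps)
  next
    case (Suc j)
    have B: "B (Suc j) = z * \<xi> (Suc j) - \<xi> j + 1/2 * d j * l + 1/2 * d (m + j) * (z ^ m * l)"
      using eta[of "Suc j"] Suc.prems lam[of 0] lam[of m] by (simp add: k algebra_simps)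
    have "z ^ Suc j * B (Suc j) = z ^ Suc (Suc j) * \<xi> (Suc j) - z ^ Suc j * \<xi> j + 1/2 * l * D j + 1/2 * l * D (m + j)"
      unfolding B by (simp add: D_def algebra_simps power_add)
    then show ?case using Suc by (simp add: algebra_simps)
  qed
  have "z ^ m * E = z ^ Suc m * IT + 1/2 * l * (\<Sum>i<m. D (k + i)) + D (2 * m - 1) * l - z ^ m * B m"
  proof -
    have "(\<Sum>i<m. d (m - 1 + i) * lam i) * z ^ m = (\<Sum>i<m. l * D (k + i))"
      unfolding sum_distrib_right by (intro sum.cong) (auto simp: lam D_def k power_add)
    moreover have "d (2 * m - 1) * lam m * z ^ m = D (2 * m - 1) * l"
      by (simp add: lam D_def k power_add mult_2_right algebra_simps)
    ultimately show ?thesis unfolding E by (simp add: sum_distrib_left[symmetric] algebra_simps)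
  qed
  moreover have "(\<Sum>n\<le>m. z ^ n * B n) = (\<Sum>n\<le>k. z ^ n * B n) + z ^ m * B m" by (simp add: k)
  \<comment> \<open>The factors 1/2 of the relation pair up: each \<open>D i\<close> with
    \<open>i < 2 * m - 1\<close> occurs twice on the left, and the last one enters \<open>E\<close>
    with full weight.\<close>
  moreover have "(\<Sum>i<m. D i) + (\<Sum>i<k. D i) + (\<Sum>i<k. D (m + i)) + (\<Sum>i<m. D (k + i)) + 2 * D (2 * m - 1) = 2 * (\<Sum>i<2 * m. D i)"
  proof -
    have "(\<Sum>i<m. D (k + i)) = D k + (\<Sum>i<k. D (m + i))"
      unfolding k by (subst sum.lessThan_Suc_shift) simp
    moreover have "(\<Sum>i<2 * m. D i) = (\<Sum>i<m + k. D i) + D (2 * m - 1)" by (simp add: k mult_2)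
    moreover have "(\<Sum>i<m + k. D i) = (\<Sum>i<m. D i) + (\<Sum>i<k. D (m + i))"
      by (induction k) (auto simp: algebra_simps)
    moreover have "(\<Sum>i<m. D i) = (\<Sum>i<k. D i) + D k" by (simp add: k)
    ultimately show ?thesis by simp
  qed
  ultimately have main: "z ^ Suc m * IT - (\<Sum>n\<le>m. z ^ n * B n) = z ^ m * (E - \<xi> k) - l * (\<Sum>i<2 * m. D i)"
  proof -
    assume 1: "z ^ m * E = z ^ Suc m * IT + 1/2 * l * (\<Sum>i<m. D (k + i)) + D (2 * m - 1) * l - z ^ m * B m"
      and 2: "(\<Sum>n\<le>m. z ^ n * B n) = (\<Sum>n\<le>k. z ^ n * B n) + z ^ m * B m"
      and 3: "(\<Sum>i<m. D i) + (\<Sum>i<k. D i) + (\<Sum>i<k. D (m + i)) + (\<Sum>i<m. D (k + i)) + 2 * D (2 * m - 1) = 2 * (\<Sum>i<2 * m. D i)"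
    have 4: "(\<Sum>i<2 * m. D i) = 1/2 * ((\<Sum>i<m. D i) + (\<Sum>i<k. D i) + (\<Sum>i<k. D (m + i)) + (\<Sum>i<m. D (k + i)) + 2 * D (2 * m - 1))"
      unfolding 3 by simp
    have 5: "z ^ Suc m * IT = z ^ m * E - 1/2 * l * (\<Sum>i<m. D (k + i)) - D (2 * m - 1) * l + z ^ m * B m"
      unfolding 1 by simp
    show ?thesis
      unfolding 2 sumB[OF order_refl] 4 5 by (simp add: k algebra_simps)
  qed
  have sumd: "(\<Sum>n = 1..2 * m. d (n - 1) * z ^ n) = (\<Sum>i<2 * m. D i)"
    by (rule sum.reindex_bij_witness[of _ Suc "\<lambda>n. n - 1"]) (auto simp: D_def)
  have sumb: "z ^ m * (E - \<xi> k) = (\<Sum>n = 2 * m + 1..2 * m + od. bb (od + 2 * m + 1 - n) * z ^ n) * l"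
  proof (cases "od = 0")
    case True
    then show ?thesis using o0 by (simp add: k)
  next
    case False
    \<comment> \<open>The recursion is followed up to the index \<open>od\<close>, where
      \<open>o1\<close> gives the entry as \<open>bb 1 * lam m\<close> and thus closes the
      sum.\<close>
    have \<alpha>: "\<alpha> 1 = z ^ (j - 1) * \<alpha> j + (\<Sum>i = 1..<j. z ^ (i - 1) * bb (od + 1 - i) * lam m)" if "1 \<le> j" "j \<le> od" for j
      using that
    proof (induction j rule: dec_induct)
      case base
      then show ?case by simp
    next
      case (step j)
      have "\<alpha> j = z * \<alpha> (Suc j) + bb (od + 1 - j) * lam m"
        using o1(3)[of "Suc j"] step False by simp
      moreover have "z ^ j = z ^ (j - 1) * z" using step(1) by (cases j) auto
      ultimately show ?case using step by (simp add: algebra_simps)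
    qed
    have "\<alpha> 1 = (\<Sum>i = 1..od. z ^ (i - 1) * bb (od + 1 - i) * lam m)"
      using \<alpha>[of od] o1(1) False by (simp add: atLeastLessThanSuc_atLeastAtMost[symmetric] algebra_simps)
    then have "E - \<xi> k = (\<Sum>i = 1..od. z * (z ^ (i - 1) * bb (od + 1 - i) * lam m))"
      using o1(2) False by (simp add: k sum_distrib_left)
    also have "\<dots> = (\<Sum>i = 1..od. z ^ i * bb (od + 1 - i) * lam m)"
    proof (rule sum.cong[OF refl])
      fix i assume "i \<in> {1..od}"
      then have "z ^ i = z * z ^ (i - 1)" by (cases i) auto
      then show "z * (z ^ (i - 1) * bb (od + 1 - i) * lam m) = z ^ i * bb (od + 1 - i) * lam m" by simp
    qed
    finally have "z ^ m * (E - \<xi> k) = (\<Sum>i = 1..od. z ^ (2 * m + i) * bb (od + 1 - i)) * l"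
      by (simp add: lam sum_distrib_left sum_distrib_right power_add mult_2_right algebra_simps)
    also have "(\<Sum>i = 1..od. z ^ (2 * m + i) * bb (od + 1 - i)) = (\<Sum>n = 2 * m + 1..2 * m + od. bb (od + 2 * m + 1 - n) * z ^ n)"
      by (rule sum.reindex_bij_witness[of _ "\<lambda>n. n - 2 * m" "\<lambda>i. 2 * m + i"]) auto
    finally show ?thesis .
  qed
  show ?thesis unfolding main sumb sumd by (simp add: algebra_simps)
qed

section \<open>Boundary values of solutions on one side\<close>

context finite_Delta
begin

definition Gr :: "(real \<Rightarrow> complex^2) \<Rightarrow> complex" where "Gr y = Lim F (\<lambda>x. y x $ 2)"
definition Gs :: "nat \<Rightarrow> complex \<Rightarrow> (real \<Rightarrow> complex^2) \<Rightarrow> complex" where "Gs m z y = Lim F (GX z m (Gr y) y)"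

lemma Gr_eq:
  assumes "chn y (\<lambda>t. z *s y t)" "N0 \<le> m" "sq (\<lambda>t. y t - r *s Tl z (Suc m) t)"
  shows "Gr y = r"
  unfolding Gr_def by (rule tendsto_Lim[OF F_neq_bot solution_limit[OF assms]])

lemma Gr_sq:
  assumes y: "chn y (\<lambda>t. z *s y t)" and m: "N0 \<le> m"
  shows "sq (\<lambda>t. y t - Gr y *s Tl z (Suc m) t)"
proof -
  obtain r where r: "sq (\<lambda>t. y t - r *s Tl z (Suc m) t)" using solution_decomposition[OF y m] .
  then show ?thesis using Gr_eq[OF y m r] by simp
qed

lemma Gs_limit:
  assumes y: "chn y (\<lambda>t. z *s y t)" and m: "N0 \<le> m"
  shows "(GX z m (Gr y) y \<longlongrightarrow> Gs m z y) F"
    "Gs m z y = (\<Sum>n\<le>m. z ^ n * om n) * y c $ 1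
      - of_real sg * z ^ Suc m * integral D (Bf (ww m) (\<lambda>t. y t - Gr y *s Tl z m t))"
proof -
  note lim = GX_limit[OF y m Gr_sq[OF y m]]
  have eq: "Gs m z y = (\<Sum>n\<le>m. z ^ n * ww n c $ 2) * y c $ 1
      - of_real sg * z ^ Suc m * integral D (Bf (ww m) (\<lambda>t. y t - Gr y *s Tl z m t))"
    unfolding Gs_def by (rule tendsto_Lim[OF F_neq_bot lim])
  show "(GX z m (Gr y) y \<longlongrightarrow> Gs m z y) F" using lim unfolding eq .
  show "Gs m z y = (\<Sum>n\<le>m. z ^ n * om n) * y c $ 1
      - of_real sg * z ^ Suc m * integral D (Bf (ww m) (\<lambda>t. y t - Gr y *s Tl z m t))"
    using eq by (simp add: ww_c)
qed

lemma wron_G: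
  assumes "chn y (\<lambda>t. z *s y t)" "chn x (\<lambda>t. z *s x t)" "N0 \<le> m" "t \<in> S"
  shows "Gr y * Gs m z x - Gr x * Gs m z y = wron y x t"
  by (rule wron_regularised[OF assms(1-3) Gr_sq[OF assms(1,3)] Gr_sq[OF assms(2,3)]
        Gs_limit(1)[OF assms(1,3)] Gs_limit(1)[OF assms(2,3)] assms(4)])

lemma Gs_as_Lim:
  assumes u: "\<And>i t. t \<in> S \<Longrightarrow> u i t = ww i t" and y: "chn y (\<lambda>t. z *s y t)" and m: "N0 \<le> m"
  shows "Lim F (\<lambda>x. \<Sum>n\<le>m. z ^ n * cdot (u n x) (J *v (y x - Lim F (\<lambda>x. y x $ 2) *s (\<Sum>j = m + 1..2 * m - n. z ^ j *s u j x)))) = Gs m z y"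
proof (rule tendsto_Lim[OF F_neq_bot Lim_transform_eventually[OF Gs_limit(1)[OF y m]]])
  show "eventually (\<lambda>x. GX z m (Gr y) y x = (\<Sum>n\<le>m. z ^ n * cdot (u n x) (J *v (y x - Lim F (\<lambda>x. y x $ 2) *s (\<Sum>j = m + 1..2 * m - n. z ^ j *s u j x))))) F"
    using eventually_D
  proof eventually_elim
    case (elim x)
    then have x: "x \<in> S" using D_sub_S by blast
    have "cdot (u n x) (J *v v) = ww n x $ 2 * v $ 1 - ww n x $ 1 * v $ 2" for n v
      unfolding cdot_def sum_2 u[OF x] ww_cnj[OF x] by (simp add: J_mult)
    then show ?case unfolding GX_def Gr_def wron_def by (simp add: u[OF x])
  qed
qed

text \<open>If the side is not indivisible, \<open>y\<close> and \<open>x\<close> are solutions with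
  the same value at \<open>c\<close>, hence equal. On an indivisible side only the second component
  at \<open>c\<close> is prescribed, as \<lambda>_0. Second components are constant there and are
  all that \<open>H\<close> sees, so \<open>y\<close> still represents \<open>f\<close>.\<close>

lemma matching:
  assumes p: "chn p (\<lambda>t. z *s p t)" "chn q (\<lambda>t. z *s q t)" "wron p q c \<noteq> 0"
    and x: "chn x (\<lambda>t. z *s x t)" "eqP x f" "chn x (\<lambda>t. z *s f t)" "sq (\<lambda>t. x t - l *s Tl z (Suc m) t)"
    and y: "chn y (\<lambda>t. z *s y t)" and m: "N0 \<le> m"
    and ni: "\<not> indivisible H lo hi \<Longrightarrow> y c = (THE v. \<exists>y. v = y c \<and> ac_representative H lo hi S f (\<lambda>t. z *s f t) y)"
    and ind: "indivisible H lo hi \<Longrightarrow> y c $ 2 = l"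
  shows "eqP y f" "Gr y = l" "sq (\<lambda>t. y t - l *s Tl z m t)"
proof -
  have yx: "eqP y x \<and> y c $ 2 = x c $ 2"
  proof (cases "indivisible H lo hi")
    case True
    have "((\<lambda>t. x t $ 2) \<longlongrightarrow> l) F" by (rule solution_limit[OF x(1) m x(4)])
    moreover have "((\<lambda>t. x t $ 2) \<longlongrightarrow> x c $ 2) F"
    proof (rule Lim_transform_eventually[OF tendsto_const])
      show "eventually (\<lambda>t. x c $ 2 = x t $ 2) F"
        using eventually_D
      proof eventually_elim
        case (elim t)
        then have "t \<in> S" using D_sub_S by blast
        from indivisible_second_const[OF True x(1) this] show ?case by (rule sym)
      qed
    qed
    ultimately have "x c $ 2 = l" using tendsto_unique[OF F_neq_bot] by blast
    moreover have "y t $ 2 = y c $ 2" "x t $ 2 = x c $ 2" if "t \<in> D" for t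
      using indivisible_second_const[OF True y, of t] indivisible_second_const[OF True x(1), of t] that D_sub_S by auto
    ultimately show ?thesis using ind[OF True] indivisible_eqP[OF True] by simp
  next
    case False
    then have c: "y c = x c" using ni val_eq[OF False x(3,2)] by simp
    have "eqP y x" by (rule eqP_cong, rule solution_unique[OF p y x(1) c]) (use D_sub_S in blast)
    then show ?thesis using c by simp
  qed
  then show yf: "eqP y f" using eqP_trans x(2) by blast
  have "eqP (\<lambda>t. x t - l *s Tl z (Suc m) t) (\<lambda>t. y t - l *s Tl z (Suc m) t)"
    using eqP_add[OF eqP_sym[OF conjunct1[OF yx]] eqP_refl[of "\<lambda>t. (- l) *s Tl z (Suc m) t"]] by simp
  from sq_eqP[OF x(4) this] have sq: "sq (\<lambda>t. y t - l *s Tl z (Suc m) t)"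
    by (simp add: cont_imp_meas cont_diff cont_scale Tl_cont chn_cont[OF y])
  show "Gr y = l" by (rule Gr_eq[OF y m sq])
  show "sq (\<lambda>t. y t - l *s Tl z m t)" by (rule remainder_chn(2)[OF y m sq])
qed

end

section \<open>Hamiltonians of kind (A)\<close>

definition psd_entries :: "real^2^2 \<Rightarrow> bool" where
  "psd_entries M \<longleftrightarrow> M $ 2 $ 1 = M $ 1 $ 2 \<and> 0 \<le> M $ 1 $ 1 \<and> 0 \<le> M $ 2 $ 2 \<and> (M $ 1 $ 2)\<^sup>2 \<le> M $ 1 $ 1 * M $ 2 $ 2"

text \<open>For \<open>a \<noteq> 0\<close> the test vector with entries \<open>- r\<close> and
  \<open>a\<close> gives \<open>a * (a * b - r * r) \<ge> 0\<close>. For \<open>a = 0\<close> the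
  form is affine in the first entry, which forces \<open>r = 0\<close>.\<close>

lemma psd_imp_psd_entries:
  assumes "transpose M = M" "\<forall>x. 0 \<le> x \<bullet> (M *v x)"
  shows "psd_entries M"
proof -
  define a b r where "a = M $ 1 $ 1" and "b = M $ 2 $ 2" and "r = M $ 1 $ 2"
  have "transpose M $ 1 $ 2 = M $ 1 $ 2" using assms(1) by simp
  then have s: "M $ 2 $ 1 = r" by (simp add: transpose_def r_def)
  have q: "0 \<le> a * x * x + 2 * r * x * y + b * y * y" for x y
    using assms(2)[rule_format, of "vector [x, y]"]
    by (simp add: inner_vec_def matrix_vector_mult_def sum_2 s a_def[symmetric] b_def[symmetric] r_def[symmetric] algebra_simps)
  have ab: "0 \<le> a" "0 \<le> b" using q[of 1 0] q[of 0 1] by simp_all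
  have "r * r \<le> a * b"
  proof (cases "a = 0")
    case True
    have "r = 0"
    proof (rule ccontr)
      assume r: "r \<noteq> 0"
      have "0 \<le> 2 * r * (- (b + 1) / (2 * r)) + b" using q[of "- (b + 1) / (2 * r)" 1] True by simp
      then show False using r by simp
    qed
    then show ?thesis using True by simp
  next
    case False
    have "0 \<le> a * (a * b - r * r)" using q[of "- r" a] by (simp add: algebra_simps)
    then show ?thesis using False ab by (simp add: zero_le_mult_iff)
  qed
  then show ?thesis using ab s by (simp add: psd_entries_def a_def b_def r_def power2_eq_square)
qed

text \<open>Replacing \<open>H\<close> by \<open>0\<close> on the null set where it is not positive semidefinite makes the
  inequalities of \<^locale>\<open>canonical_side\<close> hold everywhere.\<close>

definition entry :: "(real^2^2 \<Rightarrow> real) \<Rightarrow> hamiltonian \<Rightarrow> real \<Rightarrow> real" where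
  "entry e H t = (if psd_entries (H t) then e (H t) else 0)"

definition p11 :: "hamiltonian \<Rightarrow> real \<Rightarrow> real" where "p11 = entry (\<lambda>M. M $ 1 $ 1)"
definition p22 :: "hamiltonian \<Rightarrow> real \<Rightarrow> real" where "p22 = entry (\<lambda>M. M $ 2 $ 2)"
definition p12 :: "hamiltonian \<Rightarrow> real \<Rightarrow> real" where "p12 = entry (\<lambda>M. M $ 1 $ 2)"

text \<open>The point \<open>c\<close> joins the exceptional null set: integrability is claimed on
  intervals that may contain \<open>c\<close>, while positivity of \<open>H\<close> is known in the
  open interval.\<close>

lemma ham_side_intro:
  fixes H :: hamiltonian and c s :: real
  defines "lo \<equiv> min c s" and "hi \<equiv> max c s"
  assumes cs: "c \<noteq> s" and H: "is_hamiltonian H lo hi"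
    and loc: "\<And>u v. {u..v} \<subseteq> insert c {lo<..<hi} \<Longrightarrow> H absolutely_integrable_on {u..v}"
    and I: "cond_I H lo hi"
    and HS: "(\<lambda>t. integral (seg c t) (\<lambda>x. H x $ 2 $ 2) * H t $ 1 $ 1) absolutely_integrable_on {lo<..<hi}"
    and lp: "\<not> H absolutely_integrable_on {lo<..<hi}"
  shows "ham_side (p11 H) (p22 H) (p12 H) c s H"
proof -
  define D where "D = {lo<..<hi}"
  have Dm: "D \<in> sets lebesgue" by (simp add: D_def)
  have Hm: "H \<in> borel_measurable (lebesgue_on D)" using H by (simp add: is_hamiltonian_def D_def)
  have ae: "AE t\<in>D in lebesgue. psd_entries (H t)"
  proof -
    have "AE t\<in>D in lebesgue. transpose (H t) = H t \<and> (\<forall>x. 0 \<le> x \<bullet> (H t *v x))"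
      using H by (simp add: is_hamiltonian_def D_def)
    then show ?thesis by eventually_elim (auto intro: psd_imp_psd_entries)
  qed
  obtain N where N: "negligible N" "\<forall>t\<in>D - N. psd_entries (H t)" using ae unfolding AE_negligible by blast
  have ent: "p11 H t = H t $ 1 $ 1" "p22 H t = H t $ 2 $ 2" "p12 H t = H t $ 1 $ 2" if "psd_entries (H t)" for t
    using that by (simp_all add: p11_def p22_def p12_def entry_def)
  have nth: "bounded_linear (\<lambda>M::real^2^2. M $ i $ j)" for i j
    using bounded_linear_compose[OF bounded_linear_vec_nth[of j] bounded_linear_vec_nth[of i]] by simp
  have N': "negligible (insert c N)" using N(1) by simp
  have spike: "e' absolutely_integrable_on X" if "(\<lambda>t. H t $ i $ j) absolutely_integrable_on X" "X \<subseteq> insert c D"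
     "\<And>t. psd_entries (H t) \<Longrightarrow> e' t = H t $ i $ j" for e' X and i j :: 2
    by (rule absolutely_integrable_spike[OF that(1) N']) (use that(2,3) N(2) in auto)
  have Hij: "(\<lambda>t. H t $ i $ j) absolutely_integrable_on X" if "H absolutely_integrable_on X" for X and i j :: 2
    using absolutely_integrable_linear[OF that nth[of i j]] by (simp add: o_def)
  have meas: "(\<lambda>t. H t $ i $ j) \<in> borel_measurable (lebesgue_on D)" for i j
    by (rule measurable_compose[OF Hm]) (intro borel_measurable_continuous_onI continuous_intros)
  have pm: "{t \<in> space (lebesgue_on D). psd_entries (H t)} \<in> sets (lebesgue_on D)"
  proof -
    define a b r q where "a t = H t $ 1 $ 1" and "b t = H t $ 2 $ 2" and "r t = H t $ 1 $ 2" and "q t = H t $ 2 $ 1" for t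
    have [measurable]: "a \<in> borel_measurable (lebesgue_on D)" "b \<in> borel_measurable (lebesgue_on D)"
      "r \<in> borel_measurable (lebesgue_on D)" "q \<in> borel_measurable (lebesgue_on D)"
      using meas unfolding a_def[abs_def] b_def[abs_def] r_def[abs_def] q_def[abs_def] by auto
    have "{t \<in> space (lebesgue_on D). q t = r t \<and> 0 \<le> a t \<and> 0 \<le> b t \<and> (r t)\<^sup>2 \<le> a t * b t} \<in> sets (lebesgue_on D)"
      by measurable
    then show ?thesis by (simp add: psd_entries_def a_def b_def r_def q_def)
  qed
  have em: "(\<lambda>t. if psd_entries (H t) then H t $ i $ j else 0) \<in> borel_measurable (lebesgue_on D)" for i j
    by (rule measurable_If[OF meas _ pm]) simp
  have h22: "integral (seg c t) (p22 H) = integral (seg c t) (\<lambda>x. H x $ 2 $ 2)" if "t \<in> D" for t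
  proof (rule integral_spike[OF N'])
    fix x assume "x \<in> seg c t - insert c N"
    then have "x \<in> D - N" using that by (auto simp: seg_def D_def lo_def hi_def)
    then show "H x $ 2 $ 2 = p22 H x" using N(2) ent by force
  qed
  show ?thesis
  proof unfold_locales
    show "c \<noteq> s" by (rule cs)
    show "0 \<le> p11 H t" "0 \<le> p22 H t" "(p12 H t)\<^sup>2 \<le> p11 H t * p22 H t" for t
      by (simp_all add: p11_def p22_def p12_def entry_def psd_entries_def)
    show "p11 H absolutely_integrable_on {u..v}" "p22 H absolutely_integrable_on {u..v}" "p12 H absolutely_integrable_on {u..v}"
      if "{u..v} \<subseteq> insert c {min c s<..<max c s}" for u v
      using that ent by (intro spike[OF Hij[OF loc]]; simp add: D_def lo_def hi_def)+
    show "p11 H absolutely_integrable_on {min c s<..<max c s}"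
      using spike[OF I[unfolded cond_I_def], of "p11 H"] ent(1) by (simp add: D_def lo_def hi_def subset_insertI)
    show "(\<lambda>t. integral (seg c t) (p22 H) * p11 H t) absolutely_integrable_on {min c s<..<max c s}"
      by (rule absolutely_integrable_spike[OF HS[unfolded lo_def hi_def] N(1)])
        (use h22 N(2) ent in \<open>auto simp: D_def lo_def hi_def\<close>)
    show "p11 H \<in> borel_measurable (lebesgue_on {min c s<..<max c s})"
      "p22 H \<in> borel_measurable (lebesgue_on {min c s<..<max c s})"
      "p12 H \<in> borel_measurable (lebesgue_on {min c s<..<max c s})"
      using em unfolding p11_def p22_def p12_def entry_def[abs_def] D_def lo_def hi_def by auto
    show "AE t\<in>{min c s<..<max c s} in lebesgue. H t $ 1 $ 1 = p11 H t \<and> H t $ 2 $ 2 = p22 H t \<and> H t $ 1 $ 2 = p12 H t \<and> H t $ 2 $ 1 = p12 H t"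
      using ae unfolding D_def lo_def hi_def by eventually_elim (auto simp: ent psd_entries_def)
    show "AE t\<in>{min c s<..<max c s} in lebesgue. H t \<noteq> 0"
      using H by (simp add: is_hamiltonian_def lo_def hi_def)
    \<comment> \<open>The limit point case concerns the whole matrix, \<open>lp\<close> only
      \<open>h2\<close>. By (I) the first diagonal entry is integrable, and the sum of the diagonal
      entries dominates the off-diagonal one.\<close>
    show "\<not> p22 H absolutely_integrable_on {min c s<..<max c s}"
    proof
      assume "p22 H absolutely_integrable_on {min c s<..<max c s}"
      then have p22i: "p22 H absolutely_integrable_on D" by (simp add: D_def lo_def hi_def)
      have h11: "(\<lambda>t. H t $ 1 $ 1) absolutely_integrable_on D" using I by (simp add: cond_I_def D_def)
      have h22i: "(\<lambda>t. H t $ 2 $ 2) absolutely_integrable_on D"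
        by (rule absolutely_integrable_spike[OF p22i N(1)]) (use N(2) ent in auto)
      have sum: "(\<lambda>t. H t $ 1 $ 1 + H t $ 2 $ 2) absolutely_integrable_on D" by (intro set_integral_add(1) h11 h22i)
      have h12: "p12 H absolutely_integrable_on D"
      proof (rule measurable_bounded_by_integrable_imp_absolutely_integrable[of _ _ "\<lambda>t. p11 H t + p22 H t"])
        show "p12 H \<in> borel_measurable (lebesgue_on D)" using em unfolding p12_def entry_def[abs_def] by auto
        have "p11 H absolutely_integrable_on D" by (rule absolutely_integrable_spike[OF h11 N(1)]) (use N(2) ent in auto)
        then show "(\<lambda>t. p11 H t + p22 H t) integrable_on D" using p22i by (intro integrable_add abs_int_imp)
        fix t
        have nn: "0 \<le> p11 H t" "0 \<le> p22 H t" "(p12 H t)\<^sup>2 \<le> p11 H t * p22 H t"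
          by (simp_all add: p11_def p22_def p12_def entry_def psd_entries_def)
        have "(p12 H t)\<^sup>2 \<le> (p11 H t + p22 H t)\<^sup>2"
        proof -
          have "(p11 H t + p22 H t)\<^sup>2 = p11 H t * p22 H t + (p11 H t * p11 H t + p22 H t * p22 H t + p11 H t * p22 H t)"
            by (simp add: power2_eq_square algebra_simps)
          moreover have "0 \<le> p11 H t * p11 H t + p22 H t * p22 H t + p11 H t * p22 H t" using nn by simp
          ultimately show ?thesis using nn(3) by linarith
        qed
        then show "norm (p12 H t) \<le> p11 H t + p22 H t" using nn(1,2) by (simp add: abs_le_square_iff[symmetric])
      qed (rule Dm)
      have h12': "(\<lambda>t. H t $ 1 $ 2) absolutely_integrable_on D" "(\<lambda>t. H t $ 2 $ 1) absolutely_integrable_on D"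
        by (rule absolutely_integrable_spike[OF h12 N(1)], use N(2) ent in \<open>auto simp: psd_entries_def\<close>)+
      define B where "B i j = (\<lambda>x::real. x *\<^sub>R (axis i (axis j 1) :: real^2^2))" for i j :: 2
      have B: "bounded_linear (B i j)" for i j unfolding B_def by (rule bounded_linear_scaleR_left)
      have "(\<lambda>t. (B 1 1 (H t $ 1 $ 1) + B 1 2 (H t $ 1 $ 2)) + (B 2 1 (H t $ 2 $ 1) + B 2 2 (H t $ 2 $ 2))) absolutely_integrable_on D"
        using absolutely_integrable_linear[OF h11 B] absolutely_integrable_linear[OF h22i B]
          absolutely_integrable_linear[OF h12'(1) B] absolutely_integrable_linear[OF h12'(2) B]
        by (intro set_integral_add(1)) (auto simp: o_def)
      moreover have "(B 1 1 (M $ 1 $ 1) + B 1 2 (M $ 1 $ 2)) + (B 2 1 (M $ 2 $ 1) + B 2 2 (M $ 2 $ 2)) = M" for M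
        by (simp add: B_def vec_eq_iff forall_2 axis_def)
      ultimately show False using lp by (simp add: D_def)
    qed
  qed
qed

lemma absolutely_integrable_insert:
  fixes f :: "real \<Rightarrow> 'a::euclidean_space"
  assumes "f absolutely_integrable_on X"
  shows "f absolutely_integrable_on insert a X"
proof -
  have "f absolutely_integrable_on insert a X \<longleftrightarrow> f absolutely_integrable_on X"
  proof (rule absolutely_integrable_spike_set_eq)
    show "negligible {x \<in> insert a X - X. f x \<noteq> 0}" by (rule negligible_subset[of "{a}"]) auto
    have "{x \<in> X - insert a X. f x \<noteq> 0} = {}" by auto
    then show "negligible {x \<in> X - insert a X. f x \<noteq> 0}" by (simp only: negligible_empty)
  qed
  then show ?thesis using assms by simp
qed

lemma bounded_linear_entry: "bounded_linear (\<lambda>M::real^2^2. M $ i $ j)"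
  using bounded_linear_compose[OF bounded_linear_vec_nth[of j] bounded_linear_vec_nth[of i]] by simp

text \<open>The limit circle case at \<open>a\<close> extends local integrability to the regular
  endpoint. A finite integral of \<open>H\<close> over the whole interval would contradict the limit
  point case at \<open>b\<close>.\<close>

lemma ham_side_left:
  assumes ab: "a < b" and H: "is_hamiltonian H a b" and lc: "limit_circle_left H a b" and lp: "\<not> limit_circle_right H a b"
    and I: "cond_I H a b" and HS: "cond_HS_left H a b"
  shows "ham_side (p11 H) (p22 H) (p12 H) a b H"
proof (rule ham_side_intro)
  have mm: "min a b = a" "max a b = b" using ab by auto
  have li: "H absolutely_integrable_on {c..d}" if "a < c" "d < b" for c d
    using H that unfolding is_hamiltonian_def by (cases "c \<le> d") auto
  obtain e where e: "a < e" "e < b" "H absolutely_integrable_on {a<..<e}" using lc unfolding limit_circle_left_def by auto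
  have av: "H absolutely_integrable_on {a<..<v}" if "v < b" for v
  proof -
    have "H absolutely_integrable_on {a<..<e} \<union> {e..max e v}" using e that li by (intro set_integrable_Un) auto
    then show ?thesis by (rule set_integrable_subset) auto
  qed
  show "H absolutely_integrable_on {u..v}" if "{u..v} \<subseteq> insert a {min a b<..<max a b}" for u v
  proof (cases "u \<le> v")
    case True
    then have "u \<in> {u..v}" "v \<in> {u..v}" by auto
    then have uv: "a \<le> u" "v < b" using that ab unfolding mm by auto
    have "H absolutely_integrable_on insert a {a<..<(v + b) / 2}"
      using uv by (intro absolutely_integrable_insert av) auto
    then show ?thesis by (rule set_integrable_subset) (use uv in auto)
  qed simp
  show "a \<noteq> b" "is_hamiltonian H (min a b) (max a b)" "cond_I H (min a b) (max a b)" using ab H I by (simp_all add: mm)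
  show "\<not> H absolutely_integrable_on {min a b<..<max a b}"
  proof
    assume "H absolutely_integrable_on {min a b<..<max a b}"
    then have "H absolutely_integrable_on {e<..<b}" unfolding mm by (rule set_integrable_subset) (use e in auto)
    then show False using lp e unfolding limit_circle_right_def by auto
  qed
  have "(LINT s:{a<..<t}|lebesgue. H s $ 2 $ 2) = integral (seg a t) (\<lambda>x. H x $ 2 $ 2)" if "t \<in> {a<..<b}" for t
  proof -
    have "(\<lambda>x. H x $ 2 $ 2) absolutely_integrable_on {a<..<t}"
      using absolutely_integrable_linear[OF av bounded_linear_entry, of t] that by (simp add: o_def)
    then have "(LINT s:{a<..<t}|lebesgue. H s $ 2 $ 2) = integral {a<..<t} (\<lambda>x. H x $ 2 $ 2)"
      by (rule set_lebesgue_integral_eq_integral(2))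
    then show ?thesis using that integral_open_interval[of a t "\<lambda>x. H x $ 2 $ 2"] by (simp add: seg_def box_real cbox_interval)
  qed
  then show "(\<lambda>t. integral (seg a t) (\<lambda>x. H x $ 2 $ 2) * H t $ 1 $ 1) absolutely_integrable_on {min a b<..<max a b}"
    using HS unfolding cond_HS_left_def mm by (subst set_integrable_cong[OF refl refl]) auto
qed

lemma ham_side_right:
  assumes ab: "a < b" and H: "is_hamiltonian H a b" and lc: "limit_circle_right H a b" and lp: "\<not> limit_circle_left H a b"
    and I: "cond_I H a b" and HS: "cond_HS_right H a b"
  shows "ham_side (p11 H) (p22 H) (p12 H) b a H"
proof (rule ham_side_intro)
  have mm: "min b a = a" "max b a = b" using ab by auto
  have li: "H absolutely_integrable_on {c..d}" if "a < c" "d < b" for c d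
    using H that unfolding is_hamiltonian_def by (cases "c \<le> d") auto
  obtain e where e: "a < e" "e < b" "H absolutely_integrable_on {e<..<b}" using lc unfolding limit_circle_right_def by auto
  have av: "H absolutely_integrable_on {v<..<b}" if "a < v" for v
  proof -
    have "H absolutely_integrable_on {min e v..e} \<union> {e<..<b}" using e that li by (intro set_integrable_Un) auto
    then show ?thesis by (rule set_integrable_subset) auto
  qed
  show "H absolutely_integrable_on {u..v}" if "{u..v} \<subseteq> insert b {min b a<..<max b a}" for u v
  proof (cases "u \<le> v")
    case True
    then have "u \<in> {u..v}" "v \<in> {u..v}" by auto
    then have uv: "a < u" "v \<le> b" using that ab unfolding mm by auto
    have "H absolutely_integrable_on insert b {(a + u) / 2<..<b}"
      using uv by (intro absolutely_integrable_insert av) auto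
    then show ?thesis by (rule set_integrable_subset) (use uv in auto)
  qed simp
  show "b \<noteq> a" "is_hamiltonian H (min b a) (max b a)" "cond_I H (min b a) (max b a)" using ab H I by (simp_all add: mm)
  show "\<not> H absolutely_integrable_on {min b a<..<max b a}"
  proof
    assume "H absolutely_integrable_on {min b a<..<max b a}"
    then have "H absolutely_integrable_on {a<..<e}" unfolding mm by (rule set_integrable_subset) (use e in auto)
    then show False using lp e unfolding limit_circle_left_def by auto
  qed
  have "(LINT s:{t<..<b}|lebesgue. H s $ 2 $ 2) = integral (seg b t) (\<lambda>x. H x $ 2 $ 2)" if "t \<in> {a<..<b}" for t
  proof -
    have "(\<lambda>x. H x $ 2 $ 2) absolutely_integrable_on {t<..<b}"
      using absolutely_integrable_linear[OF av bounded_linear_entry, of t] that by (simp add: o_def)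
    then have "(LINT s:{t<..<b}|lebesgue. H s $ 2 $ 2) = integral {t<..<b} (\<lambda>x. H x $ 2 $ 2)"
      by (rule set_lebesgue_integral_eq_integral(2))
    then show ?thesis using that integral_open_interval[of t b "\<lambda>x. H x $ 2 $ 2"] by (simp add: seg_def box_real cbox_interval)
  qed
  then show "(\<lambda>t. integral (seg b t) (\<lambda>x. H x $ 2 $ 2) * H t $ 1 $ 1) absolutely_integrable_on {min b a<..<max b a}"
    using HS unfolding cond_HS_right_def mm by (subst set_integrable_cong[OF refl refl]) auto
qed

lemma indivisible_subinterval:
  assumes "indivisible H a b" "a \<le> c" "d \<le> b" "c < d"
  shows "indivisible H c d"
proof -
  obtain \<phi> where \<phi>: "indivisible_type H a b \<phi>" using assms(1) unfolding indivisible_def by blast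
  then have "AE t\<in>{a<..<b} in lebesgue. range (\<lambda>x. H t *v x) = span {xi \<phi>}" by (simp add: indivisible_type_def)
  then have "AE t\<in>{c<..<d} in lebesgue. range (\<lambda>x. H t *v x) = span {xi \<phi>}"
    by eventually_elim (use assms in auto)
  then show ?thesis using assms(4) unfolding indivisible_def indivisible_type_def by blast
qed

lemma kind_A_not_both_indivisible:
  assumes "kind_A h"
  shows "\<not> (indiv_minus h \<and> indiv_plus h)"
proof
  assume i: "indiv_minus h \<and> indiv_plus h"
  have lt: "s_minus h < sigma h" "sigma h < s_plus h" using assms by (simp_all add: kind_A_def)
  \<comment> \<open>On the right the condition in \<open>kind_A\<close> ranges over points strictly
    before \<open>s_plus h\<close>, hence the midpoint.\<close>
  have "indivisible (ham h) (s_minus h) (sigma h)" "indivisible (ham h) (sigma h) ((sigma h + s_plus h) / 2)"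
    using i lt by (auto intro: indivisible_subinterval)
  then show False using assms lt unfolding kind_A_def by force
qed

section \<open>Both sides of \<sigma> together\<close>

locale kind_A_ham =
  fixes h :: indef_hamiltonian
  assumes kind_A: "kind_A h"
begin

lemma ends: "s_minus h < sigma h" "sigma h < s_plus h"
  using kind_A by (simp_all add: kind_A_def)

lemma min_max_ends: "min (s_minus h) (sigma h) = s_minus h" "max (s_minus h) (sigma h) = sigma h"
  "min (s_plus h) (sigma h) = sigma h" "max (s_plus h) (sigma h) = s_plus h"
  using ends by auto

definition NL :: nat where "NL = the_enat (Delta_minus h)"
definition NR :: nat where "NR = the_enat (Delta_plus h)"

lemma Delta_fin: "Delta_minus h = enat NL" "Delta_plus h = enat NR"
  using kind_A by (auto simp: kind_A_def NL_def NR_def)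

lemma ham_left: "ham_side (p11 (ham h)) (p22 (ham h)) (p12 (ham h)) (s_minus h) (sigma h) (ham h)"
  using kind_A unfolding kind_A_def by (intro ham_side_left) auto

lemma ham_right: "ham_side (p11 (ham h)) (p22 (ham h)) (p12 (ham h)) (s_plus h) (sigma h) (ham h)"
  using kind_A unfolding kind_A_def by (intro ham_side_right) auto

lemma Iop_left: "ham_side.Iop (s_minus h) (sigma h) (ham h) = int_left (ham h) (s_minus h)"
  using ends by (simp add: ham_side.Iop_def[OF ham_left])

lemma Iop_right: "ham_side.Iop (s_plus h) (sigma h) (ham h) = int_right (ham h) (s_plus h)"
  using ends by (simp add: ham_side.Iop_def[OF ham_right])

lemma finite_Delta_left: "finite_Delta (p11 (ham h)) (p22 (ham h)) (p12 (ham h)) (s_minus h) (sigma h) (ham h) NL"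
  by (intro finite_Delta.intro ham_left finite_Delta_axioms.intro)
    (simp add: min_max_ends Iop_left Delta_fin(1)[symmetric] Delta_minus_def)

lemma finite_Delta_right: "finite_Delta (p11 (ham h)) (p22 (ham h)) (p12 (ham h)) (s_plus h) (sigma h) (ham h) NR"
  by (intro finite_Delta.intro ham_right finite_Delta_axioms.intro)
    (simp add: min_max_ends Iop_right Delta_fin(2)[symmetric] Delta_plus_def)

sublocale L: finite_Delta "p11 (ham h)" "p22 (ham h)" "p12 (ham h)" "s_minus h" "sigma h" "ham h" NL
  by (rule finite_Delta_left)

sublocale R: finite_Delta "p11 (ham h)" "p22 (ham h)" "p12 (ham h)" "s_plus h" "sigma h" "ham h" NR
  by (rule finite_Delta_right)

lemma L_sets: "L.D = {s_minus h<..<sigma h}" "L.S = {s_minus h..<sigma h}" "L.F = at_left (sigma h)" "L.sg = 1"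
proof -
  show D: "L.D = {s_minus h<..<sigma h}" by (simp add: L.D_def min_max_ends)
  show "L.S = {s_minus h..<sigma h}" using ends by (auto simp: L.S_def D)
  show "L.F = at_left (sigma h)"
    unfolding L.F_def D by (rule at_within_nhd[of _ "{s_minus h<..}"]) (use ends in auto)
  show "L.sg = 1" using ends by (simp add: L.sg_def)
qed

lemma R_sets: "R.D = {sigma h<..<s_plus h}" "R.S = {sigma h<..s_plus h}" "R.F = at_right (sigma h)" "R.sg = -1"
proof -
  show D: "R.D = {sigma h<..<s_plus h}" by (simp add: R.D_def min_max_ends)
  show "R.S = {sigma h<..s_plus h}" using ends by (auto simp: R.S_def D)
  show "R.F = at_right (sigma h)"
    unfolding R.F_def D by (rule at_within_nhd[of _ "{..<s_plus h}"]) (use ends in auto)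
  show "R.sg = -1" using ends by (simp add: R.sg_def)
qed

lemma om_eq: "omega_minus h = L.om" "omega_plus h = R.om"
  by (simp_all add: omega_minus_def omega_plus_def L.om_def R.om_def Iop_left Iop_right min_max_ends)

lemma w_fun_left: "t \<in> L.S \<Longrightarrow> w_fun h n t = L.ww n t"
  by (simp add: w_fun_def L.ww_def Iop_left om_eq L_sets)

lemma w_fun_right: "t \<in> R.S \<Longrightarrow> w_fun h n t = R.ww n t"
  by (simp add: w_fun_def R.ww_def Iop_right om_eq R_sets)

lemma Delta_eq: "Delta h = max NL NR"
  by (simp add: Delta_def Delta_fin max_def)

lemma Delta_ge: "NL \<le> Delta h" "NR \<le> Delta h" "1 \<le> Delta h" "Delta h = NL \<or> Delta h = NR"
  using L.N0_gt_0 by (auto simp: Delta_eq max_def)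

lemma chn_left:
  assumes "canonical_solution (ham h) (s_minus h) (sigma h) {s_minus h..<sigma h} z M"
  shows "L.chn (\<lambda>t. transpose (M t) *v v) (\<lambda>t. z *s (transpose (M t) *v v))"
  by (rule L.canonical_solution_chn) (use assms in \<open>simp add: min_max_ends L_sets\<close>)

lemma chn_right:
  assumes "canonical_solution (ham h) (sigma h) (s_plus h) {sigma h<..s_plus h} z M"
  shows "R.chn (\<lambda>t. transpose (M t) *v v) (\<lambda>t. z *s (transpose (M t) *v v))"
  by (rule R.canonical_solution_chn) (use assms in \<open>simp add: min_max_ends R_sets\<close>)

lemma val_minus_eq: "val_minus h f g = (THE v. \<exists>y. v = y (s_minus h) \<and> ac_representative (ham h) (min (s_minus h) (sigma h)) (max (s_minus h) (sigma h)) L.S f g y)"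
  by (simp only: val_minus_def min_max_ends L_sets)

lemma val_plus_eq: "val_plus h f g = (THE v. \<exists>y. v = y (s_plus h) \<and> ac_representative (ham h) (min (s_plus h) (sigma h)) (max (s_plus h) (sigma h)) R.S f g y)"
  by (simp only: val_plus_def min_max_ends R_sets)

lemma Gamma_vec_left:
  assumes "L.chn y (\<lambda>t. z *s y t)"
  shows "Gamma_vec h (at_left (sigma h)) z y = vector [L.Gs (Delta h) z y, L.Gr y]"
  using L.Gs_as_Lim[OF w_fun_left assms Delta_ge(1)]
  by (simp add: Gamma_vec_def Gamma_s_def Gamma_r_def L.Gr_def L_sets)

lemma Gamma_vec_right:
  assumes "R.chn y (\<lambda>t. z *s y t)"
  shows "Gamma_vec h (at_right (sigma h)) z y = vector [R.Gs (Delta h) z y, R.Gr y]"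
  using R.Gs_as_Lim[OF w_fun_right assms Delta_ge(2)]
  by (simp add: Gamma_vec_def Gamma_s_def Gamma_r_def R.Gr_def R_sets)

lemma integral_split:
  fixes G :: "real \<Rightarrow> complex"
  assumes "G absolutely_integrable_on L.D" "G absolutely_integrable_on R.D"
  shows "(LINT t:{s_minus h<..<s_plus h}|lebesgue. G t) = integral L.D G + integral R.D G"
proof -
  have U: "{s_minus h<..<s_plus h} = insert (sigma h) (L.D \<union> R.D)" using ends by (auto simp: L_sets R_sets)
  have m: "L.D \<in> sets lebesgue" "R.D \<in> sets lebesgue" by (simp_all add: L_sets R_sets)
  have i: "G absolutely_integrable_on {s_minus h<..<s_plus h}"
    unfolding U by (intro absolutely_integrable_insert set_integrable_Un assms m)
  have "L.D \<inter> R.D = {}" by (auto simp: L_sets R_sets)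
  then have "integral (L.D \<union> R.D) G = integral L.D G + integral R.D G"
    using assms by (intro integral_Un abs_int_imp) auto
  moreover have "integral {s_minus h<..<s_plus h} G = integral (L.D \<union> R.D) G"
  proof (rule integral_spike_set)
    show "negligible {x \<in> {s_minus h<..<s_plus h} - (L.D \<union> R.D). G x \<noteq> 0}"
      by (rule negligible_subset[of "{sigma h}"]) (auto simp: U)
    have "{x \<in> L.D \<union> R.D - {s_minus h<..<s_plus h}. G x \<noteq> 0} = {}" by (auto simp: U)
    then show "negligible {x \<in> L.D \<union> R.D - {s_minus h<..<s_plus h}. G x \<noteq> 0}" by (simp only: negligible_empty)
  qed
  ultimately show ?thesis using set_lebesgue_integral_eq_integral(2)[OF i] by simp
qed

text \<open>\<open>p\<close>, \<open>q\<close> and \<open>p'\<close>, \<open>q'\<close> are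
  fundamental systems that provide uniqueness on the two sides. The jump of \<Gamma>_s is the
  identity \<open>boundary_algebra\<close>, with the integrals of the two one-sided formulas
  collected in \<open>IT\<close>.\<close>

lemma boundary_values_jump:
  assumes \<Gamma>: "((F, model_scale z F), (y (s_minus h), y (s_plus h))) \<in> Gamma_map h"
    and yL: "L.chn y (\<lambda>t. z *s y t)" and yR: "R.chn y (\<lambda>t. z *s y t)"
    and pL: "L.chn p (\<lambda>t. z *s p t)" "L.chn q (\<lambda>t. z *s q t)" "L.wron p q (s_minus h) \<noteq> 0"
    and pR: "R.chn p' (\<lambda>t. z *s p' t)" "R.chn q' (\<lambda>t. z *s q' t)" "R.wron p' q' (s_plus h) \<noteq> 0"
  shows "R.Gr y = L.Gr y" "R.Gs (Delta h) z y = L.Gs (Delta h) z y + p_poly h z * L.Gr y"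
proof -
  define m where "m = Delta h"
  have m: "NL \<le> m" "NR \<le> m" "1 \<le> m" "m = NL \<or> m = NR" using Delta_ge by (simp_all add: m_def)
  obtain f \<xi> \<alpha> where F: "F = (f, \<xi>, \<alpha>)" by (cases F)
  define g where "g = (\<lambda>t. z *s f t)"
  have G: "model_scale z F = (g, \<lambda>i. z * \<xi> i, \<lambda>k. z * \<alpha> k)" by (simp add: F model_scale_def g_def)
  obtain lam where T: "T_coeff h F (model_scale z F) lam" and b: "y (s_minus h) = bdry_minus h F (model_scale z F) lam"
      "y (s_plus h) = bdry_plus h F (model_scale z F) lam"
    using \<Gamma> unfolding Gamma_map_def by blast
  define l where "l = lam 0"
  have TL: "in_Tmax (ham h) (min (s_minus h) (sigma h)) (max (s_minus h) (sigma h)) (\<lambda>t. f t - (\<Sum>i\<le>m. lam i *s w_fun h i t)) (\<lambda>t. z *s f t - (\<Sum>i<m. lam (i + 1) *s w_fun h i t))"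
    and TR: "in_Tmax (ham h) (min (s_plus h) (sigma h)) (max (s_plus h) (sigma h)) (\<lambda>t. f t - (\<Sum>i\<le>m. lam i *s w_fun h i t)) (\<lambda>t. z *s f t - (\<Sum>i<m. lam (i + 1) *s w_fun h i t))"
    using T unfolding T_coeff_def G unfolding F g_def by (simp_all add: Tmax_H_def m_def min_max_ends)
  have wL: "w_fun h i t = L.ww i t" if "t \<in> L.D" for i t using that L.D_sub_S by (intro w_fun_left) blast
  have wR: "w_fun h i t = R.ww i t" if "t \<in> R.D" for i t using that R.D_sub_S by (intro w_fun_right) blast
  obtain xL where xL: "L.chn xL (\<lambda>t. z *s xL t)" "L.eqP xL f" "L.chn xL (\<lambda>t. z *s f t)" "L.sq (\<lambda>t. xL t - (\<Sum>i\<le>m. lam i *s L.ww i t))"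
    "L.sq (\<lambda>t. \<Sum>i<m. (lam (i + 1) - z * lam i) *s L.ww i t)"
    using L.Tmax_solution[OF TL wL m(1)] by blast
  obtain xR where xR: "R.chn xR (\<lambda>t. z *s xR t)" "R.eqP xR f" "R.chn xR (\<lambda>t. z *s f t)" "R.sq (\<lambda>t. xR t - (\<Sum>i\<le>m. lam i *s R.ww i t))"
    "R.sq (\<lambda>t. \<Sum>i<m. (lam (i + 1) - z * lam i) *s R.ww i t)"
    using R.Tmax_solution[OF TR wR m(2)] by blast
  \<comment> \<open>At least one side attains \<open>Delta h\<close>. The recursion is derived
    there, and the coefficients are common to both sides.\<close>
  have rec: "lam (i + 1) = z * lam i" if "i < m" for i
    using m(4) L.lam_recursion[OF _ xL(5) that] R.lam_recursion[OF _ xR(5) that] by blast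
  have lam: "lam i = z ^ i * l" if "i \<le> m" for i
    using that by (induction i) (use rec in \<open>auto simp: l_def\<close>)
  have tl: "(\<Sum>i\<le>m. lam i *s w i) = l *s (\<Sum>i<Suc m. z ^ i *s w i)" for w :: "nat \<Rightarrow> complex^2"
  proof -
    have "(\<Sum>i\<le>m. lam i *s w i) = (\<Sum>i\<le>m. l *s (z ^ i *s w i))"
      by (intro sum.cong) (simp_all add: lam mult.commute)
    then show ?thesis by (simp only: vec.scale_sum_right lessThan_Suc_atMost)
  qed
  have sqL: "L.sq (\<lambda>t. xL t - l *s L.Tl z (Suc m) t)" using xL(4) unfolding tl L.Tl_def .
  have sqR: "R.sq (\<lambda>t. xR t - l *s R.Tl z (Suc m) t)" using xR(4) unfolding tl R.Tl_def .
  have niL: "y (s_minus h) = val_minus h f g" if "\<not> indiv_minus h"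
    using b(1) that unfolding bdry_minus_def G unfolding F by simp
  have niR: "y (s_plus h) = val_plus h f g" if "\<not> indiv_plus h"
    using b(2) that unfolding bdry_plus_def G unfolding F by simp
  have iL: "y (s_minus h) = vector [val_plus h f g $ 1 + z * \<xi> 0 + 1/2 * (\<Sum>i<m. of_real (dpar h i) * lam (i + 1)), l]" if "indiv_minus h"
    using b(1) that unfolding bdry_minus_def G unfolding F by (simp add: m_def l_def)
  have iR: "y (s_plus h) = vector [val_minus h f g $ 1 - z * \<xi> 0 - 1/2 * (\<Sum>i<m. of_real (dpar h i) * lam (i + 1)), l]" if "indiv_plus h"
    using b(2) that unfolding bdry_plus_def G unfolding F by (simp add: m_def l_def)
  have nL: "y (s_minus h) = (THE v. \<exists>y. v = y (s_minus h) \<and> ac_representative (ham h) L.lo L.hi L.S f (\<lambda>t. z *s f t) y)"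
      if "\<not> indivisible (ham h) L.lo L.hi"
      using niL that by (simp only: val_minus_eq g_def min_max_ends not_False_eq_True)
  have iL': "y (s_minus h) $ 2 = l" if "indivisible (ham h) L.lo L.hi"
      using iL that by (simp add: min_max_ends)

  have L: "L.eqP y f" "L.Gr y = l" "L.sq (\<lambda>t. y t - l *s L.Tl z m t)"
    by (rule L.matching[OF pL xL(1-3) sqL yL m(1)]; use nL iL' in blast)+
  have nR: "y (s_plus h) = (THE v. \<exists>y. v = y (s_plus h) \<and> ac_representative (ham h) R.lo R.hi R.S f (\<lambda>t. z *s f t) y)"
      if "\<not> indivisible (ham h) R.lo R.hi"
      using niR that by (simp only: val_plus_eq g_def min_max_ends not_False_eq_True)
  have iR': "y (s_plus h) $ 2 = l" if "indivisible (ham h) R.lo R.hi"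
      using iR that by (simp add: min_max_ends)

  have R: "R.eqP y f" "R.Gr y = l" "R.sq (\<lambda>t. y t - l *s R.Tl z m t)"
    by (rule R.matching[OF pR xR(1-3) sqR yR m(2)]; use nR iR' in blast)+
  show "R.Gr y = L.Gr y" using L(2) R(2) by simp
  \<comment> \<open>\<open>B_term\<close> without its case distinction, extended to
    \<open>k = 0\<close>, where it is the difference of the first components at the two
    endpoints.\<close>
  define B where "B k = L.om k * y (s_minus h) $ 1 - R.om k * y (s_plus h) $ 1" for k
  note nb = kind_A_not_both_indivisible[OF kind_A]
  have B: "B_term h f g k = B k" if "1 \<le> k" for k
  proof -
    have "L.om k = 0" if "indiv_minus h" using L.indivisible_om[of k] that \<open>1 \<le> k\<close> by (simp add: min_max_ends)
    moreover have "R.om k = 0" if "indiv_plus h" using R.indivisible_om[of k] that \<open>1 \<le> k\<close> by (simp add: min_max_ends)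
    ultimately show ?thesis using nb niL niR by (auto simp: B_term_def B_def om_eq)
  qed
  \<comment> \<open>With an indivisible side the relation does not prescribe \<eta>_0; the equation
    is then read off from the boundary mapping, which contains \<eta>_0.\<close>
  have eta0: "z * \<xi> 0 = B 0 - 1/2 * (\<Sum>i<m. of_real (dpar h i) * lam (i + 1))"
  proof -
    have B0: "B 0 = y (s_minus h) $ 1 - y (s_plus h) $ 1" by (simp add: B_def L.om_0 R.om_0)
    show ?thesis
    proof (cases "indiv_minus h \<or> indiv_plus h")
      case True
      then show ?thesis using nb iL iR niL niR by (auto simp: B0)
    next
      case False
      then have "z * \<xi> 0 = val_minus h f g $ 1 - val_plus h f g $ 1 - 1/2 * (\<Sum>i<m. of_real (dpar h i) * lam (i + 1))"
        using T unfolding T_coeff_def G unfolding F by (simp add: m_def)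
      then show ?thesis using False niL niR by (simp add: B0)
    qed
  qed
  define IT where "IT = integral L.D (L.Bf (L.ww m) (\<lambda>t. y t - l *s L.Tl z m t)) + integral R.D (R.Bf (R.ww m) (\<lambda>t. y t - l *s R.Tl z m t))"
  have E: "E_term h f g lam = z * IT + 1/2 * (\<Sum>i<m. of_real (dpar h (m - 1 + i)) * lam i) + of_real (dpar h (2 * m - 1)) * lam m - B m"
  proof -
    define G where "G t = cdot (w_fun h m t) (cmat (ham h t) *v (z *s f t - (\<Sum>i<m. lam (i + 1) *s w_fun h i t)))" for t
    have IL: "G absolutely_integrable_on L.D" "integral L.D G = z * integral L.D (L.Bf (L.ww m) (\<lambda>t. y t - l *s L.Tl z m t))"
      unfolding G_def by (rule L.integral_cdot[OF L(1) wL m(1) lam L(3)]; assumption)+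
    have IR: "G absolutely_integrable_on R.D" "integral R.D G = z * integral R.D (R.Bf (R.ww m) (\<lambda>t. y t - l *s R.Tl z m t))"
      unfolding G_def by (rule R.integral_cdot[OF R(1) wR m(2) lam R(3)]; assumption)+
    have "(LINT t:{s_minus h<..<s_plus h}|lebesgue. G t) = z * IT"
      unfolding integral_split[OF IL(1) IR(1)] IL(2) IR(2) IT_def by (simp add: distrib_left)
    then show ?thesis
      unfolding E_term_def m_def[symmetric] g_def G_def B[OF m(3), unfolded g_def] by simp
  qed
  have key: "z ^ Suc m * IT - (\<Sum>n\<le>m. z ^ n * B n)
    = (- (\<Sum>n = 1..2 * m. of_real (dpar h (n - 1)) * z ^ n) + (\<Sum>n = 2 * m + 1..2 * m + odd_o h. of_real (bpar h (odd_o h + 2 * m + 1 - n)) * z ^ n)) * l"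
  proof (rule boundary_algebra[where d = "\<lambda>n. of_real (dpar h n)" and bb = "\<lambda>n. of_real (bpar h n)" and B = B and lam = lam
        and \<xi> = \<xi> and \<alpha> = \<alpha> and l = l, OF m(3) lam eta0 _ E])
    show "z * \<xi> k = \<xi> (k - 1) - 1/2 * of_real (dpar h (k - 1)) * lam 0 - 1/2 * of_real (dpar h (k + m - 1)) * lam m + B k"
      if "1 \<le> k" "k \<le> m - 1" for k
      using T that unfolding T_coeff_def G unfolding F by (simp add: m_def B)
    show "\<xi> (m - 1) = E_term h f g lam" if "odd_o h = 0"
      using T that unfolding T_coeff_def G unfolding F by (simp add: m_def)
    show "\<alpha> (odd_o h) = of_real (bpar h 1) * lam m" "z * \<alpha> 1 = E_term h f g lam - \<xi> (m - 1)" if "0 < odd_o h"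
      using T that unfolding T_coeff_def G unfolding F by (simp_all add: m_def)
    show "z * \<alpha> j = \<alpha> (j - 1) - of_real (bpar h (odd_o h + 2 - j)) * lam m" if "0 < odd_o h" "2 \<le> j" "j \<le> odd_o h" for j
      using T that unfolding T_coeff_def G unfolding F by (simp add: m_def)
  qed
  have sB: "(\<Sum>n\<le>m. z ^ n * B n) = (\<Sum>n\<le>m. z ^ n * L.om n) * y (s_minus h) $ 1 - (\<Sum>n\<le>m. z ^ n * R.om n) * y (s_plus h) $ 1"
    by (simp add: B_def sum_subtractf sum_distrib_right right_diff_distrib mult.assoc)
  \<comment> \<open>The signs \<open>L.sg = 1\<close> and \<open>R.sg = -1\<close> make the two
    integrals add up, while the endpoint terms are subtracted.\<close>
  have "R.Gs m z y - L.Gs m z y = z ^ Suc m * IT - (\<Sum>n\<le>m. z ^ n * B n)"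
    unfolding L.Gs_limit(2)[OF yL m(1)] R.Gs_limit(2)[OF yR m(2)] L(2) R(2) L_sets(4) R_sets(4) sB IT_def
    by (simp add: algebra_simps)
  then show "R.Gs (Delta h) z y = L.Gs (Delta h) z y + p_poly h z * L.Gr y"
    unfolding key L(2) p_poly_def m_def[symmetric] by (simp add: algebra_simps)
qed

end

text \<open>\<open>form\<close> expresses that \<open>M ** adj N = P ** adj Q\<close> for the
  adjugates; equal nonzero determinants turn adjugates into inverses.\<close>

lemma eq_of_symplectic_form_eq:
  fixes P Q M N :: "complex^2^2"
  assumes d: "det Q = det N" "det N \<noteq> 0"
    and form: "\<And>i k. M $ i $ 1 * N $ k $ 2 - M $ i $ 2 * N $ k $ 1 = P $ i $ 1 * Q $ k $ 2 - P $ i $ 2 * Q $ k $ 1"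
  shows "M = P ** matrix_inv Q ** N"
proof -
  define adj where "adj A = (vector [vector [A $ 2 $ 2, - A $ 1 $ 2], vector [- A $ 2 $ 1, A $ 1 $ 1]] :: complex^2^2)" for A :: "complex^2^2"
  have adj: "A ** adj A = mat (det A)" "adj A ** A = mat (det A)" for A
    by (simp_all add: adj_def matrix_matrix_mult_def vec_eq_iff forall_2 sum_2 mat_def det_2 algebra_simps)
  have eq: "M ** adj N = P ** adj Q"
    using form[of 1 1] form[of 1 2] form[of 2 1] form[of 2 2]
    by (simp add: adj_def matrix_matrix_mult_def vec_eq_iff forall_2 sum_2 algebra_simps)
  have Q: "matrix_inv Q ** Q = mat 1"
    using d invertible_det_nz[of Q] someI_ex[of "\<lambda>A. Q ** A = mat 1 \<and> A ** Q = mat 1"]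
    by (auto simp: invertible_def matrix_inv_def)
  have "adj Q = matrix_inv Q ** (Q ** adj Q)" unfolding matrix_mul_assoc Q by simp
  then have adjQ: "adj Q = matrix_inv Q ** mat (det N)" by (simp add: adj d)
  have mm: "A ** mat c = (\<chi> i j. c * A $ i $ j)" "mat c ** A = (\<chi> i j. c * A $ i $ j)" for A :: "complex^2^2" and c
    by (simp_all add: matrix_matrix_mult_def vec_eq_iff forall_2 sum_2 mat_def)
  have "M ** mat (det N) = M ** adj N ** N" by (simp add: adj(2)[symmetric] matrix_mul_assoc)
  also have "\<dots> = P ** matrix_inv Q ** (mat (det N) ** N)" by (simp add: eq adjQ matrix_mul_assoc)
  also have "mat (det N) ** N = N ** mat (det N)" by (simp add: mm)
  also have "P ** matrix_inv Q ** (N ** mat (det N)) = (P ** matrix_inv Q ** N) ** mat (det N)" by (simp add: matrix_mul_assoc)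
  finally show ?thesis using d(2) unfolding mm by (simp add: vec_eq_iff)
qed

lemma transpose_mult_axis: "transpose (M :: complex^'n^'m) *v axis i 1 = M $ i"
  by (simp add: matrix_vector_mult_def transpose_def axis_def vec_eq_iff if_distrib cong: if_cong)

lemma transpose_Gamma_mat:
  "transpose (Gamma_mat h L z (\<lambda>t. transpose (M t))) $ i = Gamma_vec h L z (\<lambda>t. M t $ i)"
  unfolding Gamma_mat_def transpose_mult_axis by (simp add: vec_eq_iff transpose_def)

theorem theorem4p12:
  fixes h :: indef_hamiltonian and W V :: "real \<Rightarrow> complex \<Rightarrow> complex^2^2"
  assumes "kind_A h"
    and "maximal_chain h W"
    and "\<forall>z. canonical_solution (ham h) (sigma h) (s_plus h) {sigma h<..s_plus h} z (\<lambda>t. V t z)"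
    and "\<forall>z. \<forall>t\<in>{sigma h<..s_plus h}. invertible (V t z)"
  shows "\<forall>z. det (U_minus h W z) = 1 \<and>
    (\<forall>t\<in>{sigma h<..s_plus h}.
       det (U_plus h V z) = det (V t z) \<and>
       W t z = U_minus h W z ** transpose (R_mat h z) ** matrix_inv (U_plus h V z) ** V t z)"
proof
  fix z
  interpret kind_A_ham h by (rule kind_A_ham.intro) fact
  \<comment> \<open>Rows of \<open>W\<close> are columns of its transpose, so every
    \<open>y i\<close> is a solution on both sides.\<close>
  define y where "y i t = W t z $ i" for i t
  define v where "v i t = V t z $ i" for i t
  define m where "m = Delta h"
  note m = Delta_ge(1,2)[folded m_def]
  have W: "canonical_solution (ham h) (s_minus h) (sigma h) {s_minus h..<sigma h} z (\<lambda>t. W t z)"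
      "W (s_minus h) z = mat 1"
      "canonical_solution (ham h) (sigma h) (s_plus h) {sigma h<..s_plus h} z (\<lambda>t. W t z)"
      "\<And>i. \<exists>F. ((F, model_scale z F), (axis i 1, W (s_plus h) z $ i)) \<in> Gamma_map h"
    using assms(2) unfolding maximal_chain_def transpose_mult_axis by blast+
  have yL: "L.chn (y i) (\<lambda>t. z *s y i t)" and yR: "R.chn (y i) (\<lambda>t. z *s y i t)" for i
    using chn_left[OF W(1), of "axis i 1"] chn_right[OF W(3), of "axis i 1"]
    unfolding transpose_mult_axis y_def by auto
  have vR: "R.chn (v i) (\<lambda>t. z *s v i t)" for i
    using chn_right[OF assms(3)[rule_format], of z "axis i 1"] unfolding transpose_mult_axis v_def .
  have Um: "U_minus h W z $ i = vector [L.Gs m z (y i), L.Gr (y i)]" for i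
    using Gamma_vec_left[OF yL] unfolding U_minus_def transpose_Gamma_mat y_def m_def .
  have Up: "U_plus h V z $ i = vector [R.Gs m z (v i), R.Gr (v i)]" for i
    using Gamma_vec_right[OF vR] unfolding U_plus_def transpose_Gamma_mat v_def m_def .
  have ends': "s_minus h \<in> L.S" "s_plus h \<in> R.S" using ends by (simp_all add: L_sets R_sets)
  \<comment> \<open>Row 2 comes first: with the sign convention of \<open>wron\<close> this gives
    the determinant and not its negative.\<close>
  have w1: "L.wron (y 2) (y 1) (s_minus h) = 1"
    by (simp add: L.wron_def y_def W(2) mat_def)
  have detV: "R.wron (v 2) (v 1) t = det (V t z)" for t
    by (simp add: R.wron_def v_def det_2 algebra_simps)
  have nz: "det (V t z) \<noteq> 0" if "t \<in> R.S" for t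
    using assms(4) that invertible_det_nz[of "V t z"] unfolding R_sets by blast
  have dm: "det (U_minus h W z) = 1"
    using L.wron_G[OF yL yL m(1) ends'(1), of 2 1] w1 by (simp add: det_2 Um algebra_simps)
  have dp: "det (U_plus h V z) = det (V t z)" if "t \<in> R.S" for t
    using R.wron_G[OF vR vR m(2) that, of 2 1] detV[of t] by (simp add: det_2 Up algebra_simps)
  \<comment> \<open>By the jump formula the rows of \<open>P\<close> are the boundary values of the
    rows of \<open>W\<close>, taken from the right of \<sigma>.\<close>
  define P where "P = U_minus h W z ** transpose (R_mat h z)"
  have P: "P $ i $ 1 = R.Gs m z (y i)" "P $ i $ 2 = R.Gr (y i)" for i
  proof -
    obtain F where F: "((F, model_scale z F), (axis i 1, W (s_plus h) z $ i)) \<in> Gamma_map h" using W(4) by blast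
    have "y i (s_minus h) = axis i 1" by (simp add: y_def W(2) mat_def axis_def vec_eq_iff eq_commute)
    then have F': "((F, model_scale z F), (y i (s_minus h), y i (s_plus h))) \<in> Gamma_map h" using F by (simp add: y_def)
    have "L.wron (y 2) (y 1) (s_minus h) \<noteq> 0" "R.wron (v 2) (v 1) (s_plus h) \<noteq> 0"
      using w1 detV nz ends' by simp_all
    note j = boundary_values_jump[OF F' yL yR yL yL this(1) vR vR this(2)]
    show "P $ i $ 1 = R.Gs m z (y i)" "P $ i $ 2 = R.Gr (y i)"
      using j by (simp_all add: P_def matrix_matrix_mult_def sum_2 transpose_def R_mat_def Um m_def algebra_simps)
  qed
  \<comment> \<open>The Wronskians of the rows of \<open>V\<close> with those of \<open>W\<close>,
    computed at \<open>t\<close> and again from the boundary values, determine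
    \<open>W t z\<close>.\<close>
  have "W t z = P ** matrix_inv (U_plus h V z) ** V t z" if t: "t \<in> R.S" for t
  proof (rule eq_of_symplectic_form_eq[OF dp[OF t] nz[OF t]])
    fix i k
    show "W t z $ i $ 1 * V t z $ k $ 2 - W t z $ i $ 2 * V t z $ k $ 1
        = P $ i $ 1 * U_plus h V z $ k $ 2 - P $ i $ 2 * U_plus h V z $ k $ 1"
      using R.wron_G[OF vR yR m(2) t, of k i] by (simp add: P Up R.wron_def y_def v_def algebra_simps)
  qed
  then show "det (U_minus h W z) = 1 \<and>
    (\<forall>t\<in>{sigma h<..s_plus h}.
       det (U_plus h V z) = det (V t z) \<and>
       W t z = U_minus h W z ** transpose (R_mat h z) ** matrix_inv (U_plus h V z) ** V t z)"
    using dm dp unfolding P_def R_sets by blast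
qed

end
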